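(* In the setting described in the context, let $(u,\sigma)\in(\mathcal V\cap W^{2,2}(0,T;H))\times L^p(0,T;L^p(\Omega;\mathbb R^{d\times d}_{sym}))$ be a weak solution to the nonlinear viscoelastic system $$\ddot u(t)-\operatorname{div}(\sigma(t))=f(t),\qquad G(\sigma(t))=eu(t)+e\dot u(t)\qquad\text{in }\Omega\setminus\Gamma_t,\ t\in[0,T],$$ with boundary conditions $u(t)=z(t)$ on $\partial_D\Omega$ and $\sigma(t)\nu=0$ on $\partial_N\Omega\cup\Gamma_t$, satisfying the initial conditions $u(0)=u^0$ in $V$ and $\dot u(0)=u^1$ in $H$. Then the function $u$ is unique, i.e. any two such weak solutions $(u_1,\sigma_1),(u_2,\sigma_2)$ in this class satisfy $u_1=u_2$. Moreover, if $G$ is strictly monotone, i.e. $(G(\xi_1)-G(\xi_2))\cdot(\xi_1-\xi_2)>0$ for all $\xi_1\ne\xi_2$ in $\mathbb R^{d\times d}_{sym}$, then also $\sigma$ is unique, i.e. $\sigma_1=\sigma_2$.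
   Context: Setting. $T>0$, $d\ge 2$ is an integer, $\Omega\subset\mathbb R^d$ is a bounded open set with Lipschitz boundary, $\partial_D\Omega$ is a Borel subset of $\partial\Omega$, $\partial_N\Omega:=\partial\Omega\setminus\partial_D\Omega$, $\nu$ is the outer unit normal, and $\Gamma\subset\overline\Omega$. Assume: (E1) $\Gamma$ is closed, $\mathcal L^d(\Gamma)=0$ and $\mathcal H^{d-1}(\Gamma\cap\partial\Omega)=0$; (E2) $\Omega\setminus\Gamma$ is the union of two disjoint bounded open sets $\Omega_1,\Omega_2$ with Lipschitz boundary; (E3) for $i\in\{1,2\}$, $\partial_D\Omega\cap\partial\Omega_i$ contains the graph of a Lipschitz function over a nonempty open subset of $\mathbb R^{d-1}$; (E4) $\{\Gamma_t\}_{t\in[0,T]}$ is a family of closed subsets of $\Gamma$ with $\Gamma_s\subset\Gamma_t$ for all $0\le s\le t\le T$. Let $2^*:=\infty$ if $d=2$ and $2^*:=\frac{2d}{d-2}$ if $d>2$; fix $p\in(1,2^* )$ and $p':=\frac p{p-1}$. $\mathbb R^{d\times d}_{sym}$ is the space of symmetric matrices with Frobenius product $A\cdot B$. Set $H:=L^2(\Omega;\mathbb R^d)$, $V:=W^{1,p'}(\Omega\setminus\Gamma;\mathbb R^d)$, $V_t:=W^{1,p'}(\Omega\setminus\Gamma_t;\mathbb R^d)$, $V^D:=\{u\in V: u=0\text{ on }\partial_D\Omega\}$, $V_t^D:=\{u\in V_t: u=0\text{ on }\partial_D\Omega\}$ (traces). Since $\Gamma$ is Lebesgue-null, functions and gradients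 on $\Omega\setminus\Gamma_t$ or $\Omega\setminus\Gamma$ are regarded as defined a.e. on $\Omega$, and $V_t\subset V$. For $u\in V$, $eu:=\frac12(\nabla u+\nabla u^T)$ with $\nabla u$ the distributional gradient in $\Omega\setminus\Gamma$. $V$ and $V_t$ carry the norm $(\|u\|_{p'}^{p'}+\|eu\|_{p'}^{p'})^{1/p'}$, equivalent to the Sobolev norm. Write $(g,h)_{p,p'}:=\int_\Omega g\cdot h\,dx$ for $g\in L^p(\Omega;\mathbb R^{d\times d}_{sym})$, $h\in L^{p'}(\Omega;\mathbb R^{d\times d}_{sym})$. $G\colon\mathbb R^{d\times d}_{sym}\to\mathbb R^{d\times d}_{sym}$ satisfies: (G1) $G=\nabla\phi$ for a convex $C^1$ function $\phi\colon\mathbb R^{d\times d}_{sym}\to\mathbb R$; (G2) there are $b_1>0$, $b_2\ge0$ with $G(\xi)\cdot\xi\ge b_1|\xi|^p-b_2$ for all $\xi$; (G3) there is $b_3>0$ with $|G(\xi)|\le b_3(1+|\xi|^{p-1})$ for all $\xi$. Data: (D1) $f\in L^2(0,T;H)$; (D2) $z\in W^{2,p'}(0,T;V_0)$; (D3) $u^0,u^1\in V_0$ with $u^0-z(0)\in V_0^D$ and $u^1-\dot z(0)\in V_0^D$. Spaces: $\mathcal V:=\{\varphi\in W^{1,p'}(0,T;V)\cap W^{1,\infty}(0,T;H):\varphi(t)\in V_t\ \forall t\in[0,T]\}$, $\mathcal D:=\{\varphi\in C^1_c(0,T;V):\varphi(t)\in V_t^D\ \forall t\in[0,T]\}$. Weak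 solution. A pair $(u,\sigma)\in\mathcal V\times L^p(0,T;L^p(\Omega;\mathbb R^{d\times d}_{sym}))$ is a weak solution to the system with the stated boundary conditions if: (i) $u(t)-z(t)\in V_t^D$ for all $t\in[0,T]$; (ii) $-\int_0^T(\dot u,\dot\varphi)_H\,dt+\int_0^T(\sigma,e\varphi)_{p,p'}\,dt=\int_0^T(f,\varphi)_H\,dt$ for all $\varphi\in\mathcal D$; (iii) $G(\sigma(t))=eu(t)+e\dot u(t)$ a.e. in $\Omega\setminus\Gamma_t$ for a.e. $t\in[0,T]$. (The Neumann condition is encoded in (ii).) Functions in $W^{1,q}(0,T;X)$ are identified with their continuous representatives. *)

theory Defs
  imports "HOL-Analysis.Analysis" "HOL-Library.Function_Algebras"
begin

section \<open>Pointwise vector space structure on functions\<close>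

instantiation "fun" :: (type, real_vector) real_vector
begin

definition scaleR_fun :: "real \<Rightarrow> ('a \<Rightarrow> 'b) \<Rightarrow> 'a \<Rightarrow> 'b"
  where "scaleR_fun c f = (\<lambda>x. c *\<^sub>R f x)"

instance
  by standard (auto simp: scaleR_fun_def fun_eq_iff algebra_simps)

end

section \<open>Hausdorff measure and Lipschitz boundaries\<close>

text \<open>The normalising factor \<^term>\<open>unit_ball_vol s\<close> is the usual
  $\pi^{s/2} / \Gamma(s/2+1)$. The term $0^s$ below equals $0$, so the definition is the standard
  one for $s > 0$ only. The library's \<^const>\<open>diameter\<close> is meaningful for bounded sets only.\<close>

definition hausdorff_delta :: "real \<Rightarrow> real \<Rightarrow> 'a::metric_space set \<Rightarrow> ennreal" where
  "hausdorff_delta s \<delta> A =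
     (INF C \<in> {C :: nat \<Rightarrow> 'a set. A \<subseteq> (\<Union>i. C i) \<and> (\<forall>i. bounded (C i) \<and> diameter (C i) \<le> \<delta>)}.
        \<Sum>i. ennreal (unit_ball_vol s * (diameter (C i) / 2) powr s))"

definition hausdorff_outer :: "real \<Rightarrow> 'a::metric_space set \<Rightarrow> ennreal" where
  "hausdorff_outer s A = (SUP \<delta> \<in> {0<..}. hausdorff_delta s \<delta> A)"

text \<open>\<^const>\<open>measure_of\<close> returns the null measure when its last argument is not countably additive;
  this does not happen here, because a metric outer measure is countably additive on Borel sets.\<close>

definition hausdorff_measure :: "real \<Rightarrow> 'a::metric_space measure" where
  "hausdorff_measure s = measure_of UNIV (sets borel) (hausdorff_outer s)"

text \<open>\<^term>\<open>{y. y \<bullet> e = 0}\<close> plays the role of $\mathbb{R}^{d-1}$, and the unit vector \<open>e\<close> that of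
  the last coordinate direction after a rotation of the axes.\<close>

definition lipschitz_domain :: "'a::euclidean_space set \<Rightarrow> bool" where
  "lipschitz_domain U \<longleftrightarrow> open U \<and> bounded U \<and>
     (\<forall>x \<in> frontier U. \<exists>r e g L. r > 0 \<and> norm e = 1 \<and> L-lipschitz_on {y. y \<bullet> e = 0} g \<and>
        U \<inter> ball x r = {y \<in> ball x r. g (y - (y \<bullet> e) *\<^sub>R e) < y \<bullet> e})"

definition contains_lipschitz_graph :: "'a::euclidean_space set \<Rightarrow> bool" where
  "contains_lipschitz_graph S \<longleftrightarrow>
     (\<exists>e A g L. norm e = 1 \<and> A \<noteq> {} \<and> openin (top_of_set {y. y \<bullet> e = 0}) A \<and>
        L-lipschitz_on A g \<and> (\<lambda>y. y + g y *\<^sub>R e) ` A \<subseteq> S)"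

section \<open>Seminormed spaces of functions\<close>

text \<open>Lebesgue and Sobolev functions are represented by actual functions, not by classes modulo
  null sets. Accordingly a Banach space is given by a set of representatives and a seminorm, and
  two representatives \<open>f\<close>, \<open>g\<close> denote the same element if \<open>snorm X (f - g) = 0\<close>.\<close>

record 'x fspace =
  elts :: "'x set"
  snorm :: "'x \<Rightarrow> real"

definition L_space ::
    "'a::euclidean_space set \<Rightarrow> 'b::euclidean_space set \<Rightarrow> real \<Rightarrow> ('a \<Rightarrow> 'b) fspace" where
  "L_space U S q =
     \<lparr> elts = {f. f \<in> borel_measurable (lebesgue_on U) \<and>
                 integrable (lebesgue_on U) (\<lambda>x. norm (f x) powr q) \<and>
                 (AE x in lebesgue_on U. f x \<in> S)},
       snorm = (\<lambda>f. (LINT x|lebesgue_on U. norm (f x) powr q) powr (1 / q)) \<rparr>"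

definition pairing ::
    "'a::euclidean_space set \<Rightarrow> ('a \<Rightarrow> 'b::euclidean_space) \<Rightarrow> ('a \<Rightarrow> 'b) \<Rightarrow> real" where
  "pairing U g h = (LINT x|lebesgue_on U. g x \<bullet> h x)"

section \<open>Weak gradients and Sobolev spaces\<close>

fun C_k :: "nat \<Rightarrow> ('a::euclidean_space \<Rightarrow> 'b::real_normed_vector) \<Rightarrow> bool" where
  "C_k 0 f \<longleftrightarrow> continuous_on UNIV f"
| "C_k (Suc k) f \<longleftrightarrow> f differentiable_on UNIV \<and> (\<forall>v. C_k k (\<lambda>x. frechet_derivative f (at x) v))"

definition smooth :: "('a::euclidean_space \<Rightarrow> 'b::real_normed_vector) \<Rightarrow> bool" where
  "smooth f \<longleftrightarrow> (\<forall>k. C_k k f)"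

definition test_fun :: "'a::euclidean_space set \<Rightarrow> ('a \<Rightarrow> real) \<Rightarrow> bool" where
  "test_fun U \<psi> \<longleftrightarrow> smooth \<psi> \<and> (\<exists>K. compact K \<and> K \<subseteq> U \<and> (\<forall>x. x \<notin> K \<longrightarrow> \<psi> x = 0))"

definition locally_integrable ::
    "'a::euclidean_space set \<Rightarrow> ('a \<Rightarrow> 'b::euclidean_space) \<Rightarrow> bool" where
  "locally_integrable U f \<longleftrightarrow> (\<forall>K. compact K \<and> K \<subseteq> U \<longrightarrow> set_integrable lebesgue K f)"

definition weak_grad ::
    "(real^'n) set \<Rightarrow> (real^'n \<Rightarrow> real^'n) \<Rightarrow> (real^'n \<Rightarrow> real^'n^'n) \<Rightarrow> bool" where
  "weak_grad U u D \<longleftrightarrow> locally_integrable U u \<and> locally_integrable U D \<and>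
     (\<forall>\<psi> i j. test_fun U \<psi> \<longrightarrow>
        (LINT x|lebesgue_on U. u x $ i * frechet_derivative \<psi> (at x) (axis j 1)) =
        - (LINT x|lebesgue_on U. D x $ i $ j * \<psi> x))"

text \<open>A weak gradient is unique up to null sets.\<close>

definition grad :: "(real^'n) set \<Rightarrow> (real^'n \<Rightarrow> real^'n) \<Rightarrow> real^'n \<Rightarrow> real^'n^'n" where
  "grad U u = (SOME D. weak_grad U u D)"

definition sym_grad :: "(real^'n) set \<Rightarrow> (real^'n \<Rightarrow> real^'n) \<Rightarrow> real^'n \<Rightarrow> real^'n^'n" where
  "sym_grad U u x = (1/2) *\<^sub>R (grad U u x + transpose (grad U u x))"

definition sym_matrices :: "(real^'n^'n) set" where
  "sym_matrices = {A. transpose A = A}"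

text \<open>The Sobolev space $W^{1,q}(U;\mathbb{R}^d)$, with the norm of \<open>u\<close> and of its symmetric
  gradient.\<close>

definition W_space :: "(real^'n) set \<Rightarrow> real \<Rightarrow> (real^'n \<Rightarrow> real^'n) fspace" where
  "W_space U q =
     \<lparr> elts = {u \<in> elts (L_space U UNIV q). \<exists>D \<in> elts (L_space U UNIV q). weak_grad U u D},
       snorm = (\<lambda>u. (snorm (L_space U UNIV q) u powr q +
                    snorm (L_space U UNIV q) (sym_grad U u) powr q) powr (1 / q)) \<rparr>"

text \<open>On a Lipschitz domain the trace operator is the continuous extension of the restriction
  to the boundary, from functions smooth up to the boundary (which are dense in $W^{1,q}(U)$) to
  $W^{1,q}(U)$, with values in $L^q(\partial U, \mathcal{H}^{d-1})$. The convergence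
  \<open>w n \<longlonglongrightarrow> u\<close> is in the full Sobolev norm.\<close>

definition has_trace ::
    "(real^'n) set \<Rightarrow> real \<Rightarrow> (real^'n \<Rightarrow> real^'n) \<Rightarrow> (real^'n \<Rightarrow> real^'n) \<Rightarrow> bool" where
  "has_trace U q u g \<longleftrightarrow> g \<in> borel_measurable borel \<and>
     (\<exists>w. (\<forall>n::nat. smooth (w n)) \<and>
        (\<lambda>n. snorm (L_space U UNIV q) (w n - u)) \<longlonglongrightarrow> 0 \<and>
        (\<lambda>n. snorm (L_space U UNIV q) (grad U (w n) - grad U u)) \<longlonglongrightarrow> 0 \<and>
        (\<lambda>n. \<integral>\<^sup>+x\<in>frontier U. ennreal (norm (w n x - g x) powr q)
               \<partial>hausdorff_measure (real CARD('n) - 1)) \<longlonglongrightarrow> 0)"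

definition zero_trace ::
    "(real^'n) set \<Rightarrow> real \<Rightarrow> (real^'n) set \<Rightarrow> (real^'n \<Rightarrow> real^'n) \<Rightarrow> bool" where
  "zero_trace U q D u \<longleftrightarrow>
     (\<exists>g. has_trace U q u g \<and>
        (AE x in hausdorff_measure (real CARD('n) - 1). x \<in> D \<inter> frontier U \<longrightarrow> g x = 0))"

text \<open>The functions of $W^{1,q}(U)$ vanishing on \<open>D\<close>. If \<open>U\<close> contains the
  Lipschitz domains \<open>U1\<close> and \<open>U2\<close> and differs from their union by a null set, then the trace on
  the outer boundary is that of the restrictions to \<open>U1\<close> and to \<open>U2\<close>.\<close>

definition W_D :: "(real^'n) set \<Rightarrow> (real^'n) set \<Rightarrow> (real^'n) set \<Rightarrow> (real^'n) set \<Rightarrow> real \<Rightarrow>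
    (real^'n \<Rightarrow> real^'n) set" where
  "W_D U1 U2 D U q = {u \<in> elts (W_space U q). zero_trace U1 q D u \<and> zero_trace U2 q D u}"

section \<open>Bochner spaces on an interval\<close>

definition simple_on :: "'x::real_vector fspace \<Rightarrow> real \<Rightarrow> (real \<Rightarrow> 'x) \<Rightarrow> bool" where
  "simple_on X T s \<longleftrightarrow> finite (s ` {0<..<T}) \<and> s ` {0<..<T} \<subseteq> elts X \<and>
     (\<forall>x. {t \<in> {0<..<T}. s t = x} \<in> sets lebesgue)"

definition simple_integral_on :: "real \<Rightarrow> (real \<Rightarrow> 'x::real_vector) \<Rightarrow> 'x" where
  "simple_integral_on T s = (\<Sum>x \<in> s ` {0<..<T}. measure lebesgue {t \<in> {0<..<T}. s t = x} *\<^sub>R x)"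

definition strongly_measurable :: "'x::real_vector fspace \<Rightarrow> real \<Rightarrow> (real \<Rightarrow> 'x) \<Rightarrow> bool" where
  "strongly_measurable X T u \<longleftrightarrow>
     (\<exists>s. (\<forall>n::nat. simple_on X T (s n)) \<and>
        (AE t in lebesgue_on {0<..<T}. u t \<in> elts X \<and> (\<lambda>n. snorm X (s n t - u t)) \<longlonglongrightarrow> 0))"

text \<open>As in \<^const>\<open>has_bochner_integral\<close>, but with values in an \<open>fspace\<close>.\<close>

definition has_integral_in ::
    "'x::real_vector fspace \<Rightarrow> real \<Rightarrow> (real \<Rightarrow> 'x) \<Rightarrow> 'x \<Rightarrow> bool" where
  "has_integral_in X T u y \<longleftrightarrow> strongly_measurable X T u \<and> y \<in> elts X \<and>
     (\<exists>s. (\<forall>n::nat. simple_on X T (s n)) \<and>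
        (\<lambda>n. \<integral>\<^sup>+t. ennreal (snorm X (s n t - u t)) \<partial>lebesgue_on {0<..<T}) \<longlonglongrightarrow> 0 \<and>
        (\<lambda>n. snorm X (simple_integral_on T (s n) - y)) \<longlonglongrightarrow> 0)"

text \<open>$L^q(0,T;X)$, for $1 \le q \le \infty$.\<close>

definition bochner_L :: "ereal \<Rightarrow> real \<Rightarrow> 'x::real_vector fspace \<Rightarrow> (real \<Rightarrow> 'x) set" where
  "bochner_L q T X = {u. strongly_measurable X T u \<and>
     (if q = \<infinity> then \<exists>C. AE t in lebesgue_on {0<..<T}. snorm X (u t) \<le> C
      else integrable (lebesgue_on {0<..<T}) (\<lambda>t. snorm X (u t) powr real_of_ereal q))}"

definition continuous_in :: "'x::real_vector fspace \<Rightarrow> real \<Rightarrow> (real \<Rightarrow> 'x) \<Rightarrow> bool" where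
  "continuous_in X T u \<longleftrightarrow>
     (\<forall>t \<in> {0..T}. u t \<in> elts X \<and> ((\<lambda>s. snorm X (u s - u t)) \<longlongrightarrow> 0) (at t within {0..T}))"

definition weak_tderiv ::
    "'x::real_vector fspace \<Rightarrow> real \<Rightarrow> (real \<Rightarrow> 'x) \<Rightarrow> (real \<Rightarrow> 'x) \<Rightarrow> bool" where
  "weak_tderiv X T u v \<longleftrightarrow>
     (\<forall>\<eta>. test_fun {0<..<T} \<eta> \<longrightarrow>
        (\<exists>y. has_integral_in X T (\<lambda>t. deriv \<eta> t *\<^sub>R u t) y \<and>
             has_integral_in X T (\<lambda>t. \<eta> t *\<^sub>R v t) (- y)))"

text \<open>$W^{k,q}(0,T;X)$. For \<open>k \<ge> 1\<close> only continuous representatives on the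
  closed interval are admitted.\<close>

fun bochner_W :: "nat \<Rightarrow> ereal \<Rightarrow> real \<Rightarrow> 'x::real_vector fspace \<Rightarrow> (real \<Rightarrow> 'x) set" where
  "bochner_W 0 q T X = bochner_L q T X"
| "bochner_W (Suc k) q T X =
     {u \<in> bochner_L q T X. continuous_in X T u \<and> (\<exists>v \<in> bochner_W k q T X. weak_tderiv X T u v)}"

text \<open>The weak time derivative in \<open>X\<close>, which is unique up to null sets; the continuous
  representative is taken if there is one.\<close>

definition tderiv :: "'x::real_vector fspace \<Rightarrow> real \<Rightarrow> (real \<Rightarrow> 'x) \<Rightarrow> real \<Rightarrow> 'x" where
  "tderiv X T u = (SOME v. weak_tderiv X T u v \<and>
     ((\<exists>w. weak_tderiv X T u w \<and> continuous_in X T w) \<longrightarrow> continuous_in X T v))"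

definition has_cderiv_at ::
    "'x::real_vector fspace \<Rightarrow> (real \<Rightarrow> 'x) \<Rightarrow> 'x \<Rightarrow> real \<Rightarrow> bool" where
  "has_cderiv_at X \<phi> y t \<longleftrightarrow> y \<in> elts X \<and>
     ((\<lambda>h. snorm X ((1 / h) *\<^sub>R (\<phi> (t + h) - \<phi> t) - y)) \<longlongrightarrow> 0) (at 0)"

text \<open>The classical time derivative in \<open>X\<close>.\<close>

definition cderiv :: "'x::real_vector fspace \<Rightarrow> (real \<Rightarrow> 'x) \<Rightarrow> real \<Rightarrow> 'x" where
  "cderiv X \<phi> t = (SOME y. has_cderiv_at X \<phi> y t)"

text \<open>$C^1_c(0,T;X)$, with functions extended by zero to the closed interval.\<close>

definition C1_c :: "real \<Rightarrow> 'x::real_vector fspace \<Rightarrow> (real \<Rightarrow> 'x) set" where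
  "C1_c T X = {\<phi>. (\<forall>t \<in> {0..T}. \<phi> t \<in> elts X) \<and>
     (\<forall>t \<in> {0<..<T}. has_cderiv_at X \<phi> (cderiv X \<phi> t) t \<and>
        ((\<lambda>s. snorm X (cderiv X \<phi> s - cderiv X \<phi> t)) \<longlongrightarrow> 0) (at t)) \<and>
     (\<exists>K. compact K \<and> K \<subseteq> {0<..<T} \<and> (\<forall>t \<in> {0..T} - K. snorm X (\<phi> t) = 0))}"

section \<open>The viscoelastic system\<close>

definition crit_exp :: "nat \<Rightarrow> ereal" where
  "crit_exp d = (if d = 2 then \<infinity> else ereal (2 * real d / (real d - 2)))"

definition conj_exp :: "real \<Rightarrow> real" where
  "conj_exp p = p / (p - 1)"

abbreviation H_space :: "(real^'n) set \<Rightarrow> (real^'n \<Rightarrow> real^'n) fspace" where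
  "H_space \<Omega> \<equiv> L_space \<Omega> UNIV 2"

text \<open>The spaces of trajectories and of test functions; \<open>\<Gamma>t t\<close> is the crack at time \<open>t\<close>,
  \<open>\<Gamma>\<close> the set containing all cracks, and \<open>\<Omega>1\<close>, \<open>\<Omega>2\<close> are the two parts of \<open>\<Omega> - \<Gamma>\<close>.\<close>

definition V_traj :: "real \<Rightarrow> real \<Rightarrow> (real^'n) set \<Rightarrow> (real^'n) set \<Rightarrow> (real \<Rightarrow> (real^'n) set) \<Rightarrow>
    (real \<Rightarrow> real^'n \<Rightarrow> real^'n) set" where
  "V_traj T p \<Omega> \<Gamma> \<Gamma>t =
     {\<phi> \<in> bochner_W 1 (conj_exp p) T (W_space (\<Omega> - \<Gamma>) (conj_exp p)) \<inter> bochner_W 1 \<infinity> T (H_space \<Omega>).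
        \<forall>t \<in> {0..T}. \<phi> t \<in> elts (W_space (\<Omega> - \<Gamma>t t) (conj_exp p))}"

definition D_traj :: "real \<Rightarrow> real \<Rightarrow> (real^'n) set \<Rightarrow> (real^'n) set \<Rightarrow> (real \<Rightarrow> (real^'n) set) \<Rightarrow>
    (real^'n) set \<Rightarrow> (real^'n) set \<Rightarrow> (real^'n) set \<Rightarrow> (real \<Rightarrow> real^'n \<Rightarrow> real^'n) set" where
  "D_traj T p \<Omega> \<Gamma> \<Gamma>t \<Omega>1 \<Omega>2 dD =
     {\<phi> \<in> C1_c T (W_space (\<Omega> - \<Gamma>) (conj_exp p)).
        \<forall>t \<in> {0..T}. \<phi> t \<in> W_D \<Omega>1 \<Omega>2 dD (\<Omega> - \<Gamma>t t) (conj_exp p)}"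

text \<open>The derivative of \<open>u\<close> is taken in \<open>H\<close> where it is paired in \<open>H\<close>, and in \<open>V\<close> where its
  gradient is needed; for a trajectory in \<^const>\<open>V_traj\<close> the two agree almost everywhere.\<close>

definition weak_solution :: "real \<Rightarrow> real \<Rightarrow> (real^'n) set \<Rightarrow> (real^'n) set \<Rightarrow>
    (real \<Rightarrow> (real^'n) set) \<Rightarrow> (real^'n) set \<Rightarrow> (real^'n) set \<Rightarrow> (real^'n) set \<Rightarrow>
    (real^'n^'n \<Rightarrow> real^'n^'n) \<Rightarrow> (real \<Rightarrow> real^'n \<Rightarrow> real^'n) \<Rightarrow> (real \<Rightarrow> real^'n \<Rightarrow> real^'n) \<Rightarrow>
    (real \<Rightarrow> real^'n \<Rightarrow> real^'n) \<Rightarrow> (real \<Rightarrow> real^'n \<Rightarrow> real^'n^'n) \<Rightarrow> bool" where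
  "weak_solution T p \<Omega> \<Gamma> \<Gamma>t \<Omega>1 \<Omega>2 dD G f z u \<sigma> \<longleftrightarrow>
     (let V = W_space (\<Omega> - \<Gamma>) (conj_exp p); H = H_space \<Omega>; e = sym_grad (\<Omega> - \<Gamma>) in
      u \<in> V_traj T p \<Omega> \<Gamma> \<Gamma>t \<and>
      \<sigma> \<in> bochner_L p T (L_space \<Omega> sym_matrices p) \<and>
      (\<forall>t \<in> {0..T}. u t - z t \<in> W_D \<Omega>1 \<Omega>2 dD (\<Omega> - \<Gamma>t t) (conj_exp p)) \<and>
      (\<forall>\<phi> \<in> D_traj T p \<Omega> \<Gamma> \<Gamma>t \<Omega>1 \<Omega>2 dD.
         - (LINT t|lebesgue_on {0<..<T}. pairing \<Omega> (tderiv H T u t) (cderiv V \<phi> t))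
         + (LINT t|lebesgue_on {0<..<T}. pairing \<Omega> (\<sigma> t) (e (\<phi> t)))
         = (LINT t|lebesgue_on {0<..<T}. pairing \<Omega> (f t) (\<phi> t))) \<and>
      (AE t in lebesgue_on {0<..<T}. AE x in lebesgue_on (\<Omega> - \<Gamma>t t).
         G (\<sigma> t x) = e (u t) x + e (tderiv V T u t) x))"

text \<open>A weak solution, twice differentiable in time with values in \<open>H\<close>, with initial displacement
  \<open>u0\<close> and initial velocity \<open>u1\<close>.\<close>

definition ivp_solution :: "real \<Rightarrow> real \<Rightarrow> (real^'n) set \<Rightarrow> (real^'n) set \<Rightarrow>
    (real \<Rightarrow> (real^'n) set) \<Rightarrow> (real^'n) set \<Rightarrow> (real^'n) set \<Rightarrow> (real^'n) set \<Rightarrow>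
    (real^'n^'n \<Rightarrow> real^'n^'n) \<Rightarrow> (real \<Rightarrow> real^'n \<Rightarrow> real^'n) \<Rightarrow> (real \<Rightarrow> real^'n \<Rightarrow> real^'n) \<Rightarrow>
    (real^'n \<Rightarrow> real^'n) \<Rightarrow> (real^'n \<Rightarrow> real^'n) \<Rightarrow>
    (real \<Rightarrow> real^'n \<Rightarrow> real^'n) \<Rightarrow> (real \<Rightarrow> real^'n \<Rightarrow> real^'n^'n) \<Rightarrow> bool" where
  "ivp_solution T p \<Omega> \<Gamma> \<Gamma>t \<Omega>1 \<Omega>2 dD G f z u0 u1 u \<sigma> \<longleftrightarrow>
     weak_solution T p \<Omega> \<Gamma> \<Gamma>t \<Omega>1 \<Omega>2 dD G f z u \<sigma> \<and>
     u \<in> bochner_W 2 2 T (H_space \<Omega>) \<and>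
     snorm (W_space (\<Omega> - \<Gamma>) (conj_exp p)) (u 0 - u0) = 0 \<and>
     snorm (H_space \<Omega>) (tderiv (H_space \<Omega>) T u 0 - u1) = 0"

end

theory Submission
  imports Defs
begin

text \<open>
  Let $w$ be the difference of two solutions. Cracks only grow, so for a fixed time $s$ and a test
  function $\psi$ supported in $(s,T)$ the product $\psi(t)\,w(s)$ is admissible in the weak formulation.
  Hence for almost every $t$ the difference of the two equations may be tested with $w(s)$ for all
  $s\le t$, and, taking difference quotients at points of differentiability, also with $w(t)+\dot w(t)$.
  Since $G(\sigma)=eu+e\dot u$, the stress term is then nonnegative by monotonicity of $G$, and Gronwall's
  inequality for $\|w+\dot w\|_H^2+\|w\|_H^2$ gives $w=0$; strict monotonicity turns the vanishing stress term into
  equality of the stresses. Neither Korn's inequality nor completeness of the spaces is needed. The Sobolev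
  embedding on Lipschitz domains is used only to see that $u^1\in L^2$, without which the seminorm in
  the initial condition $\dot u(0)=u^1$ would be a junk value.
\<close>

section \<open>Smooth functions\<close>

text \<open>The velocity of the difference is not known to be an admissible test function: it is
  reached only as a limit in \<open>V\<close>, while admissibility at t refers to the crack at t and
  to traces. The quotients (w(t) - w(t-h))/h are therefore taken backwards, where every displacement
  involved is admissible at t. Two exceptional sets have to be made uniform. The equation at frozen
  t, tested with w(s), must hold for all s up to t outside one null set of t; rational s and
  continuity in s give this. The limit of the quotients must exist for functionals built from the
  accelerations and stresses at the same t, hence for all functionals outside one null set; strong
  measurability gives this through a countable set of values. The combination Y = w + w' is dictated
  by the constitutive law, and (w', Y) + (w', w) = |Y|^2 - |w|^2 explains the extra term |w|^2 in
  the energy. The velocities in \<open>H\<close> and in \<open>V\<close> arise from the same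
  quotients, each paired in its own space, and are never compared pointwise.\<close>

lemma C_k_SucI:
  assumes "\<And>x. (f has_derivative f' x) (at x)" "\<And>v. C_k k (\<lambda>x. f' x v)"
  shows "C_k (Suc k) f"
proof -
  have "frechet_derivative f (at x) = f' x" for x
    using frechet_derivative_at[OF assms(1)] by simp
  then show ?thesis
    using assms by (auto simp: differentiable_on_def differentiable_def)
qed

lemma C_k_has_derivative:
  "C_k (Suc k) f \<Longrightarrow> (f has_derivative frechet_derivative f (at x)) (at x)"
  by (simp add: differentiable_on_def frechet_derivative_works)

lemma C_k_SucD: "C_k (Suc k) f \<Longrightarrow> C_k k f"
proof (induction k arbitrary: f)
  case 0
  then show ?case
    by (auto simp: differentiable_imp_continuous_on)
next
  case (Suc k)
  then show ?case
    by (metis C_k.simps(2))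
qed

lemma C_k_const: "C_k k (\<lambda>x. c)"
proof (induction k arbitrary: c)
  case (Suc k)
  show ?case
    by (rule C_k_SucI[where f'="\<lambda>x v. 0"]) (auto intro: Suc)
qed auto

lemma C_k_add: "C_k k f \<Longrightarrow> C_k k g \<Longrightarrow> C_k k (\<lambda>x. f x + g x)"
proof (induction k arbitrary: f g)
  case (Suc k)
  show ?case
    by (rule C_k_SucI[OF has_derivative_add[OF C_k_has_derivative[OF Suc.prems(1)]
          C_k_has_derivative[OF Suc.prems(2)]]]) (use Suc in auto)
qed (auto intro: continuous_intros)

lemma C_k_bounded_linear: "bounded_linear f \<Longrightarrow> C_k k f"
  by (cases k) (auto simp del: C_k.simps(2)
      intro!: C_k_SucI[OF bounded_linear_imp_has_derivative] C_k_const linear_continuous_on)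

lemma C_k_compose_bounded_linear:
  "bounded_linear h \<Longrightarrow> C_k k f \<Longrightarrow> C_k k (\<lambda>x. h (f x))"
proof (induction k arbitrary: f)
  case 0
  then show ?case
    by (auto intro: continuous_on_compose2[OF linear_continuous_on[of h UNIV]])
next
  case (Suc k)
  show ?case
    by (rule C_k_SucI[OF bounded_linear.has_derivative[OF Suc.prems(1)
          C_k_has_derivative[OF Suc.prems(2)]]]) (use Suc in auto)
qed

lemma C_k_mult:
  fixes f g :: "'a::euclidean_space \<Rightarrow> real"
  shows "C_k k f \<Longrightarrow> C_k k g \<Longrightarrow> C_k k (\<lambda>x. f x * g x)"
proof (induction k arbitrary: f g)
  case (Suc k)
  have "C_k k (\<lambda>x. f x * frechet_derivative g (at x) v + frechet_derivative f (at x) v * g x)" for v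
    by (intro C_k_add Suc.IH Suc.prems[THEN C_k_SucD]) (use Suc.prems in auto)
  then show ?case
    by (rule C_k_SucI[OF has_derivative_mult[OF C_k_has_derivative[OF Suc.prems(1)]
          C_k_has_derivative[OF Suc.prems(2)]]])
qed (auto intro: continuous_intros)

lemma smooth_const: "smooth (\<lambda>x. c)"
  and smooth_bounded_linear: "bounded_linear f \<Longrightarrow> smooth f"
  and smooth_add: "smooth f \<Longrightarrow> smooth g \<Longrightarrow> smooth (\<lambda>x. f x + g x)"
  by (auto simp: smooth_def C_k_const C_k_add C_k_bounded_linear)

lemma smooth_compose_bounded_linear:
  "bounded_linear h \<Longrightarrow> smooth f \<Longrightarrow> smooth (\<lambda>x. h (f x))"
  by (auto simp: smooth_def C_k_compose_bounded_linear)

lemma smooth_mult: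
  fixes f g :: "'a::euclidean_space \<Rightarrow> real"
  shows "smooth f \<Longrightarrow> smooth g \<Longrightarrow> smooth (\<lambda>x. f x * g x)"
  by (auto simp: smooth_def C_k_mult)

lemma smooth_scaleR: "smooth f \<Longrightarrow> smooth (\<lambda>x. c *\<^sub>R f x)"
  by (rule smooth_compose_bounded_linear[OF bounded_linear_scaleR_right])

lemma smooth_cmult: "smooth f \<Longrightarrow> smooth (\<lambda>x. c * f x :: real)"
  by (rule smooth_compose_bounded_linear[OF bounded_linear_mult_right])

lemma smooth_diff: "smooth f \<Longrightarrow> smooth g \<Longrightarrow> smooth (\<lambda>x. f x - g x)"
  using smooth_add[OF _ smooth_scaleR[of g "-1"]] by simp

lemma smooth_has_derivative:
  "smooth f \<Longrightarrow> (f has_derivative frechet_derivative f (at x)) (at x)"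
  using C_k_has_derivative smooth_def by blast

lemma smooth_frechet_derivative: "smooth f \<Longrightarrow> smooth (\<lambda>x. frechet_derivative f (at x) v)"
  unfolding smooth_def by (metis C_k.simps(2))

lemma smoothI:
  assumes "\<And>x. (f has_derivative f' x) (at x)" "\<And>v. smooth (\<lambda>x. f' x v)"
  shows "smooth f"
  unfolding smooth_def
proof
  fix k
  show "C_k k f"
    by (rule C_k_SucD, rule C_k_SucI[OF assms(1)]) (use assms(2) in \<open>auto simp: smooth_def\<close>)
qed

lemma smooth_continuous_on: "smooth f \<Longrightarrow> continuous_on S f"
  unfolding smooth_def by (metis C_k.simps(1) continuous_on_subset subset_UNIV)

lemma smooth_antiderivative:
  fixes f g :: "real \<Rightarrow> real"
  assumes "\<And>x. (f has_real_derivative g x) (at x)" "smooth g"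
  shows "smooth f"
  using assms by (intro smoothI[of f "\<lambda>x. (*) (g x)"])
    (auto simp: has_field_derivative_def mult.commute[of _ "v::real" for v] smooth_cmult)

text \<open>Exponentials flat at the origin; the extra powers of $1/x$ close the family under
  differentiation.\<close>

definition flat_exp :: "nat \<Rightarrow> real \<Rightarrow> real" where
  "flat_exp n x = (if x > 0 then (1 / x) ^ n * exp (- 1 / x) else 0)"

text \<open>With y = 1/x this is the decay of y^n / exp y at infinity; to the left of 0 the function
  vanishes identically.\<close>

lemma flat_exp_tendsto_0: "(flat_exp n \<longlongrightarrow> 0) (at 0)"
proof -
  have "((\<lambda>x. inverse x ^ n / exp (inverse x)) \<longlongrightarrow> 0) (at_right (0::real))"
    by (rule filterlim_compose[OF tendsto_power_div_exp_0 filterlim_inverse_at_top_right])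
  moreover have "\<forall>\<^sub>F x in at_right 0. inverse x ^ n / exp (inverse x) = flat_exp n x"
    by (auto simp: flat_exp_def eventually_at_right_less exp_minus field_simps
        intro: eventually_mono[OF eventually_at_right_less[of 0]])
  ultimately have "(flat_exp n \<longlongrightarrow> 0) (at_right 0)"
    using Lim_transform_eventually by blast
  moreover have "(flat_exp n \<longlongrightarrow> 0) (at_left 0)"
    by (rule tendsto_eventually)
      (auto simp: flat_exp_def eventually_at_filter)
  ultimately show ?thesis
    by (simp add: filterlim_split_at)
qed

lemma flat_exp_has_derivative:
  "(flat_exp n has_real_derivative flat_exp (n + 2) x - n * flat_exp (n + 1) x) (at x)"
proof -
  consider "x > 0" | "x < 0" | "x = 0"
    by linarith
  then show ?thesis
  proof cases
    case 1
    have "((\<lambda>x. (1 / x) ^ n * exp (- 1 / x)) has_real_derivative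
        flat_exp (n + 2) x - n * flat_exp (n + 1) x) (at x)"
    proof -
      have "((\<lambda>y. y ^ n * exp (- y)) has_real_derivative
          (n * y ^ (n - 1) * exp (- y) - y ^ n * exp (- y))) (at y)" for y :: real
        by (auto intro!: derivative_eq_intros)
      moreover have "((\<lambda>x. 1 / x) has_real_derivative - (1 / x)\<^sup>2) (at x)"
        using 1 by (auto intro!: derivative_eq_intros simp: power2_eq_square)
      ultimately have "((\<lambda>x. (1 / x) ^ n * exp (- (1 / x))) has_real_derivative
          (n * (1 / x) ^ (n - 1) * exp (- (1 / x)) - (1 / x) ^ n * exp (- (1 / x))) * - (1 / x)\<^sup>2) (at x)"
        by (rule DERIV_chain2)
      moreover have "(n * y ^ (n - 1) * E - y ^ n * E) * - y\<^sup>2 = y ^ (n + 2) * E - n * (y ^ (n + 1) * E)"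
        for y E :: real
        by (cases n) (auto simp: algebra_simps power2_eq_square)
      ultimately show ?thesis
        using 1 by (simp add: flat_exp_def)
    qed
    then show ?thesis
      by (rule has_field_derivative_transform_within_open[where S="{0<..}"])
        (use 1 in \<open>auto simp: flat_exp_def\<close>)
  next
    case 2
    have "((\<lambda>x. 0) has_real_derivative flat_exp (n + 2) x - n * flat_exp (n + 1) x) (at x)"
      using 2 by (simp add: flat_exp_def)
    then show ?thesis
      by (rule has_field_derivative_transform_within_open[where S="{..<0}"])
        (use 2 in \<open>auto simp: flat_exp_def\<close>)
  next
    case 3
    \<comment> \<open>At the origin the difference quotient of \<open>flat_exp n\<close> is
      \<open>flat_exp (Suc n)\<close>, so the derivative is again a limit within the same
      family.\<close>
    have "((\<lambda>h. flat_exp n h / h) \<longlongrightarrow> 0) (at 0)"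
      by (rule Lim_transform_eventually[OF flat_exp_tendsto_0[of "Suc n"]])
        (auto simp: flat_exp_def eventually_at_filter)
    then show ?thesis
      using 3 by (simp add: DERIV_def flat_exp_def)
  qed
qed

text \<open>The induction over the order \<open>k\<close> has to run over all \<open>n\<close> at
  once, because one derivative of \<open>flat_exp n\<close> brings in the indices
  \<open>n + 1\<close> and \<open>n + 2\<close>.\<close>

lemma smooth_flat_exp_comp:
  assumes "smooth P"
  shows "smooth (\<lambda>x. flat_exp n (P x))"
proof -
  have "C_k k (\<lambda>x. flat_exp n (P x))" for k
  proof (induction k arbitrary: n)
    case 0
    have "continuous_on UNIV (flat_exp n)"
      by (auto intro!: continuous_at_imp_continuous_on DERIV_isCont flat_exp_has_derivative)
    then show ?case
      using assms by (auto intro: continuous_on_compose2[of UNIV "flat_exp n"] smooth_continuous_on)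
  next
    case (Suc k)
    have "((\<lambda>x. flat_exp n (P x)) has_derivative (\<lambda>v.
        (flat_exp (n + 2) (P x) + (- n) * flat_exp (n + 1) (P x)) * frechet_derivative P (at x) v)) (at x)" for x
      using has_derivative_compose[OF smooth_has_derivative[OF assms]
          flat_exp_has_derivative[unfolded has_field_derivative_def]] by simp
    then show ?case
      by (rule C_k_SucI) (intro C_k_mult C_k_add Suc C_k_const;
          use smooth_frechet_derivative[OF assms] in \<open>simp add: smooth_def\<close>)
  qed
  then show ?thesis
    by (simp add: smooth_def)
qed

section \<open>Bump functions\<close>

definition bump :: "'a::euclidean_space \<Rightarrow> real \<Rightarrow> 'a \<Rightarrow> real" where
  "bump c r x = flat_exp 0 (r\<^sup>2 - (x - c) \<bullet> (x - c))"

text \<open>The bump is built from the squared distance, a polynomial in the coordinates, so that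
  smoothness of the norm is never at stake. It is left unnormalised: its integral is a positive
  constant carried through all limits.\<close>

lemma smooth_bump: "smooth (bump c r)"
proof -
  have 1: "smooth (\<lambda>x::'a. -2 * (x \<bullet> v) + 2 * (c \<bullet> v))" for v
    by (intro smooth_add smooth_cmult smooth_const smooth_bounded_linear bounded_linear_inner_left)
  have "smooth (\<lambda>x::'a. r\<^sup>2 - (x - c) \<bullet> (x - c))"
  proof (rule smoothI)
    show "((\<lambda>x::'a. r\<^sup>2 - (x - c) \<bullet> (x - c)) has_derivative
        (\<lambda>v. -2 * (x \<bullet> v) + 2 * (c \<bullet> v))) (at x)" for x
      by (auto intro!: derivative_eq_intros simp: algebra_simps inner_commute)
  qed (rule 1)
  from smooth_flat_exp_comp[OF this] show ?thesis
    by (simp add: bump_def[abs_def])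
qed

lemma bump_nonneg: "bump c r x \<ge> 0"
  by (auto simp: bump_def flat_exp_def)

lemma bump_pos_iff: "r > 0 \<Longrightarrow> bump c r x > 0 \<longleftrightarrow> x \<in> ball c r"
proof -
  assume "r > 0"
  then have "(x - c) \<bullet> (x - c) < r\<^sup>2 \<longleftrightarrow> norm (x - c) < r"
    unfolding power2_norm_eq_inner[symmetric]
    using power_strict_mono[of "norm (x - c)" r 2] power_less_imp_less_base[of "norm (x - c)" 2 r]
    by auto
  then show ?thesis
    by (auto simp: bump_def flat_exp_def dist_norm norm_minus_commute)
qed

lemma bump_eq_0: "r > 0 \<Longrightarrow> x \<notin> ball c r \<Longrightarrow> bump c r x = 0"
  using bump_pos_iff[of r c x] bump_nonneg[of c r x] by linarith

lemma bump_le_1: "bump c r x \<le> 1"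
  by (auto simp: bump_def flat_exp_def)

lemma continuous_on_bump: "continuous_on S (bump c r)"
  by (rule smooth_continuous_on[OF smooth_bump])

lemma bump_integrable: "r > 0 \<Longrightarrow> integrable lborel (bump c r)"
proof -
  assume r: "r > 0"
  have "integrable lborel (\<lambda>x. indicator (cball c r) x *\<^sub>R bump c r x)"
    by (rule borel_integrable_compact[OF compact_cball continuous_on_bump])
  moreover have "(\<lambda>x. indicator (cball c r) x *\<^sub>R bump c r x) = bump c r"
    using bump_eq_0[OF r, of _ c] ball_subset_cball[of c r]
    by (force simp: indicator_def fun_eq_iff)
  ultimately show ?thesis by simp
qed

lemma bump_integral_pos:
  assumes "r > 0"
  shows "(LINT x|lborel. bump c r x) > 0"
proof -
  have "(LINT x|lborel. bump c r x) \<noteq> 0"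
  proof
    assume "(LINT x|lborel. bump c r x) = 0"
    then have "AE x in lborel. bump c r x = 0"
      using integral_nonneg_eq_0_iff_AE[OF bump_integrable[OF assms], of c]
      by (metis (mono_tags, lifting) AE_I2 bump_nonneg)
    then have "AE x in lborel. x \<notin> ball c r"
      by eventually_elim (use bump_pos_iff[OF assms] in force)
    then have "ball c r \<in> null_sets lborel"
      by (subst AE_iff_null_sets) auto
    then show False
      using assms content_ball_pos[OF assms, of c] by (simp add: null_sets_def measure_def)
  qed
  then show ?thesis
    by (simp add: bump_nonneg less_le)
qed

section \<open>Lebesgue points\<close>

text \<open>Vitali covering: disjoint balls with average above \<open>b\<close> exhaust the set up
  to a null set. If they lie in an open \<open>V\<close> around {f < a} that carries little mass of
  \<open>f\<close> outside that set, their union \<open>X\<close> satisfies b |X| \<le> \<nu>(X)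
  \<le> a |X| + \<epsilon>, which forces |X| to be small.\<close>

lemma negligible_large_averages:
  fixes f :: "'a::euclidean_space \<Rightarrow> real"
  assumes f: "integrable lebesgue f" "\<And>x. f x \<ge> 0" and ab: "a < b"
  defines "\<nu> \<equiv> density lebesgue (\<lambda>x. ennreal (f x))"
  shows "negligible {x. f x < a \<and>
    (\<forall>d>0. \<exists>r>0. r < d \<and> emeasure \<nu> (ball x r) > ennreal b * emeasure lebesgue (ball x r))}"
    (is "negligible ?A")
proof (cases "a > 0")
  \<comment> \<open>As \<open>f\<close> is nonnegative, the set is empty unless \<open>a\<close> is
    positive; a positive \<open>a\<close> then makes the products in \<open>ennreal\<close>
    faithful.\<close>
  case False
  then have "\<not> f x < a" for x
    using f(2)[of x] by linarith
  then have "?A = {}"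
    by blast
  then show ?thesis by (simp only: negligible_empty)
next
  case a: True
  have meas[measurable]: "f \<in> borel_measurable lebesgue"
    using f(1) by auto
  define M where "M = {x. f x < a}"
  have M[measurable]: "M \<in> sets lebesgue"
    using borel_measurable_less[OF meas borel_measurable_const[of a]] by (simp add: M_def)
  have \<nu>_eq: "emeasure \<nu> S = (\<integral>\<^sup>+x. ennreal (f x) * indicator S x \<partial>lebesgue)"
    if "S \<in> sets lebesgue" for S
    unfolding \<nu>_def using that by (simp add: emeasure_density)
  have \<nu>_sets[simp]: "sets \<nu> = sets lebesgue"
    by (simp add: \<nu>_def)
  show ?thesis
  proof (subst negligible_outer_le, intro allI impI)
    fix e :: real assume e: "e > 0"
    \<comment> \<open>With this value the final estimate (b - a) |X| \<le> \<epsilon> reads |X|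
      \<le> e.\<close>
    define \<epsilon> where "\<epsilon> = e * (b - a)"
    have \<epsilon>: "\<epsilon> > 0"
      using e ab by (simp add: \<epsilon>_def)
    have "\<exists>T. open T \<and> M \<subseteq> T \<and> emeasure lebesgue (T - M) < ennreal (inverse (real (Suc n)))" for n
      by (metis M sets_lebesgue_outer_open of_nat_0_less_iff zero_less_Suc inverse_positive_iff_positive)
    then obtain T where T: "\<And>n. open (T n)" "\<And>n. M \<subseteq> T n"
        "\<And>n. emeasure lebesgue (T n - M) < ennreal (inverse (real (Suc n)))"
      by metis
    \<comment> \<open>The sets \<open>W n\<close> decrease to a null set, so the integral of
      \<open>f\<close> over them tends to 0 by dominated convergence; this yields an open set
      \<open>V\<close> with little mass outside \<open>M\<close>.\<close>
    define W where "W n = (\<Inter>k\<le>n. T k) - M" for n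
    have W[measurable]: "W n \<in> sets lebesgue" for n
      unfolding W_def using T(1) by (intro sets.Diff M) (auto intro!: open_INT)
    have "decseq W"
      by (auto simp: decseq_def W_def)
    have "(\<lambda>n. LINT x|lebesgue. indicator (W n) x *\<^sub>R f x) \<longlonglongrightarrow>
        (LINT x|lebesgue. indicator (\<Inter>n. W n) x *\<^sub>R f x)"
    proof (rule integral_dominated_convergence[where w=f])
      show "AE x in lebesgue. (\<lambda>n. indicator (W n) x *\<^sub>R f x) \<longlonglongrightarrow> indicator (\<Inter>n. W n) x *\<^sub>R f x"
        by (intro AE_I2 tendsto_scaleR tendsto_const LIMSEQ_indicator_decseq \<open>decseq W\<close>)
    qed (use f in \<open>auto simp: indicator_def\<close>)
    moreover have "(\<Inter>n. W n) \<in> null_sets lebesgue"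
    proof -
      have "emeasure lebesgue (\<Inter>n. W n) \<le> ennreal (inverse (real (Suc n)))" for n
        by (rule order_trans[OF emeasure_mono less_imp_le[OF T(3)[of n]]])
          (use T(1) in \<open>auto simp: W_def intro!: sets.Diff\<close>)
      then have "emeasure lebesgue (\<Inter>n. W n) \<le> ennreal 0"
        by (intro LIMSEQ_le_const[OF tendsto_ennrealI[OF LIMSEQ_inverse_real_of_nat]]) blast
      then show ?thesis
        by (auto simp: null_sets_def)
    qed
    then have "AE x in lebesgue. x \<notin> (\<Inter>n. W n)"
      by (rule AE_not_in)
    then have "(LINT x|lebesgue. indicator (\<Inter>n. W n) x *\<^sub>R f x) = 0"
      by (intro integral_eq_zero_AE) (auto simp: indicator_def)
    ultimately have "\<forall>\<^sub>F n in sequentially. (LINT x|lebesgue. indicator (W n) x *\<^sub>R f x) < \<epsilon>"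
      using order_tendstoD(2) \<epsilon> by auto
    then obtain N where N: "(LINT x|lebesgue. indicator (W N) x *\<^sub>R f x) < \<epsilon>"
      by (auto simp: eventually_sequentially)
    define V where "V = (\<Inter>k\<le>N. T k)"
    have V: "open V" "M \<subseteq> V" "W N = V - M"
      using T by (auto simp: V_def W_def intro!: open_INT)
    have small: "emeasure \<nu> (V - M) \<le> ennreal \<epsilon>"
    proof -
      have "emeasure \<nu> (V - M) = (\<integral>\<^sup>+x. ennreal (indicator (W N) x *\<^sub>R f x) \<partial>lebesgue)"
        unfolding V(3)[symmetric] \<nu>_eq[OF W] by (intro nn_integral_cong) (auto simp: indicator_def)
      also have "\<dots> = ennreal (LINT x|lebesgue. indicator (W N) x *\<^sub>R f x)"
        using f integrable_mult_indicator[OF W f(1), of N] by (intro nn_integral_eq_integral) auto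
      finally show ?thesis
        using N by (simp add: ennreal_leI)
    qed
    define K where "K = {(x, r). x \<in> ?A \<and> r > 0 \<and> ball x r \<subseteq> V \<and>
        emeasure \<nu> (ball x r) > ennreal b * emeasure lebesgue (ball x r)}"
    obtain C where C: "countable C" "C \<subseteq> K"
        "pairwise (\<lambda>i j. disjnt (ball (fst i) (snd i)) (ball (fst j) (snd j))) C"
        "negligible (?A - (\<Union>i\<in>C. ball (fst i) (snd i)))"
    proof (rule Vitali_covering_theorem_balls[of ?A K fst snd])
      fix x and d :: real assume x: "x \<in> ?A" "d > 0"
      then have "x \<in> V"
        using V(2) by (auto simp: M_def)
      then obtain d' where d': "d' > 0" "ball x d' \<subseteq> V"
        using V(1) open_contains_ball by blast
      have "min d d' > 0" using x d' by simp
      then obtain r where r: "r > 0" "r < min d d'"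
          "emeasure \<nu> (ball x r) > ennreal b * emeasure lebesgue (ball x r)"
        using x(1) by blast
      then have "(x, r) \<in> K"
        using x d' subset_ball[of r d' x] by (auto simp: K_def)
      then show "\<exists>i. i \<in> K \<and> x \<in> ball (fst i) (snd i) \<and> snd i < d"
        using r by (intro exI[of _ "(x, r)"]) auto
    qed blast
    define X where "X = (\<Union>i\<in>C. ball (fst i) (snd i))"
    have CK: "ball (fst i) (snd i) \<subseteq> V"
        "ennreal b * emeasure lebesgue (ball (fst i) (snd i)) \<le> emeasure \<nu> (ball (fst i) (snd i))"
      if "i \<in> C" for i
      using subsetD[OF C(2) that] by (simp_all add: K_def case_prod_beta less_imp_le)
    have "open X"
      by (auto simp: X_def)
    then have X: "X \<in> sets lebesgue" "X \<subseteq> V"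
      using CK by (auto simp: X_def)
    have disj: "disjoint_family_on (\<lambda>i. ball (fst i) (snd i)) C"
      using C(3) by (auto simp: disjoint_family_on_def pairwise_def disjnt_def)
    have "ennreal b * emeasure lebesgue X =
        ennreal b * (\<integral>\<^sup>+i. emeasure lebesgue (ball (fst i) (snd i)) \<partial>count_space C)"
      unfolding X_def by (subst emeasure_UN_countable[OF _ C(1) disj]) auto
    also have "\<dots> = (\<integral>\<^sup>+i. ennreal b * emeasure lebesgue (ball (fst i) (snd i)) \<partial>count_space C)"
      by (simp add: nn_integral_cmult)
    also have "\<dots> \<le> (\<integral>\<^sup>+i. emeasure \<nu> (ball (fst i) (snd i)) \<partial>count_space C)"
      using CK by (intro nn_integral_mono) simp
    also have "\<dots> = emeasure \<nu> X"
      unfolding X_def by (subst emeasure_UN_countable[OF _ C(1) disj]) auto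
    finally have 1: "ennreal b * emeasure lebesgue X \<le> emeasure \<nu> X" .
    have VM: "X \<inter> M \<in> sets lebesgue" "V - M \<in> sets lebesgue"
      using V(1) by (auto intro!: sets.Int sets.Diff X M)
    have "emeasure \<nu> X \<le> emeasure \<nu> ((X \<inter> M) \<union> (V - M))"
      using X(2) sets.Un[OF VM] by (intro emeasure_mono) auto
    also have "\<dots> \<le> emeasure \<nu> (X \<inter> M) + emeasure \<nu> (V - M)"
      using VM by (intro emeasure_subadditive) simp_all
    also have "\<dots> \<le> ennreal a * emeasure lebesgue X + ennreal \<epsilon>"
    proof (rule add_mono[OF _ small])
      have "emeasure \<nu> (X \<inter> M) \<le> (\<integral>\<^sup>+x. ennreal a * indicator X x \<partial>lebesgue)"
        by (subst \<nu>_eq[OF VM(1)]) (auto intro!: nn_integral_mono simp: indicator_def M_def ennreal_leI)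
      then show "emeasure \<nu> (X \<inter> M) \<le> ennreal a * emeasure lebesgue X"
        using X(1) by (simp add: nn_integral_cmult_indicator)
    qed
    finally have 2: "emeasure \<nu> X \<le> ennreal a * emeasure lebesgue X + ennreal \<epsilon>" .
    \<comment> \<open>The finite total mass of \<open>f\<close> bounds |X|; otherwise the term a |X|
      could not be subtracted.\<close>
    have "emeasure \<nu> X \<le> (\<integral>\<^sup>+x. ennreal (f x) \<partial>lebesgue)"
      using X by (subst \<nu>_eq) (auto intro!: nn_integral_mono simp: indicator_def)
    also have "\<dots> < \<infinity>"
      using f by (simp add: nn_integral_eq_integral)
    finally have "ennreal b * emeasure lebesgue X < \<infinity>"
      using 1 by (simp add: order_le_less_trans)
    then have fin: "emeasure lebesgue X \<noteq> \<infinity>"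
      using a ab by (auto simp: ennreal_mult_less_top)
    then have Xm: "X \<in> lmeasurable"
      using X(1) by (simp add: fmeasurable_def top.not_eq_extremum)
    have "b * measure lebesgue X \<le> a * measure lebesgue X + \<epsilon>"
    proof -
      have "ennreal (b * measure lebesgue X) \<le> ennreal (a * measure lebesgue X + \<epsilon>)"
        using order_trans[OF 1 2] a ab \<epsilon> Xm
        by (simp add: emeasure_eq_measure2 ennreal_mult' ennreal_plus)
      then show ?thesis
        using a \<epsilon> by (subst (asm) ennreal_le_iff) auto
    qed
    then have "(b - a) * measure lebesgue X \<le> (b - a) * e"
      by (simp add: \<epsilon>_def algebra_simps)
    then have Xe: "measure lebesgue X \<le> e"
      using ab by simp
    show "\<exists>T. ?A \<subseteq> T \<and> T \<in> lmeasurable \<and> measure lebesgue T \<le> e"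
    proof (intro exI[of _ "X \<union> (?A - X)"] conjI)
      have neg: "?A - X \<in> null_sets lebesgue"
        using C(4) by (simp add: X_def negligible_iff_null_sets)
      then show "X \<union> (?A - X) \<in> lmeasurable"
        using Xm by (intro fmeasurable.Un) (auto simp: null_sets_def fmeasurable_def)
      show "measure lebesgue (X \<union> (?A - X)) \<le> e"
        using Xe neg Xm by (simp only: measure_Un_null_set fmeasurableD)
    qed auto
  qed
qed

text \<open>Between g x and g x + e there are rationals a < b, so countably many exceptional sets of
  \<open>negligible_large_averages\<close> cover all thresholds.\<close>

lemma AE_averages_le:
  fixes g :: "'a::euclidean_space \<Rightarrow> real"
  assumes g: "integrable lebesgue g" "\<And>x. g x \<ge> 0"
  shows "AE x in lebesgue. \<forall>e>0. \<forall>\<^sub>F r in at_right 0.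
    (LINT y:ball x r|lebesgue. g y) \<le> (g x + e) * measure lebesgue (ball x r)"
proof -
  define \<nu> where "\<nu> = density lebesgue (\<lambda>x. ennreal (g x))"
  define A where "A a b = {x. g x < a \<and>
    (\<forall>d>0. \<exists>r>0. r < d \<and> emeasure \<nu> (ball x r) > ennreal b * emeasure lebesgue (ball x r))}" for a b
  have meas[measurable]: "g \<in> borel_measurable lebesgue"
    using g by auto
  have "AE x in lebesgue. x \<notin> A a b" if "a < b" for a b
    unfolding A_def \<nu>_def using negligible_large_averages[OF g that]
    by (intro AE_not_in) (simp add: negligible_iff_null_sets)
  then have "AE x in lebesgue. \<forall>a\<in>\<rat>. \<forall>b\<in>\<rat>. a < b \<longrightarrow> x \<notin> A a b"
    by (auto simp: AE_ball_countable countable_rat)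
  then show ?thesis
  proof eventually_elim
    case (elim x)
    show ?case
    proof (intro allI impI)
      fix e :: real assume e: "e > 0"
      obtain a where a: "a \<in> \<rat>" "g x < a" "a < g x + e"
        using Rats_dense_in_real[of "g x" "g x + e"] e by auto
      obtain b where b: "b \<in> \<rat>" "a < b" "b < g x + e"
        using Rats_dense_in_real[OF a(3)] by auto
      have b0: "b > 0"
        using g(2)[of x] a b by linarith
      have "x \<notin> A a b"
        using elim a b by blast
      then obtain d where d: "d > 0"
          "\<And>r. 0 < r \<Longrightarrow> r < d \<Longrightarrow> emeasure \<nu> (ball x r) \<le> ennreal b * emeasure lebesgue (ball x r)"
        using a(2) unfolding A_def mem_Collect_eq by (metis not_less)
      have "(LINT y:ball x r|lebesgue. g y) \<le> (g x + e) * measure lebesgue (ball x r)"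
        if r: "0 < r" "r < d" for r
      proof -
        have "ennreal (LINT y:ball x r|lebesgue. g y) = (\<integral>\<^sup>+y. ennreal (indicator (ball x r) y *\<^sub>R g y) \<partial>lebesgue)"
          unfolding set_lebesgue_integral_def
          using g integrable_mult_indicator[of "ball x r" lebesgue g]
          by (subst nn_integral_eq_integral) auto
        also have "\<dots> = emeasure \<nu> (ball x r)"
          unfolding \<nu>_def by (subst emeasure_density) (auto intro!: nn_integral_cong simp: indicator_def)
        also have "\<dots> \<le> ennreal b * emeasure lebesgue (ball x r)"
          by (rule d(2)[OF r])
        also have "\<dots> = ennreal (b * measure lebesgue (ball x r))"
          using b0 by (simp add: emeasure_eq_measure2 ennreal_mult')
        finally have "(LINT y:ball x r|lebesgue. g y) \<le> b * measure lebesgue (ball x r)"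
          using b0 by (subst (asm) ennreal_le_iff) auto
        also have "\<dots> \<le> (g x + e) * measure lebesgue (ball x r)"
          using b by (intro mult_right_mono) auto
        finally show ?thesis .
      qed
      then show "\<forall>\<^sub>F r in at_right 0.
          (LINT y:ball x r|lebesgue. g y) \<le> (g x + e) * measure lebesgue (ball x r)"
        using d(1) by (auto simp: eventually_at_right_field intro!: exI[of _ d])
    qed
  qed
qed

text \<open>The integral is divided by a power of the radius instead of the volume of the ball; the
  two differ by the constant factor \<open>unit_ball_vol\<close>, which does not affect a limit
  0.\<close>

definition lebesgue_point :: "('a::euclidean_space \<Rightarrow> real) \<Rightarrow> 'a \<Rightarrow> bool" where
  "lebesgue_point f x \<longleftrightarrow>
     ((\<lambda>r. (LINT y:ball x r|lebesgue. \<bar>f y - f x\<bar>) / r ^ DIM('a)) \<longlongrightarrow> 0) (at_right 0)"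

text \<open>The upper bound for averages is applied to |f - c| for all rational \<open>c\<close> at
  once; at a good point \<open>c\<close> is then picked close to f x, where |f x - c| is
  small.\<close>

lemma AE_lebesgue_point_compact:
  fixes f :: "'a::euclidean_space \<Rightarrow> real"
  assumes f: "set_integrable lebesgue K f" and K: "compact K"
  shows "AE x in lebesgue. x \<in> interior K \<longrightarrow> lebesgue_point f x"
proof -
  define g where "g c x = indicator K x *\<^sub>R \<bar>f x - c\<bar>" for c x
  have ci: "set_integrable lebesgue K (\<lambda>x. c)" for c :: real
    unfolding set_integrable_def using lmeasurable_compact[OF K]
    by (intro integrable_scaleR_left integrable_real_indicator) (auto simp: fmeasurable_def)
  have g: "integrable lebesgue (g c)" for c
    using set_integrable_abs[OF set_integral_diff(1)[OF f ci[of c]]]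
    by (simp add: g_def[abs_def] set_integrable_def)
  have g0: "g c x \<ge> 0" for c x
    by (simp add: g_def)
  have "AE x in lebesgue. \<forall>c\<in>\<rat>. \<forall>e>0. \<forall>\<^sub>F r in at_right 0.
    (LINT y:ball x r|lebesgue. g c y) \<le> (g c x + e) * measure lebesgue (ball x r)"
    by (subst AE_ball_countable[OF countable_rat]) (use AE_averages_le[OF g g0] in blast)
  then show ?thesis
  proof eventually_elim
    case (elim x)
    show ?case
    proof
      assume x: "x \<in> interior K"
      obtain d where d: "d > 0" "ball x d \<subseteq> interior K"
        using x open_interior open_contains_ball by blast
      have sub: "ball x r \<subseteq> K" if "r < d" for r
        using that d subset_ball[of r d x] interior_subset by force
      let ?u = "unit_ball_vol (real DIM('a))"
      show "lebesgue_point f x"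
        unfolding lebesgue_point_def
      proof (rule tendstoI)
        fix e :: real assume e: "e > 0"
        \<comment> \<open>Three contributions of size \<open>e'\<close> arise: |f x - c|, the slack
          in the bound for averages, and the replacement of \<open>c\<close> by f x. The factor 4
          and the added 1 keep 3 e' times the volume of the unit ball below
          \<open>e\<close>.\<close>
        define e' where "e' = e / (4 * (?u + 1))"
        have u0: "?u > 0" by simp
        have e': "e' > 0"
          unfolding e'_def by (intro divide_pos_pos mult_pos_pos add_pos_pos e u0) auto
        have e'_e: "3 * e' * ?u < e"
        proof -
          have "e / (4 * (k + 1)) * (k + 1) = e / 4" if "k > 0" for k :: real
            using that by (simp add: field_simps)
          from this[OF u0] have "e' * ?u + e' = e / 4"
            unfolding e'_def by (simp only: distrib_left mult_1_right)
          then have "4 * (e' * ?u) + 4 * e' = e"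
            by simp
          then have "4 * (e' * ?u) < e" "e' * ?u > 0"
            using e' u0 by (auto intro: mult_pos_pos simp only: )
          then show ?thesis
            by simp
        qed
        obtain c where c: "c \<in> \<rat>" "f x < c" "c < f x + e'"
          using Rats_dense_in_real[of "f x" "f x + e'"] e' by auto
        have gx: "g c x \<le> e'"
          using c by (auto simp: g_def indicator_def)
        have "\<forall>\<^sub>F r in at_right 0. (LINT y:ball x r|lebesgue. g c y) \<le> (g c x + e') * measure lebesgue (ball x r)"
          using elim c(1) e' by blast
        moreover have "\<forall>\<^sub>F r in at_right 0. 0 < r \<and> r < d"
          using d(1) by (auto simp: eventually_at_right_field intro!: exI[of _ d])
        ultimately show "\<forall>\<^sub>F r in at_right 0.
            dist ((LINT y:ball x r|lebesgue. \<bar>f y - f x\<bar>) / r ^ DIM('a)) 0 < e"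
        proof eventually_elim
          case (elim r)
          have ball: "ball x r \<in> sets lebesgue"
            by simp
          have fi: "set_integrable lebesgue (ball x r) f"
            by (rule set_integrable_subset[OF f]) (use sub elim in auto)
          have ci: "set_integrable lebesgue (ball x r) (\<lambda>x. c)" for c :: real
            by (rule set_integrable_subset[OF ci]) (use sub elim in auto)
          have i1: "set_integrable lebesgue (ball x r) (\<lambda>y. \<bar>f y - c\<bar>)" for c
            by (rule set_integrable_abs[OF set_integral_diff(1)[OF fi ci]])
          have "(LINT y:ball x r|lebesgue. \<bar>f y - f x\<bar>) \<le> (LINT y:ball x r|lebesgue. \<bar>f y - c\<bar> + e')"
            using c by (intro set_integral_mono i1 set_integral_add ci) auto
          also have "\<dots> = (LINT y:ball x r|lebesgue. \<bar>f y - c\<bar>) + (LINT y:ball x r|lebesgue. e')"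
            by (rule set_integral_add(2)[OF i1 ci])
          also have "(LINT y:ball x r|lebesgue. \<bar>f y - c\<bar>) = (LINT y:ball x r|lebesgue. g c y)"
            by (rule set_lebesgue_integral_cong[OF ball])
              (use sub elim in \<open>auto simp: g_def indicator_def subset_iff\<close>)
          also have "\<dots> \<le> (g c x + e') * measure lebesgue (ball x r)"
            using elim by blast
          also have "\<dots> \<le> (e' + e') * measure lebesgue (ball x r)"
            using gx by (intro mult_right_mono) auto
          also have "(LINT y:ball x r|lebesgue. e') = e' * measure lebesgue (ball x r)"
            by (simp add: set_lebesgue_integral_def)
          finally have "(LINT y:ball x r|lebesgue. \<bar>f y - f x\<bar>) \<le> 3 * e' * measure lebesgue (ball x r)"
            by simp
          also have "measure lebesgue (ball x r) = ?u * r ^ DIM('a)"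
            using elim by (simp add: content_ball)
          finally have "(LINT y:ball x r|lebesgue. \<bar>f y - f x\<bar>) / r ^ DIM('a) \<le> 3 * e' * ?u"
            using elim by (simp add: field_simps)
          also have "\<dots> < e"
            by (rule e'_e)
          finally show ?case
            using elim by (simp add: set_lebesgue_integral_def)
        qed
      qed
    qed
  qed
qed

text \<open>Lindelof reduces an open set to countably many balls whose closures lie in it, and on
  each closure the compact case applies.\<close>

theorem AE_lebesgue_point:
  fixes f :: "'a::euclidean_space \<Rightarrow> real"
  assumes "open U" "locally_integrable U f"
  shows "AE x in lebesgue. x \<in> U \<longrightarrow> lebesgue_point f x"
proof -
  define F where "F = {ball x r |x r. cball x r \<subseteq> U}"
  obtain F' where F': "F' \<subseteq> F" "countable F'" "\<Union>F' = \<Union>F"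
    by (rule Lindelof[of F]) (auto simp: F_def)
  have "\<Union>F = U"
  proof
    show "\<Union>F \<subseteq> U"
      using ball_subset_cball by (force simp: F_def)
    show "U \<subseteq> \<Union>F"
    proof
      fix x assume "x \<in> U"
      then obtain e where e: "e > 0" "cball x e \<subseteq> U"
        using assms(1) open_contains_cball by blast
      then have "ball x e \<in> F"
        unfolding F_def by blast
      then show "x \<in> \<Union>F"
        using e(1) centre_in_ball by blast
    qed
  qed
  have "AE x in lebesgue. \<forall>B\<in>F'. x \<in> B \<longrightarrow> lebesgue_point f x"
  proof (subst AE_ball_countable[OF F'(2)], intro ballI)
    fix B assume "B \<in> F'"
    then obtain c r where B: "B = ball c r" "cball c r \<subseteq> U"
      using F'(1) by (auto simp: F_def)
    then have "set_integrable lebesgue (cball c r) f"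
      using assms(2) by (auto simp: locally_integrable_def)
    from AE_lebesgue_point_compact[OF this compact_cball]
    show "AE x in lebesgue. x \<in> B \<longrightarrow> lebesgue_point f x"
      by (simp add: B interior_cball)
  qed
  then show ?thesis
    by eventually_elim (use F'(3) \<open>\<Union>F = U\<close> in blast)
qed

section \<open>Lebesgue spaces\<close>

lemma powr_add_le:
  fixes a b q :: real
  assumes "a \<ge> 0" "b \<ge> 0" "q > 0"
  shows "(a + b) powr q \<le> 2 powr q * (a powr q + b powr q)"
proof -
  have "(a + b) powr q \<le> (2 * max a b) powr q"
    using assms by (intro powr_mono2) auto
  also have "\<dots> = 2 powr q * max a b powr q"
    using assms by (simp add: powr_mult)
  also have "\<dots> \<le> 2 powr q * (a powr q + b powr q)"
    by (intro mult_left_mono) (auto simp: max_def)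
  finally show ?thesis .
qed

lemma powr_convex_le:
  fixes x y t q :: real
  assumes "x \<ge> 0" "y \<ge> 0" "0 \<le> t" "t \<le> 1" "q \<ge> 1"
  shows "((1 - t) * x + t * y) powr q \<le> (1 - t) * x powr q + t * y powr q"
proof -
  have le: "(s * z) powr q \<le> s * z powr q" if "0 \<le> s" "s \<le> 1" "z \<ge> 0" for s z :: real
  proof -
    have "s powr q \<le> s powr 1"
      using that assms by (intro powr_mono') auto
    then show ?thesis
      using that by (simp add: powr_mult mult_right_mono)
  qed
  \<comment> \<open>The cases with a zero are separate because convexity of the power function is
    taken on the positive reals.\<close>
  consider "x = 0" | "y = 0" | "x > 0" "y > 0"
    using assms by linarith
  then show ?thesis
  proof cases
    case 3
    then show ?thesis
      using convex_onD[OF powr_convex[OF assms(5)], of t x y] assms by simp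
  qed (use le[of t y] le[of "1 - t" x] assms in auto)
qed

lemma integrable_powr_add:
  fixes f g :: "'a \<Rightarrow> 'b::euclidean_space"
  assumes [measurable]: "f \<in> borel_measurable M" "g \<in> borel_measurable M"
    and "integrable M (\<lambda>x. norm (f x) powr q)" "integrable M (\<lambda>x. norm (g x) powr q)" "q > 0"
  shows "integrable M (\<lambda>x. norm (f x + g x) powr q)"
proof (rule Bochner_Integration.integrable_bound)
  show "integrable M (\<lambda>x. 2 powr q * (norm (f x) powr q + norm (g x) powr q))"
    using assms by (intro integrable_mult_right Bochner_Integration.integrable_add)
  have "norm (f x + g x) powr q \<le> 2 powr q * (norm (f x) powr q + norm (g x) powr q)" for x
    using order_trans[OF powr_mono2[OF _ _ norm_triangle_ineq] powr_add_le] assms(5) by auto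
  then show "AE x in M. norm (norm (f x + g x) powr q)
      \<le> norm (2 powr q * (norm (f x) powr q + norm (g x) powr q))"
    by (auto intro!: AE_I2 simp: abs_mult)
qed measurable

section \<open>The inequalities of Minkowski and Hoelder\<close>

lemma AE_eq_0_of_powr_integral:
  fixes f :: "'a \<Rightarrow> 'b::euclidean_space"
  assumes "integrable M (\<lambda>x. norm (f x) powr q)" "(LINT x|M. norm (f x) powr q) = 0"
  shows "AE x in M. f x = 0"
  using integral_nonneg_eq_0_iff_AE[OF assms(1)] assms(2) by simp

text \<open>Convexity of the q-th power is applied to the normalised values |f|/a and |g|/b with
  weights a/(a+b) and b/(a+b), where \<open>a\<close> and \<open>b\<close> are the two norms;
  integration then gives (a+b)^q. A function of norm 0 vanishes almost everywhere and is treated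
  apart.\<close>

lemma Minkowski:
  fixes f g :: "'a \<Rightarrow> 'b::euclidean_space"
  assumes meas[measurable]: "f \<in> borel_measurable M" "g \<in> borel_measurable M"
    and int: "integrable M (\<lambda>x. norm (f x) powr q)" "integrable M (\<lambda>x. norm (g x) powr q)"
    and q: "q \<ge> 1"
  shows "(LINT x|M. norm (f x + g x) powr q) powr (1 / q)
    \<le> (LINT x|M. norm (f x) powr q) powr (1 / q) + (LINT x|M. norm (g x) powr q) powr (1 / q)"
proof -
  let ?A = "LINT x|M. norm (f x) powr q" and ?B = "LINT x|M. norm (g x) powr q"
  have A0: "?A \<ge> 0" and B0: "?B \<ge> 0"
    by (auto intro: Bochner_Integration.integral_nonneg)
  consider "?A = 0" | "?B = 0" | "?A > 0" "?B > 0"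
    using A0 B0 by linarith
  then show ?thesis
  proof cases
    case 1
    then have "AE x in M. norm (f x + g x) powr q = norm (g x) powr q"
      using AE_eq_0_of_powr_integral[OF int(1)] by auto
    then have "(LINT x|M. norm (f x + g x) powr q) = ?B"
      by (intro integral_cong_AE) auto
    then show ?thesis
      by simp
  next
    case 2
    then have "AE x in M. norm (f x + g x) powr q = norm (f x) powr q"
      using AE_eq_0_of_powr_integral[OF int(2)] by auto
    then have "(LINT x|M. norm (f x + g x) powr q) = ?A"
      by (intro integral_cong_AE) auto
    then show ?thesis
      by simp
  next
    case 3
    define a b where "a = ?A powr (1 / q)" and "b = ?B powr (1 / q)"
    have a: "a > 0" "a powr q = ?A" and b: "b > 0" "b powr q = ?B"
      using 3 q by (auto simp: a_def b_def powr_powr)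
    define t where "t = b / (a + b)"
    have t: "0 \<le> t" "t \<le> 1" "1 - t = a / (a + b)"
      using a b by (auto simp: t_def field_simps)
    have pw: "norm (f x + g x) powr q
        \<le> (a + b) powr q * ((1 - t) * (norm (f x) powr q / ?A) + t * (norm (g x) powr q / ?B))" for x
    proof -
      have "norm (f x + g x) powr q \<le> (norm (f x) + norm (g x)) powr q"
        using q by (intro powr_mono2 norm_triangle_ineq) auto
      also have "norm (f x) + norm (g x) = (a + b) * ((1 - t) * (norm (f x) / a) + t * (norm (g x) / b))"
        using a b unfolding t(3) by (simp add: t_def distrib_left)
      also have "\<dots> powr q = (a + b) powr q * ((1 - t) * (norm (f x) / a) + t * (norm (g x) / b)) powr q"
        by (rule powr_mult)
      also have "\<dots> \<le> (a + b) powr q * ((1 - t) * (norm (f x) / a) powr q + t * (norm (g x) / b) powr q)"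
        using a b t q by (intro mult_left_mono powr_convex_le) auto
      finally show ?thesis
        using a b by (simp add: powr_divide)
    qed
    have "(LINT x|M. norm (f x + g x) powr q)
        \<le> (LINT x|M. (a + b) powr q * ((1 - t) * (norm (f x) powr q / ?A) + t * (norm (g x) powr q / ?B)))"
      using q by (intro integral_mono integrable_powr_add meas int pw integrable_mult_right
          Bochner_Integration.integrable_add integrable_divide) auto
    also have "\<dots> = (a + b) powr q * ((1 - t) * (?A / ?A) + t * (?B / ?B))"
      by (subst integral_mult_right_zero, subst Bochner_Integration.integral_add)
        (auto intro!: integrable_mult_right integrable_divide int)
    also have "\<dots> = (a + b) powr q"
      using 3 by simp
    finally have "(LINT x|M. norm (f x + g x) powr q) powr (1 / q) \<le> ((a + b) powr q) powr (1 / q)"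
      using q by (intro powr_mono2) (auto intro: Bochner_Integration.integral_nonneg)
    also have "\<dots> = a + b"
      using a b q by (simp add: powr_powr)
    finally show ?thesis
      by (simp add: a_def b_def)
  qed
qed

text \<open>Young's inequality for the functions divided by their norms; after integration the two
  terms are 1/p and 1/q, which add up to 1.\<close>

lemma Hoelder:
  fixes f g :: "'a \<Rightarrow> 'b::euclidean_space"
  assumes meas[measurable]: "f \<in> borel_measurable M" "g \<in> borel_measurable M"
    and int: "integrable M (\<lambda>x. norm (f x) powr p)" "integrable M (\<lambda>x. norm (g x) powr q)"
    and pq: "p > 1" "q > 1" "1 / p + 1 / q = 1"
  shows Hoelder_integrable_norm: "integrable M (\<lambda>x. norm (f x) * norm (g x))"
    and Hoelder_integrable: "integrable M (\<lambda>x. f x \<bullet> g x)"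
    and Hoelder_norm: "(LINT x|M. norm (f x) * norm (g x))
      \<le> (LINT x|M. norm (f x) powr p) powr (1 / p) * (LINT x|M. norm (g x) powr q) powr (1 / q)"
    and Hoelder_inner: "\<bar>LINT x|M. f x \<bullet> g x\<bar>
      \<le> (LINT x|M. norm (f x) powr p) powr (1 / p) * (LINT x|M. norm (g x) powr q) powr (1 / q)"
proof -
  show 1: "integrable M (\<lambda>x. norm (f x) * norm (g x))"
  proof (rule Bochner_Integration.integrable_bound)
    show "integrable M (\<lambda>x. norm (f x) powr p / p + norm (g x) powr q / q)"
      using int by auto
    have "norm (f x) * norm (g x) \<le> norm (f x) powr p / p + norm (g x) powr q / q" for x
      using Youngs_inequality[OF pq] by simp
    then show "AE x in M. norm (norm (f x) * norm (g x))
        \<le> norm (norm (f x) powr p / p + norm (g x) powr q / q)"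
      using pq by (auto intro!: AE_I2)
  qed measurable
  show 2: "integrable M (\<lambda>x. f x \<bullet> g x)"
    by (rule Bochner_Integration.integrable_bound[OF 1]) (auto simp: Cauchy_Schwarz_ineq2)
  let ?A = "LINT x|M. norm (f x) powr p" and ?B = "LINT x|M. norm (g x) powr q"
  have A0: "?A \<ge> 0" and B0: "?B \<ge> 0"
    by (auto intro: Bochner_Integration.integral_nonneg)
  consider "?A = 0 \<or> ?B = 0" | "?A > 0" "?B > 0"
    using A0 B0 by linarith
  then show 3: "(LINT x|M. norm (f x) * norm (g x)) \<le> ?A powr (1 / p) * ?B powr (1 / q)"
  proof cases
    case 1
    then have "AE x in M. norm (f x) * norm (g x) = 0"
      using AE_eq_0_of_powr_integral[OF int(1)] AE_eq_0_of_powr_integral[OF int(2)] by auto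
    then have "(LINT x|M. norm (f x) * norm (g x)) = 0"
      by (rule integral_eq_zero_AE)
    then show ?thesis
      by simp
  next
    case AB: 2
    define a b where "a = ?A powr (1 / p)" and "b = ?B powr (1 / q)"
    have a: "a > 0" "a powr p = ?A" and b: "b > 0" "b powr q = ?B"
      using AB pq by (auto simp: a_def b_def powr_powr)
    have "norm (f x) * norm (g x) \<le> a * b * (norm (f x) powr p / ?A / p + norm (g x) powr q / ?B / q)" for x
    proof -
      have "norm (f x) * norm (g x) = a * b * ((norm (f x) / a) * (norm (g x) / b))"
        using a b by simp
      also have "\<dots> \<le> a * b * ((norm (f x) / a) powr p / p + (norm (g x) / b) powr q / q)"
        using a b Youngs_inequality[OF pq, of "norm (f x) / a" "norm (g x) / b"]
        by (intro mult_left_mono) auto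
      finally show ?thesis
        using a b by (simp add: powr_divide)
    qed
    then have "(LINT x|M. norm (f x) * norm (g x))
        \<le> (LINT x|M. a * b * (norm (f x) powr p / ?A / p + norm (g x) powr q / ?B / q))"
      using 1 int by (intro integral_mono) auto
    also have "\<dots> = a * b * (?A / ?A / p + ?B / ?B / q)"
      by (subst integral_mult_right_zero, subst Bochner_Integration.integral_add)
        (use int in auto)
    also have "\<dots> = a * b"
      using AB pq by simp
    finally show ?thesis
      by (simp add: a_def b_def)
  qed
  have "\<bar>LINT x|M. f x \<bullet> g x\<bar> \<le> (LINT x|M. norm (f x) * norm (g x))"
    using order_trans[OF integral_abs_bound integral_mono[OF integrable_abs[OF 2] 1]]
    by (simp add: Cauchy_Schwarz_ineq2)
  then show "\<bar>LINT x|M. f x \<bullet> g x\<bar> \<le> ?A powr (1 / p) * ?B powr (1 / q)"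
    using 3 by linarith
qed

lemma conj_exp:
  assumes "p > 1"
  shows "conj_exp p > 1" "1 / p + 1 / conj_exp p = 1"
  using assms by (auto simp: conj_exp_def field_simps)

text \<open>Completeness of Lebesgue measure: preimages under the two functions differ by a null
  set. This is what lets representatives be exchanged without a separate measurability assumption on
  the new one.\<close>

lemma borel_measurable_lebesgue_on_AE:
  fixes f g :: "'a::euclidean_space \<Rightarrow> 'b::euclidean_space"
  assumes f: "f \<in> borel_measurable (lebesgue_on U)" and eq: "AE x in lebesgue_on U. f x = g x"
    and U: "U \<in> sets lebesgue"
  shows "g \<in> borel_measurable (lebesgue_on U)"
proof -
  let ?f = "\<lambda>x. if x \<in> U then f x else 0" and ?g = "\<lambda>x. if x \<in> U then g x else 0"
  have f': "?f \<in> borel_measurable lebesgue"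
    using f U by (simp add: borel_measurable_if)
  have "AE x in lebesgue. ?f x = ?g x"
    using eq U by (auto simp: AE_restrict_space_iff)
  then have ae: "AE x in lebesgue. x \<in> ?f -` S \<longleftrightarrow> x \<in> ?g -` S" for S
    by eventually_elim auto
  have "?g -` S \<in> sets lebesgue" if "S \<in> sets borel" for S
    using completion.in_sets_AE[OF ae] measurable_sets[OF f' that] by auto
  then have "?g \<in> borel_measurable lebesgue"
    by (auto intro!: measurableI)
  then show ?thesis
    by (rule borel_measurable_if_D)
qed

lemma L_space_elts_iff:
  "f \<in> elts (L_space U S q) \<longleftrightarrow> f \<in> borel_measurable (lebesgue_on U) \<and>
     integrable (lebesgue_on U) (\<lambda>x. norm (f x) powr q) \<and> (AE x in lebesgue_on U. f x \<in> S)"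
  by (simp add: L_space_def)

lemma snorm_L_space:
  "snorm (L_space U S q) f = (LINT x|lebesgue_on U. norm (f x) powr q) powr (1 / q)"
  by (simp add: L_space_def)

lemma L_space_nonneg: "snorm (L_space U S q) f \<ge> 0"
  by (simp add: snorm_L_space)

lemma L_space_snorm_UNIV: "snorm (L_space U S q) = snorm (L_space U UNIV q)"
  by (simp add: snorm_L_space fun_eq_iff)

lemma L_space_elts_mono: "f \<in> elts (L_space U S q) \<Longrightarrow> S \<subseteq> S' \<Longrightarrow> f \<in> elts (L_space U S' q)"
  by (auto simp: L_space_elts_iff)

lemma L_space_add:
  assumes "f \<in> elts (L_space U S q)" "g \<in> elts (L_space U S q)" "q > 0" "subspace S"
  shows "f + g \<in> elts (L_space U S q)"
  using assms by (auto simp: L_space_elts_iff plus_fun_def subspace_add intro!: integrable_powr_add)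

lemma L_space_scaleR:
  assumes "f \<in> elts (L_space U S q)" "subspace S"
  shows "c *\<^sub>R f \<in> elts (L_space U S q)"
  using assms by (auto simp: L_space_elts_iff scaleR_fun_def powr_mult subspace_scale)

lemma L_space_diff:
  assumes "f \<in> elts (L_space U S q)" "g \<in> elts (L_space U S q)" "q > 0" "subspace S"
  shows "f - g \<in> elts (L_space U S q)"
  using L_space_add[OF assms(1) L_space_scaleR[OF assms(2,4), of "-1"] assms(3,4)] by simp

lemma L_space_zero: "subspace S \<Longrightarrow> 0 \<in> elts (L_space U S q)"
  by (auto simp: L_space_elts_iff subspace_0 zero_fun_def)

lemma L_space_snorm_scaleR: "q > 0 \<Longrightarrow> snorm (L_space U S q) (c *\<^sub>R f) = \<bar>c\<bar> * snorm (L_space U S q) f"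
  by (simp add: snorm_L_space scaleR_fun_def powr_mult powr_powr)

lemma L_space_snorm_minus_commute: "snorm (L_space U S q) (f - g) = snorm (L_space U S q) (g - f)"
  by (simp add: snorm_L_space norm_minus_commute)

lemma L_space_triangle:
  assumes "f \<in> elts (L_space U S q)" "g \<in> elts (L_space U S q)" "q \<ge> 1"
  shows "snorm (L_space U S q) (f + g) \<le> snorm (L_space U S q) f + snorm (L_space U S q) g"
  using assms Minkowski[of f "lebesgue_on U" g q] by (simp add: L_space_elts_iff snorm_L_space)

lemma L_space_triangle_diff:
  assumes "f \<in> elts (L_space U S q)" "g \<in> elts (L_space U S q)" "q \<ge> 1" "subspace S"
  shows "snorm (L_space U S q) (f - g) \<le> snorm (L_space U S q) f + snorm (L_space U S q) g"
  using L_space_triangle[OF assms(1) L_space_scaleR[OF assms(2,4), of "-1"] assms(3)]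
    L_space_snorm_scaleR[of q U S "-1" g] assms(3) by simp

lemma L_space_snorm_AE_cong:
  assumes "AE x in lebesgue_on U. f x = g x" "f \<in> borel_measurable (lebesgue_on U)" "U \<in> sets lebesgue"
  shows "snorm (L_space U S q) f = snorm (L_space U S q) g"
proof -
  have [measurable]: "g \<in> borel_measurable (lebesgue_on U)"
    by (rule borel_measurable_lebesgue_on_AE[OF assms(2,1,3)])
  note [measurable] = assms(2)
  have "(LINT x|lebesgue_on U. norm (f x) powr q) = (LINT x|lebesgue_on U. norm (g x) powr q)"
    by (intro integral_cong_AE) (use assms(1) in auto)
  then show ?thesis
    by (simp add: snorm_L_space)
qed

lemma L_space_AE_cong:
  assumes "AE x in lebesgue_on U. f x = g x" "f \<in> elts (L_space U S q)" "U \<in> sets lebesgue"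
  shows "g \<in> elts (L_space U S q)"
proof -
  have [measurable]: "f \<in> borel_measurable (lebesgue_on U)"
    using assms(2) by (simp add: L_space_elts_iff)
  have [measurable]: "g \<in> borel_measurable (lebesgue_on U)"
    by (rule borel_measurable_lebesgue_on_AE[OF _ assms(1,3)]) simp
  have "AE x in lebesgue_on U. norm (f x) powr q = norm (g x) powr q"
    using assms(1) by auto
  then have "integrable (lebesgue_on U) (\<lambda>x. norm (g x) powr q)"
    using assms(2) by (subst integrable_cong_AE[symmetric]) (auto simp: L_space_elts_iff)
  moreover have "AE x in lebesgue_on U. g x \<in> S"
    using assms(1,2) by (auto simp: L_space_elts_iff)
  ultimately show ?thesis
    by (simp add: L_space_elts_iff)
qed

lemma L_space_snorm_eq_0D:
  assumes "f \<in> elts (L_space U S q)" "snorm (L_space U S q) f = 0"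
  shows "AE x in lebesgue_on U. f x = 0"
  using AE_eq_0_of_powr_integral[of "lebesgue_on U" f q] assms
  by (simp add: snorm_L_space L_space_elts_iff)

lemma L_space_snorm_eq_0I:
  assumes "AE x in lebesgue_on U. f x = 0" "q > 0"
  shows "snorm (L_space U S q) f = 0"
proof -
  have "(LINT x|lebesgue_on U. norm (f x) powr q) = 0"
    using assms by (intro integral_eq_zero_AE) auto
  then show ?thesis
    by (simp add: snorm_L_space)
qed

lemma L_space_Hoelder:
  assumes "f \<in> elts (L_space U S p)" "g \<in> elts (L_space U S' q)"
    and pq: "p > 1" "q > 1" "1 / p + 1 / q = 1"
  shows L_space_pairing_integrable: "integrable (lebesgue_on U) (\<lambda>x. f x \<bullet> g x)"
    and L_space_pairing_le: "\<bar>pairing U f g\<bar> \<le> snorm (L_space U S p) f * snorm (L_space U S' q) g"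
  using Hoelder_integrable[of f "lebesgue_on U" g p q] Hoelder_inner[of f "lebesgue_on U" g p q] assms
  by (auto simp: L_space_elts_iff snorm_L_space pairing_def)

section \<open>Domains that differ by a null set\<close>

lemma lebesgue_on_AE_null:
  assumes U: "U \<in> sets lebesgue" and N: "N \<in> null_sets lebesgue"
  shows "(AE x in lebesgue_on (U - N). P x) \<longleftrightarrow> (AE x in lebesgue_on U. P x)"
proof -
  have UN: "(U - N) \<inter> space lebesgue \<in> sets lebesgue" "U \<inter> space lebesgue \<in> sets lebesgue"
    using U N by auto
  have "(AE x in lebesgue. x \<in> U - N \<longrightarrow> P x) \<longleftrightarrow> (AE x in lebesgue. x \<in> U \<longrightarrow> P x)"
    using AE_not_in[OF N] by (auto elim: AE_mp)
  then show ?thesis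
    unfolding AE_restrict_space_iff[OF UN(1)] AE_restrict_space_iff[OF UN(2)] .
qed

lemma AE_restrict_0_null:
  assumes "N \<in> null_sets lebesgue"
  shows "AE x in lebesgue. (if x \<in> U then k x else 0) = (if x \<in> U - N then k x else (0::'c::zero))"
  using AE_not_in[OF assms] by auto

lemma borel_measurable_lebesgue_on_null:
  fixes f :: "'a::euclidean_space \<Rightarrow> 'b::euclidean_space"
  assumes U: "U \<in> sets lebesgue" and N: "N \<in> null_sets lebesgue"
  shows "f \<in> borel_measurable (lebesgue_on (U - N)) \<longleftrightarrow> f \<in> borel_measurable (lebesgue_on U)"
proof -
  have UN: "U - N \<in> sets lebesgue"
    using U N by auto
  have ae: "AE x in lebesgue_on UNIV. (if x \<in> U then f x else 0) = (if x \<in> U - N then f x else 0)"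
    unfolding lebesgue_on_UNIV_eq by (rule AE_restrict_0_null[OF N])
  then have ae': "AE x in lebesgue_on UNIV. (if x \<in> U - N then f x else 0) = (if x \<in> U then f x else 0)"
    by eventually_elim (rule sym)
  have top: "UNIV \<in> sets lebesgue"
    by simp
  have "(\<lambda>x. if x \<in> U then f x else 0) \<in> borel_measurable lebesgue \<longleftrightarrow>
      (\<lambda>x. if x \<in> U - N then f x else 0) \<in> borel_measurable lebesgue"
    using borel_measurable_lebesgue_on_AE[OF _ ae top] borel_measurable_lebesgue_on_AE[OF _ ae' top]
    unfolding lebesgue_on_UNIV_eq by blast
  then show ?thesis
    unfolding borel_measurable_if[OF U] borel_measurable_if[OF UN] by (rule sym)
qed

lemma
  fixes h :: "'a::euclidean_space \<Rightarrow> real"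
  assumes U: "U \<in> sets lebesgue" and N: "N \<in> null_sets lebesgue"
  shows integrable_lebesgue_on_null: "integrable (lebesgue_on (U - N)) h \<longleftrightarrow> integrable (lebesgue_on U) h"
    and integral_lebesgue_on_null: "(LINT x|lebesgue_on (U - N). h x) = (LINT x|lebesgue_on U. h x)"
proof -
  have UN: "U - N \<in> sets lebesgue"
    using U N by auto
  note meas = borel_measurable_lebesgue_on_null[OF U N, of h] and eq = AE_restrict_0_null[OF N, of U h]
  have "integrable lebesgue (\<lambda>x. if x \<in> U then h x else 0) \<longleftrightarrow>
      integrable lebesgue (\<lambda>x. if x \<in> U - N then h x else 0)"
    if "h \<in> borel_measurable (lebesgue_on U)"
    using that meas by (intro integrable_cong_AE eq borel_measurable_if_I U UN) auto
  then show int: "integrable (lebesgue_on (U - N)) h \<longleftrightarrow> integrable (lebesgue_on U) h"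
    unfolding Lebesgue_Measure.integrable_restrict_UNIV[OF U] Lebesgue_Measure.integrable_restrict_UNIV[OF UN] using meas by blast
  show "(LINT x|lebesgue_on (U - N). h x) = (LINT x|lebesgue_on U. h x)"
  proof (cases "integrable (lebesgue_on U) h")
    case True
    then have "h \<in> borel_measurable (lebesgue_on U)"
      by simp
    then have "(LINT x|lebesgue. (if x \<in> U then h x else 0)) = (LINT x|lebesgue. (if x \<in> U - N then h x else 0))"
      using meas by (intro integral_cong_AE eq borel_measurable_if_I U UN) auto
    then show ?thesis
      unfolding Lebesgue_Measure.integral_restrict_UNIV[OF U] Lebesgue_Measure.integral_restrict_UNIV[OF UN] by simp
  \<comment> \<open>If \<open>h\<close> is not integrable, both integrals are the default value 0,
    so they still agree.\<close>
  qed (use int in \<open>simp add: not_integrable_integral_eq\<close>)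
qed

text \<open>An equality of records, not merely of norms. It implements the convention that functions
  on the cracked domain are regarded as defined almost everywhere on the whole domain.\<close>

lemma L_space_null:
  assumes "U \<in> sets lebesgue" "N \<in> null_sets lebesgue"
  shows "L_space (U - N) S q = L_space U S q"
  by (simp add: L_space_def lebesgue_on_AE_null[OF assms] borel_measurable_lebesgue_on_null[OF assms]
      integral_lebesgue_on_null[OF assms] integrable_lebesgue_on_null[OF assms])

section \<open>Weak gradients\<close>

lemma C_k_affine: "C_k k f \<Longrightarrow> C_k k (\<lambda>y. f (s *\<^sub>R (y - x)))"
proof (induction k arbitrary: f)
  case 0
  then show ?case
    by (auto intro!: continuous_on_compose2[of UNIV f] continuous_intros)
next
  case (Suc k)
  have "((\<lambda>y. f (s *\<^sub>R (y - x))) has_derivative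
      (\<lambda>v. frechet_derivative f (at (s *\<^sub>R (y - x))) (s *\<^sub>R v))) (at y)" for y
    by (rule has_derivative_compose[OF _ C_k_has_derivative[OF Suc.prems]])
      (auto intro!: derivative_eq_intros)
  moreover have "C_k k (\<lambda>y. frechet_derivative f (at (s *\<^sub>R (y - x))) (s *\<^sub>R v))" for v
    using Suc.IH[of "\<lambda>z. frechet_derivative f (at z) (s *\<^sub>R v)"] Suc.prems by simp
  ultimately show ?case
    by (rule C_k_SucI)
qed

lemma smooth_affine: "smooth f \<Longrightarrow> smooth (\<lambda>y. f (s *\<^sub>R (y - x)))"
  by (auto simp: smooth_def C_k_affine)

lemma lborel_integral_affine:
  fixes f :: "'a::euclidean_space \<Rightarrow> real"
  assumes [measurable]: "f \<in> borel_measurable borel" and c: "c > 0"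
  shows "(LINT x|lborel. f ((1 / c) *\<^sub>R (x - t))) = c ^ DIM('a) * (LINT x|lborel. f x)"
proof -
  have "(LINT x|lborel. f ((1 / c) *\<^sub>R (x - t))) =
      (LINT x|density (distr lborel borel (\<lambda>x. t + c *\<^sub>R x)) (\<lambda>_. ennreal (\<bar>c\<bar> ^ DIM('a))). f ((1 / c) *\<^sub>R (x - t)))"
    using lborel_affine[of c t] c by simp
  also have "\<dots> = (LINT x|distr lborel borel (\<lambda>x. t + c *\<^sub>R x). \<bar>c\<bar> ^ DIM('a) * f ((1 / c) *\<^sub>R (x - t)))"
    by (subst integral_density) auto
  also have "\<dots> = (LINT x|lborel. \<bar>c\<bar> ^ DIM('a) * f x)"
    using c by (subst integral_distr) auto
  finally show ?thesis
    using c by simp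
qed

lemma continuous_compact_support_bounded:
  fixes g :: "'a::topological_space \<Rightarrow> real"
  assumes "continuous_on UNIV g" "compact K" "\<And>x. x \<notin> K \<Longrightarrow> g x = 0"
  obtains B where "B > 0" "\<And>x. \<bar>g x\<bar> \<le> B"
proof -
  have "bounded (g ` K)"
    using assms(1,2) by (meson compact_continuous_image compact_imp_bounded continuous_on_subset subset_UNIV)
  then obtain B where "\<forall>x\<in>K. \<bar>g x\<bar> \<le> B"
    by (auto simp: bounded_iff)
  then have "\<bar>g x\<bar> \<le> \<bar>B\<bar> + 1" for x
    using assms(3)[of x] by (cases "x \<in> K") force+
  then show thesis
    using that[of "\<bar>B\<bar> + 1"] by simp
qed

lemma borel_measurable_lebesgue_continuous:
  fixes g :: "'a::euclidean_space \<Rightarrow> 'b::euclidean_space"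
  shows "continuous_on UNIV g \<Longrightarrow> g \<in> borel_measurable lebesgue"
  by (simp add: borel_measurable_continuous_onI measurable_completion)

lemma set_integrable_mult_bounded:
  fixes f g :: "'a::euclidean_space \<Rightarrow> real"
  assumes f: "set_integrable lebesgue K f" and [measurable]: "g \<in> borel_measurable lebesgue"
    and B: "\<And>x. \<bar>g x\<bar> \<le> B" and 0: "\<And>x. x \<notin> K \<Longrightarrow> g x = 0"
  shows "integrable lebesgue (\<lambda>x. f x * g x)"
proof -
  have [measurable]: "(\<lambda>x. indicator K x *\<^sub>R f x) \<in> borel_measurable lebesgue"
    using f by (auto simp: set_integrable_def)
  have "integrable lebesgue (\<lambda>x. (indicator K x *\<^sub>R f x) * g x)"
  proof (rule Bochner_Integration.integrable_bound)
    show "integrable lebesgue (\<lambda>x. B * (indicator K x *\<^sub>R f x))"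
      using f by (auto simp: set_integrable_def)
    show "AE x in lebesgue. norm ((indicator K x *\<^sub>R f x) * g x) \<le> norm (B * (indicator K x *\<^sub>R f x))"
      by (auto simp: abs_mult mult.commute intro!: AE_I2 mult_right_mono order_trans[OF B abs_ge_self])
  qed measurable
  moreover have "(\<lambda>x. (indicator K x *\<^sub>R f x) * g x) = (\<lambda>x. f x * g x)"
    using 0 by (auto simp: indicator_def fun_eq_iff)
  ultimately show ?thesis
    by simp
qed

lemma sets_lebesgue_open: "open U \<Longrightarrow> U \<in> sets lebesgue"
  by simp

lemma
  fixes h :: "'a::euclidean_space \<Rightarrow> real"
  assumes U: "U \<in> sets lebesgue" and 0: "\<And>x. x \<notin> U \<Longrightarrow> h x = 0"
  shows integral_lebesgue_on_eq: "(LINT x|lebesgue_on U. h x) = (LINT x|lebesgue. h x)"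
    and integrable_lebesgue_on_eq: "integrable (lebesgue_on U) h \<longleftrightarrow> integrable lebesgue h"
proof -
  have eq: "(\<lambda>x. if x \<in> U then h x else 0) = h"
    using 0 by auto
  show "(LINT x|lebesgue_on U. h x) = (LINT x|lebesgue. h x)"
    using Lebesgue_Measure.integral_restrict_UNIV[OF U, of h] eq by simp
  show "integrable (lebesgue_on U) h \<longleftrightarrow> integrable lebesgue h"
    using Lebesgue_Measure.integrable_restrict_UNIV[OF U, of h] eq by simp
qed

text \<open>The bump may be centred at any \<open>c\<close>, so the averages can look at
  \<open>x\<close> from one side only, as cone averages near a boundary require. The mean of |f - f
  x| over the ball of radius S r controls the error.\<close>

lemma mollifier_tendsto:
  fixes f :: "'a::euclidean_space \<Rightarrow> real"
  assumes f: "set_integrable lebesgue (cball x R) f" and R: "R > 0"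
    and x: "lebesgue_point f x" and \<epsilon>: "\<epsilon> > 0"
  shows "((\<lambda>r. (LINT y|lebesgue. f y * bump c \<epsilon> ((1 / r) *\<^sub>R (y - x))) / r ^ DIM('a))
    \<longlongrightarrow> f x * (LINT z|lborel. bump c \<epsilon> z)) (at_right 0)"
proof -
  let ?n = "DIM('a)" and ?I = "LINT z|lborel. bump c \<epsilon> z"
  \<comment> \<open>The ball of radius \<open>S\<close> around 0 contains the support of the bump,
    so the dilated bump lives in the ball of radius S r around \<open>x\<close>.\<close>
  define S where "S = norm c + \<epsilon>"
  have S: "S > 0"
    using \<epsilon> by (simp add: S_def add_nonneg_pos)
  let ?J = "\<lambda>r. (LINT y|lebesgue. f y * bump c \<epsilon> ((1 / r) *\<^sub>R (y - x)))"
  let ?K = "\<lambda>r. (LINT y:ball x r|lebesgue. \<bar>f y - f x\<bar>)"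
  have filt: "filterlim (\<lambda>r. S * r) (at_right 0) (at_right 0)"
    using S by (intro filterlim_at_withinI eventually_at_right_less[THEN eventually_mono])
      (auto intro!: tendsto_eq_intros)
  have lim: "((\<lambda>r. S ^ ?n * (?K (S * r) / (S * r) ^ ?n)) \<longlongrightarrow> S ^ ?n * 0) (at_right 0)"
    by (intro tendsto_mult tendsto_const filterlim_compose[OF x[unfolded lebesgue_point_def] filt])
  have "\<forall>\<^sub>F r in at_right 0. norm (?J r / r ^ ?n - f x * ?I) \<le> S ^ ?n * (?K (S * r) / (S * r) ^ ?n)"
  proof -
    have "\<forall>\<^sub>F r in at_right 0. 0 < r \<and> r < R / S"
      using R S by (auto simp: eventually_at_right_field intro!: exI[of _ "R / S"])
    then show ?thesis
    proof eventually_elim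
      case (elim r)
      let ?b = "\<lambda>y. bump c \<epsilon> ((1 / r) *\<^sub>R (y - x))"
      have b0: "?b y = 0" if "y \<notin> ball x (S * r)" for y
      proof (rule bump_eq_0[OF \<epsilon>])
        show "(1 / r) *\<^sub>R (y - x) \<notin> ball c \<epsilon>"
        proof
          assume "(1 / r) *\<^sub>R (y - x) \<in> ball c \<epsilon>"
          then have "norm ((1 / r) *\<^sub>R (y - x)) < S"
            using norm_triangle_ineq2[of "(1 / r) *\<^sub>R (y - x)" c]
            by (auto simp: S_def dist_norm norm_minus_commute)
          moreover have "norm (y - x) = r * norm ((1 / r) *\<^sub>R (y - x))"
            using elim by (simp only: norm_scaleR) simp
          ultimately have "norm (y - x) < S * r"
            using elim mult_strict_left_mono[of _ S r] by (metis mult.commute)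
          then show False
            using that by (simp add: dist_norm norm_minus_commute)
        qed
      qed
      have sub: "ball x (S * r) \<subseteq> cball x R"
        using elim S by (auto simp: field_simps)
      have fi: "set_integrable lebesgue (ball x (S * r)) f"
        by (rule set_integrable_subset[OF f]) (use sub in auto)
      have ci: "set_integrable lebesgue (ball x (S * r)) (\<lambda>_. f x)"
        unfolding set_integrable_def
        by (intro integrable_scaleR_left integrable_real_indicator)
          (use emeasure_lborel_ball_finite[of x "S * r"] in auto)
      have bm: "?b \<in> borel_measurable lebesgue"
        by (intro borel_measurable_lebesgue_continuous smooth_continuous_on smooth_affine smooth_bump)
      have b1: "\<bar>?b y\<bar> \<le> 1" for y
        using bump_le_1[of c \<epsilon>] bump_nonneg[of c \<epsilon>] by auto
      note i1 = set_integrable_mult_bounded[OF fi bm b1 b0]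
      note i2 = set_integrable_mult_bounded[OF ci bm b1 b0]
      have "(LINT y|lebesgue. f x * ?b y) = f x * (LINT y|lebesgue. ?b y)"
        by simp
      also have "(LINT y|lebesgue. ?b y) = (LINT y|lborel. ?b y)"
        by (rule integral_completion)
          (auto intro!: borel_measurable_continuous_onI smooth_continuous_on smooth_affine smooth_bump)
      also have "\<dots> = r ^ ?n * ?I"
        using elim by (intro lborel_integral_affine)
          (auto intro!: borel_measurable_continuous_onI continuous_on_bump)
      finally have eq: "(LINT y|lebesgue. f x * ?b y) = f x * (r ^ ?n * ?I)" .
      have "(LINT y|lebesgue. f y * ?b y - f x * ?b y) = ?J r - (LINT y|lebesgue. f x * ?b y)"
        by (rule Bochner_Integration.integral_diff[OF i1 i2])
      then have "?J r - f x * (r ^ ?n * ?I) = (LINT y|lebesgue. f y * ?b y - f x * ?b y)"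
        unfolding eq by (rule sym)
      also have "\<bar>\<dots>\<bar> \<le> (LINT y|lebesgue. \<bar>f y * ?b y - f x * ?b y\<bar>)"
        by (rule integral_abs_bound)
      also have "\<dots> \<le> ?K (S * r)"
        unfolding set_lebesgue_integral_def
      proof (rule integral_mono)
        show "integrable lebesgue (\<lambda>y. \<bar>f y * ?b y - f x * ?b y\<bar>)"
          using i1 i2 by auto
        show "integrable lebesgue (\<lambda>y. indicator (ball x (S * r)) y *\<^sub>R \<bar>f y - f x\<bar>)"
          using set_integrable_abs[OF set_integral_diff(1)[OF fi ci]] by (simp add: set_integrable_def)
        show "\<bar>f y * ?b y - f x * ?b y\<bar> \<le> indicator (ball x (S * r)) y *\<^sub>R \<bar>f y - f x\<bar>" for y
          using b0[of y] mult_left_mono[OF b1[of y], of "\<bar>f y - f x\<bar>"]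
          by (cases "y \<in> ball x (S * r)") (auto simp: left_diff_distrib[symmetric] abs_mult)
      qed
      finally have *: "\<bar>?J r - f x * (r ^ ?n * ?I)\<bar> \<le> ?K (S * r)" .
      have "norm (?J r / r ^ ?n - f x * ?I) = \<bar>?J r - f x * (r ^ ?n * ?I)\<bar> / r ^ ?n"
      proof -
        have "?J r / r ^ ?n - f x * ?I = (?J r - f x * (r ^ ?n * ?I)) / r ^ ?n"
          using elim by (simp add: diff_divide_distrib)
        then show ?thesis
          using elim by (simp add: abs_divide)
      qed
      also have "\<dots> \<le> ?K (S * r) / r ^ ?n"
        using * elim by (intro divide_right_mono) auto
      also have "\<dots> = S ^ ?n * (?K (S * r) / (S * r) ^ ?n)"
        using S by (simp add: power_mult_distrib)
      finally show ?case .
    qed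
  qed
  from Lim_null_comparison[OF this] lim have "((\<lambda>r. ?J r / r ^ ?n - f x * ?I) \<longlongrightarrow> 0) (at_right 0)"
    by simp
  then show ?thesis
    using Lim_null by blast
qed

section \<open>Test functions and the fundamental lemma\<close>

lemma test_fun_supportE:
  assumes "test_fun U \<psi>"
  obtains K where "compact K" "K \<subseteq> U" "\<And>x. x \<notin> K \<Longrightarrow> \<psi> x = 0"
    "\<And>x v. x \<notin> K \<Longrightarrow> frechet_derivative \<psi> (at x) v = 0"
proof -
  obtain K where K: "compact K" "K \<subseteq> U" "\<And>x. x \<notin> K \<Longrightarrow> \<psi> x = 0"
    using assms by (auto simp: test_fun_def)
  have "frechet_derivative \<psi> (at x) v = 0" if "x \<notin> K" for x v
  proof -
    have "(\<psi> has_derivative (\<lambda>v. 0)) (at x)"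
      by (rule has_derivative_transform_within_open[of "\<lambda>_. 0" _ _ _ "- K"])
        (use K that compact_imp_closed in auto)
    then show ?thesis
      using frechet_derivative_at by metis
  qed
  with K show thesis
    by (rule that)
qed

lemma test_fun_mono: "test_fun U \<psi> \<Longrightarrow> U \<subseteq> U' \<Longrightarrow> test_fun U' \<psi>"
  by (auto simp: test_fun_def)

text \<open>At a Lebesgue point the mollified values, which vanish by assumption for small radii,
  tend to f x times the positive integral of the bump.\<close>

lemma fundamental_lemma:
  fixes f :: "'a::euclidean_space \<Rightarrow> real"
  assumes U: "open U" and f: "locally_integrable U f"
    and 0: "\<And>\<psi>. test_fun U \<psi> \<Longrightarrow> (LINT x|lebesgue_on U. f x * \<psi> x) = 0"
  shows "AE x in lebesgue_on U. f x = 0"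
proof -
  have "AE x in lebesgue. x \<in> U \<longrightarrow> f x = 0"
    using AE_lebesgue_point[OF U f]
  proof eventually_elim
    case (elim x)
    show ?case
    proof
      assume "x \<in> U"
      then obtain R where R: "R > 0" "cball x R \<subseteq> U"
        using U open_contains_cball by blast
      have "set_integrable lebesgue (cball x R) f"
        using f R by (auto simp: locally_integrable_def)
      from mollifier_tendsto[OF this R(1), of 1 0] elim \<open>x \<in> U\<close>
      have lim: "((\<lambda>r. (LINT y|lebesgue. f y * bump 0 1 ((1 / r) *\<^sub>R (y - x))) / r ^ DIM('a))
        \<longlongrightarrow> f x * (LINT z|lborel. bump (0::'a) 1 z)) (at_right 0)"
        by simp
      have "\<forall>\<^sub>F r in at_right 0. 0 < r \<and> r < R"
        using R by (auto simp: eventually_at_right_field intro!: exI[of _ R])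
      then have "\<forall>\<^sub>F r in at_right 0.
        (LINT y|lebesgue. f y * bump 0 1 ((1 / r) *\<^sub>R (y - x))) / r ^ DIM('a) = 0"
      proof eventually_elim
        case (elim r)
        let ?b = "\<lambda>y. bump 0 1 ((1 / r) *\<^sub>R (y - x))"
        have b0: "?b y = 0" if "y \<notin> cball x R" for y
        proof (rule bump_eq_0)
          have N: "norm (y - x) = r * norm ((1 / r) *\<^sub>R (y - x))"
            using elim by (simp only: norm_scaleR) simp
          have "norm (y - x) > r"
            using that elim by (simp add: dist_norm norm_minus_commute)
          then have "\<not> norm ((1 / r) *\<^sub>R (y - x)) < 1"
            using N elim mult_strict_left_mono[of "norm ((1 / r) *\<^sub>R (y - x))" 1 r] by linarith
          then show "(1 / r) *\<^sub>R (y - x) \<notin> ball 0 1"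
            by (simp only: mem_ball dist_0_norm not_False_eq_True)
        qed simp
        have "test_fun U ?b"
          unfolding test_fun_def using R(2) b0
          by (intro conjI exI[of _ "cball x R"] smooth_affine smooth_bump compact_cball) auto
        moreover have "f y * ?b y = 0" if "y \<notin> U" for y
          using b0[of y] R(2) that by (metis mult_zero_right subsetD)
        ultimately show ?case
          using 0[of ?b] integral_lebesgue_on_eq[OF sets_lebesgue_open[OF U], of "\<lambda>y. f y * ?b y"] by simp
      qed
      then have "((\<lambda>r. (LINT y|lebesgue. f y * bump 0 1 ((1 / r) *\<^sub>R (y - x))) / r ^ DIM('a))
        \<longlongrightarrow> 0) (at_right 0)"
        by (rule tendsto_eventually)
      from tendsto_unique[OF _ lim this] show "f x = 0"
        using bump_integral_pos[of 1 "0::'a"] by simp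
    qed
  qed
  then show ?thesis
    using U by (subst AE_restrict_space_iff) auto
qed

section \<open>Calculus of weak gradients\<close>

lemma locally_integrable_mult:
  fixes f g :: "'a::euclidean_space \<Rightarrow> real"
  assumes U: "open U" and f: "locally_integrable U f" and K: "compact K" "K \<subseteq> U"
    and g: "continuous_on UNIV g" "\<And>x. x \<notin> K \<Longrightarrow> g x = 0"
  shows "integrable (lebesgue_on U) (\<lambda>x. f x * g x)"
proof -
  obtain B where B: "\<And>x. \<bar>g x\<bar> \<le> B"
    using continuous_compact_support_bounded[OF g(1) K(1) g(2)] by blast
  have "set_integrable lebesgue K f"
    using f K by (auto simp: locally_integrable_def)
  from set_integrable_mult_bounded[OF this borel_measurable_lebesgue_continuous[OF g(1)] B g(2)]
  show ?thesis
    by (subst integrable_lebesgue_on_eq) (use U g(2) K in auto)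
qed

lemma locally_integrable_test_fun:
  fixes f :: "'a::euclidean_space \<Rightarrow> real"
  assumes "open U" "locally_integrable U f" "test_fun U \<psi>"
  shows "integrable (lebesgue_on U) (\<lambda>x. f x * \<psi> x)"
    and "integrable (lebesgue_on U) (\<lambda>x. f x * frechet_derivative \<psi> (at x) v)"
proof -
  obtain K where K: "compact K" "K \<subseteq> U" "\<And>x. x \<notin> K \<Longrightarrow> \<psi> x = 0"
      "\<And>x v. x \<notin> K \<Longrightarrow> frechet_derivative \<psi> (at x) v = 0"
    using test_fun_supportE[OF assms(3)] by metis
  have s: "smooth \<psi>"
    using assms(3) by (simp add: test_fun_def)
  show "integrable (lebesgue_on U) (\<lambda>x. f x * \<psi> x)"
    by (rule locally_integrable_mult[OF assms(1,2) K(1,2) smooth_continuous_on[OF s] K(3)])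
  show "integrable (lebesgue_on U) (\<lambda>x. f x * frechet_derivative \<psi> (at x) v)"
    by (rule locally_integrable_mult[OF assms(1,2) K(1,2)
        smooth_continuous_on[OF smooth_frechet_derivative[OF s]] K(4)])
qed

lemma locally_integrable_compose_linear:
  assumes "bounded_linear h" "locally_integrable U f"
  shows "locally_integrable U (\<lambda>x. h (f x))"
  using integrable_bounded_linear[OF assms(1), of lebesgue "\<lambda>x. indicator _ x *\<^sub>R f x"] assms(2)
  by (simp add: locally_integrable_def set_integrable_def
      linear_cmul[OF bounded_linear.linear[OF assms(1)]])

lemma locally_integrable_add:
  "locally_integrable U f \<Longrightarrow> locally_integrable U g \<Longrightarrow> locally_integrable U (\<lambda>x. f x + g x)"
  and locally_integrable_diff:
  "locally_integrable U f \<Longrightarrow> locally_integrable U g \<Longrightarrow> locally_integrable U (\<lambda>x. f x - g x)"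
  by (auto simp: locally_integrable_def intro!: set_integral_add set_integral_diff)

lemma locally_integrable_mono: "locally_integrable U f \<Longrightarrow> U' \<subseteq> U \<Longrightarrow> locally_integrable U' f"
  by (auto simp: locally_integrable_def)

lemma locally_integrable_nth: "locally_integrable U u \<Longrightarrow> locally_integrable U (\<lambda>x. u x $ i)"
  by (rule locally_integrable_compose_linear[OF bounded_linear_vec_nth])

lemma weak_grad_integral:
  "weak_grad U u D \<Longrightarrow> test_fun U \<psi> \<Longrightarrow>
    (LINT x|lebesgue_on U. u x $ i * frechet_derivative \<psi> (at x) (axis j 1)) =
    - (LINT x|lebesgue_on U. D x $ i $ j * \<psi> x)"
  by (simp add: weak_grad_def)

lemma weak_grad_locally_integrable:
  assumes "weak_grad U u D"
  shows "locally_integrable U (\<lambda>x. u x $ i)" "locally_integrable U (\<lambda>x. D x $ i $ j)"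
  using assms by (auto simp: weak_grad_def intro!: locally_integrable_nth)

lemma weak_grad_unique:
  fixes u :: "real^'n \<Rightarrow> real^'n"
  assumes U: "open U" and D: "weak_grad U u D" "weak_grad U u E"
  shows "AE x in lebesgue_on U. D x = E x"
proof -
  have "AE x in lebesgue_on U. D x $ i $ j - E x $ i $ j = 0" for i j
  proof (rule fundamental_lemma[OF U])
    show "locally_integrable U (\<lambda>x. D x $ i $ j - E x $ i $ j)"
      using D by (auto intro!: locally_integrable_diff weak_grad_locally_integrable)
    fix \<psi> assume \<psi>: "test_fun U \<psi>"
    show "(LINT x|lebesgue_on U. (D x $ i $ j - E x $ i $ j) * \<psi> x) = 0"
      using weak_grad_integral[OF D(1) \<psi>, of i j] weak_grad_integral[OF D(2) \<psi>, of i j]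
        locally_integrable_test_fun(1)[OF U weak_grad_locally_integrable(2)[OF D(1)] \<psi>, of i j]
        locally_integrable_test_fun(1)[OF U weak_grad_locally_integrable(2)[OF D(2)] \<psi>, of i j]
      by (simp add: left_diff_distrib)
  qed
  then have "AE x in lebesgue_on U. \<forall>i j. D x $ i $ j - E x $ i $ j = 0"
    by (simp add: AE_all_countable)
  then show ?thesis
    by eventually_elim (simp add: vec_eq_iff)
qed

lemma weak_grad_add:
  fixes u v :: "real^'n \<Rightarrow> real^'n"
  assumes U: "open U" and "weak_grad U u D" "weak_grad U v E"
  shows "weak_grad U (u + v) (D + E)"
  unfolding weak_grad_def
proof (intro conjI allI impI)
  show "locally_integrable U (u + v)" "locally_integrable U (D + E)"
    using assms by (auto simp: weak_grad_def plus_fun_def intro!: locally_integrable_add)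
  fix \<psi> :: "real^'n \<Rightarrow> real" and i j assume \<psi>: "test_fun U \<psi>"
  show "(LINT x|lebesgue_on U. (u + v) x $ i * frechet_derivative \<psi> (at x) (axis j 1)) =
      - (LINT x|lebesgue_on U. (D + E) x $ i $ j * \<psi> x)"
    using weak_grad_integral[OF assms(2) \<psi>, of i j] weak_grad_integral[OF assms(3) \<psi>, of i j]
      locally_integrable_test_fun[OF U weak_grad_locally_integrable(1)[OF assms(2)] \<psi>, of i]
      locally_integrable_test_fun[OF U weak_grad_locally_integrable(1)[OF assms(3)] \<psi>, of i]
      locally_integrable_test_fun[OF U weak_grad_locally_integrable(2)[OF assms(2)] \<psi>, of i j]
      locally_integrable_test_fun[OF U weak_grad_locally_integrable(2)[OF assms(3)] \<psi>, of i j]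
    by (simp add: distrib_right)
qed

lemma weak_grad_scaleR:
  assumes "weak_grad U u D"
  shows "weak_grad U (c *\<^sub>R u) (c *\<^sub>R D)"
  using assms
  by (auto simp: weak_grad_def scaleR_fun_def mult.assoc
      intro!: locally_integrable_compose_linear[OF bounded_linear_scaleR_right])

lemma weak_grad_subset:
  fixes u :: "real^'n \<Rightarrow> real^'n"
  assumes "open U" "open U'" "U' \<subseteq> U" "weak_grad U u D"
  shows "weak_grad U' u D"
  unfolding weak_grad_def
proof (intro conjI allI impI)
  show "locally_integrable U' u" "locally_integrable U' D"
    using assms by (auto simp: weak_grad_def intro: locally_integrable_mono)
  fix \<psi> :: "real^'n \<Rightarrow> real" and i j assume \<psi>: "test_fun U' \<psi>"
  obtain K where K: "compact K" "K \<subseteq> U'" "\<And>x. x \<notin> K \<Longrightarrow> \<psi> x = 0"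
      "\<And>x v. x \<notin> K \<Longrightarrow> frechet_derivative \<psi> (at x) v = 0"
    using test_fun_supportE[OF \<psi>] by metis
  have eq: "(LINT x|lebesgue_on U'. h x * g x) = (LINT x|lebesgue_on U. h x * g x)"
    if g: "\<And>x. x \<notin> K \<Longrightarrow> g x = 0" for h g :: "real^'n \<Rightarrow> real"
  proof -
    have "h x * g x = 0" if "x \<notin> U'" for x
      using g[of x] K(2) that by auto
    then show ?thesis
      using assms(3) integral_lebesgue_on_eq[OF sets_lebesgue_open[OF assms(2)], of "\<lambda>x. h x * g x"]
        integral_lebesgue_on_eq[OF sets_lebesgue_open[OF assms(1)], of "\<lambda>x. h x * g x"]
      by (metis subsetD)
  qed
  show "(LINT x|lebesgue_on U'. u x $ i * frechet_derivative \<psi> (at x) (axis j 1)) =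
      - (LINT x|lebesgue_on U'. D x $ i $ j * \<psi> x)"
    using weak_grad_integral[OF assms(4) test_fun_mono[OF \<psi> assms(3)], of i j]
      eq[of "\<lambda>x. frechet_derivative \<psi> (at x) (axis j 1)" "\<lambda>x. u x $ i", OF K(4)]
      eq[of \<psi> "\<lambda>x. D x $ i $ j", OF K(3)] by simp
qed

lemma weak_grad_grad: "weak_grad U u D \<Longrightarrow> weak_grad U u (grad U u)"
  unfolding grad_def by (rule someI[of "weak_grad U u"])

lemma AE_grad_eq:
  "open U \<Longrightarrow> weak_grad U u D \<Longrightarrow> AE x in lebesgue_on U. grad U u x = D x"
  by (rule weak_grad_unique[OF _ weak_grad_grad])

section \<open>The Sobolev embedding into square-integrable functions\<close>

lemma linear_frechet_derivative_smooth: "smooth \<kappa> \<Longrightarrow> linear (frechet_derivative \<kappa> (at x))"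
  by (rule has_derivative_linear[OF smooth_has_derivative])

text \<open>Differentiation under the integral sign. \<open>E\<close> is the derivative of the
  kernel in radial direction, which is what a change of the dilation parameter produces.\<close>

lemma DERIV_integral_dilation:
  fixes v \<kappa> :: "'a::euclidean_space \<Rightarrow> real"
  assumes v: "integrable lebesgue v" and \<kappa>: "smooth \<kappa>" "compact K" "\<And>z. z \<notin> K \<Longrightarrow> \<kappa> z = 0"
    and l: "l > 0"
  defines "E \<equiv> \<lambda>z. frechet_derivative \<kappa> (at z) z"
  shows "((\<lambda>l. LINT x|lebesgue. v x * \<kappa> ((1 / l) *\<^sub>R (x - y))) has_real_derivative
    - (1 / l) * (LINT x|lebesgue. v x * E ((1 / l) *\<^sub>R (x - y)))) (at l)"
proof -
  have lin: "linear (frechet_derivative \<kappa> (at z))" for z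
    by (rule linear_frechet_derivative_smooth[OF \<kappa>(1)])
  \<comment> \<open>The direction in \<open>E\<close> varies with the point, so continuity is read
    off from the expansion in coordinates.\<close>
  have E_eq: "E = (\<lambda>z. \<Sum>b\<in>Basis. (z \<bullet> b) * frechet_derivative \<kappa> (at z) b)"
  proof
    fix z
    have "E z = frechet_derivative \<kappa> (at z) (\<Sum>b\<in>Basis. (z \<bullet> b) *\<^sub>R b)"
      by (simp add: E_def euclidean_representation)
    then show "E z = (\<Sum>b\<in>Basis. (z \<bullet> b) * frechet_derivative \<kappa> (at z) b)"
      by (simp add: linear_sum[OF lin] linear_cmul[OF lin])
  qed
  have E_cont: "continuous_on UNIV E"
    unfolding E_eq by (intro continuous_intros smooth_continuous_on smooth_frechet_derivative \<kappa>(1))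
  have "test_fun UNIV \<kappa>"
    using \<kappa> by (auto simp: test_fun_def)
  then obtain K' where K': "compact K'" "\<And>x v. x \<notin> K' \<Longrightarrow> frechet_derivative \<kappa> (at x) v = 0"
    using test_fun_supportE by metis
  obtain B where B: "B > 0" "\<And>z. \<bar>E z\<bar> \<le> B"
    by (rule continuous_compact_support_bounded[OF E_cont K'(1)]) (auto simp: E_def K'(2))
  obtain B' where B': "B' > 0" "\<And>z. \<bar>\<kappa> z\<bar> \<le> B'"
    using continuous_compact_support_bounded[OF smooth_continuous_on[OF \<kappa>(1)] \<kappa>(2,3)] by blast
  have der: "((\<lambda>l. \<kappa> ((1 / l) *\<^sub>R (x - y))) has_real_derivative
      - (1 / l) * E ((1 / l) *\<^sub>R (x - y))) (at l)" if "l > 0" for l x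
  proof -
    have "((\<lambda>l. (1 / l) *\<^sub>R (x - y)) has_derivative (\<lambda>h. (- (1 / l) * h) *\<^sub>R ((1 / l) *\<^sub>R (x - y)))) (at l)"
      using that by (auto intro!: derivative_eq_intros simp: field_simps)
    from has_derivative_compose[OF this smooth_has_derivative[OF \<kappa>(1)]]
    have "((\<lambda>l. \<kappa> ((1 / l) *\<^sub>R (x - y))) has_derivative
        (\<lambda>h. frechet_derivative \<kappa> (at ((1 / l) *\<^sub>R (x - y))) ((- (1 / l) * h) *\<^sub>R ((1 / l) *\<^sub>R (x - y))))) (at l)" .
    also have "(\<lambda>h. frechet_derivative \<kappa> (at ((1 / l) *\<^sub>R (x - y))) ((- (1 / l) * h) *\<^sub>R ((1 / l) *\<^sub>R (x - y)))) =
        (*) (- (1 / l) * E ((1 / l) *\<^sub>R (x - y)))"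
    proof
      fix h
      let ?z = "(1 / l) *\<^sub>R (x - y)"
      have "frechet_derivative \<kappa> (at ?z) ((- (1 / l) * h) *\<^sub>R ?z) = (- (1 / l) * h) * E ?z"
        unfolding E_def using linear_cmul[OF lin, of ?z "- (1 / l) * h" ?z] by (simp only: real_scaleR_def)
      also have "a * h * b = a * b * h" for a b :: real
        by simp
      finally show "frechet_derivative \<kappa> (at ?z) ((- (1 / l) * h) *\<^sub>R ?z) = - (1 / l) * E ?z * h" .
    qed
    finally show ?thesis
      by (simp only: has_field_derivative_def)
  qed
  have [measurable]: "v \<in> borel_measurable lebesgue"
    using v by auto
  have m: "(\<lambda>x. k ((1 / l) *\<^sub>R (x - y))) \<in> borel_measurable lebesgue"
    if k: "continuous_on UNIV k" for k :: "'a \<Rightarrow> real" and l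
    by (rule borel_measurable_lebesgue_continuous, rule continuous_on_compose2[OF k])
      (auto intro!: continuous_intros)
  note m1[measurable] = m[OF smooth_continuous_on[OF \<kappa>(1)]] and m2[measurable] = m[OF E_cont]
  have int: "integrable lebesgue (\<lambda>x. v x * \<kappa> ((1 / l) *\<^sub>R (x - y)))" for l
  proof (rule Bochner_Integration.integrable_bound)
    show "integrable lebesgue (\<lambda>x. B' * v x)"
      using v by simp
    show "AE x in lebesgue. norm (v x * \<kappa> ((1 / l) *\<^sub>R (x - y))) \<le> norm (B' * v x)"
    proof (rule AE_I2)
      fix x
      have "\<bar>v x\<bar> * \<bar>\<kappa> ((1 / l) *\<^sub>R (x - y))\<bar> \<le> \<bar>v x\<bar> * B'"
        by (intro mult_left_mono B') auto
      then show "norm (v x * \<kappa> ((1 / l) *\<^sub>R (x - y))) \<le> norm (B' * v x)"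
        by (simp add: abs_mult mult.commute abs_of_pos[OF B'(1)])
    qed
  qed measurable
  let ?I = "\<lambda>l. LINT x|lebesgue. v x * \<kappa> ((1 / l) *\<^sub>R (x - y))"
  \<comment> \<open>Scales are kept above l/2: there the derivative in the scale is bounded by 2/l
    times the bound of \<open>E\<close>, and the mean value theorem supplies a majorant of the
    difference quotients.\<close>
  have "((\<lambda>l'. (?I l' - ?I l) / (l' - l)) \<longlongrightarrow> - (1 / l) * (LINT x|lebesgue. v x * E ((1 / l) *\<^sub>R (x - y))))
      (at l within {l/2<..})"
    unfolding tendsto_at_iff_sequentially
  proof (intro allI impI)
    fix X assume X: "\<forall>i. X i \<in> {l/2<..} - {l}" "X \<longlonglongrightarrow> l"
    let ?q = "\<lambda>i x. (\<kappa> ((1 / X i) *\<^sub>R (x - y)) - \<kappa> ((1 / l) *\<^sub>R (x - y))) / (X i - l)"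
    have "(\<lambda>i. LINT x|lebesgue. v x * ?q i x) \<longlonglongrightarrow> (LINT x|lebesgue. v x * (- (1 / l) * E ((1 / l) *\<^sub>R (x - y))))"
    proof (rule integral_dominated_convergence)
      show "integrable lebesgue (\<lambda>x. (2 / l * B) * \<bar>v x\<bar>)"
        using v by simp
      show "AE x in lebesgue. (\<lambda>i. v x * ?q i x) \<longlonglongrightarrow> v x * (- (1 / l) * E ((1 / l) *\<^sub>R (x - y)))"
      proof (intro AE_I2 tendsto_mult tendsto_const)
        fix x
        have "((\<lambda>l'. (\<kappa> ((1 / l') *\<^sub>R (x - y)) - \<kappa> ((1 / l) *\<^sub>R (x - y))) / (l' - l)) \<longlongrightarrow>
            - (1 / l) * E ((1 / l) *\<^sub>R (x - y))) (at l within {l/2<..})"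
          using has_field_derivative_at_within[OF der[OF l]] by (simp add: has_field_derivative_iff)
        then show "(\<lambda>i. ?q i x) \<longlonglongrightarrow> - (1 / l) * E ((1 / l) *\<^sub>R (x - y))"
          using X unfolding tendsto_at_iff_sequentially comp_def by blast
      qed
      fix i
      have q: "\<bar>?q i x\<bar> \<le> 2 / l * B" for x
      proof -
        from X(1) have "X i \<in> {l/2<..} - {l}" ..
        then have Xi: "X i > l / 2" "X i \<noteq> l"
          unfolding Diff_iff greaterThan_iff singleton_iff by blast+
        have "norm (\<kappa> ((1 / X i) *\<^sub>R (x - y)) - \<kappa> ((1 / l) *\<^sub>R (x - y))) \<le> 2 / l * B * norm (X i - l)"
        proof (rule field_differentiable_bound[where S="{l/2<..}" and f="\<lambda>l. \<kappa> ((1 / l) *\<^sub>R (x - y))"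
              and f'="\<lambda>z. - (1 / z) * E ((1 / z) *\<^sub>R (x - y))"])
          show "((\<lambda>l. \<kappa> ((1 / l) *\<^sub>R (x - y))) has_field_derivative - (1 / z) * E ((1 / z) *\<^sub>R (x - y)))
              (at z within {l/2<..})" if "z \<in> {l/2<..}" for z
          proof -
            have "z > 0"
              using that l by simp
            then show ?thesis
              by (rule has_field_derivative_at_within[OF der])
          qed
          show "norm (- (1 / z) * E ((1 / z) *\<^sub>R (x - y))) \<le> 2 / l * B" if "z \<in> {l/2<..}" for z
          proof -
            have "1 / z \<le> 2 / l"
              using that l by (auto simp: field_simps)
            show ?thesis
            proof -
              have "1 / z * \<bar>E ((1 / z) *\<^sub>R (x - y))\<bar> \<le> 2 / l * B"
                using B l \<open>1 / z \<le> 2 / l\<close> by (intro mult_mono) auto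
              then show ?thesis
                using that l by (simp add: abs_mult)
            qed
          qed
        qed (use Xi l in auto)
        then show ?thesis
          using Xi(2) by (simp add: field_simps abs_mult)
      qed
      show "AE x in lebesgue. norm (v x * ?q i x) \<le> (2 / l * B) * \<bar>v x\<bar>"
        using mult_left_mono[OF q abs_ge_zero] by (auto simp: abs_mult mult.commute intro!: AE_I2)
    qed measurable
    moreover have "(LINT x|lebesgue. v x * ?q i x) = (?I (X i) - ?I l) / (X i - l)" for i
    proof -
      have "(LINT x|lebesgue. v x * ?q i x) =
          (LINT x|lebesgue. (v x * \<kappa> ((1 / X i) *\<^sub>R (x - y)) - v x * \<kappa> ((1 / l) *\<^sub>R (x - y))) / (X i - l))"
        by (simp only: right_diff_distrib times_divide_eq_right)
      also have "\<dots> = (?I (X i) - ?I l) / (X i - l)"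
        by (simp only: integral_divide_zero Bochner_Integration.integral_diff[OF int int])
      finally show ?thesis .
    qed
    moreover have "(LINT x|lebesgue. v x * (- (1 / l) * E ((1 / l) *\<^sub>R (x - y)))) =
        - (1 / l) * (LINT x|lebesgue. v x * E ((1 / l) *\<^sub>R (x - y)))"
      by (subst integral_mult_right_zero[symmetric]) (simp only: mult.left_commute)
    ultimately show "((\<lambda>l'. (?I l' - ?I l) / (l' - l)) \<circ> X) \<longlonglongrightarrow>
        - (1 / l) * (LINT x|lebesgue. v x * E ((1 / l) *\<^sub>R (x - y)))"
      by (simp only: comp_def)
  qed
  then show ?thesis
    using l by (simp add: has_field_derivative_iff at_within_open[of l "{l/2<..}"])
qed

text \<open>If $k_\lambda(x) = \lambda^{-n} \rho((x-y)/\lambda)$ then $\partial_\lambda k_\lambda$ is minus the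
  divergence of $k_\lambda(x) (x-y)/\lambda$. So averages of \<open>u\<close> at different scales are compared
  through the weak gradient of \<open>u\<close>, tested only inside the cone at \<open>y\<close>.\<close>

locale sobolev_cone =
  fixes U W :: "(real^'n) set" and u :: "real^'n \<Rightarrow> real" and g :: "'n \<Rightarrow> real^'n \<Rightarrow> real"
    and f :: "real^'n \<Rightarrow> real" and c :: "real^'n" and \<epsilon> q :: real
  assumes U: "open U" and W: "W \<subseteq> U" "W \<in> lmeasurable"
    and cone: "\<And>y l z. y \<in> W \<Longrightarrow> 0 < l \<Longrightarrow> l \<le> 1 \<Longrightarrow> z \<in> cball c \<epsilon> \<Longrightarrow> y + l *\<^sub>R z \<in> U"
    and \<epsilon>: "\<epsilon> > 0"
    and u: "integrable (lebesgue_on U) u" "locally_integrable U u"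
    and g: "\<And>j. locally_integrable U (g j)"
    and weak: "\<And>\<psi> j. test_fun U \<psi> \<Longrightarrow>
      (LINT x|lebesgue_on U. u x * frechet_derivative \<psi> (at x) (axis j 1)) =
      - (LINT x|lebesgue_on U. g j x * \<psi> x)"
    and f: "f \<in> borel_measurable lebesgue" "\<And>x. f x \<ge> 0" "\<And>x j. x \<in> U \<Longrightarrow> \<bar>g j x\<bar> \<le> f x"
      "integrable lebesgue (\<lambda>x. f x powr q)"
    and q: "1 < q" "q \<le> 2" "2 * real CARD('n) / q < real CARD('n) + 2"
begin

definition S :: real where "S = norm c + \<epsilon>"

text \<open>Unnormalised average of \<open>u\<close> over the part at scale \<open>l\<close> of the
  cone with apex \<open>y\<close>; as \<open>l\<close> decreases to 0 it tends, for almost every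
  \<open>y\<close>, to u y times the integral of the bump.\<close>

definition A :: "real^'n \<Rightarrow> real \<Rightarrow> real" where
  "A y l = (LINT x|lebesgue_on U. u x * bump c \<epsilon> ((1 / l) *\<^sub>R (x - y))) / l ^ CARD('n)"

definition I :: "real^'n \<Rightarrow> real \<Rightarrow> real" where
  "I y r = (LINT x:cball y r|lebesgue. f x)"

definition J :: "real^'n \<Rightarrow> real \<Rightarrow> real" where
  "J y r = (LINT x:cball y r|lebesgue. f x powr q)"

lemma S_pos: "S > 0"
  using \<epsilon> by (simp add: S_def add_nonneg_pos)

lemma U_sets: "U \<in> sets lebesgue"
  by (rule sets_lebesgue_open[OF U])

lemma bump_cone:
  assumes "0 < l" "bump c \<epsilon> ((1 / l) *\<^sub>R (x - y)) \<noteq> 0"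
  shows "\<exists>z\<in>cball c \<epsilon>. x = y + l *\<^sub>R z" "norm (x - y) \<le> l * S"
proof -
  let ?z = "(1 / l) *\<^sub>R (x - y)"
  have z: "?z \<in> ball c \<epsilon>"
    using bump_eq_0[OF \<epsilon>, of ?z c] assms(2) by blast
  have xy: "x - y = l *\<^sub>R ?z"
    using assms(1) by simp
  then have "x = y + l *\<^sub>R ?z"
    by (simp only: xy[symmetric] add_diff_cancel_left' diff_add_cancel add.commute[of y])
  then show "\<exists>z\<in>cball c \<epsilon>. x = y + l *\<^sub>R z"
    using z ball_subset_cball by blast
  have "norm ?z \<le> S"
  proof -
    have "norm (?z - c) < \<epsilon>"
      using z unfolding mem_ball dist_norm norm_minus_commute[of c] .
    then show ?thesis
      using norm_triangle_ineq2[of ?z c] unfolding S_def by linarith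
  qed
  moreover have "norm (x - y) = l * norm ?z"
    using arg_cong[OF xy, of norm] assms(1) unfolding norm_scaleR[of l] by simp
  ultimately show "norm (x - y) \<le> l * S"
    using assms(1) mult_left_mono[of "norm ?z" S l] by linarith
qed

text \<open>The weak formulation is tested with the components of x - y times the dilated bump.
  Summing the partial derivative of each component in its own direction gives n times the bump plus
  its radial derivative; the first part cancels the derivative of the factor l^(-n), and only
  integrals of \<open>g\<close> remain.\<close>

lemma A_derivative:
  assumes y: "y \<in> W" and l: "0 < l" "l \<le> 1"
  shows "(A y has_real_derivative
    (\<Sum>j\<in>UNIV. LINT x|lebesgue_on U. g j x * ((x - y) $ j * bump c \<epsilon> ((1 / l) *\<^sub>R (x - y)))) / l ^ Suc CARD('n)) (at l)"
proof -
  let ?n = "CARD('n)" and ?\<rho> = "bump c \<epsilon>"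
  let ?v = "\<lambda>x. if x \<in> U then u x else 0"
  let ?z = "\<lambda>x. (1 / l) *\<^sub>R (x - y)"
  let ?E = "\<lambda>z. frechet_derivative ?\<rho> (at z) z"
  have v: "integrable lebesgue ?v"
    using u(1) Lebesgue_Measure.integrable_restrict_UNIV[OF U_sets, of u] by simp
  have Uv: "(LINT x|lebesgue_on U. u x * h x) = (LINT x|lebesgue. ?v x * h x)" for h
    using Lebesgue_Measure.integral_restrict_UNIV[OF U_sets, of "\<lambda>x. u x * h x"]
    by (simp add: if_distrib[where f="\<lambda>z. z * _"] cong: if_cong)
  have \<rho>0: "?\<rho> z = 0" if "z \<notin> cball c \<epsilon>" for z
    using that bump_eq_0[OF \<epsilon>] ball_subset_cball by blast
  have lin: "linear (frechet_derivative ?\<rho> (at z))" for z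
    by (rule linear_frechet_derivative_smooth[OF smooth_bump])
  define \<psi> where "\<psi> j x = (x - y) $ j * ?\<rho> (?z x)" for j x
  have \<psi>_s: "smooth (\<psi> j)" for j
  proof -
    have "smooth (\<lambda>x::real^'n. x $ j + - y $ j)"
      by (intro smooth_add smooth_const smooth_bounded_linear bounded_linear_vec_nth)
    then show ?thesis
      unfolding \<psi>_def using smooth_mult[OF _ smooth_affine[OF smooth_bump]] by simp
  qed
  have test: "test_fun U (\<psi> j)" for j
    unfolding test_fun_def
  proof (intro conjI exI)
    \<comment> \<open>The support lies in the image of the closed ball under z to y + l z, which the
      cone condition puts inside \<open>U\<close>.\<close>
    let ?K = "(\<lambda>z. y + l *\<^sub>R z) ` cball c \<epsilon>"
    show "compact ?K"
      by (intro compact_continuous_image continuous_intros compact_cball)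
    show "?K \<subseteq> U"
      using cone[OF y l] by auto
    show "\<forall>x. x \<notin> ?K \<longrightarrow> \<psi> j x = 0"
      using bump_cone(1)[OF l(1)] by (auto simp: \<psi>_def image_iff)
  qed (rule \<psi>_s)
  have d\<psi>: "frechet_derivative (\<psi> j) (at x) (axis j 1) =
      ?\<rho> (?z x) + (x - y) $ j * (1 / l) * frechet_derivative ?\<rho> (at (?z x)) (axis j 1)" for j x
  proof -
    have 1: "((\<lambda>x. (x - y) $ j) has_derivative (\<lambda>h. h $ j)) (at x)"
    proof -
      have "((\<lambda>x. x $ j - y $ j) has_derivative (\<lambda>h. h $ j - 0)) (at x)"
        by (intro has_derivative_diff bounded_linear_imp_has_derivative bounded_linear_vec_nth has_derivative_const)
      then show ?thesis
        by simp
    qed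
    have "((\<lambda>x. ?\<rho> (?z x)) has_derivative (\<lambda>h. frechet_derivative ?\<rho> (at (?z x)) ((1 / l) *\<^sub>R h))) (at x)"
      by (rule has_derivative_compose[OF _ smooth_has_derivative[OF smooth_bump]])
        (auto intro!: derivative_eq_intros)
    from has_derivative_mult[OF 1 this]
    have "(\<psi> j has_derivative (\<lambda>h. (x - y) $ j * frechet_derivative ?\<rho> (at (?z x)) ((1 / l) *\<^sub>R h) + h $ j * ?\<rho> (?z x))) (at x)"
      by (simp add: \<psi>_def[abs_def])
    from frechet_derivative_at[OF this, symmetric] show ?thesis
      by (simp only: linear_cmul[OF lin]) simp
  qed
  have sum_d\<psi>: "(\<Sum>j\<in>UNIV. frechet_derivative (\<psi> j) (at x) (axis j 1)) = ?n * ?\<rho> (?z x) + ?E (?z x)" for x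
  proof -
    \<comment> \<open>Expanding the argument in the standard basis identifies the weighted sum of
      the partial derivatives with the radial derivative.\<close>
    have "?z x = (\<Sum>j\<in>UNIV. ((x - y) $ j * (1 / l)) *\<^sub>R axis j 1)"
      by (simp add: vec_eq_iff axis_def if_distrib[where f="\<lambda>z. _ * z"] cong: if_cong)
    from arg_cong[OF this, of "frechet_derivative ?\<rho> (at (?z x))"]
    have "?E (?z x) = (\<Sum>j\<in>UNIV. (x - y) $ j * (1 / l) * frechet_derivative ?\<rho> (at (?z x)) (axis j 1))"
      by (simp only: linear_sum[OF lin] linear_cmul[OF lin] real_scaleR_def)
    then show ?thesis
      by (simp only: d\<psi> sum.distrib) simp
  qed
  have i1: "integrable (lebesgue_on U) (\<lambda>x. u x * frechet_derivative (\<psi> j) (at x) (axis j 1))" for j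
    by (rule locally_integrable_test_fun(2)[OF U u(2) test])
  have i\<rho>: "integrable (lebesgue_on U) (\<lambda>x. u x * ?\<rho> (?z x))"
  proof (rule locally_integrable_mult[OF U u(2)])
    let ?K = "(\<lambda>z. y + l *\<^sub>R z) ` cball c \<epsilon>"
    show "compact ?K"
      by (intro compact_continuous_image continuous_intros compact_cball)
    show "?K \<subseteq> U"
      using cone[OF y l] by auto
    show "?\<rho> (?z x) = 0" if "x \<notin> ?K" for x
      using bump_cone(1)[OF l(1)] that by (auto simp: image_iff)
    show "continuous_on UNIV (\<lambda>x. ?\<rho> (?z x))"
      by (rule smooth_continuous_on[OF smooth_affine[OF smooth_bump]])
  qed
  have "(LINT x|lebesgue_on U. u x * (?n * ?\<rho> (?z x) + ?E (?z x))) =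
      (\<Sum>j\<in>UNIV. LINT x|lebesgue_on U. u x * frechet_derivative (\<psi> j) (at x) (axis j 1))"
    unfolding sum_d\<psi>[symmetric] sum_distrib_left using i1 by (intro Bochner_Integration.integral_sum) auto
  also have "\<dots> = - (\<Sum>j\<in>UNIV. LINT x|lebesgue_on U. g j x * \<psi> j x)"
    using weak[OF test] by (simp add: sum_negf)
  finally have eq: "(LINT x|lebesgue_on U. u x * (?n * ?\<rho> (?z x) + ?E (?z x))) =
      - (\<Sum>j\<in>UNIV. LINT x|lebesgue_on U. g j x * \<psi> j x)" .
  have "(LINT x|lebesgue_on U. u x * (?n * ?\<rho> (?z x) + ?E (?z x))) =
      (LINT x|lebesgue_on U. ?n * (u x * ?\<rho> (?z x)) + u x * ?E (?z x))"
    by (simp add: algebra_simps)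
  also have "\<dots> = ?n * (LINT x|lebesgue_on U. u x * ?\<rho> (?z x)) + (LINT x|lebesgue_on U. u x * ?E (?z x))"
  proof (subst Bochner_Integration.integral_add)
    have "integrable (lebesgue_on U) (\<lambda>x. u x * (?n * ?\<rho> (?z x) + ?E (?z x)) - ?n * (u x * ?\<rho> (?z x)))"
      unfolding sum_d\<psi>[symmetric] sum_distrib_left using i1 i\<rho>
      by (intro Bochner_Integration.integrable_diff Bochner_Integration.integrable_sum integrable_mult_right) auto
    then show "integrable (lebesgue_on U) (\<lambda>x. u x * ?E (?z x))"
      by (simp add: algebra_simps)
  qed (use i\<rho> in auto)
  finally have E: "(LINT x|lebesgue_on U. u x * ?E (?z x)) =
      - real ?n * (LINT x|lebesgue_on U. u x * ?\<rho> (?z x)) - (\<Sum>j\<in>UNIV. LINT x|lebesgue_on U. g j x * \<psi> j x)"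
    using eq by simp
  have dv: "((\<lambda>l. LINT x|lebesgue_on U. u x * ?\<rho> ((1 / l) *\<^sub>R (x - y))) has_real_derivative
      - (1 / l) * (LINT x|lebesgue_on U. u x * ?E (?z x))) (at l)"
    unfolding Uv by (rule DERIV_integral_dilation[OF v smooth_bump compact_cball \<rho>0 l(1)])
  from DERIV_divide[OF dv DERIV_pow[of ?n]] l(1)
  have der: "(A y has_real_derivative (- (1 / l) * (LINT x|lebesgue_on U. u x * ?E (?z x)) * l ^ ?n
      - (LINT x|lebesgue_on U. u x * ?\<rho> (?z x)) * (?n * l ^ (?n - Suc 0))) / (l ^ ?n * l ^ ?n)) (at l)"
    by (simp add: A_def[abs_def])
  have alg: "(- (1 / l) * (- N * a - s) * l ^ k - a * (N * l ^ (k - Suc 0))) / (l ^ k * l ^ k) = s / l ^ Suc k"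
    if k0: "k > 0" for N a s :: real and k
  proof -
    obtain m where k: "k = Suc m"
      using k0 by (cases k) auto
    show ?thesis
      unfolding k using l(1) by (simp add: field_simps)
  qed
  show ?thesis
    using der unfolding E alg[OF zero_less_card_finite] \<psi>_def .
qed

section \<open>Local integrals of the gradient bound and dyadic increments\<close>

lemma f_cball: "set_integrable lebesgue (cball y r) f"
  and fq_cball: "set_integrable lebesgue (cball y r) (\<lambda>x. f x powr q)"
proof -
  note [measurable] = f(1)
  show 1: "set_integrable lebesgue (cball y r) (\<lambda>x. f x powr q)"
    using integrable_mult_indicator[OF _ f(4), of "cball y r"] by (simp add: set_integrable_def)
  have le: "f x \<le> 1 + f x powr q" for x
  proof (cases "f x \<le> 1")
    case False
    then have "f x powr 1 \<le> f x powr q"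
      using q by (intro powr_mono) auto
    then show ?thesis
      using False by simp
  qed (simp add: add_increasing2)
  have ci: "set_integrable lebesgue (cball y r) (\<lambda>_. 1 :: real)"
    using emeasure_lborel_cball_finite[of y r]
    unfolding set_integrable_def by (intro integrable_scaleR_left integrable_real_indicator) auto
  have [measurable]: "cball y r \<in> sets lebesgue"
    by simp
  show "set_integrable lebesgue (cball y r) f"
    using set_integral_add(1)[OF ci 1] unfolding set_integrable_def
  proof (rule Bochner_Integration.integrable_bound)
    show "(\<lambda>x. indicator (cball y r) x *\<^sub>R f x) \<in> borel_measurable lebesgue"
      by measurable
  qed (use f(2) le in \<open>auto simp: indicator_def intro!: AE_I2\<close>)
qed

lemma I_mono: "r \<le> s \<Longrightarrow> I y r \<le> I y s"
  unfolding I_def set_lebesgue_integral_def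
  by (rule integral_mono[OF f_cball[unfolded set_integrable_def] f_cball[unfolded set_integrable_def]])
    (use f(2) in \<open>auto simp: indicator_def\<close>)

lemma I_nonneg: "I y r \<ge> 0" and J_nonneg: "J y r \<ge> 0"
  unfolding I_def J_def set_lebesgue_integral_def using f(2)
  by (auto intro!: Bochner_Integration.integral_nonneg)

text \<open>On the support every coordinate of x - y is at most l S, and the bump is at most 1. One
  factor \<open>l\<close> therefore cancels against l^(n+1), leaving l^n.\<close>

lemma A_derivative_le:
  assumes y: "y \<in> W" and l: "0 < l" "l \<le> 1"
  shows "\<bar>(\<Sum>j\<in>UNIV. LINT x|lebesgue_on U. g j x * ((x - y) $ j * bump c \<epsilon> ((1 / l) *\<^sub>R (x - y)))) / l ^ Suc CARD('n)\<bar>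
    \<le> CARD('n) * S * I y (l * S) / l ^ CARD('n)"
proof -
  let ?h = "\<lambda>j x. g j x * ((x - y) $ j * bump c \<epsilon> ((1 / l) *\<^sub>R (x - y)))"
  have "\<bar>LINT x|lebesgue_on U. ?h j x\<bar> \<le> l * S * I y (l * S)" for j
  proof -
    have "(LINT x|lebesgue_on U. ?h j x) = (LINT x|lebesgue. (if x \<in> U then ?h j x else 0))"
      by (rule Lebesgue_Measure.integral_restrict_UNIV[OF U_sets, symmetric])
    also have "\<bar>\<dots>\<bar> \<le> (LINT x|lebesgue. \<bar>(if x \<in> U then ?h j x else 0)\<bar>)"
      by (rule integral_abs_bound)
    also have "\<dots> \<le> (LINT x|lebesgue. l * S * (indicator (cball y (l * S)) x *\<^sub>R f x))"
    proof (rule integral_mono_AE')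
      show "integrable lebesgue (\<lambda>x. l * S * (indicator (cball y (l * S)) x *\<^sub>R f x))"
        using f_cball by (auto simp: set_integrable_def)
      show "AE x in lebesgue. \<bar>(if x \<in> U then ?h j x else 0)\<bar> \<le> l * S * (indicator (cball y (l * S)) x *\<^sub>R f x)"
      proof (rule AE_I2)
        fix x
        show "\<bar>(if x \<in> U then ?h j x else 0)\<bar> \<le> l * S * (indicator (cball y (l * S)) x *\<^sub>R f x)"
        proof (cases "x \<in> U \<and> bump c \<epsilon> ((1 / l) *\<^sub>R (x - y)) \<noteq> 0")
          case True
          then have le: "norm (x - y) \<le> l * S"
            using bump_cone(2)[OF l(1)] by blast
          have "\<bar>(x - y) $ j * bump c \<epsilon> ((1 / l) *\<^sub>R (x - y))\<bar> \<le> (l * S) * 1"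
            unfolding abs_mult using component_le_norm_cart[of "x - y" j] le bump_le_1[of c \<epsilon>] bump_nonneg[of c \<epsilon>]
            by (intro mult_mono) auto
          then have "\<bar>g j x\<bar> * \<bar>(x - y) $ j * bump c \<epsilon> ((1 / l) *\<^sub>R (x - y))\<bar> \<le> f x * (l * S)"
            using f(2,3) True by (intro mult_mono) auto
          moreover have "x \<in> cball y (l * S)"
            using le by (simp add: dist_norm norm_minus_commute)
          ultimately show ?thesis
            using True by (simp add: abs_mult mult.commute)
        next
          case False
          then show ?thesis
            using l S_pos f(2)[of x] by (auto simp: indicator_def)
        qed
      qed
    qed (use l S_pos f(2) in \<open>auto simp: indicator_def\<close>)
    also have "\<dots> = l * S * I y (l * S)"
      by (simp add: I_def set_lebesgue_integral_def)
    finally show ?thesis .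
  qed
  then have "\<bar>\<Sum>j\<in>UNIV. LINT x|lebesgue_on U. ?h j x\<bar> \<le> (\<Sum>j\<in>(UNIV::'n set). l * S * I y (l * S))"
    by (intro order_trans[OF sum_abs] sum_mono)
  then have "\<bar>\<Sum>j\<in>UNIV. LINT x|lebesgue_on U. ?h j x\<bar> / l ^ Suc CARD('n) \<le> CARD('n) * (l * S * I y (l * S)) / l ^ Suc CARD('n)"
    using l by (intro divide_right_mono) auto
  then show ?thesis
    using l by (simp add: abs_divide)
qed

text \<open>Hoelder against the indicator of the ball, whose integral is the volume.\<close>

lemma I_le_J:
  assumes "r \<ge> 0"
  shows "I y r \<le> J y r powr (1 / q) * (unit_ball_vol CARD('n) * r ^ CARD('n)) powr (1 - 1 / q)"
proof -
  define q' where "q' = q / (q - 1)"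
  have q': "q' > 1" "1 / q + 1 / q' = 1"
    using q by (auto simp: q'_def field_simps)
  let ?B = "cball y r"
  note [measurable] = f(1)
  have [measurable]: "?B \<in> sets lebesgue"
    by simp
  have e1: "norm (indicator ?B x *\<^sub>R f x) powr q = indicator ?B x *\<^sub>R f x powr q" for x
    using f(2)[of x] q by (auto simp: indicator_def)
  have e2: "norm (indicator ?B x :: real) powr q' = indicator ?B x" for x
    by (auto simp: indicator_def)
  have "(LINT x|lebesgue. norm (indicator ?B x *\<^sub>R f x) * norm (indicator ?B x :: real)) \<le>
      (LINT x|lebesgue. norm (indicator ?B x *\<^sub>R f x) powr q) powr (1 / q)
      * (LINT x|lebesgue. norm (indicator ?B x :: real) powr q') powr (1 / q')"
  proof (rule Hoelder_norm)
    show "integrable lebesgue (\<lambda>x. norm (indicator ?B x *\<^sub>R f x) powr q)"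
      unfolding e1 using fq_cball by (simp add: set_integrable_def)
    show "integrable lebesgue (\<lambda>x. norm (indicator ?B x :: real) powr q')"
      unfolding e2 using emeasure_lborel_cball_finite[of y r] by (intro integrable_real_indicator) auto
  qed (use q q' in auto)
  also have "(LINT x|lebesgue. norm (indicator ?B x :: real) powr q') = unit_ball_vol CARD('n) * r ^ CARD('n)"
    unfolding e2 using content_cball[OF assms, of y] by simp
  also have "(LINT x|lebesgue. norm (indicator ?B x *\<^sub>R f x) powr q) = J y r"
    unfolding e1 by (simp add: J_def set_lebesgue_integral_def)
  also have "(LINT x|lebesgue. norm (indicator ?B x *\<^sub>R f x) * norm (indicator ?B x :: real)) = I y r"
    unfolding I_def set_lebesgue_integral_def
    by (rule Bochner_Integration.integral_cong) (use f(2) in \<open>auto simp: indicator_def\<close>)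
  also have "1 / q' = 1 - 1 / q"
    using q' by simp
  finally show ?thesis .
qed

definition M :: real where "M = (LINT x|lebesgue. f x powr q)"

lemma J_le_M: "J y r \<le> M"
  unfolding J_def M_def set_lebesgue_integral_def
  by (rule integral_mono[OF fq_cball[unfolded set_integrable_def] f(4)]) (auto simp: indicator_def)

text \<open>Constant of \<open>A_diff_le\<close>. The factor 2^n is the price of replacing the scale
  2^(-k-1) by 2^(-k) in l^(-n); the volume comes from Hoelder, and the power of \<open>M\<close>
  from bounding J^(2/q) by M^(2/q - 1) J.\<close>

definition C :: real where
  "C = (2 ^ CARD('n) * CARD('n) * S)\<^sup>2 * (unit_ball_vol CARD('n) * S ^ CARD('n)) powr (2 - 2 / q) * M powr (2 / q - 1)"

text \<open>Growth factor, from one dyadic scale to the next, of the coefficient in the bound for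
  the squared increments.\<close>

definition \<tau> :: real where "\<tau> = 2 powr (2 * CARD('n) / q - 2)"

text \<open>Mean value theorem between consecutive dyadic scales, then Hoelder. Because q \<le> 2,
  the power J^(2/q) is at most M^(2/q - 1) J, so the bound becomes linear in \<open>J\<close> and
  can be integrated over \<open>y\<close>.\<close>

lemma A_diff_le:
  assumes y: "y \<in> W"
  shows "(A y ((1/2) ^ k) - A y ((1/2) ^ Suc k))\<^sup>2 \<le> C * \<tau> ^ k * J y ((1/2) ^ k * S)"
proof -
  let ?n = "CARD('n)"
  let ?a = "(1/2) ^ k :: real" and ?b = "(1/2) ^ Suc k :: real"
  let ?r = "?a * S"
  have ab: "0 < ?b" "?b \<le> ?a" "?a \<le> 1"
    by (auto simp: power_le_one)
  have "norm (A y ?a - A y ?b) \<le> (?n * S * I y ?r / ?b ^ ?n) * norm (?a - ?b)"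
  proof (rule field_differentiable_bound[where S="{?b..?a}" and f="A y"])
    fix l assume l: "l \<in> {?b..?a}"
    then have "?b \<le> l" "l \<le> ?a"
      unfolding atLeastAtMost_iff by blast+
    then have l01: "0 < l" "l \<le> 1"
      using less_le_trans[OF ab(1)] order_trans[OF _ ab(3)] by blast+
    show "(A y has_field_derivative (\<Sum>j\<in>UNIV. LINT x|lebesgue_on U. g j x * ((x - y) $ j * bump c \<epsilon> ((1 / l) *\<^sub>R (x - y)))) / l ^ Suc CARD('n))
        (at l within {?b..?a})"
      by (rule has_field_derivative_at_within[OF A_derivative[OF y l01]])
    have "?n * S * I y (l * S) / l ^ ?n \<le> ?n * S * I y ?r / ?b ^ ?n"
      using l ab S_pos I_nonneg I_mono[of "l * S" ?r y]
      by (intro frac_le mult_left_mono power_mono mult_nonneg_nonneg) auto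
    then show "norm ((\<Sum>j\<in>UNIV. LINT x|lebesgue_on U. g j x * ((x - y) $ j * bump c \<epsilon> ((1 / l) *\<^sub>R (x - y)))) / l ^ Suc CARD('n))
        \<le> ?n * S * I y ?r / ?b ^ ?n"
      using A_derivative_le[OF y l01] by simp
  qed (use ab in auto)
  also have "\<dots> \<le> (?n * S * I y ?r / ?b ^ ?n) * ?a"
    using S_pos I_nonneg ab by (intro mult_left_mono) (auto simp del: power_Suc)
  also have "\<dots> = (2 ^ ?n * ?n * S) * (I y ?r * (?a / ?a ^ ?n))"
    by (simp add: power_mult_distrib field_simps power_commutes)
  finally have "\<bar>A y ?a - A y ?b\<bar>\<^sup>2 \<le> ((2 ^ ?n * ?n * S) * (I y ?r * (?a / ?a ^ ?n)))\<^sup>2"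
    by (intro power_mono) auto
  also have "\<dots> = (2 ^ ?n * ?n * S)\<^sup>2 * ((I y ?r)\<^sup>2 * (?a / ?a ^ ?n)\<^sup>2)"
    by (simp only: power_mult_distrib)
  also have "\<dots> \<le> (2 ^ ?n * ?n * S)\<^sup>2 * ((M powr (2 / q - 1) * J y ?r * ((unit_ball_vol ?n * S ^ ?n) powr (2 - 2 / q)
      * ?a powr (?n * (2 - 2 / q)))) * (?a / ?a ^ ?n)\<^sup>2)"
  proof (intro mult_left_mono mult_right_mono)
    have "(I y ?r)\<^sup>2 \<le> (J y ?r powr (1 / q) * (unit_ball_vol ?n * ?r ^ ?n) powr (1 - 1 / q))\<^sup>2"
      using S_pos by (intro power_mono I_le_J I_nonneg) auto
    also have "\<dots> = J y ?r powr (2 / q) * (unit_ball_vol ?n * ?r ^ ?n) powr (2 - 2 / q)"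
      by (simp add: power_mult_distrib powr_power[symmetric] powr_powr flip: powr_add)
        (simp add: power2_eq_square powr_add[symmetric] algebra_simps)
    also have "(unit_ball_vol ?n * ?r ^ ?n) powr (2 - 2 / q)
        = (unit_ball_vol ?n * S ^ ?n) powr (2 - 2 / q) * ?a powr (?n * (2 - 2 / q))"
    proof -
      have "unit_ball_vol ?n * ?r ^ ?n = (unit_ball_vol ?n * S ^ ?n) * ?a ^ ?n"
        by (simp add: power_mult_distrib)
      moreover have "(?a ^ ?n) powr (2 - 2 / q) = ?a powr (?n * (2 - 2 / q))"
        using powr_realpow[of ?a ?n] by (simp only: powr_powr[symmetric]) simp
      ultimately show ?thesis
        by (simp only: powr_mult)
    qed
    also have "J y ?r powr (2 / q) \<le> M powr (2 / q - 1) * J y ?r"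
    proof (cases "J y ?r = 0")
      case False
      then have J: "J y ?r > 0"
        using J_nonneg[of y ?r] by simp
      then have "J y ?r powr (2 / q) = J y ?r powr (2 / q - 1) * J y ?r"
        by (simp add: powr_diff)
      also have "\<dots> \<le> M powr (2 / q - 1) * J y ?r"
        using q J J_le_M[of y ?r] by (intro mult_right_mono powr_mono2) (auto simp: field_simps)
      finally show ?thesis .
    qed simp
    finally show "(I y ?r)\<^sup>2 \<le> M powr (2 / q - 1) * J y ?r * ((unit_ball_vol ?n * S ^ ?n) powr (2 - 2 / q)
      * ?a powr (?n * (2 - 2 / q)))"
      by (simp add: mult_right_mono)
  qed auto
  also have "\<dots> = C * (?a powr (?n * (2 - 2 / q)) * (?a / ?a ^ ?n)\<^sup>2) * J y ?r"
    by (simp add: C_def)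
  \<comment> \<open>Exponents of 2^(-k): n (2 - 2/q) from Hoelder and 2 - 2n from the scale factors,
    together 2 - 2n/q.\<close>
  also have "?a powr (?n * (2 - 2 / q)) * (?a / ?a ^ ?n)\<^sup>2 = \<tau> ^ k"
  proof -
    have a: "?a = 2 powr (- k)"
      by (simp add: powr_minus powr_realpow power_divide field_simps)
    have "(?a / ?a ^ ?n)\<^sup>2 = ?a powr (2 - 2 * real ?n)"
    proof -
      have "?a / ?a ^ ?n = ?a powr (1 - real ?n)"
      proof -
        have "?a powr 1 = ?a" "?a powr real ?n = ?a ^ ?n"
          using powr_realpow[of ?a ?n] by simp_all
        then show ?thesis
          using powr_diff[of ?a 1 "real ?n"] by metis
      qed
      then have "(?a / ?a ^ ?n)\<^sup>2 = (?a powr (1 - real ?n)) powr 2"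
        by (simp add: powr_numeral)
      then show ?thesis
        by (simp add: powr_powr algebra_simps)
    qed
    then have "?a powr (?n * (2 - 2 / q)) * (?a / ?a ^ ?n)\<^sup>2 = ?a powr (2 - 2 * ?n / q)"
      by (simp add: powr_add[symmetric] algebra_simps)
    also have "\<dots> = 2 powr ((2 * ?n / q - 2) * k)"
      unfolding a powr_powr by (simp add: algebra_simps)
    also have "\<dots> = \<tau> ^ k"
      by (simp add: \<tau>_def powr_powr[symmetric] powr_realpow)
    finally show ?thesis .
  qed
  finally show ?thesis
    by simp
qed

end

section \<open>Summation over the dyadic scales\<close>

context sobolev_cone
begin

text \<open>Subcriticality of the exponent in the form 2n/q - 2 < n.\<close>

lemma \<tau>_less: "\<tau> < 2 ^ CARD('n)"
proof -
  have "\<tau> < 2 powr real CARD('n)"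
    unfolding \<tau>_def using q(3) by (intro powr_less_mono) auto
  then show ?thesis
    by (simp add: powr_realpow)
qed

text \<open>Chosen so that \<tau>^k = s^k s^k 2^(n k). One factor s^k pays for Cauchy-Schwarz, the
  other makes the integrated series converge, and 2^(n k) is compensated by the volume of balls of
  radius 2^(-k) S.\<close>

definition s :: real where "s = sqrt (\<tau> / 2 ^ CARD('n))"

lemma s_bounds: "0 < s" "s < 1" and s_square: "s\<^sup>2 = \<tau> / 2 ^ CARD('n)"
  using \<tau>_less by (auto simp: s_def \<tau>_def)

text \<open>Telescoping over the scales, with Cauchy-Schwarz weighted by the square roots of s^k,
  whose squares form a convergent geometric series.\<close>

lemma A_square_le:
  assumes y: "y \<in> W"
  shows "(A y ((1/2) ^ N))\<^sup>2 \<le> 2 * (A y 1)\<^sup>2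
    + 2 / (1 - s) * C * (\<Sum>k<N. s ^ k * 2 ^ (CARD('n) * k) * J y ((1/2) ^ k * S))"
proof -
  let ?a = "\<lambda>k. A y ((1/2) ^ k)"
  define \<delta> where "\<delta> k = ?a (Suc k) - ?a k" for k
  have sk: "s ^ k > 0" for k
    using s_bounds by simp
  have C0: "C \<ge> 0"
    by (simp add: C_def)
  have "(\<Sum>k<N. \<delta> k)\<^sup>2 = (\<Sum>k<N. sqrt (s ^ k) * (\<delta> k / sqrt (s ^ k)))\<^sup>2"
    using s_bounds by simp
  also have "\<dots> \<le> (\<Sum>k<N. (sqrt (s ^ k))\<^sup>2) * (\<Sum>k<N. (\<delta> k / sqrt (s ^ k))\<^sup>2)"
    by (rule Cauchy_Schwarz_ineq_sum)
  also have "\<dots> = (\<Sum>k<N. s ^ k) * (\<Sum>k<N. (\<delta> k)\<^sup>2 / s ^ k)"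
    using s_bounds by (simp add: power_divide)
  also have "\<dots> \<le> 1 / (1 - s) * (\<Sum>k<N. C * (s ^ k * 2 ^ (CARD('n) * k) * J y ((1/2) ^ k * S)))"
  proof (rule mult_mono)
    show "(\<Sum>k<N. s ^ k) \<le> 1 / (1 - s)"
      using s_bounds by (simp add: sum_gp_strict divide_right_mono)
    show "(\<Sum>k<N. (\<delta> k)\<^sup>2 / s ^ k) \<le> (\<Sum>k<N. C * (s ^ k * 2 ^ (CARD('n) * k) * J y ((1/2) ^ k * S)))"
    proof (rule sum_mono)
      fix k
      have "(\<delta> k)\<^sup>2 \<le> C * \<tau> ^ k * J y ((1/2) ^ k * S)"
        using A_diff_le[OF y, of k] by (simp only: \<delta>_def power2_commute)
      also have "\<tau> = s * s * 2 ^ CARD('n)"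
        using s_square by (simp add: power2_eq_square)
      also have "C * (s * s * 2 ^ CARD('n)) ^ k * J y ((1/2) ^ k * S) =
          s ^ k * (C * (s ^ k * 2 ^ (CARD('n) * k) * J y ((1/2) ^ k * S)))"
        by (simp only: power_mult_distrib power_mult[symmetric] mult.assoc mult.left_commute)
      finally show "(\<delta> k)\<^sup>2 / s ^ k \<le> C * (s ^ k * 2 ^ (CARD('n) * k) * J y ((1/2) ^ k * S))"
        using sk[of k] by (subst pos_divide_le_eq) (simp_all only: mult.commute)
    qed
  qed (use s_bounds in \<open>auto intro!: sum_nonneg\<close>)
  finally have \<delta>: "(\<Sum>k<N. \<delta> k)\<^sup>2 \<le> 1 / (1 - s) * (C * (\<Sum>k<N. s ^ k * 2 ^ (CARD('n) * k) * J y ((1/2) ^ k * S)))"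
    by (simp only: sum_distrib_left)
  have "?a N = A y 1 + (\<Sum>k<N. \<delta> k)"
    using sum_lessThan_telescope[of ?a N] by (simp add: \<delta>_def)
  then have "(?a N)\<^sup>2 \<le> 2 * (A y 1)\<^sup>2 + 2 * (\<Sum>k<N. \<delta> k)\<^sup>2"
    using zero_le_power2[of "A y 1 - (\<Sum>k<N. \<delta> k)"] by (simp add: power2_sum power2_diff)
  then show ?thesis
    using \<delta> by (simp add: mult.assoc)
qed

text \<open>Tonelli: each point \<open>x\<close> is counted for all \<open>y\<close> in the ball of
  radius \<open>r\<close> around it. The interchange is done for Borel measures, so
  \<open>f x powr q\<close> is first replaced by a Borel representative.\<close>

lemma nn_integral_J:
  assumes "r \<ge> 0"
  shows "(\<integral>\<^sup>+y. ennreal (J y r) \<partial>lebesgue) = ennreal (unit_ball_vol CARD('n) * r ^ CARD('n) * M)"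
proof -
  obtain F where F: "F \<in> borel_measurable lborel" "AE x in lborel. f x powr q = F x"
    using completion_ex_borel_measurable_real[of "\<lambda>x. f x powr q" lborel] f(1) by auto
  note [measurable] = F(1)
  have ae: "AE x in lebesgue. f x powr q = F x"
    by (rule AE_completion[OF F(2)])
  have J: "ennreal (J y r) = (\<integral>\<^sup>+x. ennreal (F x) * indicator (cball y r) x \<partial>lborel)" for y
  proof -
    have "ennreal (J y r) = (\<integral>\<^sup>+x. ennreal (indicator (cball y r) x *\<^sub>R f x powr q) \<partial>lebesgue)"
      unfolding J_def set_lebesgue_integral_def
      using fq_cball[unfolded set_integrable_def] by (intro nn_integral_eq_integral[symmetric]) auto
    also have "\<dots> = (\<integral>\<^sup>+x. ennreal (F x) * indicator (cball y r) x \<partial>lebesgue)"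
      using ae by (intro nn_integral_cong_AE) (auto simp: indicator_def)
    finally show ?thesis
      by (simp only: nn_integral_completion)
  qed
  have "(\<integral>\<^sup>+y. ennreal (J y r) \<partial>lebesgue) =
      (\<integral>\<^sup>+y. (\<integral>\<^sup>+x. ennreal (F x) * indicator (cball y r) x \<partial>lborel) \<partial>lborel)"
    by (simp only: J nn_integral_completion)
  also have "\<dots> = (\<integral>\<^sup>+x. (\<integral>\<^sup>+y. ennreal (F x) * indicator (cball y r) x \<partial>lborel) \<partial>lborel)"
  proof (rule lborel_pair.Fubini')
    have "(\<lambda>(x, y). ennreal (F x) * indicator {z. dist (snd z) (fst z) \<le> r} (x, y)) \<in> borel_measurable (lborel \<Otimes>\<^sub>M lborel)"
      by measurable
    moreover have "(\<lambda>(x, y). ennreal (F x) * indicator {z. dist (snd z) (fst z) \<le> r} (x, y)) =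
        (\<lambda>(x::real^'n, y). ennreal (F x) * indicator (cball y r) x)"
      by (auto simp: indicator_def fun_eq_iff)
    ultimately show "(\<lambda>(x, y). ennreal (F x) * indicator (cball y r) x) \<in> borel_measurable (lborel \<Otimes>\<^sub>M lborel)"
      by simp
  qed
  also have "\<dots> = (\<integral>\<^sup>+x. ennreal (F x) * ennreal (unit_ball_vol CARD('n) * r ^ CARD('n)) \<partial>lborel)"
  proof (rule nn_integral_cong)
    fix x :: "real^'n"
    have "(\<integral>\<^sup>+y. ennreal (F x) * indicator (cball y r) x \<partial>lborel) =
        (\<integral>\<^sup>+y. ennreal (F x) * indicator (cball x r) y \<partial>lborel)"
      by (intro nn_integral_cong) (auto simp: indicator_def dist_commute)
    also have "\<dots> = ennreal (F x) * emeasure lborel (cball x r)"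
      by (simp add: nn_integral_cmult_indicator)
    also have "emeasure lborel (cball x r) = ennreal (unit_ball_vol CARD('n) * r ^ CARD('n))"
      using emeasure_cball[OF assms, of x] by simp
    finally show "(\<integral>\<^sup>+y. ennreal (F x) * indicator (cball y r) x \<partial>lborel) =
        ennreal (F x) * ennreal (unit_ball_vol CARD('n) * r ^ CARD('n))" .
  qed
  also have "\<dots> = (\<integral>\<^sup>+x. ennreal (F x) \<partial>lborel) * ennreal (unit_ball_vol CARD('n) * r ^ CARD('n))"
    by (simp add: nn_integral_multc)
  also have "(\<integral>\<^sup>+x. ennreal (F x) \<partial>lborel) = (\<integral>\<^sup>+x. ennreal (F x) \<partial>lebesgue)"
    by (simp only: nn_integral_completion)
  also have "\<dots> = (\<integral>\<^sup>+x. ennreal (f x powr q) \<partial>lebesgue)"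
    using ae by (intro nn_integral_cong_AE) auto
  also have "\<dots> = ennreal M"
    unfolding M_def by (intro nn_integral_eq_integral f(4)) auto
  also have "ennreal M * ennreal (unit_ball_vol CARD('n) * r ^ CARD('n)) = ennreal (M * (unit_ball_vol CARD('n) * r ^ CARD('n)))"
    by (rule ennreal_mult'[symmetric]) (auto simp: M_def intro: Bochner_Integration.integral_nonneg)
  finally show ?thesis
    by (simp add: mult.commute)
qed

lemma J_measurable: "(\<lambda>y. J y r) \<in> borel_measurable lebesgue"
proof -
  obtain F where F: "F \<in> borel_measurable lborel" "AE x in lborel. f x powr q = F x"
    using completion_ex_borel_measurable_real[of "\<lambda>x. f x powr q" lborel] f(1) by auto
  note [measurable] = F(1)
  have ae: "AE x in lebesgue. f x powr q = F x"
    by (rule AE_completion[OF F(2)])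
  note [measurable] = f(1)
  have [measurable]: "cball y r \<in> sets lebesgue" "F \<in> borel_measurable lebesgue" for y
    using F(1) by (auto intro: measurable_completion)
  have J: "J y r = (LINT x|lborel. indicator {z. dist (fst z) (snd z) \<le> r} (y, x) * F x)" for y
  proof -
    have "J y r = (LINT x|lebesgue. indicator {z. dist (fst z) (snd z) \<le> r} (y, x) * F x)"
      unfolding J_def set_lebesgue_integral_def
    proof (rule integral_cong_AE)
      show "AE x in lebesgue. indicator (cball y r) x *\<^sub>R f x powr q
          = indicator {z. dist (fst z) (snd z) \<le> r} (y, x) * F x"
        using ae by eventually_elim (auto simp: indicator_def)
      have "(\<lambda>x. indicator (cball y r) x * F x) \<in> borel_measurable lebesgue"
        by measurable
      moreover have "(\<lambda>x. indicator (cball y r) x * F x) = (\<lambda>x. indicator {z. dist (fst z) (snd z) \<le> r} (y, x) * F x)"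
        by (auto simp: indicator_def)
      ultimately show "(\<lambda>x. indicator {z. dist (fst z) (snd z) \<le> r} (y, x) * F x) \<in> borel_measurable lebesgue"
        by simp
    qed measurable
    also have "\<dots> = (LINT x|lborel. indicator {z. dist (fst z) (snd z) \<le> r} (y, x) * F x)"
      by (rule integral_completion) measurable
    finally show ?thesis .
  qed
  have "(\<lambda>y. LINT x|lborel. indicator {z. dist (fst z) (snd z) \<le> r} (y, x) * F x) \<in> borel_measurable lborel"
    by measurable
  then show ?thesis
    unfolding J by (intro measurable_completion) simp
qed

text \<open>Almost everywhere the averages A y (2^(-N)) converge to a positive multiple of u y,
  while their squares stay below the integrable function \<open>R\<close>; the limit inherits the
  bound.\<close>

theorem square_integrable: "set_integrable lebesgue W (\<lambda>x. (u x)\<^sup>2)"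
proof -
  define c0 where "c0 = (LINT z|lborel. bump c \<epsilon> z)"
  have c0: "c0 > 0"
    unfolding c0_def by (rule bump_integral_pos[OF \<epsilon>])
  define B where "B = (LINT x|lebesgue_on U. \<bar>u x\<bar>)"
  let ?n = "CARD('n)"
  have B0: "B \<ge> 0"
    by (auto simp: B_def intro: Bochner_Integration.integral_nonneg)
  have A1: "(A y 1)\<^sup>2 \<le> B\<^sup>2" for y
  proof -
    have "\<bar>A y 1\<bar> \<le> (LINT x|lebesgue_on U. \<bar>u x * bump c \<epsilon> (x - y)\<bar>)"
      by (simp add: A_def integral_abs_bound)
    also have "\<dots> \<le> B"
      unfolding B_def
    proof (rule integral_mono_AE')
      show "AE x in lebesgue_on U. \<bar>u x * bump c \<epsilon> (x - y)\<bar> \<le> \<bar>u x\<bar>"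
        using mult_left_mono[OF bump_le_1 abs_ge_zero]
        by (auto intro!: AE_I2 simp: abs_mult abs_of_nonneg[OF bump_nonneg])
    qed (use u(1) in auto)
    finally show ?thesis
      by (metis abs_ge_zero power2_abs power_mono)
  qed
  define K where "K = 2 / (1 - s) * C"
  have K0: "K \<ge> 0"
    using s_bounds by (simp add: K_def C_def)
  let ?t = "\<lambda>k y. s ^ k * 2 ^ (?n * k) * J y ((1/2) ^ k * S)"
  have t0: "?t k y \<ge> 0" for k y
    using s_bounds J_nonneg by simp
  \<comment> \<open>Common majorant of the squared averages on \<open>W\<close>: the average at
    scale 1 is bounded by the L^1 norm \<open>B\<close>, and the series collects the
    increments.\<close>
  define R where "R y = ennreal (2 * B\<^sup>2) * indicator W y + ennreal K * (\<Sum>k. ennreal (?t k y))" for y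
  have [measurable]: "W \<in> sets lebesgue"
    using W by auto
  note [measurable] = J_measurable
  have AR: "ennreal ((A y ((1/2) ^ N))\<^sup>2) \<le> R y" if "y \<in> W" for y N
  proof -
    have "(A y ((1/2) ^ N))\<^sup>2 \<le> 2 * B\<^sup>2 + K * (\<Sum>k<N. ?t k y)"
      using A_square_le[OF that, of N] A1[of y] by (simp add: K_def)
    then have "ennreal ((A y ((1/2) ^ N))\<^sup>2) \<le> ennreal (2 * B\<^sup>2 + K * (\<Sum>k<N. ?t k y))"
      by (rule ennreal_leI)
    also have "\<dots> = ennreal (2 * B\<^sup>2) + ennreal K * (\<Sum>k<N. ennreal (?t k y))"
      using t0 K0 by (simp add: ennreal_plus sum_nonneg ennreal_mult' sum_ennreal)
    also have "\<dots> \<le> R y"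
      unfolding R_def using that by (intro add_mono mult_left_mono sum_le_suminf) auto
    finally show ?thesis .
  qed
  have lim: "AE y in lebesgue. y \<in> W \<longrightarrow> (\<lambda>N. A y ((1/2) ^ N)) \<longlonglongrightarrow> u y * c0"
    using AE_lebesgue_point[OF U u(2)]
  proof eventually_elim
    case (elim y)
    show ?case
    proof
      assume "y \<in> W"
      then have y: "y \<in> U"
        using W(1) by auto
      then obtain r where r: "r > 0" "cball y r \<subseteq> U"
        using U open_contains_cball by blast
      let ?v = "\<lambda>x. if x \<in> U then u x else 0"
      have si: "set_integrable lebesgue (cball y r) u"
        using u(2) r(2) by (auto simp: locally_integrable_def)
      have lim: "((\<lambda>l. (LINT x|lebesgue. u x * bump c \<epsilon> ((1 / l) *\<^sub>R (x - y))) / l ^ DIM(real^'n))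
          \<longlongrightarrow> u y * c0) (at_right 0)"
        unfolding c0_def by (rule mollifier_tendsto[OF si r(1) _ \<epsilon>]) (use elim y in simp)
      have eq: "(LINT x|lebesgue. u x * bump c \<epsilon> ((1 / l) *\<^sub>R (x - y))) / l ^ DIM(real^'n) = A y l"
        if "0 < l" "l \<le> 1" for l
      proof -
        have "bump c \<epsilon> ((1 / l) *\<^sub>R (x - y)) = 0" if x: "x \<notin> U" for x
        proof (rule ccontr)
          assume "bump c \<epsilon> ((1 / l) *\<^sub>R (x - y)) \<noteq> 0"
          from bump_cone(1)[OF \<open>0 < l\<close> this] show False
            using cone[OF \<open>y \<in> W\<close> \<open>0 < l\<close> \<open>l \<le> 1\<close>] x by auto
        qed
        then show ?thesis
          unfolding A_def by (subst integral_lebesgue_on_eq[OF U_sets]) auto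
      qed
      have half: "filterlim (\<lambda>N. (1/2) ^ N :: real) (at_right 0) sequentially"
        by (intro filterlim_at_withinI LIMSEQ_realpow_zero) auto
      have "(\<lambda>N. (LINT x|lebesgue. u x * bump c \<epsilon> ((1 / (1/2) ^ N) *\<^sub>R (x - y))) / ((1/2) ^ N) ^ DIM(real^'n))
          \<longlonglongrightarrow> u y * c0"
        by (rule filterlim_compose[OF lim half])
      then show "(\<lambda>N. A y ((1/2) ^ N)) \<longlonglongrightarrow> u y * c0"
      proof (rule Lim_transform_eventually)
        show "\<forall>\<^sub>F N in sequentially. (LINT x|lebesgue. u x * bump c \<epsilon> ((1 / (1/2) ^ N) *\<^sub>R (x - y)))
            / ((1/2) ^ N) ^ DIM(real^'n) = A y ((1/2) ^ N)"
          by (rule always_eventually, rule allI, rule eq) (auto simp: power_le_one)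
      qed
    qed
  qed
  have uR: "AE y in lebesgue. ennreal (c0\<^sup>2 * (indicator W y *\<^sub>R (u y)\<^sup>2)) \<le> R y"
    using lim
  proof eventually_elim
    case (elim y)
    show ?case
    proof (cases "y \<in> W")
      case True
      then have "(\<lambda>N. ennreal ((A y ((1/2) ^ N))\<^sup>2)) \<longlonglongrightarrow> ennreal ((u y * c0)\<^sup>2)"
        using elim by (intro tendsto_ennrealI tendsto_power) auto
      then have "ennreal ((u y * c0)\<^sup>2) \<le> R y"
        by (rule LIMSEQ_le_const2) (use AR[OF True] in blast)
      then show ?thesis
        using True by (simp add: power_mult_distrib mult.commute)
    qed simp
  qed
  have Rint: "(\<integral>\<^sup>+y. R y \<partial>lebesgue) < \<infinity>"
  proof -
    have t_int: "(\<integral>\<^sup>+y. ennreal (?t k y) \<partial>lebesgue) = ennreal (s ^ k * (unit_ball_vol ?n * S ^ ?n * M))" for k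
    proof -
      have "(\<integral>\<^sup>+y. ennreal (?t k y) \<partial>lebesgue) = (\<integral>\<^sup>+y. ennreal (s ^ k * 2 ^ (?n * k)) * ennreal (J y ((1/2) ^ k * S)) \<partial>lebesgue)"
        using s_bounds J_nonneg by (intro nn_integral_cong) (simp add: ennreal_mult')
      also have "\<dots> = ennreal (s ^ k * 2 ^ (?n * k)) * ennreal (unit_ball_vol ?n * ((1/2) ^ k * S) ^ ?n * M)"
        using S_pos by (subst nn_integral_cmult) (auto simp: nn_integral_J)
      also have "\<dots> = ennreal (s ^ k * 2 ^ (?n * k) * (unit_ball_vol ?n * ((1/2) ^ k * S) ^ ?n * M))"
        using s_bounds by (subst ennreal_mult') auto
      \<comment> \<open>The ball of radius 2^(-k) S contributes the factor 2^(-n k), which cancels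
        the weight 2^(n k); a geometric series in \<open>s\<close> is left.\<close>
      also have "s ^ k * 2 ^ (?n * k) * (unit_ball_vol ?n * ((1/2) ^ k * S) ^ ?n * M) = s ^ k * (unit_ball_vol ?n * S ^ ?n * M)"
      proof -
        have "((1/2) ^ k * S) ^ ?n * 2 ^ (?n * k) = S ^ ?n"
          by (simp add: power_mult_distrib power_divide power_mult[symmetric] mult.commute)
        moreover have "x * y * (z * Y * m) = x * (z * (Y * y) * m)" for x y z Y m :: real
          by (simp only: ac_simps)
        ultimately show ?thesis
          by (simp only:)
      qed
      finally show ?thesis .
    qed
    have M0: "M \<ge> 0"
      by (auto simp: M_def intro: Bochner_Integration.integral_nonneg)
    have "(\<integral>\<^sup>+y. R y \<partial>lebesgue) = ennreal (2 * B\<^sup>2) * emeasure lebesgue W + ennreal K * (\<Sum>k. \<integral>\<^sup>+y. ennreal (?t k y) \<partial>lebesgue)"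
    proof -
      have tm[measurable]: "(\<lambda>y. ennreal (?t k y)) \<in> borel_measurable lebesgue" for k
        by (intro measurable_compose[OF _ measurable_ennreal] borel_measurable_times borel_measurable_const J_measurable)
      have sm: "(\<lambda>y. \<Sum>k. ennreal (?t k y)) \<in> borel_measurable lebesgue"
        by (rule borel_measurable_suminf_order[OF tm])
      have "(\<integral>\<^sup>+y. R y \<partial>lebesgue) = (\<integral>\<^sup>+y. ennreal (2 * B\<^sup>2) * indicator W y \<partial>lebesgue)
          + (\<integral>\<^sup>+y. ennreal K * (\<Sum>k. ennreal (?t k y)) \<partial>lebesgue)"
        unfolding R_def
      proof (rule nn_integral_add)
        show "(\<lambda>y. ennreal (2 * B\<^sup>2) * indicator W y) \<in> borel_measurable lebesgue"
          by measurable
        show "(\<lambda>y. ennreal K * (\<Sum>k. ennreal (?t k y))) \<in> borel_measurable lebesgue"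
          by (intro borel_measurable_times_ennreal borel_measurable_const sm)
      qed
      also have "(\<integral>\<^sup>+y. ennreal (2 * B\<^sup>2) * indicator W y \<partial>lebesgue) = ennreal (2 * B\<^sup>2) * emeasure lebesgue W"
        by (rule nn_integral_cmult_indicator) measurable
      also have "(\<integral>\<^sup>+y. ennreal K * (\<Sum>k. ennreal (?t k y)) \<partial>lebesgue) = ennreal K * (\<integral>\<^sup>+y. (\<Sum>k. ennreal (?t k y)) \<partial>lebesgue)"
        by (rule nn_integral_cmult[OF sm])
      also have "(\<integral>\<^sup>+y. (\<Sum>k. ennreal (?t k y)) \<partial>lebesgue) = (\<Sum>k. \<integral>\<^sup>+y. ennreal (?t k y) \<partial>lebesgue)"
        by (rule nn_integral_suminf[OF tm])
      finally show ?thesis .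
    qed
    also have "(\<Sum>k. \<integral>\<^sup>+y. ennreal (?t k y) \<partial>lebesgue) = ennreal (\<Sum>k. s ^ k * (unit_ball_vol ?n * S ^ ?n * M))"
      unfolding t_int using s_bounds S_pos M0
      by (intro suminf_ennreal2 summable_mult2 summable_geometric) auto
    also have "ennreal (2 * B\<^sup>2) * emeasure lebesgue W + ennreal K * ennreal (\<Sum>k. s ^ k * (unit_ball_vol ?n * S ^ ?n * M)) < \<infinity>"
      using W(2) by (auto simp: fmeasurable_def ennreal_mult_less_top)
    finally show ?thesis .
  qed
  have [measurable]: "u \<in> borel_measurable (lebesgue_on U)"
    using u(1) by auto
  have "u \<in> borel_measurable (lebesgue_on W)"
    by (rule measurable_restrict_mono[OF _ W(1)]) simp
  then have m: "(\<lambda>y. indicator W y *\<^sub>R (u y)\<^sup>2) \<in> borel_measurable lebesgue"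
    by (subst borel_measurable_restrict_space_iff[symmetric]) auto
  have "integrable lebesgue (\<lambda>y. c0\<^sup>2 * (indicator W y *\<^sub>R (u y)\<^sup>2))"
  proof (rule integrableI_nonneg)
    have "(\<integral>\<^sup>+y. ennreal (c0\<^sup>2 * (indicator W y *\<^sub>R (u y)\<^sup>2)) \<partial>lebesgue) \<le> (\<integral>\<^sup>+y. R y \<partial>lebesgue)"
      by (rule nn_integral_mono_AE[OF uR])
    then show "(\<integral>\<^sup>+y. ennreal (c0\<^sup>2 * (indicator W y *\<^sub>R (u y)\<^sup>2)) \<partial>lebesgue) < \<infinity>"
      using Rint by (rule order_le_less_trans)
  qed (use m in \<open>auto simp: indicator_def\<close>)
  then show ?thesis
    using c0 by (simp add: set_integrable_def)
qed

end

text \<open>At a boundary point the cone opens in the direction \<open>e\<close> in which the domain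
  lies above the graph, narrow enough for the Lipschitz constant. At an interior point a small ball
  around 0 serves as the cone.\<close>

lemma lipschitz_domain_cone:
  fixes U :: "'a::euclidean_space set"
  assumes "lipschitz_domain U" "x0 \<in> closure U"
  obtains r c \<epsilon> where "r > 0" "\<epsilon> > 0"
    "\<And>y l z. y \<in> U \<inter> ball x0 r \<Longrightarrow> 0 < l \<Longrightarrow> l \<le> 1 \<Longrightarrow> z \<in> cball c \<epsilon> \<Longrightarrow> y + l *\<^sub>R z \<in> U"
proof (cases "x0 \<in> U")
  case True
  then obtain r where r: "r > 0" "ball x0 r \<subseteq> U"
    using assms(1) open_contains_ball unfolding lipschitz_domain_def by blast
  show thesis
  proof (rule that[of "r / 2" "r / 2" 0])
    fix y z :: 'a and l :: real assume *: "y \<in> U \<inter> ball x0 (r / 2)" "0 < l" "l \<le> 1" "z \<in> cball 0 (r / 2)"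
    have "norm (l *\<^sub>R z) \<le> 1 * (r / 2)"
      unfolding norm_scaleR using * by (intro mult_mono) auto
    then have "dist x0 (y + l *\<^sub>R z) < r"
      using * dist_triangle[of x0 "y + l *\<^sub>R z" y] by (simp add: dist_norm)
    then show "y + l *\<^sub>R z \<in> U"
      using r(2) by auto
  qed (use r in auto)
next
  case False
  then have "x0 \<in> frontier U"
    using assms unfolding lipschitz_domain_def frontier_def by (simp add: interior_open)
  then obtain r e g L where r: "r > 0" and e: "norm e = 1" and L: "L-lipschitz_on {y. y \<bullet> e = 0} g"
      and U: "U \<inter> ball x0 r = {y \<in> ball x0 r. g (y - (y \<bullet> e) *\<^sub>R e) < y \<bullet> e}"
  proof -
    from assms(1) \<open>x0 \<in> frontier U\<close> have "\<exists>r e g L. r > 0 \<and> norm e = 1 \<and> L-lipschitz_on {y. y \<bullet> e = 0} g \<and>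
        U \<inter> ball x0 r = {y \<in> ball x0 r. g (y - (y \<bullet> e) *\<^sub>R e) < y \<bullet> e}"
      unfolding lipschitz_domain_def by (elim conjE) (rule bspec)
    then show thesis
      by (elim exE conjE) (rule that)
  qed
  have L0: "L \<ge> 0"
    using L by (rule lipschitz_on_nonneg)
  have ee: "e \<bullet> e = 1"
    using e by (simp add: norm_eq_1)
  \<comment> \<open>The length satisfies r/2 + 2h < r, which keeps the cone in the coordinate ball.
    The width defined next satisfies 2 L \<epsilon> \<le> h - \<epsilon>: a perturbation of size
    \<epsilon> moves the projection by at most 2 \<epsilon> and the graph by 2 L \<epsilon>, while
    the height gains at least h - \<epsilon>.\<close>
  define h where "h = r / 6"
  define \<epsilon> where "\<epsilon> = h / (2 * L + 2)"
  have h: "h > 0"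
    using r by (simp add: h_def)
  have \<epsilon>: "\<epsilon> > 0" "\<epsilon> \<le> h" "(2 * L + 2) * \<epsilon> = h"
    using h L0 by (auto simp: \<epsilon>_def field_simps)
  show thesis
  proof (rule that[of "r / 2" \<epsilon> "h *\<^sub>R e"])
    fix y z :: 'a and l :: real assume *: "y \<in> U \<inter> ball x0 (r / 2)" "0 < l" "l \<le> 1" "z \<in> cball (h *\<^sub>R e) \<epsilon>"
    define d where "d = z - h *\<^sub>R e"
    have d: "norm d \<le> \<epsilon>"
      using * by (simp add: d_def dist_norm norm_minus_commute)
    have z: "z = h *\<^sub>R e + d"
      by (simp add: d_def)
    define P where "P x = x - (x \<bullet> e) *\<^sub>R e" for x
    have P0: "P x \<in> {y. y \<bullet> e = 0}" for x
      by (simp add: P_def inner_diff_left ee)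
    have norm_P: "norm (P x) \<le> 2 * norm x" for x
    proof -
      have "norm (P x) \<le> norm x + \<bar>x \<bullet> e\<bar>"
        using norm_triangle_ineq4[of x "(x \<bullet> e) *\<^sub>R e"] e by (simp add: P_def)
      also have "\<bar>x \<bullet> e\<bar> \<le> norm x"
        using Cauchy_Schwarz_ineq2[of x e] e by simp
      finally show ?thesis
        by simp
    qed
    have "norm z \<le> h + \<epsilon>"
      using norm_triangle_ineq[of "h *\<^sub>R e" d] d e h by (simp add: z)
    then have "norm (l *\<^sub>R z) \<le> 1 * (h + \<epsilon>)"
      unfolding norm_scaleR using * by (intro mult_mono) auto
    also have "\<dots> < r / 2"
      using \<epsilon> h by (simp add: h_def)
    finally have ball: "y + l *\<^sub>R z \<in> ball x0 r"
      using * dist_triangle[of x0 "y + l *\<^sub>R z" y] by (simp add: dist_norm)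
    have y: "g (P y) < y \<bullet> e"
      using * U subset_ball[of "r / 2" r x0] r by (auto simp: P_def)
    have "P (y + l *\<^sub>R z) - P y = l *\<^sub>R P d"
      by (simp add: P_def z inner_add_left inner_diff_left ee algebra_simps)
    then have "dist (g (P (y + l *\<^sub>R z))) (g (P y)) \<le> L * norm (l *\<^sub>R P d)"
      using lipschitz_onD[OF L P0 P0, of "y + l *\<^sub>R z" y] by (simp add: dist_norm)
    also have "norm (l *\<^sub>R P d) \<le> l * (2 * \<epsilon>)"
      using * norm_P[of d] d by (simp add: mult_left_mono)
    finally have "g (P (y + l *\<^sub>R z)) \<le> g (P y) + L * (l * (2 * \<epsilon>))"
      using L0 by (simp add: dist_real_def mult_left_mono abs_le_iff)
    moreover have "(y + l *\<^sub>R z) \<bullet> e \<ge> y \<bullet> e + l * (h - \<epsilon>)"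
    proof -
      have "\<bar>d \<bullet> e\<bar> \<le> \<epsilon>"
        using Cauchy_Schwarz_ineq2[of d e] e d by simp
      then have "l * (h - \<epsilon>) \<le> l * (h + d \<bullet> e)"
        using * by (intro mult_left_mono) auto
      then show ?thesis
        by (simp add: z inner_add_left ee)
    qed
    moreover have "L * (l * (2 * \<epsilon>)) \<le> l * (h - \<epsilon>)"
    proof -
      have "2 * L * \<epsilon> + 2 * \<epsilon> = h"
        using \<epsilon>(3) by (simp only: distrib_right)
      then have "2 * L * \<epsilon> \<le> h - \<epsilon>"
        using \<epsilon>(1) by linarith
      from mult_left_mono[OF this, of l] show ?thesis
        using * by (simp add: ac_simps)
    qed
    ultimately have "g (P (y + l *\<^sub>R z)) < (y + l *\<^sub>R z) \<bullet> e"
      using y by linarith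
    with ball have "y + l *\<^sub>R z \<in> U \<inter> ball x0 r"
      unfolding U by (simp add: P_def)
    then show "y + l *\<^sub>R z \<in> U"
      by blast
  qed (use r \<epsilon> in auto)
qed

text \<open>On a finite measure space constants are integrable, and x^r \<le> 1 + x^q for
  nonnegative x.\<close>

lemma integrable_powr_le:
  fixes f :: "'a \<Rightarrow> 'b::euclidean_space"
  assumes "finite_measure M" and [measurable]: "f \<in> borel_measurable M"
    and "integrable M (\<lambda>x. norm (f x) powr q)" and r: "0 < r" "r \<le> q"
  shows "integrable M (\<lambda>x. norm (f x) powr r)"
proof -
  interpret finite_measure M by fact
  have "norm (f x) powr r \<le> 1 + norm (f x) powr q" for x
  proof (cases "norm (f x) \<le> 1")
    case True
    then have "norm (f x) powr r \<le> 1 powr r"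
      using r by (intro powr_mono2) auto
    then show ?thesis
      by (simp add: add_increasing2)
  next
    case False
    then have "norm (f x) powr r \<le> norm (f x) powr q"
      using r by (intro powr_mono) auto
    then show ?thesis
      by simp
  qed
  then have "AE x in M. norm (norm (f x) powr r) \<le> norm (1 + norm (f x) powr q)"
    by (auto intro!: AE_I2)
  moreover have "integrable M (\<lambda>x. 1 + norm (f x) powr q)"
    using assms(3) by simp
  moreover have "(\<lambda>x. norm (f x) powr r) \<in> borel_measurable M"
    by measurable
  ultimately show ?thesis
    using Bochner_Integration.integrable_bound by blast
qed

lemma lipschitz_domain_open: "lipschitz_domain U \<Longrightarrow> open U"
  by (auto simp: lipschitz_domain_def)

lemma lmeasurable_bounded_open: "bounded U \<Longrightarrow> open U \<Longrightarrow> U \<in> lmeasurable"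
  by (rule lmeasurable_open)

text \<open>The condition on \<open>q\<close> says q > 2n/(n+2), that is, 2 lies strictly below the
  Sobolev exponent. For q \<ge> 2 finiteness of the measure suffices; otherwise compactness of the
  closure leaves finitely many neighbourhoods with a cone condition, and the estimate is applied to
  one component of \<open>v\<close> at a time.\<close>

theorem sobolev_embedding:
  fixes v :: "real^'n \<Rightarrow> real^'n"
  assumes U: "lipschitz_domain U" and v: "v \<in> elts (W_space U q)"
    and q: "q > 1" "2 * real CARD('n) / q < real CARD('n) + 2"
  shows "v \<in> elts (L_space U UNIV 2)"
proof -
  have Uo: "open U" and Ub: "bounded U"
    using U by (auto simp: lipschitz_domain_def)
  have Ul: "U \<in> lmeasurable"
    by (rule lmeasurable_bounded_open[OF Ub Uo])
  have Us: "U \<in> sets lebesgue"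
    using Ul by auto
  interpret fin: finite_measure "lebesgue_on U"
    by (rule finite_measure_lebesgue_on[OF Ul])
  obtain D where vL: "v \<in> elts (L_space U UNIV q)" and D: "D \<in> elts (L_space U UNIV q)" "weak_grad U v D"
    using v by (auto simp: W_space_def)
  have vm[measurable]: "v \<in> borel_measurable (lebesgue_on U)"
    using vL by (simp add: L_space_elts_iff)
  have v1: "integrable (lebesgue_on U) (\<lambda>x. norm (v x) powr 1)"
    by (rule integrable_powr_le[OF fin.finite_measure_axioms vm]) (use vL q in \<open>auto simp: L_space_elts_iff\<close>)
  show ?thesis
  proof (cases "q \<ge> 2")
    case True
    have "integrable (lebesgue_on U) (\<lambda>x. norm (v x) powr 2)"
      by (rule integrable_powr_le[OF fin.finite_measure_axioms vm])
        (use vL True in \<open>auto simp: L_space_elts_iff\<close>)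
    then show ?thesis
      by (simp add: L_space_elts_iff)
  next
    case False
    have local: "\<exists>r>0. \<forall>i. set_integrable lebesgue (U \<inter> ball x0 r) (\<lambda>x. (v x $ i)\<^sup>2)"
      if x0: "x0 \<in> closure U" for x0
    proof -
      obtain r c \<epsilon> where r: "r > 0" "\<epsilon> > 0"
        "\<And>y l z. y \<in> U \<inter> ball x0 r \<Longrightarrow> 0 < l \<Longrightarrow> l \<le> 1 \<Longrightarrow> z \<in> cball c \<epsilon> \<Longrightarrow> y + l *\<^sub>R z \<in> U"
        by (rule lipschitz_domain_cone[OF U x0]) (rule that; assumption)
      have "set_integrable lebesgue (U \<inter> ball x0 r) (\<lambda>x. (v x $ i)\<^sup>2)" for i
      proof -
        \<comment> \<open>The norm of the gradient, extended by 0 to the whole space, is a common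
          majorant of its entries.\<close>
        let ?f = "\<lambda>x. if x \<in> U then norm (D x) else 0"
        interpret sobolev_cone U "U \<inter> ball x0 r" "\<lambda>x. v x $ i" "\<lambda>j x. D x $ i $ j" ?f c \<epsilon> q
        proof
          show "U \<inter> ball x0 r \<in> lmeasurable"
            by (rule lmeasurable_bounded_open) (use Uo Ub in auto)
          show "integrable (lebesgue_on U) (\<lambda>x. v x $ i)"
            by (rule Bochner_Integration.integrable_bound[OF v1 measurable_compose[OF vm
                  borel_measurable_continuous_onI[OF linear_continuous_on[OF bounded_linear_vec_nth]]]])
              (auto simp: component_le_norm_cart)
          have "D \<in> borel_measurable (lebesgue_on U)"
            using D(1) by (simp add: L_space_elts_iff)
          then have "(\<lambda>x. norm (D x)) \<in> borel_measurable (lebesgue_on U)"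
            by measurable
          then show "?f \<in> borel_measurable lebesgue"
            by (rule borel_measurable_if_I[OF _ Us])
          have "integrable lebesgue (\<lambda>x. if x \<in> U then norm (D x) powr q else 0)"
            using D(1) by (subst Lebesgue_Measure.integrable_restrict_UNIV[OF Us]) (simp add: L_space_elts_iff)
          moreover have "(\<lambda>x. if x \<in> U then norm (D x) powr q else 0) = (\<lambda>x. ?f x powr q)"
            by auto
          ultimately show "integrable lebesgue (\<lambda>x. ?f x powr q)"
            by simp
          show "\<bar>D x $ i $ j\<bar> \<le> ?f x" if "x \<in> U" for x j
            using that order_trans[OF component_le_norm_cart[of "D x $ i" j] Finite_Cartesian_Product.norm_nth_le[of "D x" i]] by simp
          show "(LINT x|lebesgue_on U. v x $ i * frechet_derivative \<psi> (at x) (axis j 1)) =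
              - (LINT x|lebesgue_on U. D x $ i $ j * \<psi> x)" if "test_fun U \<psi>" for \<psi> j
            by (rule weak_grad_integral[OF D(2) that])
        qed (use Uo r q False D(2) in \<open>auto intro: weak_grad_locally_integrable\<close>)
        show ?thesis
          by (rule square_integrable)
      qed
      then show ?thesis
        using r(1) by blast
    qed
    then obtain r where r: "\<And>x0. x0 \<in> closure U \<Longrightarrow> r x0 > 0"
        "\<And>x0 i. x0 \<in> closure U \<Longrightarrow> set_integrable lebesgue (U \<inter> ball x0 (r x0)) (\<lambda>x. (v x $ i)\<^sup>2)"
      by metis
    have "compact (closure U)"
      using Ub by simp
    then obtain X where X: "X \<subseteq> closure U" "finite X" "closure U \<subseteq> (\<Union>x\<in>X. ball x (r x))"
      by (rule compactE_image[of _ "closure U" "\<lambda>x. ball x (r x)"]) (use r(1) in auto)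
    have UX: "(\<Union>x\<in>X. U \<inter> ball x (r x)) = U"
      using X(3) closure_subset[of U] by blast
    have "set_integrable lebesgue U (\<lambda>x. (v x $ i)\<^sup>2)" for i
    proof -
      have "set_integrable lebesgue (\<Union>x\<in>X. U \<inter> ball x (r x)) (\<lambda>x. (v x $ i)\<^sup>2)"
        by (rule set_integrable_UN[OF X(2)]) (use r(2) X(1) Us in auto)
      then show ?thesis
        by (simp only: UX)
    qed
    then have "integrable (lebesgue_on U) (\<lambda>x. (v x $ i)\<^sup>2)" for i
      using Us by (simp add: set_integrable_def integrable_restrict_space)
    then have "integrable (lebesgue_on U) (\<lambda>x. \<Sum>i\<in>UNIV. (v x $ i)\<^sup>2)"
      by auto
    moreover have "(\<Sum>i\<in>UNIV. (v x $ i)\<^sup>2) = norm (v x) powr 2" for x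
      by (simp add: norm_vec_def L2_set_def sum_nonneg)
    ultimately show ?thesis
      by (simp add: L_space_elts_iff)
  qed
qed

section \<open>Sobolev spaces and traces\<close>

text \<open>Translation invariance: the difference quotients of an integrable function have integral
  0, and here they converge dominatedly to the derivative.\<close>

lemma integral_directional_derivative_eq_0:
  fixes g :: "'a::euclidean_space \<Rightarrow> real"
  assumes g: "smooth g" "compact K" "\<And>x. x \<notin> K \<Longrightarrow> g x = 0"
  shows "(LINT x|lebesgue. frechet_derivative g (at x) v) = 0"
proof -
  let ?d = "\<lambda>x. frechet_derivative g (at x) v"
  have "test_fun UNIV g"
    using g by (auto simp: test_fun_def)
  then obtain K' where K': "compact K'" "\<And>x v. x \<notin> K' \<Longrightarrow> frechet_derivative g (at x) v = 0"
    using test_fun_supportE by metis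
  have dc: "continuous_on UNIV ?d"
    by (rule smooth_continuous_on[OF smooth_frechet_derivative[OF g(1)]])
  obtain B where B: "B > 0" "\<And>x. \<bar>?d x\<bar> \<le> B"
    using continuous_compact_support_bounded[OF dc K'(1)] K'(2) by metis
  obtain R where R: "\<And>x. x \<in> K \<Longrightarrow> norm x \<le> R"
    using compact_imp_bounded[OF g(2)] by (auto simp: bounded_iff)
  \<comment> \<open>Outside this ball both \<open>x\<close> and its translates by at most
    \<open>v\<close> miss the support, so the majorant may be supported here.\<close>
  let ?C = "cball (0::'a) (R + norm v)"
  have [measurable]: "g \<in> borel_measurable borel"
    by (rule borel_measurable_continuous_onI[OF smooth_continuous_on[OF g(1)]])
  have [measurable]: "?d \<in> borel_measurable borel"
    by (rule borel_measurable_continuous_onI[OF dc])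
  define h where "h n = inverse (real (Suc n))" for n
  have h: "0 < h n" "h n \<le> 1" for n
    by (auto simp: h_def inverse_le_1_iff)
  have h_lim: "h \<longlonglongrightarrow> 0"
    unfolding h_def by (rule LIMSEQ_inverse_real_of_nat)
  let ?q = "\<lambda>n x. (g (h n *\<^sub>R v + x) - g x) / h n"
  have "(\<lambda>n. LINT x|lborel. ?q n x) \<longlonglongrightarrow> (LINT x|lborel. ?d x)"
  proof (rule integral_dominated_convergence)
    have "integrable lborel (\<lambda>x. indicator ?C x *\<^sub>R B)"
      by (rule borel_integrable_compact) auto
    then show "integrable lborel (\<lambda>x. B * indicator ?C x)"
      by (simp add: mult.commute)
    have der: "((\<lambda>t. g (t *\<^sub>R v + x)) has_real_derivative frechet_derivative g (at (t *\<^sub>R v + x)) v) (at t)" for t x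
    proof -
      have "((\<lambda>t. t *\<^sub>R v + x) has_derivative (\<lambda>s. s *\<^sub>R v)) (at t)"
        by (auto intro!: derivative_eq_intros)
      from has_derivative_compose[OF this smooth_has_derivative[OF g(1)]]
      have "((\<lambda>t. g (t *\<^sub>R v + x)) has_derivative (\<lambda>s. frechet_derivative g (at (t *\<^sub>R v + x)) (s *\<^sub>R v))) (at t)" .
      also have "(\<lambda>s. frechet_derivative g (at (t *\<^sub>R v + x)) (s *\<^sub>R v)) = (*) (frechet_derivative g (at (t *\<^sub>R v + x)) v)"
        using linear_cmul[OF linear_frechet_derivative_smooth[OF g(1)]] by (simp add: fun_eq_iff mult.commute)
      finally show ?thesis
        by (simp only: has_field_derivative_def)
    qed
    show "AE x in lborel. (\<lambda>n. ?q n x) \<longlonglongrightarrow> ?d x"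
    proof (rule AE_I2)
      fix x
      have "((\<lambda>t. (g (t *\<^sub>R v + x) - g (0 *\<^sub>R v + x)) / (t - 0)) \<longlongrightarrow> frechet_derivative g (at (0 *\<^sub>R v + x)) v) (at 0)"
        using der[where t=0 and x=x] unfolding has_field_derivative_iff .
      then have "((\<lambda>t. (g (t *\<^sub>R v + x) - g x) / t) \<longlongrightarrow> ?d x) (at 0)"
        by simp
      moreover have "filterlim h (at 0) sequentially"
        using h(1) h_lim by (intro filterlim_atI) (auto simp: less_imp_neq[symmetric] intro!: always_eventually)
      ultimately show "(\<lambda>n. ?q n x) \<longlonglongrightarrow> ?d x"
        by (rule filterlim_compose)
    qed
    fix n
    show "AE x in lborel. norm (?q n x) \<le> B * indicator ?C x"
    proof (rule AE_I2)
      fix x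
      show "norm (?q n x) \<le> B * indicator ?C x"
      proof (cases "x \<in> ?C")
        case True
        have "norm (g (h n *\<^sub>R v + x) - g (0 *\<^sub>R v + x)) \<le> B * norm (h n - 0)"
          by (rule field_differentiable_bound[where S=UNIV and f="\<lambda>t. g (t *\<^sub>R v + x)"
                and f'="\<lambda>t. frechet_derivative g (at (t *\<^sub>R v + x)) v"])
            (use B der in auto)
        then show ?thesis
          using True h(1)[of n] by (simp add: abs_divide pos_divide_le_eq)
      next
        case False
        have "norm v * h n \<le> norm v"
          using h[of n] by (simp add: mult_left_le)
        moreover have "norm x \<le> norm (h n *\<^sub>R v + x) + norm v * h n"
          using norm_triangle_ineq4[of "h n *\<^sub>R v + x" "h n *\<^sub>R v"] h(1)[of n] by (simp add: mult.commute)
        moreover have "norm x > R + norm v"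
          using False by simp
        ultimately have "norm (h n *\<^sub>R v + x) > R" "norm x > R"
          using norm_ge_zero[of v] by linarith+
        then have "g (h n *\<^sub>R v + x) = 0" "g x = 0"
          using R g(3) by (meson not_le)+
        then show ?thesis
          using False by simp
      qed
    qed
  qed measurable
  moreover have "(LINT x|lborel. ?q n x) = 0" for n
  proof -
    have gi: "integrable lborel g"
    proof -
      have "integrable lborel (\<lambda>x. indicator K x *\<^sub>R g x)"
        by (rule borel_integrable_compact[OF g(2) smooth_continuous_on[OF g(1)]])
      moreover have "(\<lambda>x. indicator K x *\<^sub>R g x) = g"
        using g(3) by (auto simp: indicator_def fun_eq_iff)
      ultimately show ?thesis
        by simp
    qed
    have gi': "integrable lborel (\<lambda>x. g (h n *\<^sub>R v + x))"
      using gi by (subst (asm) lborel_distr_plus[of "h n *\<^sub>R v", symmetric], subst (asm) integrable_distr_eq) auto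
    have "(LINT x|lborel. g (h n *\<^sub>R v + x)) = (LINT x|distr lborel borel ((+) (h n *\<^sub>R v)). g x)"
      by (subst integral_distr) auto
    also have "\<dots> = (LINT x|lborel. g x)"
      by (simp only: lborel_distr_plus)
    finally show ?thesis
      using gi gi' by simp
  qed
  ultimately have "(\<lambda>n. 0) \<longlonglongrightarrow> (LINT x|lborel. ?d x)"
    by (simp only:)
  then have "(LINT x|lborel. ?d x) = 0"
    using LIMSEQ_unique[OF tendsto_const] by metis
  then show ?thesis
    by (subst integral_completion) simp_all
qed

section \<open>Smooth functions as weakly differentiable functions\<close>

lemma locally_integrable_continuous:
  fixes f :: "'a::euclidean_space \<Rightarrow> 'b::euclidean_space"
  assumes "continuous_on UNIV f"
  shows "locally_integrable U f"
  unfolding locally_integrable_def set_integrable_def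
proof (intro allI impI, elim conjE)
  fix K :: "'a set" assume K: "compact K"
  have [measurable]: "f \<in> borel_measurable borel" "K \<in> sets borel"
    by (rule borel_measurable_continuous_onI[OF assms], rule borel_closed[OF compact_imp_closed[OF K]])
  have "integrable lborel (\<lambda>x. indicator K x *\<^sub>R f x)"
    by (rule borel_integrable_compact[OF K continuous_on_subset[OF assms]]) simp
  then show "integrable lebesgue (\<lambda>x. indicator K x *\<^sub>R f x)"
    by (subst integrable_completion) simp_all
qed

definition jacobian :: "(real^'n \<Rightarrow> real^'n) \<Rightarrow> real^'n \<Rightarrow> real^'n^'n" where
  "jacobian w x = (\<chi> i j. frechet_derivative w (at x) (axis j 1) $ i)"

lemma continuous_on_jacobian:
  assumes "smooth w"
  shows "continuous_on S (jacobian w)"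
  unfolding jacobian_def
  by (intro continuous_on_vec_lambda continuous_on_component smooth_continuous_on smooth_frechet_derivative assms)

text \<open>Integration by parts: the product of a component of \<open>w\<close> with the test
  function has compact support, so its partial derivative integrates to 0.\<close>

lemma weak_grad_smooth:
  fixes w :: "real^'n \<Rightarrow> real^'n"
  assumes w: "smooth w" and U: "open U"
  shows "weak_grad U w (jacobian w)"
  unfolding weak_grad_def
proof (intro conjI allI impI)
  show "locally_integrable U w" "locally_integrable U (jacobian w)"
    by (intro locally_integrable_continuous smooth_continuous_on continuous_on_jacobian w)+
  fix \<psi> :: "real^'n \<Rightarrow> real" and i j :: 'n assume \<psi>: "test_fun U \<psi>"
  obtain K where K: "compact K" "K \<subseteq> U" "\<And>x. x \<notin> K \<Longrightarrow> \<psi> x = 0"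
      "\<And>x v. x \<notin> K \<Longrightarrow> frechet_derivative \<psi> (at x) v = 0"
    using test_fun_supportE[OF \<psi>] by metis
  have \<psi>s: "smooth \<psi>"
    using \<psi> by (simp add: test_fun_def)
  let ?e = "axis j (1::real)"
  have wi: "smooth (\<lambda>x. w x $ i)"
    by (rule smooth_compose_bounded_linear[OF bounded_linear_vec_nth w])
  have "((\<lambda>x. w x $ i * \<psi> x) has_derivative (\<lambda>h. w x $ i * frechet_derivative \<psi> (at x) h + frechet_derivative w (at x) h $ i * \<psi> x)) (at x)" for x
    by (rule has_derivative_mult[OF bounded_linear.has_derivative[OF bounded_linear_vec_nth smooth_has_derivative[OF w]]
          smooth_has_derivative[OF \<psi>s]])
  from frechet_derivative_at[OF this, symmetric]
  have fd: "frechet_derivative (\<lambda>x. w x $ i * \<psi> x) (at x) ?e = w x $ i * frechet_derivative \<psi> (at x) ?e + jacobian w x $ i $ j * \<psi> x" for x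
    by (simp add: jacobian_def)
  have Us: "U \<in> sets lebesgue"
    by (rule sets_lebesgue_open[OF U])
  have z: "w x $ i * frechet_derivative \<psi> (at x) ?e = 0" "jacobian w x $ i $ j * \<psi> x = 0" if "x \<notin> U" for x
    using that K(2-4) by auto
  let ?a = "\<lambda>x. w x $ i * frechet_derivative \<psi> (at x) ?e" and ?b = "\<lambda>x. jacobian w x $ i $ j * \<psi> x"
  have e1: "(LINT x|lebesgue_on U. ?a x) = (LINT x|lebesgue. ?a x)" "integrable (lebesgue_on U) ?a \<longleftrightarrow> integrable lebesgue ?a"
    by (rule integral_lebesgue_on_eq[OF Us], erule z, rule integrable_lebesgue_on_eq[OF Us], erule z)
  have e2: "(LINT x|lebesgue_on U. ?b x) = (LINT x|lebesgue. ?b x)" "integrable (lebesgue_on U) ?b \<longleftrightarrow> integrable lebesgue ?b"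
    by (rule integral_lebesgue_on_eq[OF Us], erule z, rule integrable_lebesgue_on_eq[OF Us], erule z)
  have i1: "integrable lebesgue ?a"
    by (rule iffD1[OF e1(2) locally_integrable_test_fun(2)[OF U
            locally_integrable_continuous[OF smooth_continuous_on[OF wi]] \<psi>]])
  have i2: "integrable lebesgue ?b"
    by (rule iffD1[OF e2(2) locally_integrable_test_fun(1)[OF U
            locally_integrable_continuous[OF continuous_on_component[OF continuous_on_component[OF continuous_on_jacobian[OF w]]]] \<psi>]])
  have "0 = (LINT x|lebesgue. w x $ i * frechet_derivative \<psi> (at x) ?e + jacobian w x $ i $ j * \<psi> x)"
    unfolding fd[symmetric]
    by (rule integral_directional_derivative_eq_0[symmetric, OF smooth_mult[OF wi \<psi>s] K(1)]) (simp add: K(3))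
  also have "\<dots> = (LINT x|lebesgue. w x $ i * frechet_derivative \<psi> (at x) ?e) + (LINT x|lebesgue. jacobian w x $ i $ j * \<psi> x)"
    by (rule Bochner_Integration.integral_add[OF i1 i2])
  finally show "(LINT x|lebesgue_on U. w x $ i * frechet_derivative \<psi> (at x) ?e) =
      - (LINT x|lebesgue_on U. jacobian w x $ i $ j * \<psi> x)"
    unfolding e1(1) e2(1) by simp
qed

lemma L_space_bounded_continuous:
  fixes f :: "'a::euclidean_space \<Rightarrow> 'b::euclidean_space"
  assumes U: "open U" "bounded U" and f: "continuous_on UNIV f" and q: "q > 0"
  shows "f \<in> elts (L_space U UNIV q)"
proof -
  have fm[measurable]: "f \<in> borel_measurable (lebesgue_on U)"
    by (rule measurable_restrict_space1[OF borel_measurable_lebesgue_continuous[OF f]])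
  interpret finite_measure "lebesgue_on U"
    by (rule finite_measure_lebesgue_on[OF lmeasurable_open[OF U(2,1)]])
  have "compact (f ` closure U)"
    using U f by (intro compact_continuous_image) (auto intro: continuous_on_subset)
  then obtain B where "\<forall>y\<in>f ` closure U. norm y \<le> B"
    using compact_imp_bounded[of "f ` closure U"] unfolding bounded_iff by auto
  then have B: "\<And>x. x \<in> closure U \<Longrightarrow> norm (f x) \<le> B"
    by blast
  have "integrable (lebesgue_on U) (\<lambda>x. norm (f x) powr q)"
  proof (rule integrable_const_bound[where B="B powr q"])
    show "AE x in lebesgue_on U. norm (norm (f x) powr q) \<le> B powr q"
      using B closure_subset[of U] q by (intro AE_I2) (auto intro!: powr_mono2)
  qed measurable
  then show ?thesis
    by (simp add: L_space_elts_iff)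
qed

lemma L_space_subset:
  fixes f :: "'a::euclidean_space \<Rightarrow> 'b::euclidean_space"
  assumes "f \<in> elts (L_space U S q)" "U' \<subseteq> U" "U \<in> sets lebesgue" "U' \<in> sets lebesgue"
  shows "f \<in> elts (L_space U' S q)"
proof -
  have "integrable lebesgue (\<lambda>x. indicator U x *\<^sub>R norm (f x) powr q)"
    using assms(1,3) by (simp add: L_space_elts_iff integrable_restrict_space)
  from integrable_mult_indicator[OF assms(4) this]
  have "integrable lebesgue (\<lambda>x. indicator U' x *\<^sub>R (indicator U x *\<^sub>R norm (f x) powr q))" .
  moreover have "(\<lambda>x. indicator U' x *\<^sub>R (indicator U x *\<^sub>R norm (f x) powr q)) = (\<lambda>x. indicator U' x *\<^sub>R norm (f x) powr q)"
    using assms(2) by (auto simp: indicator_def fun_eq_iff)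
  ultimately have "integrable (lebesgue_on U') (\<lambda>x. norm (f x) powr q)"
    using assms(4) by (simp add: integrable_restrict_space)
  moreover have "f \<in> borel_measurable (lebesgue_on U')"
    by (rule measurable_restrict_mono[OF _ assms(2)]) (use assms(1) in \<open>simp add: L_space_elts_iff\<close>)
  moreover have "AE x in lebesgue. x \<in> U \<longrightarrow> f x \<in> S"
    using assms(1,3) by (subst AE_restrict_space_iff[symmetric]) (auto simp: L_space_elts_iff)
  then have "AE x in lebesgue_on U'. f x \<in> S"
    using assms(2,4) by (subst AE_restrict_space_iff) auto
  ultimately show ?thesis
    by (simp add: L_space_elts_iff)
qed

section \<open>Sobolev spaces of representatives\<close>

lemma W_space_iff:
  "u \<in> elts (W_space U q) \<longleftrightarrow>
    u \<in> elts (L_space U UNIV q) \<and> (\<exists>D \<in> elts (L_space U UNIV q). weak_grad U u D)"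
  by (simp add: W_space_def)

lemma W_space_L: "u \<in> elts (W_space U q) \<Longrightarrow> u \<in> elts (L_space U UNIV q)"
  by (simp add: W_space_iff)

lemma W_space_weak_grad: "u \<in> elts (W_space U q) \<Longrightarrow> weak_grad U u (grad U u)"
  by (auto simp: W_space_iff intro: weak_grad_grad)

lemma W_space_grad_L:
  assumes "open U" "u \<in> elts (W_space U q)"
  shows "grad U u \<in> elts (L_space U UNIV q)"
proof -
  obtain D where D: "D \<in> elts (L_space U UNIV q)" "weak_grad U u D"
    using assms(2) by (auto simp: W_space_iff)
  have "AE x in lebesgue_on U. D x = grad U u x"
    by (rule weak_grad_unique[OF assms(1) D(2) weak_grad_grad[OF D(2)]])
  from L_space_AE_cong[OF this D(1) sets_lebesgue_open[OF assms(1)]] show ?thesis .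
qed

text \<open>\<open>grad\<close> is a choice among weak gradients and is thus linear only almost
  everywhere; every identity for gradients carries this exception.\<close>

lemma W_space_add_scaleR:
  assumes "open U" "u \<in> elts (W_space U q)" "v \<in> elts (W_space U q)" "q > 0"
  shows "u + c *\<^sub>R v \<in> elts (W_space U q)"
    and AE_grad_add_scaleR: "AE x in lebesgue_on U. grad U (u + c *\<^sub>R v) x = grad U u x + c *\<^sub>R grad U v x"
proof -
  have w: "weak_grad U (u + c *\<^sub>R v) (grad U u + c *\<^sub>R grad U v)"
    by (intro weak_grad_add weak_grad_scaleR W_space_weak_grad[OF assms(2)] W_space_weak_grad[OF assms(3)] assms(1))
  have "grad U u + c *\<^sub>R grad U v \<in> elts (L_space U UNIV q)"
    by (intro L_space_add L_space_scaleR W_space_grad_L assms subspace_UNIV)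
  moreover have "u + c *\<^sub>R v \<in> elts (L_space U UNIV q)"
    by (intro L_space_add L_space_scaleR W_space_L assms subspace_UNIV)
  ultimately show "u + c *\<^sub>R v \<in> elts (W_space U q)"
    using w by (auto simp: W_space_iff)
  show "AE x in lebesgue_on U. grad U (u + c *\<^sub>R v) x = grad U u x + c *\<^sub>R grad U v x"
    using AE_grad_eq[OF assms(1) w] by (simp add: scaleR_fun_def)
qed

lemma W_space_zero: "0 \<in> elts (W_space U q)"
proof -
  have "weak_grad U 0 0"
    by (auto simp: weak_grad_def zero_fun_def intro!: locally_integrable_continuous continuous_intros)
  then show ?thesis
    unfolding W_space_iff by (intro conjI bexI[of _ 0] L_space_zero subspace_UNIV)
qed

lemma
  assumes U: "open U" and q: "q > 0" and u: "u \<in> elts (W_space U q)" and v: "v \<in> elts (W_space U q)"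
  shows W_space_add: "u + v \<in> elts (W_space U q)"
  using W_space_add_scaleR(1)[OF U u v q, of 1] by simp

lemma AE_sym_grad_add_scaleR:
  assumes "open U" "u \<in> elts (W_space U q)" "v \<in> elts (W_space U q)" "q > 0"
  shows "AE x in lebesgue_on U. sym_grad U (u + c *\<^sub>R v) x = sym_grad U u x + c *\<^sub>R sym_grad U v x"
  using AE_grad_add_scaleR[OF assms, of c]
  by eventually_elim (simp add: sym_grad_def vec_eq_iff transpose_def algebra_simps)

lemma AE_grad_0: "open U \<Longrightarrow> AE x in lebesgue_on U. grad U 0 x = 0"
  using AE_grad_eq[of U 0 0]
  by (simp add: weak_grad_def zero_fun_def locally_integrable_continuous continuous_intros)

lemma AE_sym_grad_scaleR:
  assumes "open U" "u \<in> elts (W_space U q)" "q > 0"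
  shows "AE x in lebesgue_on U. sym_grad U (c *\<^sub>R u) x = c *\<^sub>R sym_grad U u x"
  using AE_sym_grad_add_scaleR[OF assms(1) W_space_zero assms(2,3), of c] AE_grad_0[OF assms(1)]
  by eventually_elim (simp add: sym_grad_def transpose_def vec_eq_iff)

lemma subspace_sym_matrices: "subspace (sym_matrices :: (real^'n^'n) set)"
  by (auto simp: subspace_def sym_matrices_def transpose_def vec_eq_iff)

lemma bounded_linear_transpose: "bounded_linear (transpose :: real^'n^'m \<Rightarrow> real^'m^'n)"
  by (auto simp: transpose_def vec_eq_iff intro!: linear_conv_bounded_linear[THEN iffD1] linearI)

lemma sym_grad_L:
  assumes U: "open U" and u: "u \<in> elts (W_space U q)" and q: "q > 0"
  shows "sym_grad U u \<in> elts (L_space U sym_matrices q)"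
proof -
  have g: "grad U u \<in> elts (L_space U UNIV q)"
    by (rule W_space_grad_L[OF U u])
  then have [measurable]: "grad U u \<in> borel_measurable (lebesgue_on U)"
    by (simp add: L_space_elts_iff)
  have [measurable]: "transpose \<in> borel_measurable (borel :: (real^'n^'n) measure)"
    by (rule borel_measurable_continuous_onI[OF linear_continuous_on[OF bounded_linear_transpose]])
  have norm_t: "norm (transpose A) = norm A" for A :: "real^'n^'n"
  proof -
    have "(\<Sum>i\<in>UNIV. \<Sum>j\<in>UNIV. (A $ j $ i)\<^sup>2) = (\<Sum>i\<in>UNIV. \<Sum>j\<in>UNIV. (A $ i $ j)\<^sup>2)"
      by (rule sum.swap)
    then show ?thesis
      by (simp add: norm_vec_def L2_set_def transpose_def sum_nonneg)
  qed
  have "(\<lambda>x. transpose (grad U u x)) \<in> elts (L_space U UNIV q)"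
    using g unfolding L_space_elts_iff norm_t by simp
  from L_space_scaleR[OF L_space_add[OF g this q subspace_UNIV] subspace_UNIV, of "1/2"]
  have "(\<lambda>x. (1/2) *\<^sub>R (grad U u x + transpose (grad U u x))) \<in> elts (L_space U UNIV q)"
    by (simp add: plus_fun_def scaleR_fun_def)
  moreover have "sym_grad U u x \<in> sym_matrices" for x
    by (simp add: sym_grad_def sym_matrices_def transpose_def vec_eq_iff add.commute)
  ultimately show ?thesis
    by (simp add: L_space_elts_iff sym_grad_def[abs_def])
qed

lemma snorm_W_space:
  "snorm (W_space U q) u = (snorm (L_space U UNIV q) u powr q + snorm (L_space U UNIV q) (sym_grad U u) powr q) powr (1 / q)"
  by (simp add: W_space_def)

lemma snorm_W_space_nonneg: "snorm (W_space U q) u \<ge> 0"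
  by (simp add: snorm_W_space)

text \<open>The last bound rests on 2 \<le> 2^q. Its constant is crude, but it serves to show that
  norms tend to 0 or vanish.\<close>

lemma
  assumes q: "q \<ge> 1"
  shows L_le_snorm_W: "snorm (L_space U UNIV q) u \<le> snorm (W_space U q) u"
    and sym_grad_le_snorm_W: "snorm (L_space U S q) (sym_grad U u) \<le> snorm (W_space U q) u"
    and snorm_W_le: "snorm (W_space U q) u \<le> 2 * (snorm (L_space U UNIV q) u + snorm (L_space U UNIV q) (sym_grad U u))"
proof -
  let ?a = "snorm (L_space U UNIV q) u" and ?b = "snorm (L_space U UNIV q) (sym_grad U u)"
  have ab: "?a \<ge> 0" "?b \<ge> 0"
    by (auto simp: L_space_nonneg)
  have pw: "(x powr q) powr (1 / q) = x" if "x \<ge> 0" for x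
    using that q by (simp add: powr_powr)
  have "(?a powr q) powr (1 / q) \<le> (?a powr q + ?b powr q) powr (1 / q)"
    using q by (intro powr_mono2) auto
  then show "?a \<le> snorm (W_space U q) u"
    by (simp only: pw[OF ab(1)] snorm_W_space)
  have "(?b powr q) powr (1 / q) \<le> (?a powr q + ?b powr q) powr (1 / q)"
    using q by (intro powr_mono2) auto
  then have "?b \<le> snorm (W_space U q) u"
    by (simp only: pw[OF ab(2)] snorm_W_space)
  then show "snorm (L_space U S q) (sym_grad U u) \<le> snorm (W_space U q) u"
    by (simp only: L_space_snorm_UNIV[of U S])
  have "?a powr q \<le> (?a + ?b) powr q" "?b powr q \<le> (?a + ?b) powr q"
    using ab q by (auto intro!: powr_mono2)
  moreover have "(?a + ?b) powr q + (?a + ?b) powr q \<le> (2 * (?a + ?b)) powr q"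
  proof -
    have "2 powr 1 \<le> 2 powr q"
      using q by (intro powr_mono) auto
    then show ?thesis
      using mult_right_mono[of 2 "2 powr q" "(?a + ?b) powr q"] by (simp only: powr_mult mult_2[symmetric]) simp
  qed
  ultimately have "(?a powr q + ?b powr q) powr (1 / q) \<le> ((2 * (?a + ?b)) powr q) powr (1 / q)"
    using q ab by (intro powr_mono2) auto
  moreover have "2 * (?a + ?b) \<ge> 0"
    using ab by simp
  ultimately show "snorm (W_space U q) u \<le> 2 * (?a + ?b)"
    by (simp only: snorm_W_space pw)
qed

lemma W_space_subset:
  assumes "open U" "open U'" "U' \<subseteq> U" "u \<in> elts (W_space U q)"
  shows "u \<in> elts (W_space U' q)"
proof -
  obtain D where D: "D \<in> elts (L_space U UNIV q)" "weak_grad U u D"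
    using assms(4) by (auto simp: W_space_iff)
  note sets = sets_lebesgue_open[OF assms(1)] sets_lebesgue_open[OF assms(2)]
  have "u \<in> elts (L_space U' UNIV q)" "D \<in> elts (L_space U' UNIV q)" "weak_grad U' u D"
    by (rule L_space_subset[OF W_space_L[OF assms(4)] assms(3) sets],
        rule L_space_subset[OF D(1) assms(3) sets], rule weak_grad_subset[OF assms(1-3) D(2)])
  then show ?thesis
    unfolding W_space_iff by (intro conjI bexI)
qed

section \<open>Traces\<close>

lemma sets_hausdorff_measure [measurable_cong]: "sets (hausdorff_measure s) = sets borel"
  unfolding hausdorff_measure_def by (subst sets_measure_of) (auto simp: sets.sigma_sets_eq[of borel, simplified])

lemma tendsto_0_le:
  fixes f g :: "nat \<Rightarrow> 'a::{linorder_topology, zero}"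
  assumes "\<And>n. 0 \<le> f n" "\<And>n. f n \<le> g n" "g \<longlonglongrightarrow> 0"
  shows "f \<longlonglongrightarrow> 0"
  by (rule tendsto_sandwich[of "\<lambda>_. 0" f sequentially g]) (use assms in auto)

text \<open>The approximating sequences are combined linearly. The two interior norms obey
  Minkowski; for the boundary integrals, which are nonnegative integrals in \<open>ennreal\<close>,
  the inequality (a+b)^q \<le> 2^q (a^q + b^q) is enough.\<close>

lemma has_trace_add_scaleR:
  fixes u v :: "real^'n \<Rightarrow> real^'n"
  assumes U: "open U" "bounded U" and q: "q \<ge> 1"
    and u: "u \<in> elts (W_space U q)" "has_trace U q u g"
    and v: "v \<in> elts (W_space U q)" "has_trace U q v h"
  shows "has_trace U q (u + c *\<^sub>R v) (\<lambda>x. g x + c *\<^sub>R h x)"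
proof -
  have gm[measurable]: "g \<in> borel_measurable borel" and hm[measurable]: "h \<in> borel_measurable borel"
    using u v by (auto simp: has_trace_def)
  let ?H = "hausdorff_measure (real CARD('n) - 1) :: (real^'n) measure"
  let ?L = "snorm (L_space U UNIV q)" and ?LL = "snorm (L_space U UNIV q) :: (real^'n \<Rightarrow> real^'n^'n) \<Rightarrow> real"
  let ?b = "\<lambda>w g. \<integral>\<^sup>+x\<in>frontier U. ennreal (norm (w x - g x :: real^'n) powr q) \<partial>?H"
  obtain w where w: "\<And>n. smooth (w n)" "(\<lambda>n. ?L (w n - u)) \<longlonglongrightarrow> 0"
      "(\<lambda>n. ?LL (grad U (w n) - grad U u)) \<longlonglongrightarrow> 0" "(\<lambda>n. ?b (w n) g) \<longlonglongrightarrow> 0"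
    using u(2) unfolding has_trace_def by blast
  obtain w' where w': "\<And>n. smooth (w' n)" "(\<lambda>n. ?L (w' n - v)) \<longlonglongrightarrow> 0"
      "(\<lambda>n. ?LL (grad U (w' n) - grad U v)) \<longlonglongrightarrow> 0" "(\<lambda>n. ?b (w' n) h) \<longlonglongrightarrow> 0"
    using v(2) unfolding has_trace_def by blast
  have q0: "q > 0"
    using q by simp
  \<comment> \<open>On a bounded set smooth functions lie in the Sobolev space through their
    Jacobians, so the almost everywhere linearity of \<open>grad\<close> covers the
    approximants.\<close>
  have sW: "k \<in> elts (W_space U q)" if "smooth k" for k
    unfolding W_space_iff
    using L_space_bounded_continuous[OF U smooth_continuous_on[OF that] q0]
      L_space_bounded_continuous[OF U continuous_on_jacobian[OF that] q0] weak_grad_smooth[OF that U(1)] by blast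
  define k where "k n = w n + c *\<^sub>R w' n" for n
  have ks: "smooth (k n)" for n
    using smooth_add[OF w(1)[of n] smooth_scaleR[OF w'(1)[of n], of c]]
    by (simp add: k_def plus_fun_def scaleR_fun_def)
  note sub = subspace_UNIV
  have L_le: "?L (k n - (u + c *\<^sub>R v)) \<le> ?L (w n - u) + \<bar>c\<bar> * ?L (w' n - v)" for n
  proof -
    have eq: "k n - (u + c *\<^sub>R v) = (w n - u) + c *\<^sub>R (w' n - v)"
      by (simp add: k_def scaleR_diff_right)
    have L: "w n - u \<in> elts (L_space U UNIV q)" "c *\<^sub>R (w' n - v) \<in> elts (L_space U UNIV q)"
      by (intro L_space_diff L_space_scaleR W_space_L sW w(1) w'(1) u(1) v(1) q0 sub)+
    show ?thesis
      using L_space_triangle[OF L q] unfolding eq L_space_snorm_scaleR[OF q0] .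
  qed
  have "(\<lambda>n. ?L (w n - u) + \<bar>c\<bar> * ?L (w' n - v)) \<longlonglongrightarrow> 0 + \<bar>c\<bar> * 0"
    by (intro tendsto_add tendsto_mult tendsto_const w(2) w'(2))
  then have 1: "(\<lambda>n. ?L (k n - (u + c *\<^sub>R v))) \<longlonglongrightarrow> 0"
    by (intro tendsto_0_le[OF L_space_nonneg L_le]) simp
  have LL_le: "?LL (grad U (k n) - grad U (u + c *\<^sub>R v)) \<le> ?LL (grad U (w n) - grad U u) + \<bar>c\<bar> * ?LL (grad U (w' n) - grad U v)" for n
  proof -
    let ?A = "(grad U (w n) - grad U u) + c *\<^sub>R (grad U (w' n) - grad U v)"
    have ae: "AE x in lebesgue_on U. ?A x = (grad U (k n) - grad U (u + c *\<^sub>R v)) x"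
      using AE_grad_add_scaleR[OF U(1) sW[OF w(1)[of n]] sW[OF w'(1)[of n]] q0, of c]
        AE_grad_add_scaleR[OF U(1) u(1) v(1) q0, of c]
      by eventually_elim (simp add: k_def scaleR_fun_def algebra_simps)
    have L: "grad U (w n) - grad U u \<in> elts (L_space U UNIV q)" "c *\<^sub>R (grad U (w' n) - grad U v) \<in> elts (L_space U UNIV q)"
      by (intro L_space_diff L_space_scaleR W_space_grad_L U sW w(1) w'(1) u(1) v(1) q0 sub)+
    have "?A \<in> borel_measurable (lebesgue_on U)"
      using L_space_add[OF L q0 sub] by (simp add: L_space_elts_iff)
    note eq = L_space_snorm_AE_cong[OF ae this sets_lebesgue_open[OF U(1)], of UNIV q, symmetric]
    show ?thesis
      using L_space_triangle[OF L q] unfolding eq L_space_snorm_scaleR[OF q0] .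
  qed
  have "(\<lambda>n. ?LL (grad U (w n) - grad U u) + \<bar>c\<bar> * ?LL (grad U (w' n) - grad U v)) \<longlonglongrightarrow> 0 + \<bar>c\<bar> * 0"
    by (intro tendsto_add tendsto_mult tendsto_const w(3) w'(3))
  then have 2: "(\<lambda>n. ?LL (grad U (k n) - grad U (u + c *\<^sub>R v))) \<longlonglongrightarrow> 0"
    by (intro tendsto_0_le[OF L_space_nonneg LL_le]) simp
  have le: "?b (k n) (\<lambda>x. g x + c *\<^sub>R h x) \<le> ennreal (2 powr q) * ?b (w n) g + ennreal (2 powr q * \<bar>c\<bar> powr q) * ?b (w' n) h" for n
  proof -
    have [measurable]: "w n \<in> borel_measurable borel" "w' n \<in> borel_measurable borel"
      by (auto intro: borel_measurable_continuous_onI smooth_continuous_on w(1) w'(1))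
    have [measurable]: "frontier U \<in> sets borel"
      by (intro borel_closed) simp
    have pw: "norm (k n x - (g x + c *\<^sub>R h x)) powr q \<le> 2 powr q * norm (w n x - g x) powr q
        + 2 powr q * \<bar>c\<bar> powr q * norm (w' n x - h x) powr q" for x
    proof -
      have eq: "k n x - (g x + c *\<^sub>R h x) = (w n x - g x) + c *\<^sub>R (w' n x - h x)"
        by (simp add: k_def scaleR_fun_def algebra_simps)
      have "norm (k n x - (g x + c *\<^sub>R h x)) \<le> norm (w n x - g x) + \<bar>c\<bar> * norm (w' n x - h x)"
        unfolding eq using norm_triangle_ineq[of "w n x - g x" "c *\<^sub>R (w' n x - h x)"] by simp
      then have "norm (k n x - (g x + c *\<^sub>R h x)) powr q \<le> (norm (w n x - g x) + \<bar>c\<bar> * norm (w' n x - h x)) powr q"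
        using q0 by (intro powr_mono2) auto
      also have "\<dots> \<le> 2 powr q * (norm (w n x - g x) powr q + (\<bar>c\<bar> * norm (w' n x - h x)) powr q)"
        by (intro powr_add_le q0) auto
      finally show ?thesis
        by (simp add: powr_mult algebra_simps)
    qed
    have "?b (k n) (\<lambda>x. g x + c *\<^sub>R h x) \<le> (\<integral>\<^sup>+x. ennreal (2 powr q) * (ennreal (norm (w n x - g x) powr q) * indicator (frontier U) x)
        + ennreal (2 powr q * \<bar>c\<bar> powr q) * (ennreal (norm (w' n x - h x) powr q) * indicator (frontier U) x) \<partial>?H)"
      using pw by (intro nn_integral_mono)
        (auto simp: indicator_def ennreal_mult'[symmetric] ennreal_plus[symmetric] simp del: ennreal_plus intro!: ennreal_leI)
    also have "\<dots> = ennreal (2 powr q) * ?b (w n) g + ennreal (2 powr q * \<bar>c\<bar> powr q) * ?b (w' n) h"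
      by (subst nn_integral_add) (auto simp: nn_integral_cmult)
    finally show ?thesis .
  qed
  have "(\<lambda>n. ennreal (2 powr q) * ?b (w n) g + ennreal (2 powr q * \<bar>c\<bar> powr q) * ?b (w' n) h)
      \<longlonglongrightarrow> ennreal (2 powr q) * 0 + ennreal (2 powr q * \<bar>c\<bar> powr q) * 0"
    by (intro tendsto_add tendsto_mult_ennreal tendsto_const w(4) w'(4)) auto
  then have 3: "(\<lambda>n. ?b (k n) (\<lambda>x. g x + c *\<^sub>R h x)) \<longlonglongrightarrow> 0"
    by (intro tendsto_0_le[OF _ le]) simp_all
  show ?thesis
    unfolding has_trace_def using ks 1 2 3 by (intro conjI exI[of _ k] allI) measurable
qed

lemma zero_trace_add_scaleR:
  fixes u v :: "real^'n \<Rightarrow> real^'n"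
  assumes U: "open U" "bounded U" and q: "q \<ge> 1"
    and u: "u \<in> elts (W_space U q)" "zero_trace U q D u"
    and v: "v \<in> elts (W_space U q)" "zero_trace U q D v"
  shows "zero_trace U q D (u + c *\<^sub>R v)"
proof -
  obtain g h where g: "has_trace U q u g" "AE x in hausdorff_measure (real CARD('n) - 1). x \<in> D \<inter> frontier U \<longrightarrow> g x = 0"
    and h: "has_trace U q v h" "AE x in hausdorff_measure (real CARD('n) - 1). x \<in> D \<inter> frontier U \<longrightarrow> h x = 0"
    using u(2) v(2) unfolding zero_trace_def by blast
  from g(2) h(2) have "AE x in hausdorff_measure (real CARD('n) - 1). x \<in> D \<inter> frontier U \<longrightarrow> g x + c *\<^sub>R h x = 0"
    by eventually_elim simp
  then show ?thesis
    unfolding zero_trace_def using has_trace_add_scaleR[OF U q u(1) g(1) v(1) h(1)] by blast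
qed

lemma zero_trace_0: "q > 0 \<Longrightarrow> zero_trace U q D (0 :: real^'n \<Rightarrow> real^'n)"
proof -
  assume q: "q > 0"
  have "smooth (0 :: real^'n \<Rightarrow> real^'n)"
    unfolding zero_fun_def by (rule smooth_const)
  moreover have "snorm (L_space U UNIV q) (0 :: real^'n \<Rightarrow> 'b::euclidean_space) = 0"
    using q by (simp add: snorm_L_space)
  ultimately have "has_trace U q (0 :: real^'n \<Rightarrow> real^'n) (\<lambda>x. 0)"
    unfolding has_trace_def using q by (intro conjI exI[of _ "\<lambda>n. 0"] allI) (auto simp: snorm_L_space)
  then show ?thesis
    unfolding zero_trace_def by (intro exI[of _ "\<lambda>x. 0"]) auto
qed

lemma W_D_subset_W: "u \<in> W_D U1 U2 D U q \<Longrightarrow> u \<in> elts (W_space U q)"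
  by (simp add: W_D_def)

lemma W_D_0: "q > 0 \<Longrightarrow> 0 \<in> W_D U1 U2 D U q"
  by (simp add: W_D_def W_space_zero zero_trace_0)

lemma W_D_add_scaleR:
  assumes "open U" "open U1" "bounded U1" "U1 \<subseteq> U" "open U2" "bounded U2" "U2 \<subseteq> U" "q \<ge> 1"
    and "u \<in> W_D U1 U2 D U q" "v \<in> W_D U1 U2 D U q"
  shows "u + c *\<^sub>R v \<in> W_D U1 U2 D U q"
  using assms W_space_subset[OF assms(1,2,4)] W_space_subset[OF assms(1,5,7)]
  by (auto simp: W_D_def intro!: W_space_add_scaleR(1) zero_trace_add_scaleR)

lemma W_D_mono:
  assumes "open U" "open U'" "U' \<subseteq> U" "u \<in> W_D U1 U2 D U q"
  shows "u \<in> W_D U1 U2 D U' q"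
  using assms W_space_subset[OF assms(1-3)] by (auto simp: W_D_def)

section \<open>Weak time derivatives\<close>

lemma smooth_step:
  obtains P :: "real \<Rightarrow> real" where "smooth P" "\<And>x. (P has_real_derivative bump 0 1 x) (at x)"
    "\<And>x. x \<le> -1 \<Longrightarrow> P x = 0" "\<And>x. x \<ge> 1 \<Longrightarrow> P x = (LINT z|lborel. bump (0::real) 1 z)"
    "\<And>x. 0 \<le> P x" "\<And>x. P x \<le> (LINT z|lborel. bump (0::real) 1 z)"
proof -
  let ?b = "bump (0::real) 1" and ?c = "LINT z|lborel. bump (0::real) 1 z"
  have cont: "continuous_on UNIV ?b"
    by (rule continuous_on_bump)
  have isC: "isCont ?b x" for x
    using cont by (simp add: continuous_on_eq_continuous_at)
  obtain P0 where "\<And>x. (P0 has_vector_derivative ?b x) (at x)"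
    using einterval_antiderivative[of "-\<infinity>" "\<infinity>" ?b] isC by auto
  then have P0: "(P0 has_real_derivative ?b x) (at x)" for x
    by (simp add: has_real_derivative_iff_has_vector_derivative)
  define P where "P x = P0 x - P0 (-1)" for x
  have P: "(P has_real_derivative ?b x) (at x)" for x
    unfolding P_def using DERIV_diff[OF P0[of x] DERIV_const[of "P0 (-1)"]] by simp
  have mono: "P x \<le> P y" if "x \<le> y" for x y
    by (rule DERIV_nonneg_imp_nondecreasing[OF that]) (use P bump_nonneg in blast)
  have out: "?b x = 0" if "\<bar>x\<bar> \<ge> 1" for x
    using that by (intro bump_eq_0) auto
  have nonpos: "\<exists>y. (P has_real_derivative y) (at x) \<and> y \<le> 0" if "\<bar>x\<bar> \<ge> 1" for x
    using P[of x] out[OF that] by (intro exI[of _ "?b x"]) simp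
  have left: "P x = 0" if "x \<le> -1" for x
  proof -
    have "P (-1) \<le> P x"
      by (rule DERIV_nonpos_imp_nonincreasing[OF that]) (rule nonpos, auto)
    then show ?thesis
      using mono[OF that] by (simp add: P_def)
  qed
  have FTC: "(LINT x|lborel. ?b x * indicator {-1..1} x) = P 1 - P (-1)"
    by (rule integral_FTC_Icc_real) (use P isC in auto)
  have "(\<lambda>x. ?b x * indicator {-1..1} x) = ?b"
  proof
    fix x
    show "?b x * indicator {-1..1} x = ?b x"
      using out[of x] by (cases "\<bar>x\<bar> \<ge> 1") (simp, auto simp: indicator_def)
  qed
  then have P1: "P 1 = ?c"
    using FTC left[of "-1"] by simp
  have right: "P x = ?c" if "x \<ge> 1" for x
  proof -
    have "P x \<le> P 1"
      by (rule DERIV_nonpos_imp_nonincreasing[OF that]) (rule nonpos, auto)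
    then show ?thesis
      using mono[OF that] P1 by simp
  qed
  show thesis
  proof (rule that)
    show "smooth P"
      by (rule smooth_antiderivative[OF P smooth_bump])
    show "0 \<le> P x" for x
      using left[of "min x (-1)"] mono[of "min x (-1)" x] by simp
    show "P x \<le> ?c" for x
      using right[of "max x 1"] mono[of x "max x 1"] by simp
    show "(P has_real_derivative ?b x) (at x)" for x
      by (rule P)
    show "x \<le> -1 \<Longrightarrow> P x = 0" "x \<ge> 1 \<Longrightarrow> P x = ?c" for x
      by (rule left, assumption, rule right)
  qed
qed

text \<open>Difference of two rescaled smooth steps, divided by the height of a step: one rises
  before \<open>a\<close>, the other takes effect after \<open>b\<close>.\<close>

lemma cutoff_exists:
  fixes T a b :: real
  assumes "0 < a" "a < b" "b < T"
  obtains \<eta> where "test_fun {0<..<T} \<eta>" "\<And>x. a \<le> x \<Longrightarrow> x \<le> b \<Longrightarrow> \<eta> x = 1"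
proof -
  obtain P where "smooth P" "\<And>x. (P has_real_derivative bump 0 1 x) (at x)"
    "\<And>x. x \<le> -1 \<Longrightarrow> P x = 0" "\<And>x. x \<ge> 1 \<Longrightarrow> P x = (LINT z|lborel. bump (0::real) 1 z)"
    "\<And>x. 0 \<le> P x" "\<And>x. P x \<le> (LINT z|lborel. bump (0::real) 1 z)"
    using smooth_step by metis
  note P = this(1,3,4)
  let ?c = "LINT z|lborel. bump (0::real) 1 z"
  have c: "?c > 0"
    by (rule bump_integral_pos) simp
  \<comment> \<open>The two ramps have width 2r and centres a - r and b + r; 4r \<le> a and 4r \<le>
    T - b keep both inside the interval.\<close>
  define r where "r = min a (T - b) / 4"
  have r: "r > 0" "2 * r < a" "b + 2 * r < T"
  proof -
    have "4 * r > 0" "4 * r \<le> a" "4 * r \<le> T - b"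
      using assms by (simp_all add: r_def)
    then show "r > 0" "2 * r < a" "b + 2 * r < T"
      by simp_all
  qed
  define \<eta> where "\<eta> x = (1 / ?c) * (P ((1 / r) *\<^sub>R (x - (a - r))) - P ((1 / r) *\<^sub>R (x - (b + r))))" for x
  have "smooth \<eta>"
    unfolding \<eta>_def by (intro smooth_cmult smooth_diff smooth_affine P(1))
  moreover have "\<eta> x = 0" if "x \<notin> {a - 2 * r..b + 2 * r}" for x
  proof (cases "x < a - 2 * r")
    case True
    then have "(1 / r) *\<^sub>R (x - (a - r)) \<le> -1" "(1 / r) *\<^sub>R (x - (b + r)) \<le> -1"
      using r assms by (auto simp: field_simps)
    then show ?thesis
      unfolding \<eta>_def by (simp only: P(2)) simp
  next
    case False
    then have "(1 / r) *\<^sub>R (x - (a - r)) \<ge> 1" "(1 / r) *\<^sub>R (x - (b + r)) \<ge> 1"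
      using r assms that by (auto simp: field_simps)
    then show ?thesis
      unfolding \<eta>_def by (simp only: P(3)) simp
  qed
  moreover have "{a - 2 * r..b + 2 * r} \<subseteq> {0<..<T}"
    using r by auto
  ultimately have "test_fun {0<..<T} \<eta>"
    unfolding test_fun_def using compact_Icc by blast
  moreover have "\<eta> x = 1" if "a \<le> x" "x \<le> b" for x
  proof -
    have "(1 / r) *\<^sub>R (x - (a - r)) \<ge> 1" "(1 / r) *\<^sub>R (x - (b + r)) \<le> -1"
      using r that by (auto simp: field_simps)
    then show ?thesis
      unfolding \<eta>_def using c by (simp only: P(2,3)) simp
  qed
  ultimately show thesis
    by (rule that)
qed

lemma lebesgue_point_continuous:
  fixes f :: "'a::euclidean_space \<Rightarrow> real"
  assumes f: "isCont f x" and int: "set_integrable lebesgue (ball x R) f" and R: "R > 0"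
  shows "lebesgue_point f x"
  unfolding lebesgue_point_def
proof (rule tendstoI)
  let ?u = "unit_ball_vol (real DIM('a))"
  fix e :: real assume e: "e > 0"
  have u: "?u > 0"
    by simp
  define e' where "e' = e / (2 * ?u)"
  have e': "e' > 0" "e' * ?u < e"
    using e u by (auto simp: e'_def)
  obtain d where d: "d > 0" "\<And>y. dist y x < d \<Longrightarrow> dist (f y) (f x) < e'"
    using f e'(1) unfolding continuous_at_eps_delta by blast
  have "\<forall>\<^sub>F r in at_right 0. 0 < r \<and> r < min d R"
    using d(1) R by (auto simp: eventually_at_right_field intro!: exI[of _ "min d R"])
  then show "\<forall>\<^sub>F r in at_right 0. dist ((LINT y:ball x r|lebesgue. \<bar>f y - f x\<bar>) / r ^ DIM('a)) 0 < e"
  proof eventually_elim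
    case (elim r)
    have fi: "set_integrable lebesgue (ball x r) f"
      by (rule set_integrable_subset[OF int]) (use elim in auto)
    have ci: "set_integrable lebesgue (ball x r) (\<lambda>_. k)" for k :: real
      unfolding set_integrable_def using emeasure_lborel_ball_finite[of x r]
      by (intro integrable_scaleR_left integrable_real_indicator) auto
    have "(LINT y:ball x r|lebesgue. \<bar>f y - f x\<bar>) \<le> (LINT y:ball x r|lebesgue. e')"
      by (rule set_integral_mono[OF set_integrable_abs[OF set_integral_diff(1)[OF fi ci]] ci])
        (use d(2) elim in \<open>auto simp: dist_commute dist_real_def less_imp_le\<close>)
    also have "\<dots> = e' * (?u * r ^ DIM('a))"
      using elim by (simp add: set_lebesgue_integral_def content_ball)
    finally have "(LINT y:ball x r|lebesgue. \<bar>f y - f x\<bar>) / r ^ DIM('a) \<le> e' * ?u"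
      using elim by (simp add: divide_le_eq mult.assoc)
    moreover have "(LINT y:ball x r|lebesgue. \<bar>f y - f x\<bar>) \<ge> 0"
      by (simp add: set_lebesgue_integral_def)
    ultimately show ?case
      using e'(2) elim by simp
  qed
qed

text \<open>The test functions are differences of smooth steps of width proportional to
  \<open>h n\<close> at \<open>s\<close> and \<open>t\<close>. Their derivatives concentrate at
  these two points, where continuity of \<open>F\<close> gives its exact values, while the functions
  themselves converge to a multiple of the indicator of the interval. Hence the identity for every
  pair \<open>s\<close>, \<open>t\<close> and not merely for almost every one.\<close>

lemma du_Bois_Reymond:
  fixes F b :: "real \<Rightarrow> real"
  assumes F: "continuous_on {0<..<T} F"
    and int: "\<And>\<eta>. test_fun {0<..<T} \<eta> \<Longrightarrow> integrable (lebesgue_on {0<..<T}) (\<lambda>t. \<eta> t * b t)"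
    and eq: "\<And>\<eta>. test_fun {0<..<T} \<eta> \<Longrightarrow>
      (LINT t|lebesgue_on {0<..<T}. deriv \<eta> t * F t) = - (LINT t|lebesgue_on {0<..<T}. \<eta> t * b t)"
    and st: "0 < s" "s < t" "t < T"
  shows "set_integrable lebesgue {s<..t} b" and "F t - F s = (LINT r:{s<..t}|lebesgue. b r)"
proof -
  obtain P where P: "smooth P" "\<And>x. (P has_real_derivative bump 0 1 x) (at x)"
    "\<And>x. x \<le> -1 \<Longrightarrow> P x = 0" "\<And>x. x \<ge> 1 \<Longrightarrow> P x = (LINT z|lborel. bump (0::real) 1 z)"
    "\<And>x. 0 \<le> P x" "\<And>x. P x \<le> (LINT z|lborel. bump (0::real) 1 z)"
    using smooth_step by metis
  let ?c = "LINT z|lborel. bump (0::real) 1 z"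
  have c: "?c > 0"
    by (rule bump_integral_pos) simp
  define R where "R = min (min s (T - t)) (t - s) / 4"
  have R: "R > 0" "2 * R < s" "t + 2 * R < T" "s + 2 * R < t"
  proof -
    let ?m = "min (min s (T - t)) (t - s)"
    have "?m > 0" "?m \<le> s" "?m \<le> T - t" "?m \<le> t - s"
      using st by simp_all
    then show "R > 0" "2 * R < s" "t + 2 * R < T" "s + 2 * R < t"
      unfolding R_def by linarith+
  qed
  have IU: "{0<..<T} \<in> sets lebesgue"
    by simp
  \<comment> \<open>Only products of \<open>b\<close> with test functions are known to be
    integrable; a cutoff equal to 1 around [s, t] provides both the local integrability of
    \<open>b\<close> and the majorant used below.\<close>
  obtain \<eta>0 where \<eta>0: "test_fun {0<..<T} \<eta>0" "\<And>x. s - R \<le> x \<Longrightarrow> x \<le> t + R \<Longrightarrow> \<eta>0 x = 1"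
    using cutoff_exists[of "s - R" "t + R" T] R st by auto
  have b0: "integrable lebesgue (\<lambda>x. \<eta>0 x * b x)"
  proof -
    have z: "\<eta>0 x * b x = 0" if "x \<notin> {0<..<T}" for x
      using \<eta>0(1) that unfolding test_fun_def by auto
    have "integrable (lebesgue_on {0<..<T}) (\<lambda>x. \<eta>0 x * b x) \<longleftrightarrow> integrable lebesgue (\<lambda>x. \<eta>0 x * b x)"
      by (rule integrable_lebesgue_on_eq[OF IU]) (rule z)
    then show ?thesis
      using int[OF \<eta>0(1)] by blast
  qed
  have bi: "set_integrable lebesgue A b" if "A \<in> sets lebesgue" "A \<subseteq> {s - R..t + R}" for A
  proof -
    have "integrable lebesgue (\<lambda>x. indicator A x *\<^sub>R (\<eta>0 x * b x))"
      by (rule integrable_mult_indicator[OF that(1) b0])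
    moreover have "(\<lambda>x. indicator A x *\<^sub>R (\<eta>0 x * b x)) = (\<lambda>x. indicator A x *\<^sub>R b x)"
      using that(2) \<eta>0(2) by (auto simp: indicator_def fun_eq_iff subset_iff)
    ultimately show ?thesis
      by (simp only: set_integrable_def)
  qed
  show bst: "set_integrable lebesgue {s<..t} b"
    by (rule bi) (use R in auto)
  define h where "h n = R * inverse (real (Suc n))" for n
  have h: "0 < h n" "h n \<le> R" for n
    using R(1) by (auto simp: h_def inverse_le_1_iff mult_left_le)
  have h_lim: "h \<longlonglongrightarrow> 0"
    unfolding h_def using tendsto_mult[OF tendsto_const LIMSEQ_inverse_real_of_nat, of R] by simp
  have h_right: "filterlim h (at_right 0) sequentially"
    using h_lim h(1) by (intro filterlim_at_withinI) auto
  define \<eta> where "\<eta> n x = P ((1 / h n) *\<^sub>R (x - s)) - P ((1 / h n) *\<^sub>R (x - t))" for n x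
  have \<eta>s: "smooth (\<eta> n)" for n
    unfolding \<eta>_def by (intro smooth_diff smooth_affine P(1))
  have \<eta>_out: "\<eta> n x = 0" if "x \<notin> {s - h n..t + h n}" for n x
  proof (cases "x < s - h n")
    case True
    then have "(1 / h n) *\<^sub>R (x - s) \<le> -1" "(1 / h n) *\<^sub>R (x - t) \<le> -1"
      using h[of n] st by (auto simp: field_simps)
    then show ?thesis
      unfolding \<eta>_def by (simp only: P(3) diff_self)
  next
    case False
    then have "(1 / h n) *\<^sub>R (x - s) \<ge> 1" "(1 / h n) *\<^sub>R (x - t) \<ge> 1"
      using h[of n] st that by (auto simp: field_simps)
    then show ?thesis
      unfolding \<eta>_def by (simp only: P(4) diff_self)
  qed
  have \<eta>_in: "\<eta> n x = ?c" if "s + h n \<le> x" "x \<le> t - h n" for n x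
  proof -
    have "(1 / h n) *\<^sub>R (x - s) \<ge> 1" "(1 / h n) *\<^sub>R (x - t) \<le> -1"
      using h[of n] that by (auto simp: field_simps)
    then show ?thesis
      unfolding \<eta>_def by (simp only: P(3,4) diff_zero)
  qed
  have \<eta>_sub: "{s - h n..t + h n} \<subseteq> {0<..<T}" for n
    using h[of n] R by auto
  have \<eta>_test: "test_fun {0<..<T} (\<eta> n)" for n
    unfolding test_fun_def using \<eta>s \<eta>_out \<eta>_sub by (intro conjI exI[of _ "{s - h n..t + h n}"]) auto
  have \<eta>_bd: "\<bar>\<eta> n x\<bar> \<le> ?c" for n x
    using P(5,6)[of "(1 / h n) *\<^sub>R (x - s)"] P(5,6)[of "(1 / h n) *\<^sub>R (x - t)"] unfolding \<eta>_def by linarith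
  have \<eta>_deriv: "deriv (\<eta> n) x = (bump 0 1 ((1 / h n) *\<^sub>R (x - s)) - bump 0 1 ((1 / h n) *\<^sub>R (x - t))) / h n" for n x
  proof (rule DERIV_imp_deriv)
    have "((\<lambda>x. P ((1 / h n) *\<^sub>R (x - a))) has_real_derivative bump 0 1 ((1 / h n) *\<^sub>R (x - a)) * (1 / h n)) (at x)" for a
      by (rule DERIV_chain2[OF P(2)]) (use h(1)[of n] in \<open>auto intro!: derivative_eq_intros\<close>)
    from DERIV_diff[OF this[of s] this[of t]]
    show "(\<eta> n has_real_derivative (bump 0 1 ((1 / h n) *\<^sub>R (x - s)) - bump 0 1 ((1 / h n) *\<^sub>R (x - t))) / h n) (at x)"
      unfolding \<eta>_def by (simp add: diff_divide_distrib)
  qed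
  have lim_F: "(\<lambda>n. (LINT x|lebesgue. F x * bump 0 1 ((1 / h n) *\<^sub>R (x - a))) / h n) \<longlonglongrightarrow> F a * ?c"
    and F_int: "integrable lebesgue (\<lambda>x. F x * bump 0 1 ((1 / h n) *\<^sub>R (x - a)))"
    if a: "a = s \<or> a = t" for a n
  proof -
    have sub: "cball a R \<subseteq> {0<..<T}"
      using a R st by (auto simp: dist_real_def)
    have Fi: "set_integrable lebesgue (cball a R) F"
    proof -
      have "integrable lborel (\<lambda>x. indicator (cball a R) x *\<^sub>R F x)"
        by (rule borel_integrable_compact[OF compact_cball continuous_on_subset[OF F sub]])
      then show ?thesis
        unfolding set_integrable_def by (subst integrable_completion) auto
    qed
    have "a \<in> {0<..<T}"
      using a st by auto
    then have "isCont F a"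
      using F by (simp add: continuous_on_eq_continuous_at)
    then have "lebesgue_point F a"
      by (rule lebesgue_point_continuous[OF _ set_integrable_subset[OF Fi] R(1)]) auto
    from filterlim_compose[OF mollifier_tendsto[OF Fi R(1) this, of 1 0] h_right]
    show "(\<lambda>n. (LINT x|lebesgue. F x * bump 0 1 ((1 / h n) *\<^sub>R (x - a))) / h n) \<longlonglongrightarrow> F a * ?c"
      by simp
    show "integrable lebesgue (\<lambda>x. F x * bump 0 1 ((1 / h n) *\<^sub>R (x - a)))"
    proof (rule set_integrable_mult_bounded[OF Fi])
      show "(\<lambda>x. bump 0 1 ((1 / h n) *\<^sub>R (x - a))) \<in> borel_measurable lebesgue"
        by (rule borel_measurable_lebesgue_continuous[OF smooth_continuous_on[OF smooth_affine[OF smooth_bump]]])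
      show "\<bar>bump 0 1 ((1 / h n) *\<^sub>R (x - a))\<bar> \<le> 1" for x
        by (simp only: abs_of_nonneg[OF bump_nonneg] bump_le_1)
      show "bump 0 1 ((1 / h n) *\<^sub>R (x - a)) = 0" if "x \<notin> cball a R" for x
      proof (rule bump_eq_0)
        have "\<bar>x - a\<bar> > h n"
          using that h(2)[of n] by (simp add: dist_real_def abs_minus_commute)
        then have "\<bar>(1 / h n) *\<^sub>R (x - a)\<bar> \<ge> 1"
          using h(1)[of n] by (simp add: abs_mult field_simps)
        then show "(1 / h n) *\<^sub>R (x - a) \<notin> ball 0 1"
          by (simp only: mem_ball dist_0_norm real_norm_def not_less)
      qed simp
    qed
  qed
  have lhs: "(LINT x|lebesgue_on {0<..<T}. deriv (\<eta> n) x * F x) =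
      (LINT x|lebesgue. F x * bump 0 1 ((1 / h n) *\<^sub>R (x - s))) / h n
      - (LINT x|lebesgue. F x * bump 0 1 ((1 / h n) *\<^sub>R (x - t))) / h n" for n
  proof -
    have z: "deriv (\<eta> n) x * F x = 0" if "x \<notin> {0<..<T}" for x
    proof -
      have "bump 0 1 ((1 / h n) *\<^sub>R (x - a)) = 0" if a: "a = s \<or> a = t" for a
      proof (rule bump_eq_0)
        have "\<bar>x - a\<bar> > h n"
          using a \<open>x \<notin> {0<..<T}\<close> h(2)[of n] R st by auto
        then have "\<bar>(1 / h n) *\<^sub>R (x - a)\<bar> \<ge> 1"
          using h(1)[of n] by (simp add: abs_mult field_simps)
        then show "(1 / h n) *\<^sub>R (x - a) \<notin> ball 0 1"
          by (simp only: mem_ball dist_0_norm real_norm_def not_less)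
      qed simp
      then show ?thesis
        unfolding \<eta>_deriv by simp
    qed
    have "(LINT x|lebesgue_on {0<..<T}. deriv (\<eta> n) x * F x) = (LINT x|lebesgue. deriv (\<eta> n) x * F x)"
      by (rule integral_lebesgue_on_eq[OF IU]) (rule z)
    also have "\<dots> = (LINT x|lebesgue. (F x * bump 0 1 ((1 / h n) *\<^sub>R (x - s)) - F x * bump 0 1 ((1 / h n) *\<^sub>R (x - t))) / h n)"
      unfolding \<eta>_deriv by (intro Bochner_Integration.integral_cong) (auto simp: algebra_simps)
    also have "\<dots> = ((LINT x|lebesgue. F x * bump 0 1 ((1 / h n) *\<^sub>R (x - s)))
        - (LINT x|lebesgue. F x * bump 0 1 ((1 / h n) *\<^sub>R (x - t)))) / h n"
      by (simp only: integral_divide_zero Bochner_Integration.integral_diff[OF F_int[OF disjI1[OF refl]] F_int[OF disjI2[OF refl]]])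
    finally show ?thesis
      by (simp only: diff_divide_distrib)
  qed
  \<comment> \<open>The derivative of the test function is nonnegative near \<open>s\<close> and
    nonpositive near \<open>t\<close>, hence the order of the two terms.\<close>
  have lim1: "(\<lambda>n. LINT x|lebesgue_on {0<..<T}. deriv (\<eta> n) x * F x) \<longlonglongrightarrow> F s * ?c - F t * ?c"
    unfolding lhs by (intro tendsto_diff lim_F) auto
  have "(\<lambda>n. LINT x|lebesgue. \<eta> n x * (\<eta>0 x * b x)) \<longlonglongrightarrow> (LINT x|lebesgue. ?c * (indicator {s<..t} x *\<^sub>R b x))"
  proof (rule integral_dominated_convergence)
    show "integrable lebesgue (\<lambda>x. ?c * \<bar>\<eta>0 x * b x\<bar>)"
      using b0 by (intro integrable_mult_right integrable_abs)
    show "(\<lambda>x. ?c * (indicator {s<..t} x *\<^sub>R b x)) \<in> borel_measurable lebesgue"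
      using bst unfolding set_integrable_def by (intro borel_measurable_times borel_measurable_const) auto
    show "(\<lambda>x. \<eta> n x * (\<eta>0 x * b x)) \<in> borel_measurable lebesgue" for n
      using b0 borel_measurable_lebesgue_continuous[OF smooth_continuous_on[OF \<eta>s]]
      by (intro borel_measurable_times[of "\<eta> n"]) auto
    show "AE x in lebesgue. norm (\<eta> n x * (\<eta>0 x * b x)) \<le> ?c * \<bar>\<eta>0 x * b x\<bar>" for n
      unfolding real_norm_def abs_mult[of "\<eta> n x" for n x] by (intro AE_I2 mult_right_mono \<eta>_bd abs_ge_zero)
    have "AE x in lebesgue. x \<noteq> s \<and> x \<noteq> t"
      by (intro AE_conjI AE_completion AE_lborel_singleton)
    then show "AE x in lebesgue. (\<lambda>n. \<eta> n x * (\<eta>0 x * b x)) \<longlonglongrightarrow> ?c * (indicator {s<..t} x *\<^sub>R b x)"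
    proof eventually_elim
      case (elim x)
      have small: "\<forall>\<^sub>F n in sequentially. h n < d" if "d > 0" for d
        using order_tendstoD(2)[OF h_lim that] .
      show ?case
      proof (cases "s < x \<and> x < t")
        case True
        then have "\<eta>0 x = 1"
          using R by (intro \<eta>0(2)) auto
        have "\<forall>\<^sub>F n in sequentially. h n < min (x - s) (t - x)"
          using True by (intro small) auto
        then have "\<forall>\<^sub>F n in sequentially. \<eta> n x * (\<eta>0 x * b x) = ?c * (indicator {s<..t} x *\<^sub>R b x)"
        proof eventually_elim
          case (elim n)
          then have "\<eta> n x = ?c"
            by (intro \<eta>_in) auto
          then show ?case
            using \<open>\<eta>0 x = 1\<close> True by simp
        qed
        then show ?thesis
          by (rule tendsto_eventually)
      next
        case False
        define d where "d = (if x < s then s - x else x - t)"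
        have "d > 0"
          using False elim by (auto simp: d_def)
        from small[OF this] have "\<forall>\<^sub>F n in sequentially. \<eta> n x * (\<eta>0 x * b x) = ?c * (indicator {s<..t} x *\<^sub>R b x)"
        proof eventually_elim
          case (elim n)
          then have "x \<notin> {s - h n..t + h n}" "x \<notin> {s<..t}"
            using False \<open>d > 0\<close> st by (auto simp: d_def split: if_splits)
          then show ?case
            by (simp add: \<eta>_out)
        qed
        then show ?thesis
          by (rule tendsto_eventually)
      qed
    qed
  qed
  moreover have "(LINT x|lebesgue. \<eta> n x * (\<eta>0 x * b x)) = (LINT x|lebesgue_on {0<..<T}. \<eta> n x * b x)" for n
  proof -
    have e: "\<eta> n x * (\<eta>0 x * b x) = \<eta> n x * b x" for x
    proof (cases "x \<in> {s - h n..t + h n}")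
      case True
      then have "\<eta>0 x = 1"
        using h(2)[of n] by (intro \<eta>0(2)) auto
      then show ?thesis
        by simp
    qed (simp add: \<eta>_out)
    have z: "\<eta> n x * b x = 0" if "x \<notin> {0<..<T}" for x
    proof -
      have "x \<notin> {s - h n..t + h n}"
        using \<eta>_sub[of n] that by blast
      then show ?thesis
        using \<eta>_out by (metis mult_zero_left)
    qed
    have "(LINT x|lebesgue_on {0<..<T}. \<eta> n x * b x) = (LINT x|lebesgue. \<eta> n x * b x)"
      by (rule integral_lebesgue_on_eq[OF IU]) (rule z)
    then show ?thesis
      by (simp only: e)
  qed
  ultimately have "(\<lambda>n. - (LINT x|lebesgue_on {0<..<T}. \<eta> n x * b x)) \<longlonglongrightarrow> - (?c * (LINT r:{s<..t}|lebesgue. b r))"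
    by (intro tendsto_minus) (simp add: set_lebesgue_integral_def)
  then have "(\<lambda>n. LINT x|lebesgue_on {0<..<T}. deriv (\<eta> n) x * F x) \<longlonglongrightarrow> - (?c * (LINT r:{s<..t}|lebesgue. b r))"
    by (simp only: eq[OF \<eta>_test])
  from LIMSEQ_unique[OF lim1 this] have "?c * (F t - F s) = ?c * (LINT r:{s<..t}|lebesgue. b r)"
    by (simp add: algebra_simps)
  then show "F t - F s = (LINT r:{s<..t}|lebesgue. b r)"
    using c by simp
qed

section \<open>Functionals of vector-valued functions of time\<close>

lemma borel_measurable_AE_LIMSEQ:
  fixes g :: "'a::euclidean_space \<Rightarrow> real"
  assumes S: "S \<in> sets lebesgue" and f: "\<And>n. f n \<in> borel_measurable (lebesgue_on S)"
    and lim: "AE x in lebesgue_on S. (\<lambda>n. f n x) \<longlonglongrightarrow> g x"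
  shows "g \<in> borel_measurable (lebesgue_on S)"
proof -
  from lim obtain N where N: "N \<in> null_sets (lebesgue_on S)" "{x \<in> S. \<not> (\<lambda>n. f n x) \<longlonglongrightarrow> g x} \<subseteq> N"
    by (auto elim!: AE_E simp: null_sets_def)
  have "(\<lambda>x. if x \<in> N then 0 else g x) \<in> borel_measurable (lebesgue_on S)"
  proof (rule borel_measurable_LIMSEQ_real)
    show "(\<lambda>x. if x \<in> N then 0 else f n x) \<in> borel_measurable (lebesgue_on S)" for n
      using N(1) f[of n] by (intro measurable_If_set) (auto simp: null_sets_def)
    show "(\<lambda>n. if x \<in> N then 0 else f n x) \<longlonglongrightarrow> (if x \<in> N then 0 else g x)"
      if "x \<in> space (lebesgue_on S)" for x
      using N(2) that by auto
  qed
  moreover have "AE x in lebesgue_on S. (if x \<in> N then 0 else g x) = g x"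
    using AE_not_in[OF N(1)] by eventually_elim simp
  ultimately show ?thesis
    by (rule borel_measurable_lebesgue_on_AE[OF _ _ S])
qed

text \<open>Since \<open>s\<close> takes finitely many values, each on a measurable set,
  \<open>\<phi>\<close> may be an arbitrary function; it is used for seminorms as well as for
  functionals.\<close>

lemma simple_on_integral:
  fixes \<phi> :: "'x::real_vector \<Rightarrow> real"
  assumes s: "simple_on X T s"
  shows "integrable (lebesgue_on {0<..<T}) (\<lambda>t. \<phi> (s t))"
    and "(LINT t|lebesgue_on {0<..<T}. \<phi> (s t)) =
      (\<Sum>x\<in>s ` {0<..<T}. measure lebesgue {t \<in> {0<..<T}. s t = x} * \<phi> x)"
proof -
  let ?I = "{0<..<T}" and ?A = "\<lambda>x. {t \<in> {0<..<T}. s t = x}"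
  have fin: "finite (s ` ?I)" and A: "\<And>x. ?A x \<in> sets lebesgue"
    using s by (auto simp: simple_on_def)
  have eq: "indicator ?I t *\<^sub>R \<phi> (s t) = (\<Sum>x\<in>s ` ?I. \<phi> x * indicator (?A x) t)" for t
  proof (cases "t \<in> ?I")
    case True
    have "(\<Sum>x\<in>s ` ?I. \<phi> x * indicator (?A x) t) = (\<Sum>x\<in>s ` ?I. if x = s t then \<phi> x else 0)"
      using True by (intro sum.cong) (auto simp: indicator_def)
    also have "\<dots> = \<phi> (s t)"
      using True fin by (simp only: sum.delta) auto
    finally show ?thesis
      using True by simp
  next
    case False
    then have "(\<Sum>x\<in>s ` ?I. \<phi> x * indicator (?A x) t) = 0"
      by (intro sum.neutral) (auto simp: indicator_def)
    then show ?thesis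
      using False by simp
  qed
  have m: "?A x \<in> lmeasurable" for x
    by (rule fmeasurableI2[OF lmeasurable_interval(2)[of 0 T]]) (use A in auto)
  have ii: "integrable lebesgue (\<lambda>t. \<phi> x * indicator (?A x) t)" for x
    using m[of x] by (intro integrable_mult_right integrable_real_indicator) (auto simp: fmeasurable_def)
  have "integrable lebesgue (\<lambda>t. indicator ?I t *\<^sub>R \<phi> (s t))"
    unfolding eq by (intro Bochner_Integration.integrable_sum ii)
  then show "integrable (lebesgue_on ?I) (\<lambda>t. \<phi> (s t))"
    by (subst integrable_restrict_space) auto
  have "(LINT t|lebesgue_on ?I. \<phi> (s t)) = (LINT t|lebesgue. indicator ?I t *\<^sub>R \<phi> (s t))"
    by (subst integral_restrict_space) auto
  also have "\<dots> = (\<Sum>x\<in>s ` ?I. LINT t|lebesgue. \<phi> x * indicator (?A x) t)"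
    unfolding eq by (intro Bochner_Integration.integral_sum ii)
  also have "\<dots> = (\<Sum>x\<in>s ` ?I. measure lebesgue (?A x) * \<phi> x)"
    by (intro sum.cong refl) (simp add: mult.commute)
  finally show "(LINT t|lebesgue_on ?I. \<phi> (s t)) = (\<Sum>x\<in>s ` ?I. measure lebesgue (?A x) * \<phi> x)" .
qed

text \<open>\<open>N\<close> is a seminorm coarser than that of \<open>X\<close>: the \<open>L\<^sup>q\<close> norm of the symmetric gradient satisfies
  the exact triangle inequality, which is not established here for the norm of the Sobolev space.\<close>

locale seminormed_fspace =
  fixes X :: "'x::real_vector fspace" and N :: "'x \<Rightarrow> real"
  assumes zero: "0 \<in> elts X"
    and lin: "x \<in> elts X \<Longrightarrow> y \<in> elts X \<Longrightarrow> x + c *\<^sub>R y \<in> elts X"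
    and N_nonneg: "N x \<ge> 0"
    and N_le: "x \<in> elts X \<Longrightarrow> N x \<le> snorm X x"
    and N_add: "x \<in> elts X \<Longrightarrow> y \<in> elts X \<Longrightarrow> N (x + y) \<le> N x + N y"
    and N_scaleR: "x \<in> elts X \<Longrightarrow> N (c *\<^sub>R x) = \<bar>c\<bar> * N x"
begin

lemma scaleR: "x \<in> elts X \<Longrightarrow> c *\<^sub>R x \<in> elts X"
  using lin[OF zero, of x c] by simp

lemma add: "x \<in> elts X \<Longrightarrow> y \<in> elts X \<Longrightarrow> x + y \<in> elts X"
  using lin[of x y 1] by simp

lemma diff: "x \<in> elts X \<Longrightarrow> y \<in> elts X \<Longrightarrow> x - y \<in> elts X"
  using lin[of x y "-1"] by simp

lemma N_commute: "x \<in> elts X \<Longrightarrow> y \<in> elts X \<Longrightarrow> N (x - y) = N (y - x)"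
  using N_scaleR[OF diff[of x y], of "-1"] by simp

lemma N_abs_diff:
  assumes "x \<in> elts X" "y \<in> elts X" "z \<in> elts X"
  shows "\<bar>N (x - z) - N (y - z)\<bar> \<le> N (x - y)"
  using N_add[OF diff[OF assms(1,2)] diff[OF assms(2,3)]]
    N_add[OF diff[OF assms(2,1)] diff[OF assms(1,3)]] N_commute[OF assms(1,2)] by auto

text \<open>An element of the dual space, restricted to \<open>elts X\<close>, with a bound by the
  coarser seminorm \<open>N\<close>. Vector-valued integrals and derivatives are evaluated through
  such functionals, as real ones.\<close>

definition functional :: "('x \<Rightarrow> real) \<Rightarrow> real \<Rightarrow> bool" where
  "functional l C \<longleftrightarrow> C \<ge> 0 \<and> (\<forall>x\<in>elts X. \<bar>l x\<bar> \<le> C * N x) \<and>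
    (\<forall>x\<in>elts X. \<forall>y\<in>elts X. \<forall>c. l (x + c *\<^sub>R y) = l x + c * l y)"

lemma functional_bound: "functional l C \<Longrightarrow> x \<in> elts X \<Longrightarrow> \<bar>l x\<bar> \<le> C * N x"
  and functional_nonneg: "functional l C \<Longrightarrow> C \<ge> 0"
  and functional_lin: "functional l C \<Longrightarrow> x \<in> elts X \<Longrightarrow> y \<in> elts X \<Longrightarrow> l (x + c *\<^sub>R y) = l x + c * l y"
  by (auto simp: functional_def)

lemma functional_zero: "functional l C \<Longrightarrow> l 0 = 0"
  using functional_lin[of l C 0 0 1] zero by simp

lemma functional_scaleR: "functional l C \<Longrightarrow> x \<in> elts X \<Longrightarrow> l (c *\<^sub>R x) = c * l x"
  using functional_lin[of l C 0 x c] zero functional_zero[of l C] by simp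

lemma functional_diff: "functional l C \<Longrightarrow> x \<in> elts X \<Longrightarrow> y \<in> elts X \<Longrightarrow> l (x - y) = l x - l y"
  using functional_lin[of l C x y "-1"] by simp

lemma functional_bound_snorm: "functional l C \<Longrightarrow> x \<in> elts X \<Longrightarrow> \<bar>l x\<bar> \<le> C * snorm X x"
  using functional_bound mult_left_mono[OF N_le functional_nonneg] order_trans by blast

lemma functional_sum:
  assumes l: "functional l C" and "finite A" "A \<subseteq> elts X"
  shows "(\<Sum>x\<in>A. m x *\<^sub>R x) \<in> elts X \<and> l (\<Sum>x\<in>A. m x *\<^sub>R x) = (\<Sum>x\<in>A. m x * l x)"
  using assms(2,3)
proof (induction A rule: finite_induct)
  case empty
  then show ?case
    using zero functional_zero[OF l] by simp
next
  case (insert a A)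
  then have IH: "(\<Sum>x\<in>A. m x *\<^sub>R x) \<in> elts X" "l (\<Sum>x\<in>A. m x *\<^sub>R x) = (\<Sum>x\<in>A. m x * l x)" and a: "a \<in> elts X"
    by auto
  show ?case
    using insert(1,2) lin[OF IH(1) a, of "m a"] functional_lin[OF l IH(1) a, of "m a"] IH(2)
    by (simp add: add.commute)
qed

text \<open>Both sides are limits along simple functions, for which the claim is linearity over a
  finite sum.\<close>

lemma has_integral_in_functional:
  assumes l: "functional l C" and u: "has_integral_in X T u y"
  shows "integrable (lebesgue_on {0<..<T}) (\<lambda>t. l (u t))"
    and "(LINT t|lebesgue_on {0<..<T}. l (u t)) = l y"
proof -
  let ?M = "lebesgue_on {0<..<T}"
  obtain s0 where s0: "\<And>n. simple_on X T (s0 n)"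
      "AE t in ?M. u t \<in> elts X \<and> (\<lambda>n. snorm X (s0 n t - u t)) \<longlonglongrightarrow> 0"
    using u unfolding has_integral_in_def strongly_measurable_def by blast
  obtain s where s: "\<And>n. simple_on X T (s n)"
      "(\<lambda>n. \<integral>\<^sup>+t. ennreal (snorm X (s n t - u t)) \<partial>?M) \<longlonglongrightarrow> 0"
      "(\<lambda>n. snorm X (simple_integral_on T (s n) - y)) \<longlonglongrightarrow> 0"
    using u unfolding has_integral_in_def by blast
  have y: "y \<in> elts X"
    using u by (simp add: has_integral_in_def)
  have elts: "s' t \<in> elts X" if "simple_on X T s'" "t \<in> {0<..<T}" for s' t
    using that by (auto simp: simple_on_def)
  have space: "AE t in ?M. t \<in> {0<..<T}"
    by (rule AE_I2) simp
  have meas: "(\<lambda>t. l (u t)) \<in> borel_measurable ?M"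
  proof (rule borel_measurable_AE_LIMSEQ)
    show "(\<lambda>t. l (s0 n t)) \<in> borel_measurable ?M" for n
      using simple_on_integral(1)[OF s0(1)] by (rule borel_measurable_integrable)
    show "AE t in ?M. (\<lambda>n. l (s0 n t)) \<longlonglongrightarrow> l (u t)"
      using s0(2) space
    proof eventually_elim
      case (elim t)
      then have "(\<lambda>n. C * snorm X (s0 n t - u t)) \<longlonglongrightarrow> 0"
        using tendsto_mult[OF tendsto_const, of _ 0 sequentially C] by fastforce
      then have "(\<lambda>n. l (s0 n t) - l (u t)) \<longlonglongrightarrow> 0"
      proof (rule Lim_null_comparison[rotated], intro always_eventually allI)
        fix n
        have "s0 n t \<in> elts X" "u t \<in> elts X"
          using elts[OF s0(1)] elim by auto
        then show "norm (l (s0 n t) - l (u t)) \<le> C * snorm X (s0 n t - u t)"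
          using functional_bound_snorm[OF l diff] functional_diff[OF l] by (metis real_norm_def)
      qed
      then show ?case
        by (rule LIM_zero_cancel)
    qed
  qed simp
  let ?d = "\<lambda>n t. l (s n t) - l (u t)"
  have si: "integrable ?M (\<lambda>t. l (s n t))" for n
    by (rule simple_on_integral(1)[OF s(1)])
  have dm: "?d n \<in> borel_measurable ?M" for n
    using borel_measurable_integrable[OF si] meas by (rule borel_measurable_diff)
  \<comment> \<open>Adding 1 makes the constant positive, so that it can be divided out even if
    \<open>C\<close> is 0.\<close>
  define K where "K = C + 1"
  have K: "K > 0"
    using functional_nonneg[OF l] by (simp add: K_def)
  have le: "(\<integral>\<^sup>+t. ennreal (\<bar>?d n t\<bar>) \<partial>?M) \<le> ennreal K * (\<integral>\<^sup>+t. ennreal (snorm X (s n t - u t)) \<partial>?M)" for n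
  proof -
    \<comment> \<open>The constant is extracted while the integrand is known to be measurable;
      \<open>snorm X (s n t - u t)\<close> is not known to be measurable in \<open>t\<close>, and
      for it only monotonicity of the integral is used.\<close>
    have "(\<integral>\<^sup>+t. ennreal (\<bar>?d n t\<bar>) \<partial>?M) = (\<integral>\<^sup>+t. ennreal K * ennreal (\<bar>?d n t\<bar> / K) \<partial>?M)"
      using K by (intro nn_integral_cong) (simp add: ennreal_mult'[symmetric])
    also have "\<dots> = ennreal K * (\<integral>\<^sup>+t. ennreal (\<bar>?d n t\<bar> / K) \<partial>?M)"
      by (rule nn_integral_cmult) (intro measurable_compose[OF _ measurable_ennreal] borel_measurable_divide
          borel_measurable_abs dm borel_measurable_const)
    also have "(\<integral>\<^sup>+t. ennreal (\<bar>?d n t\<bar> / K) \<partial>?M) \<le> (\<integral>\<^sup>+t. ennreal (snorm X (s n t - u t)) \<partial>?M)"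
    proof (rule nn_integral_mono_AE)
      show "AE t in ?M. ennreal (\<bar>?d n t\<bar> / K) \<le> ennreal (snorm X (s n t - u t))"
        using s0(2) space
      proof eventually_elim
        case (elim t)
        then have st: "s n t \<in> elts X" "u t \<in> elts X"
          using elts[OF s(1)] by auto
        have "\<bar>?d n t\<bar> \<le> C * N (s n t - u t)"
          using functional_bound[OF l diff[OF st]] functional_diff[OF l st] by simp
        also have "\<dots> \<le> K * N (s n t - u t)"
          using N_nonneg by (intro mult_right_mono) (auto simp: K_def)
        also have "\<dots> \<le> K * snorm X (s n t - u t)"
          using K N_le[OF diff[OF st]] by (intro mult_left_mono) auto
        finally show ?case
          using K by (intro ennreal_leI) (simp add: divide_le_eq mult.commute)
      qed
    qed
    finally show ?thesis
      by (simp add: mult_left_mono)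
  qed
  have lim0: "(\<lambda>n. \<integral>\<^sup>+t. ennreal (\<bar>?d n t\<bar>) \<partial>?M) \<longlonglongrightarrow> 0"
  proof (rule tendsto_sandwich[of "\<lambda>_. 0"])
    show "(\<lambda>n. ennreal K * (\<integral>\<^sup>+t. ennreal (snorm X (s n t - u t)) \<partial>?M)) \<longlonglongrightarrow> 0"
      using tendsto_mult_ennreal[OF tendsto_const s(2), of "ennreal K"] by simp
  qed (use le in auto)
  then have ev: "\<forall>\<^sub>F n in sequentially. (\<integral>\<^sup>+t. ennreal (\<bar>?d n t\<bar>) \<partial>?M) < 1"
    by (rule order_tendstoD(2)) simp
  have di: "integrable ?M (?d n)" if "(\<integral>\<^sup>+t. ennreal (\<bar>?d n t\<bar>) \<partial>?M) < 1" for n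
    using that dm[of n] by (intro integrableI_bounded) (auto intro: order_less_trans simp: less_top[symmetric])
  obtain n0 where n0: "(\<integral>\<^sup>+t. ennreal (\<bar>?d n0 t\<bar>) \<partial>?M) < 1"
    using ev by (auto simp: eventually_sequentially)
  from Bochner_Integration.integrable_diff[OF si[of n0] di[OF n0]]
  show ui: "integrable ?M (\<lambda>t. l (u t))"
    by simp
  have di: "integrable ?M (?d n)" for n
    by (rule Bochner_Integration.integrable_diff[OF si ui])
  have "(\<lambda>n. (LINT t|?M. l (s n t)) - (LINT t|?M. l (u t))) \<longlonglongrightarrow> 0"
  proof (rule tendsto_rabs_zero_cancel, rule tendsto_0_le[rotated 2])
    show "(\<lambda>n. enn2real (\<integral>\<^sup>+t. ennreal (\<bar>?d n t\<bar>) \<partial>?M)) \<longlonglongrightarrow> 0"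
      using tendsto_enn2real[OF lim0[folded ennreal_0]] by simp
    show "\<bar>(LINT t|?M. l (s n t)) - (LINT t|?M. l (u t))\<bar> \<le> enn2real (\<integral>\<^sup>+t. ennreal (\<bar>?d n t\<bar>) \<partial>?M)" for n
    proof -
      have "(LINT t|?M. l (s n t)) - (LINT t|?M. l (u t)) = (LINT t|?M. ?d n t)"
        by (rule Bochner_Integration.integral_diff[OF si ui, symmetric])
      also have "\<bar>\<dots>\<bar> \<le> (LINT t|?M. \<bar>?d n t\<bar>)"
        by (rule integral_abs_bound)
      also have "\<dots> = enn2real (\<integral>\<^sup>+t. ennreal (\<bar>?d n t\<bar>) \<partial>?M)"
        using di[of n] by (intro integral_eq_nn_integral) auto
      finally show ?thesis .
    qed
  qed simp
  then have 1: "(\<lambda>n. LINT t|?M. l (s n t)) \<longlonglongrightarrow> (LINT t|?M. l (u t))"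
    by (rule LIM_zero_cancel)
  have sint: "simple_integral_on T (s n) \<in> elts X \<and> l (simple_integral_on T (s n)) = (LINT t|?M. l (s n t))" for n
    unfolding simple_integral_on_def simple_on_integral(2)[OF s(1)]
    by (rule functional_sum[OF l]) (use s(1) in \<open>auto simp: simple_on_def\<close>)
  have "(\<lambda>n. l (simple_integral_on T (s n)) - l y) \<longlonglongrightarrow> 0"
  proof (rule Lim_null_comparison)
    show "\<forall>\<^sub>F n in sequentially. norm (l (simple_integral_on T (s n)) - l y) \<le> C * snorm X (simple_integral_on T (s n) - y)"
      using functional_bound_snorm[OF l diff[OF _ y]] functional_diff[OF l _ y] sint
      by (intro always_eventually allI) (metis real_norm_def)
    show "(\<lambda>n. C * snorm X (simple_integral_on T (s n) - y)) \<longlonglongrightarrow> 0"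
      using tendsto_mult[OF tendsto_const s(3), of C] by simp
  qed
  then have "(\<lambda>n. LINT t|?M. l (s n t)) \<longlonglongrightarrow> l y"
    using LIM_zero_cancel sint by fastforce
  from LIMSEQ_unique[OF 1 this] show "(LINT t|?M. l (u t)) = l y" .
qed

lemma functional_continuous_on:
  assumes l: "functional l C" and u: "continuous_in X T u"
  shows "continuous_on {0..T} (\<lambda>t. l (u t))"
  unfolding continuous_on_def
proof
  fix t assume t: "t \<in> {0..T}"
  have "((\<lambda>s. l (u s) - l (u t)) \<longlongrightarrow> 0) (at t within {0..T})"
  proof (rule Lim_null_comparison)
    show "((\<lambda>s. C * snorm X (u s - u t)) \<longlongrightarrow> 0) (at t within {0..T})"
      using u t tendsto_mult[OF tendsto_const, of "\<lambda>s. snorm X (u s - u t)" 0 "at t within {0..T}" C]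
      by (auto simp: continuous_in_def)
    show "\<forall>\<^sub>F s in at t within {0..T}. norm (l (u s) - l (u t)) \<le> C * snorm X (u s - u t)"
      unfolding eventually_at_filter
    proof (intro always_eventually allI impI)
      fix s assume "s \<in> {0..T}"
      then have "u s \<in> elts X" "u t \<in> elts X"
        using u t by (auto simp: continuous_in_def)
      then show "norm (l (u s) - l (u t)) \<le> C * snorm X (u s - u t)"
        using functional_bound_snorm[OF l diff] functional_diff[OF l] by (metis real_norm_def)
    qed
  qed
  then show "((\<lambda>t. l (u t)) \<longlongrightarrow> l (u t)) (at t within {0..T})"
    by (rule LIM_zero_cancel)
qed

text \<open>Only the product is assumed to lie in the space: for c = 0 both sides vanish, otherwise
  \<open>x\<close> is recovered by scaling. This fits products with a cutoff, whose vector factor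
  may leave the space where the cutoff is 0.\<close>

lemma functional_scaleR': "functional l C \<Longrightarrow> c *\<^sub>R x \<in> elts X \<Longrightarrow> l (c *\<^sub>R x) = c * l x"
  using functional_scaleR[of l C "c *\<^sub>R x" "1 / c"] functional_zero[of l C] by (cases "c = 0") auto

text \<open>Applying the functional turns the vector identity into a scalar one, and l (u t) is
  continuous in \<open>t\<close>, as the lemma of du Bois-Reymond demands.\<close>

lemma weak_tderiv_functional:
  assumes l: "functional l C" and u: "continuous_in X T u" "weak_tderiv X T u v"
  shows weak_tderiv_test_integrable: "test_fun {0<..<T} \<eta> \<Longrightarrow> integrable (lebesgue_on {0<..<T}) (\<lambda>t. \<eta> t * l (v t))"
    and weak_tderiv_test: "test_fun {0<..<T} \<eta> \<Longrightarrow>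
      (LINT t|lebesgue_on {0<..<T}. deriv \<eta> t * l (u t)) = - (LINT t|lebesgue_on {0<..<T}. \<eta> t * l (v t))"
    and weak_tderiv_integrable: "0 < s \<Longrightarrow> s < t \<Longrightarrow> t < T \<Longrightarrow> set_integrable lebesgue {s<..t} (\<lambda>r. l (v r))"
    and weak_tderiv_integral: "0 < s \<Longrightarrow> s < t \<Longrightarrow> t < T \<Longrightarrow> l (u t) - l (u s) = (LINT r:{s<..t}|lebesgue. l (v r))"
proof -
  let ?M = "lebesgue_on {0<..<T}"
  have main: "integrable ?M (\<lambda>t. \<eta> t * l (v t)) \<and>
      (LINT t|?M. deriv \<eta> t * l (u t)) = - (LINT t|?M. \<eta> t * l (v t))" if \<eta>: "test_fun {0<..<T} \<eta>" for \<eta>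
  proof -
    obtain y where y: "has_integral_in X T (\<lambda>t. deriv \<eta> t *\<^sub>R u t) y" "has_integral_in X T (\<lambda>t. \<eta> t *\<^sub>R v t) (- y)"
      using u(2) \<eta> unfolding weak_tderiv_def by blast
    note i1 = has_integral_in_functional[OF l y(1)] and i2 = has_integral_in_functional[OF l y(2)]
    have yX: "y \<in> elts X"
      using y(1) by (simp add: has_integral_in_def)
    have sp: "AE t in ?M. t \<in> {0<..<T}"
      by (rule AE_I2) simp
    have a1: "AE t in ?M. l (deriv \<eta> t *\<^sub>R u t) = deriv \<eta> t * l (u t)"
      using sp by eventually_elim (use u(1) functional_scaleR[OF l] in \<open>auto simp: continuous_in_def\<close>)
    have "AE t in ?M. \<eta> t *\<^sub>R v t \<in> elts X"
      using y(2) by (auto simp: has_integral_in_def strongly_measurable_def)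
    then have a2: "AE t in ?M. l (\<eta> t *\<^sub>R v t) = \<eta> t * l (v t)"
      by eventually_elim (rule functional_scaleR'[OF l])
    have S: "{0<..<T} \<in> sets lebesgue"
      by simp
    note m1 = borel_measurable_integrable[OF i1(1)] and m2 = borel_measurable_integrable[OF i2(1)]
    note n1 = borel_measurable_lebesgue_on_AE[OF m1 a1 S] and n2 = borel_measurable_lebesgue_on_AE[OF m2 a2 S]
    have "(LINT t|?M. deriv \<eta> t * l (u t)) = l y"
      using integral_cong_AE[OF m1 n1 a1] i1(2) by simp
    moreover have "(LINT t|?M. \<eta> t * l (v t)) = l (- y)"
      using integral_cong_AE[OF m2 n2 a2] i2(2) by simp
    moreover have "l (- y) = - l y"
      using functional_scaleR[OF l yX, of "-1"] by simp
    ultimately show ?thesis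
      using integrable_cong_AE[OF m2 n2 a2] i2(1) by simp
  qed
  show "test_fun {0<..<T} \<eta> \<Longrightarrow> integrable ?M (\<lambda>t. \<eta> t * l (v t))"
    and "test_fun {0<..<T} \<eta> \<Longrightarrow> (LINT t|?M. deriv \<eta> t * l (u t)) = - (LINT t|?M. \<eta> t * l (v t))"
    using main by blast+
  have c: "continuous_on {0<..<T} (\<lambda>t. l (u t))"
    by (rule continuous_on_subset[OF functional_continuous_on[OF l u(1)]]) auto
  show "0 < s \<Longrightarrow> s < t \<Longrightarrow> t < T \<Longrightarrow> set_integrable lebesgue {s<..t} (\<lambda>r. l (v r))"
    by (rule du_Bois_Reymond(1)[OF c]) (use main in auto)
  show "0 < s \<Longrightarrow> s < t \<Longrightarrow> t < T \<Longrightarrow> l (u t) - l (u s) = (LINT r:{s<..t}|lebesgue. l (v r))"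
    by (rule du_Bois_Reymond(2)[OF c]) (use main in auto)
qed

end

text \<open>Measurability of the norm is recovered from that of its integrable power by taking the
  root.\<close>

lemma bochner_L_snorm_integrable:
  assumes u: "u \<in> bochner_L (ereal q) T X" and q: "q \<ge> 1" and nn: "\<And>x. snorm X x \<ge> 0"
  shows "integrable (lebesgue_on {0<..<T}) (\<lambda>t. snorm X (u t))"
proof -
  interpret finite_measure "lebesgue_on {0<..<T}"
    by (rule finite_measure_lebesgue_on) (rule lmeasurable_open, auto)
  have i: "integrable (lebesgue_on {0<..<T}) (\<lambda>t. snorm X (u t) powr q)"
    using u by (simp add: bochner_L_def)
  have "(\<lambda>t. (snorm X (u t) powr q) powr (1 / q)) \<in> borel_measurable (lebesgue_on {0<..<T})"
    using borel_measurable_integrable[OF i] by measurable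
  then have m: "(\<lambda>t. snorm X (u t)) \<in> borel_measurable (lebesgue_on {0<..<T})"
    using q nn by (simp add: powr_powr)
  have "integrable (lebesgue_on {0<..<T}) (\<lambda>t. norm (snorm X (u t)) powr 1)"
    by (rule integrable_powr_le[OF finite_measure_axioms m]) (use i q nn in auto)
  then show ?thesis
    using nn by simp
qed

lemma strongly_measurable_elts:
  "strongly_measurable X T u \<Longrightarrow> AE t in lebesgue_on {0<..<T}. u t \<in> elts X"
  by (auto simp: strongly_measurable_def elim: eventually_mono)

section \<open>Difference quotients in time\<close>

context seminormed_fspace
begin

lemma bochner_L_functional:
  assumes u: "u \<in> bochner_L (ereal q) T X" and q: "q \<ge> 1" and nn: "\<And>x. snorm X x \<ge> 0"
    and l: "functional l C"
  shows "integrable (lebesgue_on {0<..<T}) (\<lambda>t. l (u t))"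
proof -
  have sm: "strongly_measurable X T u"
    using u by (simp add: bochner_L_def)
  then obtain s0 where s0: "\<And>n. simple_on X T (s0 n)"
      "AE t in lebesgue_on {0<..<T}. u t \<in> elts X \<and> (\<lambda>n. snorm X (s0 n t - u t)) \<longlonglongrightarrow> 0"
    unfolding strongly_measurable_def by blast
  have space: "AE t in lebesgue_on {0<..<T}. t \<in> {0<..<T}"
    by (rule AE_I2) simp
  have m: "(\<lambda>t. l (u t)) \<in> borel_measurable (lebesgue_on {0<..<T})"
  proof (rule borel_measurable_AE_LIMSEQ)
    show "(\<lambda>t. l (s0 n t)) \<in> borel_measurable (lebesgue_on {0<..<T})" for n
      using simple_on_integral(1)[OF s0(1)] by (rule borel_measurable_integrable)
    show "AE t in lebesgue_on {0<..<T}. (\<lambda>n. l (s0 n t)) \<longlonglongrightarrow> l (u t)"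
      using s0(2) space
    proof eventually_elim
      case (elim t)
      then have "(\<lambda>n. C * snorm X (s0 n t - u t)) \<longlonglongrightarrow> 0"
        using tendsto_mult[OF tendsto_const, of _ 0 sequentially C] by fastforce
      then have "(\<lambda>n. l (s0 n t) - l (u t)) \<longlonglongrightarrow> 0"
      proof (rule Lim_null_comparison[rotated], intro always_eventually allI)
        fix n
        have "s0 n t \<in> elts X" "u t \<in> elts X"
          using s0(1)[of n] elim by (auto simp: simple_on_def)
        then show "norm (l (s0 n t) - l (u t)) \<le> C * snorm X (s0 n t - u t)"
          using functional_bound_snorm[OF l diff] functional_diff[OF l] by (metis real_norm_def)
      qed
      then show ?case
        by (rule LIM_zero_cancel)
    qed
  qed simp
  have "AE t in lebesgue_on {0<..<T}. norm (l (u t)) \<le> norm (C * snorm X (u t))"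
    using strongly_measurable_elts[OF sm]
    by eventually_elim (use functional_bound_snorm[OF l] functional_nonneg[OF l] nn in auto)
  moreover have "integrable (lebesgue_on {0<..<T}) (\<lambda>t. C * snorm X (u t))"
    by (intro integrable_mult_right bochner_L_snorm_integrable[OF u q nn])
  ultimately show ?thesis
    using m Bochner_Integration.integrable_bound by blast
qed

text \<open>The exceptional set must serve all functionals simultaneously. Hence Lebesgue points are
  taken not for l (v r), which would depend on \<open>l\<close>, but for the scalar functions N (v r
  - x) with \<open>x\<close> in the countable set of values of the simple approximants. At such a
  point the mean of N (v r - v t) is small, and a functional sees at most \<open>C\<close> times
  this mean.\<close>

lemma difference_quotient_aux:
  assumes u: "continuous_in X T u" "weak_tderiv X T u v" and ab: "0 < a" "a < b" "b < T"
  shows "AE t in lebesgue. t \<in> {a<..<b} \<longrightarrow> v t \<in> elts X \<and> (\<forall>l C. functional l C \<longrightarrow>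
    ((\<lambda>h. (l (u t) - l (u (t - h))) / h) \<longlongrightarrow> l (v t)) (at_right 0))"
proof -
  let ?I = "{0<..<T}" and ?M = "lebesgue_on {0<..<T}"
  \<comment> \<open>The weak derivative is known to be Bochner integrable only after multiplication
    by a test function; this cutoff leaves it unchanged on [a, b].\<close>
  obtain \<eta> where \<eta>: "test_fun ?I \<eta>" "\<And>x. a \<le> x \<Longrightarrow> x \<le> b \<Longrightarrow> \<eta> x = 1"
    using cutoff_exists[OF ab] by metis
  define \<zeta> where "\<zeta> t = \<eta> t *\<^sub>R v t" for t
  have \<zeta>v: "\<zeta> t = v t" if "a \<le> t" "t \<le> b" for t
    using \<eta>(2)[OF that] by (simp add: \<zeta>_def)
  obtain y where "has_integral_in X T \<zeta> y"
    using u(2) \<eta>(1) unfolding weak_tderiv_def \<zeta>_def by blast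
  then obtain s0 s where s0: "\<And>n. simple_on X T (s0 n)"
      "AE t in ?M. \<zeta> t \<in> elts X \<and> (\<lambda>n. snorm X (s0 n t - \<zeta> t)) \<longlonglongrightarrow> 0"
    and s: "\<And>n. simple_on X T (s n)" "(\<lambda>n. \<integral>\<^sup>+t. ennreal (snorm X (s n t - \<zeta> t)) \<partial>?M) \<longlonglongrightarrow> 0"
    unfolding has_integral_in_def strongly_measurable_def by blast
  have elts: "s' t \<in> elts X" if "simple_on X T s'" "t \<in> ?I" for s' t
    using that by (auto simp: simple_on_def)
  have space: "AE t in ?M. t \<in> ?I"
    by (rule AE_I2) simp
  have IU: "?I \<in> sets lebesgue"
    by simp
  define Q where "Q = (\<Union>n. s0 n ` ?I)"
  have "countable (s0 n ` ?I)" for n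
    using s0(1)[of n] by (simp add: simple_on_def countable_finite)
  then have Q: "countable Q" "Q \<subseteq> elts X"
    using elts[OF s0(1)] unfolding Q_def by blast+
  \<comment> \<open>Extended by 0 outside the interval, so that the theorem on Lebesgue points
    applies on the whole line.\<close>
  define \<Phi> where "\<Phi> x t = (if t \<in> ?I then N (\<zeta> t - x) else 0)" for x t
  have \<Phi>_int: "integrable lebesgue (\<Phi> x)" if x: "x \<in> Q" for x
  proof -
    have xX: "x \<in> elts X"
      using x Q by blast
    have m: "(\<lambda>t. N (\<zeta> t - x)) \<in> borel_measurable ?M"
    proof (rule borel_measurable_AE_LIMSEQ[OF IU])
      show "(\<lambda>t. N (s0 n t - x)) \<in> borel_measurable ?M" for n
        using simple_on_integral(1)[OF s0(1), of "\<lambda>z. N (z - x)"] by (rule borel_measurable_integrable)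
      show "AE t in ?M. (\<lambda>n. N (s0 n t - x)) \<longlonglongrightarrow> N (\<zeta> t - x)"
        using s0(2) space
      proof eventually_elim
        case (elim t)
        have "(\<lambda>n. N (s0 n t - x) - N (\<zeta> t - x)) \<longlonglongrightarrow> 0"
        proof (rule Lim_null_comparison)
          show "(\<lambda>n. snorm X (s0 n t - \<zeta> t)) \<longlonglongrightarrow> 0"
            using elim by blast
          show "\<forall>\<^sub>F n in sequentially. norm (N (s0 n t - x) - N (\<zeta> t - x)) \<le> snorm X (s0 n t - \<zeta> t)"
          proof (intro always_eventually allI)
            fix n
            have "s0 n t \<in> elts X" "\<zeta> t \<in> elts X"
              using elts[OF s0(1)] elim by auto
            then show "norm (N (s0 n t - x) - N (\<zeta> t - x)) \<le> snorm X (s0 n t - \<zeta> t)"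
              using order_trans[OF N_abs_diff[OF _ _ xX] N_le[OF diff]] by simp
          qed
        qed
        then show ?case
          by (rule LIM_zero_cancel)
      qed
    qed
    have "\<forall>\<^sub>F n in sequentially. (\<integral>\<^sup>+t. ennreal (snorm X (s n t - \<zeta> t)) \<partial>?M) < 1"
      using s(2) by (rule order_tendstoD(2)) simp
    then obtain n where n: "(\<integral>\<^sup>+t. ennreal (snorm X (s n t - \<zeta> t)) \<partial>?M) < 1"
      by (auto simp: eventually_sequentially)
    have si: "integrable ?M (\<lambda>t. N (s n t - x))"
      by (rule simple_on_integral(1)[OF s(1)])
    let ?d = "\<lambda>t. N (s n t - x) - N (\<zeta> t - x)"
    have "integrable ?M ?d"
    proof (rule integrableI_bounded)
      show "?d \<in> borel_measurable ?M"
        by (rule borel_measurable_diff[OF borel_measurable_integrable[OF si] m])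
      have "(\<integral>\<^sup>+t. ennreal (norm (?d t)) \<partial>?M) \<le> (\<integral>\<^sup>+t. ennreal (snorm X (s n t - \<zeta> t)) \<partial>?M)"
      proof (rule nn_integral_mono_AE)
        show "AE t in ?M. ennreal (norm (?d t)) \<le> ennreal (snorm X (s n t - \<zeta> t))"
          using s0(2) space
        proof eventually_elim
          case (elim t)
          then have "s n t \<in> elts X" "\<zeta> t \<in> elts X"
            using elts[OF s(1)] by auto
          then show ?case
            using order_trans[OF N_abs_diff[OF _ _ xX] N_le[OF diff]] by (intro ennreal_leI) simp
        qed
      qed
      then show "(\<integral>\<^sup>+t. ennreal (norm (?d t)) \<partial>?M) < \<infinity>"
        using n by (auto intro: order_le_less_trans order_less_trans)
    qed
    from Bochner_Integration.integrable_diff[OF si this]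
    have "integrable ?M (\<lambda>t. N (\<zeta> t - x))"
      by simp
    then show ?thesis
      unfolding \<Phi>_def[abs_def] by (subst Lebesgue_Measure.integrable_restrict_UNIV[OF IU])
  qed
  have LP: "AE t in lebesgue. \<forall>x\<in>Q. lebesgue_point (\<Phi> x) t"
  proof (subst AE_ball_countable[OF Q(1)], intro ballI)
    fix x assume "x \<in> Q"
    then have "locally_integrable UNIV (\<Phi> x)"
      unfolding locally_integrable_def set_integrable_def
    proof (intro allI impI)
      fix K :: "real set" assume "compact K \<and> K \<subseteq> UNIV"
      then have "K \<in> sets lebesgue"
        using compact_imp_closed[of K] by auto
      then show "integrable lebesgue (\<lambda>t. indicator K t *\<^sub>R \<Phi> x t)"
        by (rule integrable_mult_indicator) (rule \<Phi>_int, fact)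
    qed
    from AE_lebesgue_point[OF open_UNIV this] show "AE t in lebesgue. lebesgue_point (\<Phi> x) t"
      by simp
  qed
  have ae\<zeta>: "AE t in lebesgue. t \<in> ?I \<longrightarrow> \<zeta> t \<in> elts X \<and> (\<lambda>n. snorm X (s0 n t - \<zeta> t)) \<longlonglongrightarrow> 0"
    using s0(2) by (subst (asm) AE_restrict_space_iff) auto
  show ?thesis
    using LP ae\<zeta>
  proof eventually_elim
    case (elim t)
    show ?case
    proof (intro impI conjI allI)
      assume t: "t \<in> {a<..<b}"
      then have tI: "t \<in> ?I" and \<zeta>t: "\<zeta> t = v t" "\<zeta> t \<in> elts X" "(\<lambda>n. snorm X (s0 n t - \<zeta> t)) \<longlonglongrightarrow> 0"
        using ab elim \<zeta>v[of t] by auto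
      then show vX: "v t \<in> elts X"
        by simp
      fix l C assume l: "functional l C"
      have C: "C \<ge> 0"
        by (rule functional_nonneg[OF l])
      show "((\<lambda>h. (l (u t) - l (u (t - h))) / h) \<longlongrightarrow> l (v t)) (at_right 0)"
      proof (rule tendstoI)
        fix e :: real assume e: "e > 0"
        \<comment> \<open>The error will be \<open>C\<close> times three terms below
          \<open>d\<close>: one from the Lebesgue point and two from the distance \<open>pp\<close>
          between v t and its approximation \<open>x\<close>.\<close>
        define d where "d = e / (4 * (C + 1))"
        have d: "d > 0" and Cd: "C * (3 * d) < e"
        proof -
          show "d > 0"
            using e C by (simp add: d_def)
          have "e / (4 * k) * k = e / 4" if "k \<noteq> 0" for k
            using that by simp
          from this[of "C + 1"] have "d * (C + 1) = e / 4"
            using C by (simp add: d_def del: distrib_left_numeral)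
          then show "C * (3 * d) < e"
            using e \<open>d > 0\<close> by (simp add: algebra_simps)
        qed
        have "\<forall>\<^sub>F n in sequentially. snorm X (s0 n t - \<zeta> t) < d"
          using \<zeta>t(3) d by (rule order_tendstoD(2))
        then obtain n where n: "snorm X (s0 n t - \<zeta> t) < d"
          by (auto simp: eventually_sequentially)
        define x where "x = s0 n t"
        have "x \<in> Q"
          unfolding x_def Q_def using tI by blast
        with Q(2) have x: "x \<in> Q" "x \<in> elts X"
          by blast+
        define pp where "pp = \<Phi> x t"
        have pp: "pp = N (\<zeta> t - x)" "0 \<le> pp" "pp < d"
        proof -
          show 1: "pp = N (\<zeta> t - x)"
            unfolding pp_def \<Phi>_def using tI by simp
          show "0 \<le> pp"
            unfolding 1 by (rule N_nonneg)
          show "pp < d"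
            using N_commute[OF \<zeta>t(2) x(2)] N_le[OF diff[OF x(2) \<zeta>t(2)]] n unfolding 1 x_def by simp
        qed
        have "lebesgue_point (\<Phi> x) t"
          using elim x(1) by blast
        then have "((\<lambda>h. (LINT y:ball t h|lebesgue. \<bar>\<Phi> x y - pp\<bar>) / h) \<longlongrightarrow> 0) (at_right 0)"
          unfolding lebesgue_point_def pp_def by simp
        then have ev1: "\<forall>\<^sub>F h in at_right 0. (LINT y:ball t h|lebesgue. \<bar>\<Phi> x y - pp\<bar>) / h < d"
          using d by (rule order_tendstoD(2))
        have "t - a > 0"
          using t by simp
        then have ev2: "\<forall>\<^sub>F h in at_right 0. 0 < h \<and> h < t - a"
          by (auto simp: eventually_at_right_field intro!: exI[of _ "t - a"])
        show "\<forall>\<^sub>F h in at_right 0. dist ((l (u t) - l (u (t - h))) / h) (l (v t)) < e"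
          using ev1 ev2
        proof eventually_elim
          case (elim h)
          let ?A = "{t - h<..t}" and ?B = "ball t h"
          have AB: "?A \<subseteq> ?B" and AI: "?A \<subseteq> {a..b}"
            using elim t by (auto simp: dist_real_def)
          have st: "0 < t - h" "t - h < t" "t < T"
            using elim t ab by auto
          have mA: "measure lebesgue ?A = h"
            using elim by simp
          have ci: "set_integrable lebesgue S (\<lambda>_. k)" if "S = ?A \<or> S = ?B" for S and k :: real
          proof -
            have "emeasure lborel ?A < \<infinity>"
              using elim by simp
            then show ?thesis
              unfolding set_integrable_def using that emeasure_lborel_ball_finite[of t h]
              by (intro integrable_scaleR_left integrable_real_indicator) auto
          qed
          have \<Phi>i: "set_integrable lebesgue S (\<Phi> x)" if "S \<in> sets lebesgue" for S
            unfolding set_integrable_def by (rule integrable_mult_indicator[OF that \<Phi>_int[OF x(1)]])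
          have absi: "set_integrable lebesgue S (\<lambda>r. \<bar>\<Phi> x r - pp\<bar>)" if "S = ?A \<or> S = ?B" for S
            by (intro set_integrable_abs set_integral_diff(1) \<Phi>i ci[OF that]) (use that in auto)
          note vi = weak_tderiv_integrable[OF l u st] and vint = weak_tderiv_integral[OF l u st]
          have "l (u t) - l (u (t - h)) - h * l (v t) = (LINT r:?A|lebesgue. l (v r) - l (v t))"
            using set_integral_diff(2)[OF vi ci[of ?A "l (v t)"]] vint mA
            by (simp add: set_lebesgue_integral_def mult.commute)
          also have "\<bar>\<dots>\<bar> \<le> (LINT r:?A|lebesgue. \<bar>l (v r) - l (v t)\<bar>)"
            using set_integral_norm_bound[OF set_integral_diff(1)[OF vi ci[of ?A "l (v t)"]]] by simp
          also have "\<dots> \<le> (LINT r:?A|lebesgue. C * (\<bar>\<Phi> x r - pp\<bar> + 2 * pp))"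
          proof (rule set_integral_mono_AE)
            show "set_integrable lebesgue ?A (\<lambda>r. \<bar>l (v r) - l (v t)\<bar>)"
              by (intro set_integrable_abs set_integral_diff(1) vi ci) simp
            show "set_integrable lebesgue ?A (\<lambda>r. C * (\<bar>\<Phi> x r - pp\<bar> + 2 * pp))"
              by (intro set_integrable_mult_right set_integral_add(1) absi ci) auto
            show "AE r\<in>?A in lebesgue. \<bar>l (v r) - l (v t)\<bar> \<le> C * (\<bar>\<Phi> x r - pp\<bar> + 2 * pp)"
              using ae\<zeta>
            proof eventually_elim
              case (elim r)
              show ?case
              proof
                assume "r \<in> ?A"
                then have r: "r \<in> ?I" "\<zeta> r = v r"
                  using AI ab \<zeta>v[of r] by auto
                then have rX: "v r \<in> elts X"
                  using elim by auto
                have "\<bar>l (v r) - l (v t)\<bar> \<le> C * N (v r - v t)"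
                  using functional_bound[OF l diff[OF rX vX]] functional_diff[OF l rX vX] by simp
                \<comment> \<open>The detour through \<open>x\<close> trades the unknown N (v r - v
                  t) for \<open>\<Phi> x\<close>, whose mean oscillation at \<open>t\<close> is
                  under control.\<close>
                also have "N (v r - v t) \<le> N (v r - x) + N (v t - x)"
                  using N_add[OF diff[OF rX x(2)] diff[OF x(2) vX]] N_commute[OF x(2) vX] by simp
                also have "N (v r - x) = \<Phi> x r"
                  using r by (simp add: \<Phi>_def)
                also have "N (v t - x) = pp"
                  using pp(1) \<zeta>t(1) by simp
                also have "\<Phi> x r + pp \<le> \<bar>\<Phi> x r - pp\<bar> + 2 * pp"
                  by simp
                finally show "\<bar>l (v r) - l (v t)\<bar> \<le> C * (\<bar>\<Phi> x r - pp\<bar> + 2 * pp)"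
                  using C by (simp add: mult_left_mono)
              qed
            qed
          qed
          also have "\<dots> = C * ((LINT r:?A|lebesgue. \<bar>\<Phi> x r - pp\<bar>) + 2 * pp * h)"
            using set_integral_add(2)[OF absi[of ?A] ci[of ?A "2 * pp"]] mA
            by (simp add: set_lebesgue_integral_def mult.commute)
          also have "(LINT r:?A|lebesgue. \<bar>\<Phi> x r - pp\<bar>) \<le> (LINT r:?B|lebesgue. \<bar>\<Phi> x r - pp\<bar>)"
            unfolding set_lebesgue_integral_def
            by (rule integral_mono[OF absi[of ?A, unfolded set_integrable_def] absi[of ?B, unfolded set_integrable_def]])
              (use AB in \<open>auto simp: indicator_def\<close>)
          also have "(LINT r:?B|lebesgue. \<bar>\<Phi> x r - pp\<bar>) \<le> d * h"
            using elim by (simp add: divide_less_eq less_imp_le)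
          finally have "\<bar>l (u t) - l (u (t - h)) - h * l (v t)\<bar> \<le> C * (d * h + 2 * pp * h)"
            using C by (simp add: mult_left_mono)
          also have "\<dots> \<le> C * (3 * d) * h"
            using C elim pp(3) by (simp add: mult.assoc mult_left_mono distrib_right[symmetric] mult_right_mono)
          finally have *: "\<bar>l (u t) - l (u (t - h)) - h * l (v t)\<bar> \<le> C * (3 * d) * h" .
          have "dist ((l (u t) - l (u (t - h))) / h) (l (v t)) = \<bar>l (u t) - l (u (t - h)) - h * l (v t)\<bar> / h"
          proof -
            have "(l (u t) - l (u (t - h))) / h - l (v t) = (l (u t) - l (u (t - h)) - h * l (v t)) / h"
              using elim by (simp add: diff_divide_distrib)
            then show ?thesis
              using elim by (simp add: dist_real_def abs_divide)
          qed
          also have "\<dots> \<le> C * (3 * d)"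
            using * elim by (simp add: divide_le_eq)
          finally show ?case
            using Cd by simp
        qed
      qed
    qed
  qed
qed

lemma difference_quotient:
  assumes u: "continuous_in X T u" "weak_tderiv X T u v" and T: "T > 0"
  shows "AE t in lebesgue_on {0<..<T}. v t \<in> elts X \<and> (\<forall>l C. functional l C \<longrightarrow>
    ((\<lambda>h. (l (u t) - l (u (t - h))) / h) \<longlongrightarrow> l (v t)) (at_right 0))"
proof -
  let ?P = "\<lambda>t. v t \<in> elts X \<and> (\<forall>l C. functional l C \<longrightarrow>
    ((\<lambda>h. (l (u t) - l (u (t - h))) / h) \<longlongrightarrow> l (v t)) (at_right 0))"
  \<comment> \<open>The shift by 3 makes even the first interval nonempty: \<open>\<delta> n\<close>
    is at most T/3.\<close>
  define \<delta> where "\<delta> n = T / (real n + 3)" for n :: nat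
  have "AE t in lebesgue. \<forall>n. t \<in> {\<delta> n<..<T - \<delta> n} \<longrightarrow> ?P t"
    unfolding AE_all_countable
  proof
    fix n
    show "AE t in lebesgue. t \<in> {\<delta> n<..<T - \<delta> n} \<longrightarrow> ?P t"
    proof (rule difference_quotient_aux[OF u])
      have "\<delta> n \<le> T / 3"
        unfolding \<delta>_def by (rule divide_left_mono) (use T in auto)
      moreover have "\<delta> n > 0"
        unfolding \<delta>_def using T by (intro divide_pos_pos) auto
      ultimately show "0 < \<delta> n" "\<delta> n < T - \<delta> n" "T - \<delta> n < T"
        using T by linarith+
    qed
  qed
  then have "AE t in lebesgue. t \<in> {0<..<T} \<longrightarrow> ?P t"
  proof eventually_elim
    case (elim t)
    show ?case
    proof
      assume t: "t \<in> {0<..<T}"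
      define m where "m = min t (T - t)"
      have m: "m > 0" "m \<le> t" "m \<le> T - t"
        using t by (auto simp: m_def)
      obtain n :: nat where "real n > T / m"
        using reals_Archimedean2 by blast
      then have "T < m * (real n + 3)"
        using m(1) by (simp add: field_simps)
      then have "\<delta> n < m"
        by (simp add: \<delta>_def divide_less_eq)
      then have "t \<in> {\<delta> n<..<T - \<delta> n}"
        using m by auto
      then show "?P t"
        using elim by blast
    qed
  qed
  then show ?thesis
    by (subst AE_restrict_space_iff) auto
qed

end

section \<open>Gronwall and energy inequalities\<close>

lemma continuous_AE_zero:
  fixes f :: "real \<Rightarrow> real"
  assumes f: "continuous_on {0..T} f" and ae: "AE t in lebesgue_on {0<..<T}. f t = 0"
    and t: "t \<in> {0..T}" and T: "T > 0"
  shows "f t = 0"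
proof (rule ccontr)
  assume nz: "f t \<noteq> 0"
  have ae': "AE t in lebesgue. t \<in> {0<..<T} \<longrightarrow> f t = 0"
    using ae by (subst (asm) AE_restrict_space_iff) auto
  have "\<exists>d>0. \<forall>s\<in>{0..T}. dist s t < d \<longrightarrow> dist (f s) (f t) < \<bar>f t\<bar>"
    using f t nz unfolding continuous_on_iff by (meson zero_less_abs_iff)
  then obtain d where d: "d > 0" "\<And>s. s \<in> {0..T} \<Longrightarrow> dist s t < d \<Longrightarrow> f s \<noteq> 0"
    by (force simp: dist_real_def)
  define l r where "l = max 0 (t - d)" and "r = min T (t + d)"
  have lr: "l < r" "0 \<le> l" "r \<le> T" "t - d \<le> l" "r \<le> t + d"
    using d(1) t T by (auto simp: l_def r_def)
  have "AE s in lebesgue. s \<notin> {l<..<r}"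
    using ae'
  proof eventually_elim
    case (elim s)
    show ?case
    proof
      assume "s \<in> {l<..<r}"
      then have "s \<in> {0<..<T}" "dist s t < d"
        using lr by (auto simp: dist_real_def)
      then show False
        using elim d(2)[of s] by auto
    qed
  qed
  then have "{l<..<r} \<in> null_sets lebesgue"
    by (subst AE_iff_null_sets) auto
  then show False
    using lr(1) by (auto simp: null_sets_def)
qed

text \<open>A Gronwall inequality whose integral is replaced by length times an upper bound. On an
  interval shorter than 1/(2K) that starts at a zero, the maximum is at most half of itself, so it
  is 0; Bolzano's principle for intervals chains these pieces.\<close>

lemma Gronwall_zero:
  fixes F :: "real \<Rightarrow> real"
  assumes F: "continuous_on {0..T} F" "\<And>t. F t \<ge> 0" "F 0 = 0" and K: "K > 0" and T: "T > 0"
    and le: "\<And>s t m. 0 < s \<Longrightarrow> s < t \<Longrightarrow> t < T \<Longrightarrow> (\<And>r. r \<in> {s..t} \<Longrightarrow> F r \<le> m) \<Longrightarrow> F t - F s \<le> K * (t - s) * m"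
    and t: "t \<in> {0..T}"
  shows "F t = 0"
proof -
  \<comment> \<open>By continuity the hypothesis extends to closed intervals that may touch 0 and
    \<open>T\<close>; margins of at most a third of the length keep the inner endpoints in
    order.\<close>
  have le': "F t - F s \<le> K * (t - s) * m" if st: "0 \<le> s" "s < t" "t \<le> T" and m: "\<And>r. r \<in> {s..t} \<Longrightarrow> F r \<le> m" for s t m
  proof -
    define d where "d n = (t - s) * inverse (real (Suc n)) / 3" for n
    have d: "0 < d n" "d n \<le> (t - s) / 3" for n
    proof -
      have "(t - s) * inverse (real (Suc n)) \<le> (t - s) * 1"
        using st by (intro mult_left_mono) (auto simp: inverse_le_1_iff)
      then show "0 < d n" "d n \<le> (t - s) / 3"
        using st by (simp_all add: d_def)
    qed
    have "d \<longlonglongrightarrow> (t - s) * 0 / 3"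
      unfolding d_def by (intro tendsto_intros LIMSEQ_inverse_real_of_nat) simp
    then have d0: "d \<longlonglongrightarrow> 0"
      by simp
    have in1: "s + d n \<in> {0..T}" "t - d n \<in> {0..T}" for n
      using d[of n] st by auto
    have "(\<lambda>n. F (s + d n)) \<longlonglongrightarrow> F s"
      by (rule continuous_on_tendsto_compose[OF F(1)])
        (use in1 st d0 tendsto_add[OF tendsto_const d0, of s] in \<open>auto intro!: always_eventually\<close>)
    moreover have "(\<lambda>n. F (t - d n)) \<longlonglongrightarrow> F t"
      by (rule continuous_on_tendsto_compose[OF F(1)])
        (use in1 st d0 tendsto_diff[OF tendsto_const d0, of t] in \<open>auto intro!: always_eventually\<close>)
    ultimately have lim: "(\<lambda>n. F (t - d n) - F (s + d n)) \<longlonglongrightarrow> F t - F s"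
      by (intro tendsto_diff)
    have m0: "m \<ge> 0"
      using order_trans[OF F(2) m[of s]] st by simp
    have "F (t - d n) - F (s + d n) \<le> K * (t - s) * m" for n
    proof -
      have "F (t - d n) - F (s + d n) \<le> K * ((t - d n) - (s + d n)) * m"
        by (rule le) (use d[of n] st m in auto)
      also have "\<dots> \<le> K * (t - s) * m"
        using d[of n] K m0 by (intro mult_right_mono mult_left_mono) auto
      finally show ?thesis .
    qed
    then show ?thesis
      by (intro LIMSEQ_le_const2[OF lim]) auto
  qed
  \<comment> \<open>The predicate hands the value 0 from the left endpoint to the whole interval,
    which makes it composable.\<close>
  define P where "P a b \<longleftrightarrow> (0 \<le> a \<and> b \<le> T \<and> F a = 0 \<longrightarrow> (\<forall>r\<in>{a..b}. F r = 0))" for a b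
  have "P 0 T"
  proof (rule Bolzano[of 0 T P])
    show "0 \<le> T"
      using T by simp
  next
    fix a b c assume 2: "P a b" "P b c" "a \<le> b" "b \<le> c"
    show "P a c"
      unfolding P_def
    proof (intro impI ballI)
      fix r assume h: "0 \<le> a \<and> c \<le> T \<and> F a = 0" "r \<in> {a..c}"
      then have 3: "\<forall>r\<in>{a..b}. F r = 0"
        using 2 unfolding P_def by force
      then have "F b = 0"
        using 2 by simp
      then have "\<forall>r\<in>{b..c}. F r = 0"
        using 2 h unfolding P_def by force
      then show "F r = 0"
        using 3 h by (cases "r \<le> b") auto
    qed
  next
    fix x assume "0 \<le> x" "x \<le> T"
    have loc: "P a b" if "b - a < 1 / (2 * K)" "a \<le> b" for a b
      unfolding P_def
    proof (intro impI ballI)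
      fix r assume h: "0 \<le> a \<and> b \<le> T \<and> F a = 0" "r \<in> {a..b}"
      have "continuous_on {a..b} F"
        by (rule continuous_on_subset[OF F(1)]) (use h in auto)
      then obtain c where c: "c \<in> {a..b}" "\<And>y. y \<in> {a..b} \<Longrightarrow> F y \<le> F c"
        using continuous_attains_sup[of "{a..b}" F] \<open>a \<le> b\<close> by auto
      have "F c \<le> 0"
      proof (cases "a = c")
        case False
        have "F c - F a \<le> K * (c - a) * F c"
          by (rule le') (use c h False in auto)
        also have "\<dots> \<le> K * (1 / (2 * K)) * F c"
          using c(1) that K F(2) by (intro mult_right_mono mult_left_mono) auto
        also have "\<dots> = F c / 2"
          using K by simp
        finally show ?thesis
          using h by simp
      qed (use h in simp)
      then show "F r = 0"
        using c(2)[OF h(2)] F(2)[of r] by simp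
    qed
    show "\<exists>d>0. \<forall>a b. a \<le> x \<and> x \<le> b \<and> b - a < d \<longrightarrow> P a b"
      by (rule exI[of _ "1 / (2 * K)"]) (use K loc in auto)
  qed
  then show ?thesis
    using F(3) t unfolding P_def by simp
qed

lemma L2_pairing:
  assumes "f \<in> elts (H_space \<Omega>)" "g \<in> elts (H_space \<Omega>)"
  shows H_pairing_integrable: "integrable (lebesgue_on \<Omega>) (\<lambda>x. f x \<bullet> g x)"
    and H_pairing_le: "\<bar>pairing \<Omega> f g\<bar> \<le> snorm (H_space \<Omega>) f * snorm (H_space \<Omega>) g"
  using L_space_pairing_integrable[OF assms] L_space_pairing_le[OF assms] by simp_all

lemma pairing_commute: "pairing \<Omega> f g = pairing \<Omega> g f"
  by (simp add: pairing_def inner_commute)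

lemma pairing_add_scaleR_left:
  assumes "integrable (lebesgue_on \<Omega>) (\<lambda>x. f x \<bullet> h x)" "integrable (lebesgue_on \<Omega>) (\<lambda>x. g x \<bullet> h x)"
  shows "pairing \<Omega> (f + c *\<^sub>R g) h = pairing \<Omega> f h + c * pairing \<Omega> g h"
  using assms by (simp add: pairing_def scaleR_fun_def inner_add_left)

lemma H_pairing_lin:
  assumes "f \<in> elts (H_space \<Omega>)" "g \<in> elts (H_space \<Omega>)" "h \<in> elts (H_space \<Omega>)"
  shows "pairing \<Omega> (f + c *\<^sub>R g) h = pairing \<Omega> f h + c * pairing \<Omega> g h"
  by (intro pairing_add_scaleR_left H_pairing_integrable assms)

lemma H_pairing_self: "pairing \<Omega> f f = (snorm (H_space \<Omega>) f)\<^sup>2"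
proof -
  have "(LINT x|lebesgue_on \<Omega>. norm (f x) powr 2) \<ge> 0"
    by simp
  then show ?thesis
    by (simp add: snorm_L_space pairing_def powr_half_sqrt dot_square_norm)
qed

lemma seminormed_L_space:
  assumes "q \<ge> 1" "subspace S"
  shows "seminormed_fspace (L_space \<Omega> S q) (snorm (L_space \<Omega> S q))"
  by standard (use assms in \<open>auto simp: L_space_zero L_space_nonneg L_space_snorm_scaleR
      intro!: L_space_triangle L_space_add L_space_scaleR\<close>)

lemma H_functional:
  fixes h :: "real^'n \<Rightarrow> real^'n"
  assumes "h \<in> elts (H_space \<Omega>)"
  shows "seminormed_fspace.functional (H_space \<Omega>) (snorm (H_space \<Omega>)) (\<lambda>x. pairing \<Omega> x h) (snorm (H_space \<Omega>) h)"
proof -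
  interpret seminormed_fspace "H_space \<Omega>" "snorm (H_space \<Omega>)"
    by (rule seminormed_L_space) (auto simp: subspace_UNIV)
  show ?thesis
    unfolding functional_def using H_pairing_lin[OF _ _ assms] H_pairing_le[OF _ assms]
    by (auto simp: L_space_nonneg mult.commute)
qed

lemma continuous_pairing:
  fixes y z :: "real \<Rightarrow> real^'n \<Rightarrow> real^'n"
  assumes y: "continuous_in (H_space \<Omega>) T y" and z: "continuous_in (H_space \<Omega>) T z"
  shows "continuous_on {0..T} (\<lambda>t. pairing \<Omega> (y t) (z t))"
  unfolding continuous_on_def
proof
  fix t assume t: "t \<in> {0..T}"
  interpret seminormed_fspace "H_space \<Omega>" "snorm (H_space \<Omega>) :: (real^'n \<Rightarrow> real^'n) \<Rightarrow> real"
    by (rule seminormed_L_space) (auto simp: subspace_UNIV)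
  let ?A = "\<lambda>s. snorm (H_space \<Omega>) (y s - y t)" and ?B = "\<lambda>s. snorm (H_space \<Omega>) (z s - z t)"
  let ?m = "\<lambda>s. ?A s * (?B s + snorm (H_space \<Omega>) (z t)) + snorm (H_space \<Omega>) (y t) * ?B s"
  have E: "y s \<in> elts (H_space \<Omega>)" "z s \<in> elts (H_space \<Omega>)" if "s \<in> {0..T}" for s
    using y z that by (auto simp: continuous_in_def)
  have "((\<lambda>s. pairing \<Omega> (y s) (z s) - pairing \<Omega> (y t) (z t)) \<longlongrightarrow> 0) (at t within {0..T})"
  proof (rule Lim_null_comparison)
    have "(?m \<longlongrightarrow> 0 * (0 + snorm (H_space \<Omega>) (z t)) + snorm (H_space \<Omega>) (y t) * 0) (at t within {0..T})"
      using y z t by (intro tendsto_add tendsto_mult tendsto_const) (auto simp: continuous_in_def)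
    then show "(?m \<longlongrightarrow> 0) (at t within {0..T})"
      by simp
    show "\<forall>\<^sub>F s in at t within {0..T}. norm (pairing \<Omega> (y s) (z s) - pairing \<Omega> (y t) (z t)) \<le> ?m s"
      unfolding eventually_at_filter
    proof (intro always_eventually allI impI)
      fix s assume s: "s \<in> {0..T}"
      note e = E[OF s] E[OF t]
      have "pairing \<Omega> (y s - y t) (z s) = pairing \<Omega> (y s) (z s) - pairing \<Omega> (y t) (z s)"
        using H_pairing_lin[OF e(1,3,2), of "-1"] by simp
      moreover have "pairing \<Omega> (z s - z t) (y t) = pairing \<Omega> (z s) (y t) - pairing \<Omega> (z t) (y t)"
        using H_pairing_lin[OF e(2,4,3), of "-1"] by simp
      ultimately have "pairing \<Omega> (y s) (z s) - pairing \<Omega> (y t) (z t)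
          = pairing \<Omega> (y s - y t) (z s) + pairing \<Omega> (z s - z t) (y t)"
        by (simp add: pairing_commute[of \<Omega> "y t"])
      moreover have "\<bar>pairing \<Omega> (y s - y t) (z s)\<bar> \<le> ?A s * snorm (H_space \<Omega>) (z s)"
        by (rule H_pairing_le[OF diff[OF e(1,3)] e(2)])
      moreover have "?A s * snorm (H_space \<Omega>) (z s) \<le> ?A s * (?B s + snorm (H_space \<Omega>) (z t))"
        using N_add[OF diff[OF e(2,4)] e(4)] by (intro mult_left_mono L_space_nonneg) simp
      moreover have "\<bar>pairing \<Omega> (z s - z t) (y t)\<bar> \<le> ?B s * snorm (H_space \<Omega>) (y t)"
        by (rule H_pairing_le[OF diff[OF e(2,4)] e(3)])
      ultimately show "norm (pairing \<Omega> (y s) (z s) - pairing \<Omega> (y t) (z t)) \<le> ?m s"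
        by (simp add: mult.commute)
    qed
  qed
  then show "((\<lambda>t. pairing \<Omega> (y t) (z t)) \<longlongrightarrow> pairing \<Omega> (y t) (z t)) (at t within {0..T})"
    by (rule LIM_zero_cancel)
qed

lemma continuous_in_lin:
  assumes "seminormed_fspace X (snorm X)" and y: "continuous_in X T y" and z: "continuous_in X T z"
  shows "continuous_in X T (\<lambda>t. y t + c *\<^sub>R z t)"
proof -
  interpret seminormed_fspace X "snorm X" by fact
  show ?thesis
    unfolding continuous_in_def
  proof (intro ballI conjI)
    fix t assume t: "t \<in> {0..T}"
    have E: "y s \<in> elts X" "z s \<in> elts X" if "s \<in> {0..T}" for s
      using y z that by (auto simp: continuous_in_def)
    show "y t + c *\<^sub>R z t \<in> elts X"
      by (rule lin[OF E[OF t]])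
    let ?m = "\<lambda>s. snorm X (y s - y t) + \<bar>c\<bar> * snorm X (z s - z t)"
    show "((\<lambda>s. snorm X (y s + c *\<^sub>R z s - (y t + c *\<^sub>R z t))) \<longlongrightarrow> 0) (at t within {0..T})"
    proof (rule Lim_null_comparison)
      have "(?m \<longlongrightarrow> 0 + \<bar>c\<bar> * 0) (at t within {0..T})"
        using y z t by (intro tendsto_add tendsto_mult tendsto_const) (auto simp: continuous_in_def)
      then show "(?m \<longlongrightarrow> 0) (at t within {0..T})"
        by simp
      show "\<forall>\<^sub>F s in at t within {0..T}. norm (snorm X (y s + c *\<^sub>R z s - (y t + c *\<^sub>R z t))) \<le> ?m s"
        unfolding eventually_at_filter
      proof (intro always_eventually allI impI)
        fix s assume s: "s \<in> {0..T}"
        have eq: "y s + c *\<^sub>R z s - (y t + c *\<^sub>R z t) = (y s - y t) + c *\<^sub>R (z s - z t)"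
          by (simp add: scaleR_diff_right)
        note d = diff[OF E(1)[OF s] E(1)[OF t]] diff[OF E(2)[OF s] E(2)[OF t]]
        have "snorm X ((y s - y t) + c *\<^sub>R (z s - z t)) \<le> ?m s"
          using N_add[OF d(1) scaleR[OF d(2), of c]] unfolding N_scaleR[OF d(2)] .
        then show "norm (snorm X (y s + c *\<^sub>R z s - (y t + c *\<^sub>R z t))) \<le> ?m s"
          unfolding eq using N_nonneg by simp
      qed
    qed
  qed
qed

text \<open>Formally the derivative of |y|^2 is 2 (b, y), but the equation for \<open>y\<close> is
  available only against fixed elements \<open>h\<close>. On a short interval from a to c the fixed
  element y(a) + y(c) is used: it turns the increment into |y(c)|^2 - |y(a)|^2 and differs little
  from 2 y(r). The errors add up to a small multiple of the integral of \<open>nb\<close>.\<close>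

lemma energy_inequality:
  fixes \<Omega> :: "(real^'n) set" and y b :: "real \<Rightarrow> real^'n \<Rightarrow> real^'n" and g nb :: "real \<Rightarrow> real"
    and \<beta> :: "real \<Rightarrow> (real^'n \<Rightarrow> real^'n) \<Rightarrow> real"
  defines "H \<equiv> H_space \<Omega>"
  assumes y: "continuous_in H T y"
    and int: "\<And>h s t. h \<in> elts H \<Longrightarrow> 0 < s \<Longrightarrow> s < t \<Longrightarrow> t < T \<Longrightarrow>
      set_integrable lebesgue {s<..t} (\<lambda>r. \<beta> r h) \<and>
      pairing \<Omega> (y t) h - pairing \<Omega> (y s) h = (LINT r:{s<..t}|lebesgue. \<beta> r h)"
    and b: "AE r in lebesgue_on {0<..<T}. b r \<in> elts H \<and> snorm H (b r) \<le> nb r \<and> pairing \<Omega> (b r) (y r) \<le> g r \<and>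
      (\<forall>h\<in>elts H. \<beta> r h = pairing \<Omega> (b r) h)"
    and nb: "integrable (lebesgue_on {0<..<T}) nb" and g: "continuous_on {0..T} g"
    and st: "0 < s" "s < t" "t < T"
  shows "(snorm H (y t))\<^sup>2 - (snorm H (y s))\<^sup>2 \<le> 2 * (LINT r:{s<..t}|lebesgue. g r)"
proof -
  interpret seminormed_fspace H "snorm H :: (real^'n \<Rightarrow> real^'n) \<Rightarrow> real"
    unfolding H_def by (rule seminormed_L_space) (auto simp: subspace_UNIV)
  have E: "y r \<in> elts H" if "r \<in> {0..T}" for r
    using y that by (simp add: continuous_in_def)
  have b': "AE r in lebesgue. r \<in> {0<..<T} \<longrightarrow> b r \<in> elts H \<and> snorm H (b r) \<le> nb r \<and> pairing \<Omega> (b r) (y r) \<le> g r \<and>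
      (\<forall>h\<in>elts H. \<beta> r h = pairing \<Omega> (b r) h)"
    using b by (subst (asm) AE_restrict_space_iff) auto
  have nbi: "set_integrable lebesgue S nb" if "S \<in> sets lebesgue" "S \<subseteq> {0<..<T}" for S
  proof -
    have "set_integrable lebesgue {0<..<T} nb"
      using nb by (simp add: set_integrable_def integrable_restrict_space)
    then show ?thesis
      by (rule set_integrable_subset[OF _ that])
  qed
  have gi: "set_integrable lebesgue S g" if "S \<in> sets lebesgue" "S \<subseteq> {0<..<T}" for S
  proof -
    have "integrable lborel (\<lambda>x. indicator {0..T} x *\<^sub>R g x)"
      by (rule borel_integrable_compact[OF compact_Icc g])
    then have "set_integrable lebesgue {0..T} g"
      unfolding set_integrable_def by (subst integrable_completion) auto
    then show ?thesis
      by (rule set_integrable_subset[OF _ that(1)]) (use that in auto)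
  qed
  have main: "(snorm H (y t))\<^sup>2 - (snorm H (y s))\<^sup>2 \<le> (LINT r:{s<..t}|lebesgue. 2 * g r + 2 * e * nb r)"
    if e: "e > 0" for e
  proof -
    let ?k = "\<lambda>r. 2 * g r + 2 * e * nb r"
    have ki: "set_integrable lebesgue S ?k" if "S \<in> sets lebesgue" "S \<subseteq> {0<..<T}" for S
      by (intro set_integral_add(1) set_integrable_mult_right gi nbi that)
    \<comment> \<open>Additive over adjacent intervals, so Bolzano's principle passes from short
      intervals to the whole of [s, t].\<close>
    define P where "P a c \<longleftrightarrow> (s \<le> a \<and> c \<le> t \<longrightarrow>
        (snorm H (y c))\<^sup>2 - (snorm H (y a))\<^sup>2 \<le> (LINT r:{a<..c}|lebesgue. ?k r))" for a c
    have "P s t"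
    proof (rule Bolzano[of s t P])
      show "s \<le> t"
        using st by simp
    next
      fix a c d assume 2: "P a c" "P c d" "a \<le> c" "c \<le> d"
      have "(LINT r:{a<..d}|lebesgue. ?k r) = (LINT r:{a<..c}|lebesgue. ?k r) + (LINT r:{c<..d}|lebesgue. ?k r)"
        if "s \<le> a" "d \<le> t"
      proof -
        have "{a<..d} = {a<..c} \<union> {c<..d}"
          using 2 by auto
        moreover have "(LINT r:{a<..c} \<union> {c<..d}|lebesgue. ?k r) = (LINT r:{a<..c}|lebesgue. ?k r) + (LINT r:{c<..d}|lebesgue. ?k r)"
          by (rule set_integral_Un[OF _ ki ki]) (use that 2 st in auto)
        ultimately show ?thesis
          by simp
      qed
      then show "P a d"
        using 2 unfolding P_def by auto
    next
      fix x assume 3: "s \<le> x" "x \<le> t"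
      have x: "x \<in> {0..T}"
        using 3 st by auto
      have "((\<lambda>r. snorm H (y r - y x)) \<longlongrightarrow> 0) (at x within {0..T})"
        using y x by (simp add: continuous_in_def)
      then have "\<forall>\<^sub>F r in at x within {0..T}. snorm H (y r - y x) < e / 2"
        using e by (intro order_tendstoD(2)) auto
      then obtain d where d: "d > 0" "\<And>r. r \<in> {0..T} \<Longrightarrow> r \<noteq> x \<Longrightarrow> dist r x < d \<Longrightarrow> snorm H (y r - y x) < e / 2"
        unfolding eventually_at by blast
      have d': "snorm H (y r - y x) \<le> e / 2" if "r \<in> {0..T}" "dist r x < d" for r
      proof (cases "r = x")
        case True
        then show ?thesis
          using e N_scaleR[OF zero, of 0] by simp
      qed (use d(2)[OF that(1) _ that(2)] in simp)
      have "P a c" if ac: "a \<le> x" "x \<le> c" "c - a < d" for a c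
        unfolding P_def
      proof (intro impI)
        assume h: "s \<le> a \<and> c \<le> t"
        show "(snorm H (y c))\<^sup>2 - (snorm H (y a))\<^sup>2 \<le> (LINT r:{a<..c}|lebesgue. ?k r)"
        proof (cases "a = c")
          case True
          then show ?thesis
            by (simp add: set_lebesgue_integral_def)
        next
          case False
          then have ac': "0 < a" "a < c" "c < T"
            using ac h st by auto
          have aE: "y a \<in> elts H" and cE: "y c \<in> elts H"
            using ac' by (auto intro!: E)
          define k where "k = y c + y a"
          have kE: "k \<in> elts H"
            unfolding k_def by (rule add[OF cE aE])
          have close: "snorm H (y r - y r') \<le> e" if "r \<in> {a..c}" "r' \<in> {a..c}" for r r'
          proof -
            have rr: "r \<in> {0..T}" "r' \<in> {0..T}" "dist r x < d" "dist r' x < d"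
              using that ac ac' by (auto simp: dist_real_def)
            show ?thesis
              using N_add[OF diff[OF E[OF rr(1)] E[OF x]] diff[OF E[OF x] E[OF rr(2)]]]
                N_commute[OF E[OF x] E[OF rr(2)]] d'[OF rr(1,3)] d'[OF rr(2,4)] by simp
          qed
          have lin1: "pairing \<Omega> (f1 + f2) k' = pairing \<Omega> f1 k' + pairing \<Omega> f2 k'"
            if "f1 \<in> elts H" "f2 \<in> elts H" "k' \<in> elts H" for f1 f2 k'
            using H_pairing_lin[of f1 \<Omega> f2 k' 1] that unfolding H_def by simp
          have "(snorm H (y c))\<^sup>2 - (snorm H (y a))\<^sup>2 = pairing \<Omega> (y c) k - pairing \<Omega> (y a) k"
            unfolding k_def H_def H_pairing_self[symmetric] using lin1[OF cE aE cE] lin1[OF cE aE aE]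
            by (simp add: pairing_commute[of \<Omega> _ "y c + y a"] pairing_commute[of \<Omega> "y a" "y c"])
          also have "\<dots> = (LINT r:{a<..c}|lebesgue. \<beta> r k)"
            using int[OF kE ac'] by blast
          also have "\<dots> \<le> (LINT r:{a<..c}|lebesgue. ?k r)"
          proof (rule set_integral_mono_AE)
            show "set_integrable lebesgue {a<..c} (\<lambda>r. \<beta> r k)"
              using int[OF kE ac'] by blast
            show "set_integrable lebesgue {a<..c} ?k"
              by (rule ki) (use ac' in auto)
            show "AE r\<in>{a<..c} in lebesgue. \<beta> r k \<le> ?k r"
              using b'
            proof eventually_elim
              case (elim r)
              show ?case
              proof
                assume r: "r \<in> {a<..c}"
                then have rI: "r \<in> {0<..<T}" "r \<in> {0..T}" "r \<in> {a..c}"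
                  using ac' by auto
                then have br: "b r \<in> elts H" "snorm H (b r) \<le> nb r" "pairing \<Omega> (b r) (y r) \<le> g r"
                    and \<beta>k: "\<beta> r k = pairing \<Omega> (b r) k"
                  using elim kE by auto
                have rE: "y r \<in> elts H"
                  by (rule E[OF rI(2)])
                \<comment> \<open>Deviation of y(c) + y(a) from 2 y(r); its norm is at most 2 e on a
                  short interval.\<close>
                define m where "m = (y c - y r) + (y a - y r)"
                have mE: "m \<in> elts H"
                  unfolding m_def by (intro add diff aE cE rE)
                have "snorm H m \<le> 2 * e"
                  using N_add[OF diff[OF cE rE] diff[OF aE rE]] close[OF _ rI(3), of c] close[OF _ rI(3), of a] ac'
                  unfolding m_def by simp
                then have m: "snorm H (b r) * snorm H m \<le> nb r * (2 * e)"
                  using br(2) N_nonneg e by (intro mult_mono) (auto intro: order_trans[OF N_nonneg])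
                have "k = (y r + y r) + m"
                  by (simp add: k_def m_def)
                then have "pairing \<Omega> (b r) k = 2 * pairing \<Omega> (b r) (y r) + pairing \<Omega> (b r) m"
                  using lin1[OF add[OF rE rE] mE br(1)] lin1[OF rE rE br(1)] by (simp add: pairing_commute[of \<Omega> "b r"])
                moreover have "\<bar>pairing \<Omega> (b r) m\<bar> \<le> snorm H (b r) * snorm H m"
                  using H_pairing_le[of "b r" \<Omega> m] br(1) mE unfolding H_def by blast
                ultimately show "\<beta> r k \<le> ?k r"
                  unfolding \<beta>k using m br(3) by (simp add: mult.commute)
              qed
            qed
          qed
          finally show ?thesis .
        qed
      qed
      then show "\<exists>d>0. \<forall>a b. a \<le> x \<and> x \<le> b \<and> b - a < d \<longrightarrow> P a b"
        using d(1) by blast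
    qed
    then show ?thesis
      by (simp add: P_def)
  qed
  have si: "{s<..t} \<in> sets lebesgue" "{s<..t} \<subseteq> {0<..<T}"
    using st by auto
  define Ig In where "Ig = (LINT r:{s<..t}|lebesgue. g r)" and "In = (LINT r:{s<..t}|lebesgue. nb r)"
  have e2: "(snorm H (y t))\<^sup>2 - (snorm H (y s))\<^sup>2 \<le> 2 * Ig + 2 * e * In" if "e > 0" for e
    using main[OF that] set_integral_add(2)[OF set_integrable_mult_right[OF gi[OF si], of 2] set_integrable_mult_right[OF nbi[OF si], of "2 * e"]]
    by (simp add: Ig_def In_def)
  \<comment> \<open>The integral of \<open>nb\<close> does not depend on \<open>e\<close>, so the
    error term disappears in the limit.\<close>
  have "((\<lambda>e. 2 * Ig + 2 * e * In) \<longlongrightarrow> 2 * Ig + 2 * 0 * In) (at_right 0)"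
    by (intro tendsto_intros)
  then have "(snorm H (y t))\<^sup>2 - (snorm H (y s))\<^sup>2 \<le> 2 * Ig + 2 * 0 * In"
    by (rule tendsto_lowerbound) (auto intro!: eventually_mono[OF eventually_at_right_less] e2)
  then show ?thesis
    by (simp add: Ig_def)
qed

section \<open>Uniqueness of weak solutions\<close>

text \<open>Sum of the tangent inequalities at \<open>x\<close> and \<open>y\<close>. Each follows
  on a segment, where the convexity bound on difference quotients passes to the derivative at the
  starting point.\<close>

lemma convex_gradient_monotone:
  fixes \<phi> :: "'a::euclidean_space \<Rightarrow> real"
  assumes S: "subspace S" and conv: "convex_on S \<phi>"
    and der: "\<And>\<xi>. \<xi> \<in> S \<Longrightarrow> (\<phi> has_derivative (\<lambda>\<eta>. G \<xi> \<bullet> \<eta>)) (at \<xi> within S)"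
    and x: "x \<in> S" and y: "y \<in> S"
  shows "(G x - G y) \<bullet> (x - y) \<ge> 0"
proof -
  have tangent: "\<phi> z \<ge> \<phi> w + G w \<bullet> (z - w)" if w: "w \<in> S" and z: "z \<in> S" for w z
  proof -
    let ?p = "\<lambda>t. w + t *\<^sub>R (z - w)"
    have inS: "?p t \<in> S" for t
      by (intro subspace_add[OF S] subspace_scale[OF S] subspace_diff[OF S] w z)
    have "(?p has_derivative (\<lambda>t. t *\<^sub>R (z - w))) (at 0 within {0..1})"
      by (auto intro!: derivative_eq_intros)
    moreover have "(\<phi> has_derivative (\<lambda>\<eta>. G w \<bullet> \<eta>)) (at (?p 0) within ?p ` {0..1})"
      using der[OF w] inS by (auto intro: has_derivative_subset)
    ultimately have "((\<lambda>t. \<phi> (?p t)) has_derivative (\<lambda>t. G w \<bullet> (t *\<^sub>R (z - w)))) (at 0 within {0..1})"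
      by (rule has_derivative_in_compose)
    moreover have "(\<lambda>t. G w \<bullet> (t *\<^sub>R (z - w))) = (*) (G w \<bullet> (z - w))"
      by (simp add: fun_eq_iff mult.commute)
    ultimately have "((\<lambda>t. \<phi> (?p t)) has_real_derivative G w \<bullet> (z - w)) (at 0 within {0..1})"
      by (simp only: has_field_derivative_def)
    then have lim: "((\<lambda>t. (\<phi> (?p t) - \<phi> w) / t) \<longlongrightarrow> G w \<bullet> (z - w)) (at 0 within {0..1})"
      by (simp add: has_field_derivative_iff)
    have "G w \<bullet> (z - w) \<le> \<phi> z - \<phi> w"
    proof (rule tendsto_upperbound[OF lim])
      show "\<forall>\<^sub>F t in at 0 within {0..1}. (\<phi> (?p t) - \<phi> w) / t \<le> \<phi> z - \<phi> w"
        unfolding eventually_at_filter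
      proof (intro always_eventually allI impI)
        fix t :: real assume t: "t \<noteq> 0" "t \<in> {0..1}"
        have "\<phi> ((1 - t) *\<^sub>R w + t *\<^sub>R z) \<le> (1 - t) * \<phi> w + t * \<phi> z"
          by (rule convex_onD[OF conv _ _ w z]) (use t in auto)
        moreover have "(1 - t) *\<^sub>R w + t *\<^sub>R z = ?p t"
          by (simp add: algebra_simps)
        ultimately have "\<phi> (?p t) - \<phi> w \<le> t * (\<phi> z - \<phi> w)"
          by (simp add: algebra_simps)
        then show "(\<phi> (?p t) - \<phi> w) / t \<le> \<phi> z - \<phi> w"
          using t by (simp add: divide_le_eq mult.commute)
      qed
      show "at 0 within {0..1::real} \<noteq> bot"
        by (simp add: at_within_Icc_at_right)
    qed
    then show ?thesis
      by simp
  qed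
  show ?thesis
    using tangent[OF x y] tangent[OF y x] by (simp add: inner_diff_left inner_diff_right)
qed

text \<open>The choice in \<open>tderiv\<close> can be met either way: a continuous weak derivative
  is a witness if there is one, and otherwise the continuity clause is void.\<close>

lemma tderiv_props:
  assumes "weak_tderiv X T u w"
  shows "weak_tderiv X T u (tderiv X T u)"
    and "continuous_in X T w \<Longrightarrow> continuous_in X T (tderiv X T u)"
proof -
  let ?P = "\<lambda>v. weak_tderiv X T u v \<and>
     ((\<exists>w. weak_tderiv X T u w \<and> continuous_in X T w) \<longrightarrow> continuous_in X T v)"
  have "\<exists>v. ?P v"
  proof (cases "\<exists>w. weak_tderiv X T u w \<and> continuous_in X T w")
    case True
    then show ?thesis
      by blast
  next
    case False
    then show ?thesis
      using assms by blast
  qed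
  then have "?P (tderiv X T u)"
    unfolding tderiv_def by (rule someI_ex)
  then show "weak_tderiv X T u (tderiv X T u)" "continuous_in X T w \<Longrightarrow> continuous_in X T (tderiv X T u)"
    using assms by blast+
qed

section \<open>Sobolev seminorms and product test functions\<close>

lemma seminormed_W_space:
  fixes U :: "(real^'n) set"
  assumes U: "open U" and q: "q \<ge> 1"
  shows "seminormed_fspace (W_space U q) (\<lambda>x. snorm (L_space U UNIV q) (sym_grad U x))"
proof
  have q0: "q > 0"
    using q by simp
  fix x y :: "real^'n \<Rightarrow> real^'n" and c :: real
  show "0 \<in> elts (W_space U q)"
    by (rule W_space_zero)
  show "snorm (L_space U UNIV q) (sym_grad U x) \<ge> 0"
    by (rule L_space_nonneg)
  show "snorm (L_space U UNIV q) (sym_grad U x) \<le> snorm (W_space U q) x"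
    by (rule sym_grad_le_snorm_W[OF q])
  assume x: "x \<in> elts (W_space U q)"
  have ex: "sym_grad U x \<in> elts (L_space U UNIV q)"
    by (rule L_space_elts_mono[OF sym_grad_L[OF U x q0]]) simp
  have "AE z in lebesgue_on U. (c *\<^sub>R sym_grad U x) z = sym_grad U (c *\<^sub>R x) z"
    using AE_sym_grad_scaleR[OF U x q0, of c] by eventually_elim (simp add: scaleR_fun_def)
  then show "snorm (L_space U UNIV q) (sym_grad U (c *\<^sub>R x)) = \<bar>c\<bar> * snorm (L_space U UNIV q) (sym_grad U x)"
    using L_space_snorm_AE_cong[where U=U and f="c *\<^sub>R sym_grad U x" and g="sym_grad U (c *\<^sub>R x)" and S=UNIV and q=q] L_space_scaleR[OF ex subspace_UNIV, of c] sets_lebesgue_open[OF U]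
    by (simp add: L_space_snorm_scaleR[OF q0] L_space_elts_iff)
  assume y: "y \<in> elts (W_space U q)"
  have ey: "sym_grad U y \<in> elts (L_space U UNIV q)"
    by (rule L_space_elts_mono[OF sym_grad_L[OF U y q0]]) simp
  show "x + c *\<^sub>R y \<in> elts (W_space U q)"
    by (rule W_space_add_scaleR(1)[OF U x y q0])
  have "AE z in lebesgue_on U. (sym_grad U x + sym_grad U y) z = sym_grad U (x + y) z"
    using AE_sym_grad_add_scaleR[OF U x y q0, of 1] by eventually_elim simp
  then have eq: "snorm (L_space U UNIV q) (sym_grad U x + sym_grad U y) = snorm (L_space U UNIV q) (sym_grad U (x + y))"
    using L_space_add[OF ex ey q0 subspace_UNIV] sets_lebesgue_open[OF U]
    by (intro L_space_snorm_AE_cong) (auto simp: L_space_elts_iff)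
  show "snorm (L_space U UNIV q) (sym_grad U (x + y)) \<le> snorm (L_space U UNIV q) (sym_grad U x) + snorm (L_space U UNIV q) (sym_grad U y)"
    unfolding eq[symmetric] by (rule L_space_triangle[OF ex ey q])
qed

text \<open>A triangle inequality with constant 4, obtained from the exact ones for the two parts of
  the norm. It suffices where norms are only shown to tend to 0 or to vanish.\<close>

lemma snorm_W_add_le:
  fixes U :: "(real^'n) set"
  assumes U: "open U" and q: "q \<ge> 1" and x: "x \<in> elts (W_space U q)" and y: "y \<in> elts (W_space U q)"
  shows "snorm (W_space U q) (x + y) \<le> 4 * (snorm (W_space U q) x + snorm (W_space U q) y)"
proof -
  interpret seminormed_fspace "W_space U q" "\<lambda>x. snorm (L_space U UNIV q) (sym_grad U x)"
    by (rule seminormed_W_space[OF U q])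
  have "snorm (W_space U q) (x + y) \<le> 2 * (snorm (L_space U UNIV q) (x + y) + snorm (L_space U UNIV q) (sym_grad U (x + y)))"
    by (rule snorm_W_le[OF q])
  also have "\<dots> \<le> 2 * ((snorm (L_space U UNIV q) x + snorm (L_space U UNIV q) y)
      + (snorm (L_space U UNIV q) (sym_grad U x) + snorm (L_space U UNIV q) (sym_grad U y)))"
    using L_space_triangle[OF W_space_L[OF x] W_space_L[OF y] q] N_add[OF x y] by simp
  also have "\<dots> \<le> 4 * (snorm (W_space U q) x + snorm (W_space U q) y)"
    using L_le_snorm_W[OF q, of U x] L_le_snorm_W[OF q, of U y] N_le[OF x] N_le[OF y] by simp
  finally show ?thesis .
qed

lemma snorm_W_scaleR:
  fixes U :: "(real^'n) set"
  assumes U: "open U" and q: "q \<ge> 1" and x: "x \<in> elts (W_space U q)"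
  shows "snorm (W_space U q) (c *\<^sub>R x) \<le> 2 * (\<bar>c\<bar> * (snorm (L_space U UNIV q) x + snorm (L_space U UNIV q) (sym_grad U x)))"
proof -
  interpret seminormed_fspace "W_space U q" "\<lambda>x. snorm (L_space U UNIV q) (sym_grad U x)"
    by (rule seminormed_W_space[OF U q])
  have "q > 0"
    using q by simp
  then show ?thesis
    using snorm_W_le[OF q, of U "c *\<^sub>R x"] N_scaleR[OF x, of c]
    by (simp add: L_space_snorm_scaleR distrib_left)
qed

text \<open>The test functions used in the uniqueness proof: a fixed displacement, switched on in time.\<close>

lemma tensor_cderiv:
  fixes x :: "real^'n \<Rightarrow> real^'n"
  assumes U: "open U" and q: "q \<ge> 1" and x: "x \<in> elts (W_space U q)" and \<psi>: "smooth \<psi>"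
  defines "V \<equiv> W_space U q" and "\<phi> \<equiv> \<lambda>t. \<psi> t *\<^sub>R x"
  shows "has_cderiv_at V \<phi> (cderiv V \<phi> t) t"
    and "snorm V (cderiv V \<phi> t - deriv \<psi> t *\<^sub>R x) = 0"
    and "((\<lambda>s. snorm V (cderiv V \<phi> s - cderiv V \<phi> t)) \<longlongrightarrow> 0) (at t)"
proof -
  interpret seminormed_fspace V "\<lambda>x. snorm (L_space U UNIV q) (sym_grad U x)"
    unfolding V_def by (rule seminormed_W_space[OF U q])
  define Z where "Z = 2 * (snorm (L_space U UNIV q) x + snorm (L_space U UNIV q) (sym_grad U x))"
  have xV: "x \<in> elts V"
    using x by (simp add: V_def)
  have sc: "snorm V (c *\<^sub>R x) \<le> \<bar>c\<bar> * Z" for c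
    using snorm_W_scaleR[OF U q x, of c] unfolding V_def Z_def by (simp add: algebra_simps)
  have nn: "snorm V y \<ge> 0" for y
    unfolding V_def by (rule snorm_W_space_nonneg)
  have minus: "snorm V (y - z) = snorm V (z - y)" if "y \<in> elts V" "z \<in> elts V" for y z
    using N_commute[OF that] unfolding V_def snorm_W_space
    by (simp only: L_space_snorm_minus_commute[of U UNIV q y z])
  have tri: "snorm V (y + z) \<le> 4 * (snorm V y + snorm V z)" if "y \<in> elts V" "z \<in> elts V" for y z
    using snorm_W_add_le[OF U q] that unfolding V_def by blast
  have d\<psi>: "(\<psi> has_real_derivative frechet_derivative \<psi> (at t) 1) (at t)" for t
  proof -
    have "frechet_derivative \<psi> (at t) h = frechet_derivative \<psi> (at t) 1 * h" for h
      using linear_cmul[OF linear_frechet_derivative_smooth[OF \<psi>, of t], of h 1] by (simp add: mult.commute)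
    then have "frechet_derivative \<psi> (at t) = (*) (frechet_derivative \<psi> (at t) 1)"
      by (rule ext)
    then show ?thesis
      using smooth_has_derivative[OF \<psi>, of t] by (simp only: has_field_derivative_def)
  qed
  then have der_eq: "deriv \<psi> t = frechet_derivative \<psi> (at t) 1" for t
    by (rule DERIV_imp_deriv)
  have hc: "has_cderiv_at V \<phi> (deriv \<psi> t *\<^sub>R x) t" for t
    unfolding has_cderiv_at_def
  proof
    show "deriv \<psi> t *\<^sub>R x \<in> elts V"
      by (rule scaleR[OF xV])
    have "((\<lambda>h. (\<psi> (t + h) - \<psi> t) / h - deriv \<psi> t) \<longlongrightarrow> 0) (at 0)"
      using d\<psi>[of t] unfolding DERIV_def der_eq[symmetric] by (rule LIM_zero)
    then have "((\<lambda>h. \<bar>(\<psi> (t + h) - \<psi> t) / h - deriv \<psi> t\<bar> * Z) \<longlongrightarrow> 0 * Z) (at 0)"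
      by (intro tendsto_mult tendsto_const tendsto_rabs_zero)
    then have lim: "((\<lambda>h. \<bar>(\<psi> (t + h) - \<psi> t) / h - deriv \<psi> t\<bar> * Z) \<longlongrightarrow> 0) (at 0)"
      by simp
    have eq: "(1 / h) *\<^sub>R (\<phi> (t + h) - \<phi> t) - deriv \<psi> t *\<^sub>R x = ((\<psi> (t + h) - \<psi> t) / h - deriv \<psi> t) *\<^sub>R x" for h
      by (simp only: \<phi>_def scaleR_left_diff_distrib diff_divide_distrib scaleR_right_diff_distrib
          scaleR_scaleR times_divide_eq_left mult_1_left)
    show "((\<lambda>h. snorm V ((1 / h) *\<^sub>R (\<phi> (t + h) - \<phi> t) - deriv \<psi> t *\<^sub>R x)) \<longlongrightarrow> 0) (at 0)"
      unfolding eq by (rule Lim_null_comparison[OF _ lim]) (use sc nn in simp)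
  qed
  then show c: "has_cderiv_at V \<phi> (cderiv V \<phi> t) t" for t
    unfolding cderiv_def using someI[of "\<lambda>y. has_cderiv_at V \<phi> y t"] hc by blast
  \<comment> \<open>\<open>cderiv\<close> is an arbitrary choice among the derivatives; any two are
    at distance 0, being limits of the same quotients.\<close>
  show z: "snorm V (cderiv V \<phi> t - deriv \<psi> t *\<^sub>R x) = 0" for t
  proof -
    let ?c = "cderiv V \<phi> t" and ?d = "deriv \<psi> t *\<^sub>R x" and ?Q = "\<lambda>h. (1 / h) *\<^sub>R (\<phi> (t + h) - \<phi> t)"
    have E: "?c \<in> elts V" "?d \<in> elts V" "?Q h \<in> elts V" for h
      using c[of t] hc[of t] by (auto simp: has_cderiv_at_def \<phi>_def intro!: scaleR diff xV)
    have le: "snorm V (?c - ?d) \<le> 4 * (snorm V (?Q h - ?c) + snorm V (?Q h - ?d))" for h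
      using tri[OF diff[OF E(1) E(3)[of h]] diff[OF E(3)[of h] E(2)]] minus[OF E(1) E(3)[of h]] by simp
    have "((\<lambda>h. 4 * (snorm V (?Q h - ?c) + snorm V (?Q h - ?d))) \<longlongrightarrow> 4 * (0 + 0)) (at 0)"
      using c[of t] hc[of t] unfolding has_cderiv_at_def by (intro tendsto_mult tendsto_add tendsto_const) auto
    then have "snorm V (?c - ?d) \<le> 4 * (0 + 0)"
      by (rule tendsto_lowerbound) (use le in auto)
    then show ?thesis
      using nn[of "?c - ?d"] by simp
  qed
  show "((\<lambda>s. snorm V (cderiv V \<phi> s - cderiv V \<phi> t)) \<longlongrightarrow> 0) (at t)"
  proof (rule Lim_null_comparison)
    have "isCont (\<lambda>s. frechet_derivative \<psi> (at s) 1) t"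
      using smooth_continuous_on[OF smooth_frechet_derivative[OF \<psi>], of UNIV] by (simp add: continuous_on_eq_continuous_at)
    then have "((\<lambda>s. deriv \<psi> s - deriv \<psi> t) \<longlongrightarrow> 0) (at t)"
      unfolding der_eq isCont_def by (rule LIM_zero)
    then have "((\<lambda>s. 16 * (\<bar>deriv \<psi> s - deriv \<psi> t\<bar> * Z)) \<longlongrightarrow> 16 * (0 * Z)) (at t)"
      by (intro tendsto_mult tendsto_const tendsto_rabs_zero)
    then show "((\<lambda>s. 16 * (\<bar>deriv \<psi> s - deriv \<psi> t\<bar> * Z)) \<longlongrightarrow> 0) (at t)"
      by simp
    \<comment> \<open>The factor 16 stems from two uses of the triangle inequality with constant 4;
      the chosen derivatives are exchanged for multiples of \<open>x\<close> at both ends at no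
      cost.\<close>
    have "snorm V (cderiv V \<phi> s - cderiv V \<phi> t) \<le> 16 * (\<bar>deriv \<psi> s - deriv \<psi> t\<bar> * Z)" for s
    proof -
      let ?c = "cderiv V \<phi>" and ?d = "\<lambda>t. deriv \<psi> t *\<^sub>R x"
      have E: "?c r \<in> elts V" "?d r \<in> elts V" for r
        using c[of r] by (auto simp: has_cderiv_at_def intro!: scaleR xV)
      have t1: "snorm V (?c s - ?c t) \<le> 4 * (snorm V (?c s - ?d s) + snorm V (?d s - ?c t))"
        using tri[OF diff[OF E(1)[of s] E(2)[of s]] diff[OF E(2)[of s] E(1)[of t]]] by simp
      have t2: "snorm V (?d s - ?c t) \<le> 4 * (snorm V (?d s - ?d t) + snorm V (?d t - ?c t))"
        using tri[OF diff[OF E(2)[of s] E(2)[of t]] diff[OF E(2)[of t] E(1)[of t]]] by simp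
      have t3: "snorm V (?d t - ?c t) = 0"
        using z[of t] minus[OF E(2)[of t] E(1)[of t]] by simp
      have t4: "snorm V (?c s - ?d s) = 0"
        by (rule z)
      have t5: "snorm V (?d s - ?d t) \<le> \<bar>deriv \<psi> s - deriv \<psi> t\<bar> * Z"
        unfolding scaleR_left_diff_distrib[symmetric] by (rule sc)
      have "a \<le> 16 * k" if "a \<le> 4 * c" "c \<le> 4 * d" "d \<le> k" for a c d k :: real
        using that by linarith
      from this[OF t1[unfolded t4 add_0_left] t2[unfolded t3 add_0_right] t5] show ?thesis .
    qed
    then show "\<forall>\<^sub>F s in at t. norm (snorm V (cderiv V \<phi> s - cderiv V \<phi> t)) \<le> 16 * (\<bar>deriv \<psi> s - deriv \<psi> t\<bar> * Z)"
      using nn by (intro always_eventually allI) simp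
  qed
qed

lemma set_integrable_continuous_compact:
  fixes f :: "real \<Rightarrow> real"
  assumes "compact K" "continuous_on K f"
  shows "set_integrable lebesgue K f"
proof -
  have K: "K \<in> sets borel"
    using assms(1) by (intro borel_closed compact_imp_closed)
  have "integrable lborel (\<lambda>x. indicator K x *\<^sub>R f x)"
    by (rule borel_integrable_compact[OF assms])
  then show ?thesis
    unfolding set_integrable_def
    by (subst integrable_completion) (auto dest: borel_measurable_integrable)
qed

text \<open>Written out, the claim is p (d - 2) < 2 d, which for d > 2 is the bound on
  \<open>p\<close> and for d = 2 is trivial.\<close>

lemma crit_exp_conj:
  assumes "1 < p" "ereal p < crit_exp d" "d \<ge> 2"
  shows "2 * real d / conj_exp p < real d + 2"
proof -
  have "p * (real d - 2) < 2 * real d"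
  proof (cases "d = 2")
    case False
    then have "real d - 2 > 0"
      using assms(3) by simp
    then show ?thesis
      using assms(2) False by (simp add: crit_exp_def less_divide_eq)
  qed simp
  then have "2 * real d * (p - 1) < (real d + 2) * p"
    by (simp add: algebra_simps)
  then show ?thesis
    using assms(1) by (simp add: conj_exp_def divide_less_eq)
qed

section \<open>The cracked domain and its functionals\<close>

lemma L_space_Un:
  assumes "f \<in> elts (L_space U1 UNIV r)" "f \<in> elts (L_space U2 UNIV r)"
    and "f \<in> borel_measurable (lebesgue_on (U1 \<union> U2))" "U1 \<in> sets lebesgue" "U2 \<in> sets lebesgue"
  shows "f \<in> elts (L_space (U1 \<union> U2) UNIV r)"
proof -
  have "set_integrable lebesgue (U1 \<union> U2) (\<lambda>x. norm (f x) powr r)"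
    by (rule set_integrable_Un)
      (use assms in \<open>auto simp: L_space_elts_iff set_integrable_def integrable_restrict_space\<close>)
  moreover have "U1 \<union> U2 \<in> sets lebesgue"
    using assms by auto
  ultimately show ?thesis
    using assms(3) by (simp add: L_space_elts_iff set_integrable_def integrable_restrict_space)
qed

text \<open>The form in which the data enter the argument: convexity of the potential appears as
  monotonicity of \<open>G\<close> on symmetric matrices, and the range of \<open>p\<close> as the
  exponent condition of the Sobolev embedding.\<close>

locale cracked_domain =
  fixes T p :: real and \<Omega> dD \<Gamma> \<Omega>1 \<Omega>2 :: "(real^'n) set" and \<Gamma>t :: "real \<Rightarrow> (real^'n) set"
    and G :: "real^'n^'n \<Rightarrow> real^'n^'n" and f z :: "real \<Rightarrow> real^'n \<Rightarrow> real^'n" and u0 u1 :: "real^'n \<Rightarrow> real^'n"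
  assumes T: "T > 0" and \<Omega>: "open \<Omega>" and \<Gamma>: "closed \<Gamma>" "\<Gamma> \<in> null_sets lebesgue"
    and E2: "\<Omega> - \<Gamma> = \<Omega>1 \<union> \<Omega>2" "lipschitz_domain \<Omega>1" "lipschitz_domain \<Omega>2"
    and E4: "\<And>t. 0 \<le> t \<Longrightarrow> t \<le> T \<Longrightarrow> closed (\<Gamma>t t) \<and> \<Gamma>t t \<subseteq> \<Gamma>"
      "\<And>s t. 0 \<le> s \<Longrightarrow> s \<le> t \<Longrightarrow> t \<le> T \<Longrightarrow> \<Gamma>t s \<subseteq> \<Gamma>t t"
    and p: "1 < p" "2 * real CARD('n) / conj_exp p < real CARD('n) + 2"
    and mono: "\<And>\<xi> \<eta>. \<xi> \<in> sym_matrices \<Longrightarrow> \<eta> \<in> sym_matrices \<Longrightarrow> (G \<xi> - G \<eta>) \<bullet> (\<xi> - \<eta>) \<ge> 0"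
    and u0: "u0 \<in> elts (W_space (\<Omega> - \<Gamma>t 0) (conj_exp p))"
    and u1: "u1 \<in> elts (W_space (\<Omega> - \<Gamma>t 0) (conj_exp p))"
begin

abbreviation q :: real where "q \<equiv> conj_exp p"
abbreviation U :: "(real^'n) set" where "U \<equiv> \<Omega> - \<Gamma>"
abbreviation H :: "(real^'n \<Rightarrow> real^'n) fspace" where "H \<equiv> H_space \<Omega>"
abbreviation V :: "(real^'n \<Rightarrow> real^'n) fspace" where "V \<equiv> W_space U q"
abbreviation S :: "(real^'n \<Rightarrow> real^'n^'n) fspace" where "S \<equiv> L_space \<Omega> sym_matrices p"
abbreviation e :: "(real^'n \<Rightarrow> real^'n) \<Rightarrow> real^'n \<Rightarrow> real^'n^'n" where "e \<equiv> sym_grad U"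
abbreviation M :: "real measure" where "M \<equiv> lebesgue_on {0<..<T}"

lemma q: "q > 1" "1 / p + 1 / q = 1"
  using conj_exp[OF p(1)] by auto

lemma U: "open U"
  by (intro open_Diff \<Omega> \<Gamma>)

lemma LU: "L_space U R r = L_space \<Omega> R r"
  by (rule L_space_null[OF sets_lebesgue_open[OF \<Omega>] \<Gamma>(2)])

lemma \<Gamma>t_null: "0 \<le> t \<Longrightarrow> t \<le> T \<Longrightarrow> \<Gamma>t t \<in> null_sets lebesgue"
  using E4(1)[of t] \<Gamma>(2) completion.complete2[of "\<Gamma>t t" \<Gamma>] by blast

lemma Ut: "0 \<le> t \<Longrightarrow> t \<le> T \<Longrightarrow> open (\<Omega> - \<Gamma>t t)" "0 \<le> t \<Longrightarrow> t \<le> T \<Longrightarrow> U \<subseteq> \<Omega> - \<Gamma>t t"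
  using E4(1)[of t] \<Omega> by (auto intro: open_Diff)

lemma AE_U: "(AE x in lebesgue_on U. P x) \<longleftrightarrow> (AE x in lebesgue_on \<Omega>. P x)"
  by (rule lebesgue_on_AE_null[OF sets_lebesgue_open[OF \<Omega>] \<Gamma>(2)])

lemma \<Omega>12: "open \<Omega>1" "bounded \<Omega>1" "open \<Omega>2" "bounded \<Omega>2"
  using E2 by (auto simp: lipschitz_domain_def)

lemma W_D_lin:
  assumes "0 \<le> t" "t \<le> T" "x \<in> W_D \<Omega>1 \<Omega>2 dD (\<Omega> - \<Gamma>t t) q" "y \<in> W_D \<Omega>1 \<Omega>2 dD (\<Omega> - \<Gamma>t t) q"
  shows "x + c *\<^sub>R y \<in> W_D \<Omega>1 \<Omega>2 dD (\<Omega> - \<Gamma>t t) q"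
  using Ut[OF assms(1,2)] E2(1) q(1) by (intro W_D_add_scaleR Ut \<Omega>12 assms) auto

sublocale HH: seminormed_fspace H "snorm H"
  by (rule seminormed_L_space) (auto simp: subspace_UNIV)

sublocale VV: seminormed_fspace V "\<lambda>x. snorm (L_space U UNIV q) (e x)"
  by (rule seminormed_W_space[OF U]) (use q in simp)

sublocale SS: seminormed_fspace S "snorm S"
  by (rule seminormed_L_space) (use p(1) subspace_sym_matrices in auto)

lemma e_L: "x \<in> elts V \<Longrightarrow> e x \<in> elts (L_space \<Omega> UNIV q)"
  using L_space_elts_mono[OF sym_grad_L[OF U _ , of x q]] q(1) unfolding LU by auto

text \<open>A fixed stress acts on displacements through the symmetric gradient, and Hoelder bounds
  this action by exactly the seminorm chosen for \<open>V\<close>.\<close>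

lemma V_functional:
  assumes "\<tau> \<in> elts S"
  shows "VV.functional (\<lambda>x. pairing \<Omega> \<tau> (e x)) (snorm S \<tau>)"
  unfolding VV.functional_def
proof (intro conjI ballI allI)
  show "snorm S \<tau> \<ge> 0"
    by (rule L_space_nonneg)
  fix x assume x: "x \<in> elts V"
  show "\<bar>pairing \<Omega> \<tau> (e x)\<bar> \<le> snorm S \<tau> * snorm (L_space U UNIV q) (e x)"
    unfolding LU by (rule L_space_pairing_le[OF assms e_L[OF x] p(1) q])
  fix y c assume y: "y \<in> elts V"
  have q0: "q > 0"
    using q(1) by simp
  have ae: "AE z in lebesgue_on \<Omega>. \<tau> z \<bullet> e (x + c *\<^sub>R y) z = \<tau> z \<bullet> e x z + c * (\<tau> z \<bullet> e y z)"
    using AE_sym_grad_add_scaleR[OF U x y q0, of c] unfolding AE_U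
    by eventually_elim (simp add: inner_add_right)
  have i: "integrable (lebesgue_on \<Omega>) (\<lambda>z. \<tau> z \<bullet> e k z)" if "k \<in> elts V" for k
    by (rule L_space_pairing_integrable[OF assms e_L[OF that] p(1) q])
  have "pairing \<Omega> \<tau> (e (x + c *\<^sub>R y)) = (LINT z|lebesgue_on \<Omega>. \<tau> z \<bullet> e x z + c * (\<tau> z \<bullet> e y z))"
    unfolding pairing_def
    by (rule integral_cong_AE[OF _ _ ae]) (use i[OF VV.lin[OF x y]] i[OF x] i[OF y] in auto)
  then show "pairing \<Omega> \<tau> (e (x + c *\<^sub>R y)) = pairing \<Omega> \<tau> (e x) + c * pairing \<Omega> \<tau> (e y)"
    using i[OF x] i[OF y] by (simp add: pairing_def)
qed

lemma S_functional:
  assumes "k \<in> elts (L_space \<Omega> UNIV q)"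
  shows "SS.functional (\<lambda>x. pairing \<Omega> x k) (snorm (L_space \<Omega> UNIV q) k)"
  unfolding SS.functional_def
proof (intro conjI ballI allI)
  show "snorm (L_space \<Omega> UNIV q) k \<ge> 0"
    by (rule L_space_nonneg)
  fix x :: "real^'n \<Rightarrow> real^'n^'n" assume x: "x \<in> elts S"
  show "\<bar>pairing \<Omega> x k\<bar> \<le> snorm (L_space \<Omega> UNIV q) k * snorm S x"
    using L_space_pairing_le[OF x assms p(1) q] by (simp add: mult.commute)
  fix y :: "real^'n \<Rightarrow> real^'n^'n" and c assume y: "y \<in> elts S"
  show "pairing \<Omega> (x + c *\<^sub>R y) k = pairing \<Omega> x k + c * pairing \<Omega> y k"
    by (rule pairing_add_scaleR_left[OF L_space_pairing_integrable[OF x assms p(1) q] L_space_pairing_integrable[OF y assms p(1) q]])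
qed

text \<open>The Lipschitz condition holds on the two parts of the cracked domain, so the embedding
  is applied on each of them and the pieces are put together.\<close>

lemma u1_H: "u1 \<in> elts H"
proof -
  have m: "u1 \<in> elts (W_space U' q)" if "open U'" "U' \<subseteq> U" for U'
    by (rule W_space_subset[OF Ut(1) that(1) _ u1]) (use T Ut(2)[of 0] that in auto)
  have sub: "\<Omega>1 \<subseteq> U" "\<Omega>2 \<subseteq> U"
    using E2(1) by auto
  have "u1 \<in> borel_measurable (lebesgue_on U)"
    using W_space_L[OF m[OF U]] by (simp add: L_space_elts_iff)
  then have "u1 \<in> elts (L_space (\<Omega>1 \<union> \<Omega>2) UNIV 2)"
    unfolding E2(1)
    by (intro L_space_Un sobolev_embedding[OF E2(2) m[OF \<Omega>12(1) sub(1)] q(1) p(2)]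
        sobolev_embedding[OF E2(3) m[OF \<Omega>12(3) sub(2)] q(1) p(2)] sets_lebesgue_open \<Omega>12)
  then show ?thesis
    unfolding E2(1)[symmetric] LU .
qed

text \<open>Besides unpacking, this integrates by parts in time: the inertia term becomes a pairing
  with the acceleration \<open>a\<close>. The velocity \<open>v\<close> is the witness from the
  second-order space, so it comes with \<open>a\<close> as its own weak derivative.\<close>

lemma solution_facts:
  assumes sol: "ivp_solution T p \<Omega> \<Gamma> \<Gamma>t \<Omega>1 \<Omega>2 dD G f z u0 u1 u \<sigma>"
  obtains v a where "continuous_in V T u" "weak_tderiv V T u (tderiv V T u)"
    "continuous_in H T u" "weak_tderiv H T u v" "continuous_in H T v" "weak_tderiv H T v a"
    "v \<in> bochner_L (ereal 2) T H" "a \<in> bochner_L (ereal 2) T H" "\<sigma> \<in> bochner_L (ereal p) T S"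
    "\<And>t. t \<in> {0..T} \<Longrightarrow> u t - z t \<in> W_D \<Omega>1 \<Omega>2 dD (\<Omega> - \<Gamma>t t) q"
    "AE t in M. AE x in lebesgue_on \<Omega>. G (\<sigma> t x) = e (u t) x + e (tderiv V T u t) x"
    "snorm V (u 0 - u0) = 0" "snorm H (v 0 - u1) = 0"
    "\<And>s \<psi> h. 0 < s \<Longrightarrow> s < T \<Longrightarrow> test_fun {s<..<T} \<psi> \<Longrightarrow> h \<in> elts H \<Longrightarrow>
      h \<in> W_D \<Omega>1 \<Omega>2 dD (\<Omega> - \<Gamma>t s) q \<Longrightarrow>
      (LINT t|M. \<psi> t * pairing \<Omega> (a t) h) + (LINT t|M. \<psi> t * pairing \<Omega> (\<sigma> t) (e h)) =
      (LINT t|M. pairing \<Omega> (f t) (\<psi> t *\<^sub>R h))"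
proof -
  note defs = ivp_solution_def weak_solution_def V_traj_def Let_def
  have ws: "weak_solution T p \<Omega> \<Gamma> \<Gamma>t \<Omega>1 \<Omega>2 dD G f z u \<sigma>" and u22: "u \<in> bochner_W 2 2 T H"
    and ini: "snorm V (u 0 - u0) = 0" "snorm H (tderiv H T u 0 - u1) = 0"
    using sol by (simp_all add: ivp_solution_def)
  have uV: "u \<in> bochner_W 1 q T V" and \<sigma>: "\<sigma> \<in> bochner_L p T S"
    and bc: "\<And>t. t \<in> {0..T} \<Longrightarrow> u t - z t \<in> W_D \<Omega>1 \<Omega>2 dD (\<Omega> - \<Gamma>t t) q"
    and eq: "\<And>\<phi>. \<phi> \<in> D_traj T p \<Omega> \<Gamma> \<Gamma>t \<Omega>1 \<Omega>2 dD \<Longrightarrow>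
         - (LINT t|M. pairing \<Omega> (tderiv H T u t) (cderiv V \<phi> t)) + (LINT t|M. pairing \<Omega> (\<sigma> t) (e (\<phi> t)))
         = (LINT t|M. pairing \<Omega> (f t) (\<phi> t))"
    and cl: "AE t in M. AE x in lebesgue_on (\<Omega> - \<Gamma>t t). G (\<sigma> t x) = e (u t) x + e (tderiv V T u t) x"
    using ws unfolding weak_solution_def Let_def V_traj_def by auto
  obtain w where cV: "continuous_in V T u" and w: "weak_tderiv V T u w"
    using uV by (auto simp: One_nat_def)
  note wV = tderiv_props(1)[OF w]
  obtain v a where cH: "continuous_in H T u" and wH: "weak_tderiv H T u v" and cv: "continuous_in H T v"
    and wv: "weak_tderiv H T v a" and vL: "v \<in> bochner_L 2 T H" and aL: "a \<in> bochner_L 2 T H"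
    using u22 by (auto simp: numeral_2_eq_2)
  let ?v = "tderiv H T u"
  note tv = tderiv_props(1)[OF wH] and tc = tderiv_props(2)[OF wH cv]
  \<comment> \<open>\<open>tderiv\<close> is a choice and need not be the witness \<open>v\<close>.
    Both are continuous weak derivatives of \<open>u\<close>, so their pairings with a fixed element
    agree at every time, including 0.\<close>
  have same: "pairing \<Omega> (?v t) h = pairing \<Omega> (v t) h" if h: "h \<in> elts H" and t: "t \<in> {0..T}" for h t
  proof -
    note l = H_functional[OF h]
    let ?F = "\<lambda>t. pairing \<Omega> (?v t) h - pairing \<Omega> (v t) h"
    have c: "continuous_on {0..T} ?F"
      by (intro continuous_on_diff HH.functional_continuous_on[OF l] tc cv)
    have "AE t in M. ?F t = 0"
    proof (rule fundamental_lemma)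
      show "locally_integrable {0<..<T} ?F"
        unfolding locally_integrable_def
        by (intro allI impI set_integrable_continuous_compact continuous_on_subset[OF c]) auto
      fix \<psi> assume \<psi>: "test_fun {0<..<T} \<psi>"
      have "(LINT t|M. ?F t * \<psi> t) = (LINT t|M. \<psi> t * pairing \<Omega> (?v t) h - \<psi> t * pairing \<Omega> (v t) h)"
        by (simp add: algebra_simps)
      also have "\<dots> = (LINT t|M. \<psi> t * pairing \<Omega> (?v t) h) - (LINT t|M. \<psi> t * pairing \<Omega> (v t) h)"
        by (rule Bochner_Integration.integral_diff[OF HH.weak_tderiv_test_integrable[OF l cH tv \<psi>]
              HH.weak_tderiv_test_integrable[OF l cH wH \<psi>]])
      also have "\<dots> = 0"
        using HH.weak_tderiv_test[OF l cH tv \<psi>] HH.weak_tderiv_test[OF l cH wH \<psi>] by simp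
      finally show "(LINT t|M. ?F t * \<psi> t) = 0" .
    qed simp
    from continuous_AE_zero[OF c this t T] show ?thesis
      by simp
  qed
  have E0: "?v 0 \<in> elts H" "v 0 \<in> elts H"
    using tc cv T by (auto simp: continuous_in_def)
  \<comment> \<open>The initial condition speaks of \<open>tderiv\<close> and is carried over to
    \<open>v\<close>; the triangle inequality for this requires \<open>u1\<close> to lie in
    \<open>H\<close>.\<close>
  have "snorm H (v 0 - u1) = 0"
  proof -
    let ?d = "?v 0 - v 0"
    have d: "?d \<in> elts H"
      by (rule HH.diff[OF E0])
    have "pairing \<Omega> ?d ?d = 0"
      using HH.functional_diff[OF H_functional[OF d] E0] same[OF d, of 0] T by simp
    then have "snorm H ?d = 0"
      by (simp add: H_pairing_self)
    then have "snorm H ((v 0 - ?v 0) + (?v 0 - u1)) \<le> 0"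
      using HH.N_add[OF HH.diff[OF E0(2,1)] HH.diff[OF E0(1) u1_H]] ini(2) HH.N_commute[OF E0] by simp
    then show ?thesis
      using HH.N_nonneg[of "v 0 - u1"] by simp
  qed
  moreover have "(LINT t|M. \<psi> t * pairing \<Omega> (a t) h) + (LINT t|M. \<psi> t * pairing \<Omega> (\<sigma> t) (e h)) =
      (LINT t|M. pairing \<Omega> (f t) (\<psi> t *\<^sub>R h))"
    if s: "0 < s" "s < T" and \<psi>s: "test_fun {s<..<T} \<psi>" and h: "h \<in> elts H" and hD: "h \<in> W_D \<Omega>1 \<Omega>2 dD (\<Omega> - \<Gamma>t s) q"
    for s \<psi> h
  proof -
    have q1: "q \<ge> 1"
      using q(1) by simp
    have hV: "h \<in> elts V"
      by (rule W_space_subset[OF Ut(1) U Ut(2) W_D_subset_W[OF hD]]) (use s in auto)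
    have sm: "smooth \<psi>"
      using \<psi>s by (simp add: test_fun_def)
    have \<psi>: "test_fun {0<..<T} \<psi>"
      by (rule test_fun_mono[OF \<psi>s]) (use s in auto)
    let ?\<phi> = "\<lambda>t. \<psi> t *\<^sub>R h"
    note tens = tensor_cderiv[OF U q1 hV sm]
    obtain K where K: "compact K" "K \<subseteq> {s<..<T}" "\<And>t. t \<notin> K \<Longrightarrow> \<psi> t = 0"
      using \<psi>s by (auto simp: test_fun_def)
    have "?\<phi> \<in> C1_c T V"
      unfolding C1_c_def mem_Collect_eq
    proof (intro conjI ballI exI[of _ K])
      show "?\<phi> t \<in> elts V" for t
        by (rule VV.scaleR[OF hV])
      show "K \<subseteq> {0<..<T}"
        using K(2) s by auto
      show "snorm V (?\<phi> t) = 0" if "t \<in> {0..T} - K" for t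
      proof -
        have "\<psi> t = 0"
          using K(3) that by blast
        then show ?thesis
          using snorm_W_scaleR[OF U q1 hV, of 0] snorm_W_space_nonneg[of U q 0] by simp
      qed
    qed (rule tens K(1))+
    moreover have "?\<phi> t \<in> W_D \<Omega>1 \<Omega>2 dD (\<Omega> - \<Gamma>t t) q" if t: "t \<in> {0..T}" for t
    proof -
      have z: "0 \<in> W_D \<Omega>1 \<Omega>2 dD (\<Omega> - \<Gamma>t t) q"
        by (rule W_D_0) (use q in simp)
      show ?thesis
      \<comment> \<open>Up to time \<open>s\<close> the product vanishes; later the crack contains
        the one at \<open>s\<close>, so \<open>h\<close> stays admissible.\<close>
      proof (cases "t \<le> s")
        case True
        then have "\<psi> t = 0"
          using K(2,3) by force
        then show ?thesis
          using z by simp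
      next
        case False
        then have "h \<in> W_D \<Omega>1 \<Omega>2 dD (\<Omega> - \<Gamma>t t) q"
          by (intro W_D_mono[OF Ut(1) Ut(1) _ hD]) (use s t E4(2)[of s t] in auto)
        from W_D_lin[OF _ _ z this, of "\<psi> t"] show ?thesis
          using t by simp
      qed
    qed
    ultimately have "?\<phi> \<in> D_traj T p \<Omega> \<Gamma> \<Gamma>t \<Omega>1 \<Omega>2 dD"
      by (simp add: D_traj_def)
    note E = eq[OF this]
    note l = H_functional[OF h]
    have IU: "integral\<^sup>L M k = integral\<^sup>L M k'" if "\<And>t. t \<in> {0<..<T} \<Longrightarrow> k t = k' t" for k k' :: "real \<Rightarrow> real"
      by (rule Bochner_Integration.integral_cong) (use that in auto)
    have "(LINT t|M. pairing \<Omega> (?v t) (cderiv V ?\<phi> t)) = (LINT t|M. deriv \<psi> t * pairing \<Omega> (v t) h)"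
    proof (rule IU)
      fix t assume t: "t \<in> {0<..<T}"
      then have vt: "?v t \<in> elts H"
        using tc by (auto simp: continuous_in_def)
      have cE: "cderiv V ?\<phi> t \<in> elts V"
        using tens(1)[of t] by (simp add: has_cderiv_at_def)
      have dE: "cderiv V ?\<phi> t - deriv \<psi> t *\<^sub>R h \<in> elts V"
        by (rule VV.diff[OF cE VV.scaleR[OF hV]])
      \<comment> \<open>The chosen derivative of the product agrees with
        \<open>deriv \<psi> t *\<^sub>R h\<close> up to seminorm 0, hence almost everywhere in
        space.\<close>
      have "snorm (L_space U UNIV q) (cderiv V ?\<phi> t - deriv \<psi> t *\<^sub>R h) = 0"
        using L_le_snorm_W[OF q1, of U "cderiv V ?\<phi> t - deriv \<psi> t *\<^sub>R h"] tens(2)[of t]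
          L_space_nonneg[of U UNIV q "cderiv V ?\<phi> t - deriv \<psi> t *\<^sub>R h"] by simp
      from L_space_snorm_eq_0D[OF W_space_L[OF dE] this]
      have ae: "AE x in lebesgue_on \<Omega>. cderiv V ?\<phi> t x = deriv \<psi> t *\<^sub>R h x"
        unfolding AE_U by (simp add: scaleR_fun_def)
      have cm: "cderiv V ?\<phi> t \<in> borel_measurable (lebesgue_on \<Omega>)"
        using W_space_L[OF cE] unfolding LU by (simp add: L_space_elts_iff)
      have vm: "?v t \<in> borel_measurable (lebesgue_on \<Omega>)" and hm: "h \<in> borel_measurable (lebesgue_on \<Omega>)"
        using vt h by (simp_all add: L_space_elts_iff)
      have "AE x in lebesgue_on \<Omega>. ?v t x \<bullet> cderiv V ?\<phi> t x = deriv \<psi> t * (?v t x \<bullet> h x)"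
        using ae by eventually_elim simp
      then have "pairing \<Omega> (?v t) (cderiv V ?\<phi> t) = deriv \<psi> t * pairing \<Omega> (?v t) h"
        unfolding pairing_def integral_mult_right_zero[symmetric]
        by (intro integral_cong_AE borel_measurable_inner borel_measurable_times borel_measurable_const cm vm hm)
      then show "pairing \<Omega> (?v t) (cderiv V ?\<phi> t) = deriv \<psi> t * pairing \<Omega> (v t) h"
        using same[OF h, of t] t by simp
    qed
    also have "\<dots> = - (LINT t|M. \<psi> t * pairing \<Omega> (a t) h)"
      by (rule HH.weak_tderiv_test[OF l cv wv \<psi>])
    finally have 1: "(LINT t|M. pairing \<Omega> (?v t) (cderiv V ?\<phi> t)) = - (LINT t|M. \<psi> t * pairing \<Omega> (a t) h)" .
    have "AE t in M. \<sigma> t \<in> elts S"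
      using \<sigma> by (intro strongly_measurable_elts) (simp add: bochner_L_def)
    then have ae2: "AE t in M. pairing \<Omega> (\<sigma> t) (e (?\<phi> t)) = \<psi> t * pairing \<Omega> (\<sigma> t) (e h)"
      by eventually_elim (rule VV.functional_scaleR[OF V_functional hV])
    \<comment> \<open>Measurability in time is established for the factored form and then carried
      over to the original pairing by equality almost everywhere.\<close>
    have sm1: "(\<lambda>t. \<psi> t * pairing \<Omega> (\<sigma> t) (e h)) \<in> borel_measurable M"
      by (intro borel_measurable_times measurable_restrict_space1[OF borel_measurable_lebesgue_continuous[OF smooth_continuous_on[OF sm]]]
          borel_measurable_integrable[OF SS.bochner_L_functional[OF \<sigma> _ L_space_nonneg S_functional[OF e_L[OF hV]]]])
        (use p in simp)
    have ae2': "AE t in M. \<psi> t * pairing \<Omega> (\<sigma> t) (e h) = pairing \<Omega> (\<sigma> t) (e (?\<phi> t))"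
      using ae2 by eventually_elim simp
    have "(LINT t|M. pairing \<Omega> (\<sigma> t) (e (?\<phi> t))) = (LINT t|M. \<psi> t * pairing \<Omega> (\<sigma> t) (e h))"
      by (rule integral_cong_AE[OF borel_measurable_lebesgue_on_AE[OF sm1 ae2'] sm1 ae2]) simp
    then show ?thesis
      using E 1 by simp
  qed
  moreover have "AE t in M. AE x in lebesgue_on \<Omega>. G (\<sigma> t x) = e (u t) x + e (tderiv V T u t) x"
  proof -
    have "AE t in M. t \<in> {0<..<T}"
      by (rule AE_I2) simp
    with cl show ?thesis
      by eventually_elim (simp add: lebesgue_on_AE_null[OF sets_lebesgue_open[OF \<Omega>] \<Gamma>t_null])
  qed
  ultimately show thesis
    using cV wV cH wH cv wv vL aL \<sigma> bc ini(1) by (intro that[of v a]) (simp_all add: numeral_eq_ereal)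
qed

end

text \<open>Rational times are dense in [0, t], and continuity also reaches the endpoint
  \<open>t\<close>, the very time at which the equation is wanted.\<close>

lemma continuous_zero_of_Rats:
  fixes F :: "real \<Rightarrow> real"
  assumes F: "continuous_on {0..T} F" and t: "0 < t" "t \<le> T"
    and 0: "\<And>s. s \<in> \<rat> \<Longrightarrow> 0 < s \<Longrightarrow> s < t \<Longrightarrow> F s = 0" and s: "s \<in> {0..t}"
  shows "F s = 0"
proof -
  let ?R = "\<rat> \<inter> {0<..<t}"
  have sub: "closure ?R \<subseteq> {0..t}"
    by (rule closure_minimal) auto
  have "x \<in> closure ?R" if x: "x \<in> {0..t}" for x
    unfolding closure_approachable
  proof (intro allI impI)
    fix d :: real assume d: "d > 0"
    define l r where "l = max 0 (x - d)" and "r = min t (x + d)"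
    have lr: "l < r" "0 \<le> l" "r \<le> t" "x - d \<le> l" "r \<le> x + d"
      using d t x by (auto simp: l_def r_def)
    obtain y where y: "y \<in> \<rat>" "l < y" "y < r"
      using Rats_dense_in_real[OF lr(1)] by blast
    then have "y \<in> ?R" "dist y x < d"
      using lr by (auto simp: dist_real_def)
    then show "\<exists>y\<in>?R. dist y x < d"
      by blast
  qed
  then have "s \<in> closure ?R"
    using s by blast
  moreover have "continuous_on (closure ?R) F"
    by (rule continuous_on_subset[OF F]) (use sub t in auto)
  ultimately show ?thesis
    using continuous_constant_on_closure[of ?R F 0 s] 0 by auto
qed

lemma integrable_mult_test_fun:
  fixes k \<psi> :: "real \<Rightarrow> real"
  assumes k: "integrable (lebesgue_on I) k" and \<psi>: "test_fun J \<psi>"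
  shows "integrable (lebesgue_on I) (\<lambda>t. \<psi> t * k t)"
proof -
  have s: "smooth \<psi>"
    using \<psi> by (simp add: test_fun_def)
  obtain K where K: "compact K" "\<And>x. x \<notin> K \<Longrightarrow> \<psi> x = 0"
    using \<psi> by (auto simp: test_fun_def)
  obtain B where B: "B > 0" "\<And>x. \<bar>\<psi> x\<bar> \<le> B"
  proof (rule continuous_compact_support_bounded[OF smooth_continuous_on[OF s] K(1)])
    fix B :: real
    assume "B > 0" "\<And>x. \<bar>\<psi> x\<bar> \<le> B"
    then show thesis
      by (rule that)
  qed (rule K(2))
  show ?thesis
  proof (rule Bochner_Integration.integrable_bound)
    show "integrable (lebesgue_on I) (\<lambda>t. B * \<bar>k t\<bar>)"
      using k by simp
    show "(\<lambda>t. \<psi> t * k t) \<in> borel_measurable (lebesgue_on I)"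
      by (intro borel_measurable_times borel_measurable_integrable[OF k]
          measurable_restrict_space1[OF borel_measurable_lebesgue_continuous[OF smooth_continuous_on[OF s]]])
    show "AE t in lebesgue_on I. norm (\<psi> t * k t) \<le> norm (B * \<bar>k t\<bar>)"
    proof (rule AE_I2)
      fix t
      have "\<bar>\<psi> t\<bar> * \<bar>k t\<bar> \<le> B * \<bar>k t\<bar>"
        by (rule mult_right_mono[OF B(2) abs_ge_zero])
      then show "norm (\<psi> t * k t) \<le> norm (B * \<bar>k t\<bar>)"
        using B(1) by (simp add: abs_mult)
    qed
  qed
qed

section \<open>The uniqueness argument\<close>

context cracked_domain
begin

theorem uniqueness:
  assumes sol: "ivp_solution T p \<Omega> \<Gamma> \<Gamma>t \<Omega>1 \<Omega>2 dD G f z u0 u1 u \<sigma>"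
    and sol': "ivp_solution T p \<Omega> \<Gamma> \<Gamma>t \<Omega>1 \<Omega>2 dD G f z u0 u1 u' \<sigma>'"
  shows "t \<in> {0..T} \<Longrightarrow> AE x in lebesgue_on \<Omega>. u t x = u' t x"
    and "\<forall>\<xi>1 \<in> sym_matrices. \<forall>\<xi>2 \<in> sym_matrices. \<xi>1 \<noteq> \<xi>2 \<longrightarrow> (G \<xi>1 - G \<xi>2) \<bullet> (\<xi>1 - \<xi>2) > 0 \<Longrightarrow>
      AE t in M. AE x in lebesgue_on \<Omega>. \<sigma> t x = \<sigma>' t x"
proof -
  from sol obtain v a where c1: "continuous_in V T u" and wV1: "weak_tderiv V T u (tderiv V T u)"
    and cH1: "continuous_in H T u" and wH1: "weak_tderiv H T u v" and cv1: "continuous_in H T v" and wv1: "weak_tderiv H T v a"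
    and vL1: "v \<in> bochner_L (ereal 2) T H" and aL1: "a \<in> bochner_L (ereal 2) T H" and \<sigma>1: "\<sigma> \<in> bochner_L (ereal p) T S"
    and D1: "\<And>t. t \<in> {0..T} \<Longrightarrow> u t - z t \<in> W_D \<Omega>1 \<Omega>2 dD (\<Omega> - \<Gamma>t t) q"
    and G1: "AE t in M. AE x in lebesgue_on \<Omega>. G (\<sigma> t x) = e (u t) x + e (tderiv V T u t) x"
    and i1: "snorm V (u 0 - u0) = 0" "snorm H (v 0 - u1) = 0"
    and weak1: "\<And>s \<psi> h. 0 < s \<Longrightarrow> s < T \<Longrightarrow> test_fun {s<..<T} \<psi> \<Longrightarrow> h \<in> elts H \<Longrightarrow>
      h \<in> W_D \<Omega>1 \<Omega>2 dD (\<Omega> - \<Gamma>t s) q \<Longrightarrow>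
      (LINT t|M. \<psi> t * pairing \<Omega> (a t) h) + (LINT t|M. \<psi> t * pairing \<Omega> (\<sigma> t) (e h)) =
      (LINT t|M. pairing \<Omega> (f t) (\<psi> t *\<^sub>R h))"
    by (rule solution_facts) blast
  from sol' obtain v' a' where c2: "continuous_in V T u'" and wV2: "weak_tderiv V T u' (tderiv V T u')"
    and cH2: "continuous_in H T u'" and wH2: "weak_tderiv H T u' v'" and cv2: "continuous_in H T v'" and wv2: "weak_tderiv H T v' a'"
    and vL2: "v' \<in> bochner_L (ereal 2) T H" and aL2: "a' \<in> bochner_L (ereal 2) T H" and \<sigma>2: "\<sigma>' \<in> bochner_L (ereal p) T S"
    and D2: "\<And>t. t \<in> {0..T} \<Longrightarrow> u' t - z t \<in> W_D \<Omega>1 \<Omega>2 dD (\<Omega> - \<Gamma>t t) q"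
    and G2: "AE t in M. AE x in lebesgue_on \<Omega>. G (\<sigma>' t x) = e (u' t) x + e (tderiv V T u' t) x"
    and i2: "snorm V (u' 0 - u0) = 0" "snorm H (v' 0 - u1) = 0"
    and weak2: "\<And>s \<psi> h. 0 < s \<Longrightarrow> s < T \<Longrightarrow> test_fun {s<..<T} \<psi> \<Longrightarrow> h \<in> elts H \<Longrightarrow>
      h \<in> W_D \<Omega>1 \<Omega>2 dD (\<Omega> - \<Gamma>t s) q \<Longrightarrow>
      (LINT t|M. \<psi> t * pairing \<Omega> (a' t) h) + (LINT t|M. \<psi> t * pairing \<Omega> (\<sigma>' t) (e h)) =
      (LINT t|M. pairing \<Omega> (f t) (\<psi> t *\<^sub>R h))"
    by (rule solution_facts) blast
  let ?vV = "tderiv V T u" and ?vV' = "tderiv V T u'"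
  define w where "w t = u t - u' t" for t
  define dv where "dv t = v t - v' t" for t
  define Y where "Y t = w t + dv t" for t
  \<comment> \<open>Kept as a combination of four symmetric gradients, so that the two constitutive
    laws give its value almost everywhere without passing to the gradient of a difference.\<close>
  define E where "E t x = (e (u t) x + e (?vV t) x) - (e (u' t) x + e (?vV' t) x)" for t x
  have space: "AE t in M. t \<in> {0<..<T}"
    by (rule AE_I2) simp
  have uE: "u t \<in> elts H" "u' t \<in> elts H" "v t \<in> elts H" "v' t \<in> elts H" "u t \<in> elts V" "u' t \<in> elts V"
    if "t \<in> {0..T}" for t
    using that cH1 cH2 cv1 cv2 c1 c2 by (auto simp: continuous_in_def)
  have wE: "w t \<in> elts H" "dv t \<in> elts H" "Y t \<in> elts H" "w t \<in> elts V" if "t \<in> {0..T}" for t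
    unfolding w_def dv_def Y_def using uE[OF that] by (auto intro!: HH.diff HH.add VV.diff)
  have aE: "AE t in M. a t \<in> elts H \<and> a' t \<in> elts H \<and> \<sigma> t \<in> elts S \<and> \<sigma>' t \<in> elts S"
    using aL1 aL2 \<sigma>1 \<sigma>2 by (intro AE_conjI strongly_measurable_elts) (auto simp: bochner_L_def)
  \<comment> \<open>For fixed \<open>s\<close> the difference w(s) satisfies the homogeneous
    Dirichlet condition and stays admissible afterwards; the fundamental lemma on (s, T) then
    localises the equation in time. The forcing cancels between the two solutions.\<close>
  have wk: "AE t in lebesgue. t \<in> {s<..<T} \<longrightarrow> pairing \<Omega> (a t) (w s) - pairing \<Omega> (a' t) (w s)
      + (pairing \<Omega> (\<sigma> t) (e (w s)) - pairing \<Omega> (\<sigma>' t) (e (w s))) = 0" if s: "0 < s" "s < T" for s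
  proof -
    have sT: "s \<in> {0..T}"
      using s by simp
    note h = wE(1)[OF sT] and hV = wE(4)[OF sT]
    have "w s = (u s - z s) + (-1) *\<^sub>R (u' s - z s)"
      by (simp add: w_def)
    then have hD: "w s \<in> W_D \<Omega>1 \<Omega>2 dD (\<Omega> - \<Gamma>t s) q"
      using W_D_lin[OF _ _ D1[OF sT] D2[OF sT], of "-1"] s by simp
    let ?k1 = "\<lambda>t. pairing \<Omega> (a t) (w s)" and ?k2 = "\<lambda>t. pairing \<Omega> (a' t) (w s)"
    let ?k3 = "\<lambda>t. pairing \<Omega> (\<sigma> t) (e (w s))" and ?k4 = "\<lambda>t. pairing \<Omega> (\<sigma>' t) (e (w s))"
    note lH = H_functional[OF h] and lS = S_functional[OF e_L[OF hV]]
    have k: "integrable M ?k1" "integrable M ?k2" "integrable M ?k3" "integrable M ?k4"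
      using HH.bochner_L_functional[OF aL1 _ L_space_nonneg lH] HH.bochner_L_functional[OF aL2 _ L_space_nonneg lH]
        SS.bochner_L_functional[OF \<sigma>1 _ L_space_nonneg lS] SS.bochner_L_functional[OF \<sigma>2 _ L_space_nonneg lS] p(1)
      by auto
    let ?g = "\<lambda>t. ?k1 t - ?k2 t + (?k3 t - ?k4 t)"
    have gM: "integrable M ?g"
      using k by (intro Bochner_Integration.integrable_add Bochner_Integration.integrable_diff)
    then have gi: "set_integrable lebesgue {0<..<T} ?g"
      unfolding set_integrable_def by (subst (asm) integrable_restrict_space) auto
    have "AE t in lebesgue_on {s<..<T}. ?g t = 0"
    proof (rule fundamental_lemma)
      show "locally_integrable {s<..<T} ?g"
        unfolding locally_integrable_def
      proof (intro allI impI)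
        fix K assume K: "compact K \<and> K \<subseteq> {s<..<T}"
        show "set_integrable lebesgue K ?g"
          by (rule set_integrable_subset[OF gi]) (use K s compact_imp_closed[of K] in auto)
      qed
      fix \<psi> assume \<psi>: "test_fun {s<..<T} \<psi>"
      then obtain K where K: "compact K" "K \<subseteq> {s<..<T}" "\<And>x. x \<notin> K \<Longrightarrow> \<psi> x = 0"
        by (auto simp: test_fun_def)
      have "(LINT t|lebesgue_on {s<..<T}. ?g t * \<psi> t) = (LINT t|lebesgue. ?g t * \<psi> t)"
      proof (rule integral_lebesgue_on_eq)
        show "?g t * \<psi> t = 0" if "t \<notin> {s<..<T}" for t
        proof -
          have "\<psi> t = 0"
            using K(2,3) that by blast
          then show ?thesis by simp
        qed
      qed simp
      also have "\<dots> = (LINT t|M. ?g t * \<psi> t)"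
      proof (rule integral_lebesgue_on_eq[symmetric])
        show "?g t * \<psi> t = 0" if "t \<notin> {0<..<T}" for t
        proof -
          have "t \<notin> K"
            using K(2) that s by auto
          then show ?thesis
            using K(3) by simp
        qed
      qed simp
      also have "\<dots> = (LINT t|M. (\<psi> t * ?k1 t - \<psi> t * ?k2 t) + (\<psi> t * ?k3 t - \<psi> t * ?k4 t))"
        by (simp only: distrib_left right_diff_distrib mult.commute[of _ "\<psi> t" for t])
      also have "\<dots> = ((LINT t|M. \<psi> t * ?k1 t) - (LINT t|M. \<psi> t * ?k2 t)) + ((LINT t|M. \<psi> t * ?k3 t) - (LINT t|M. \<psi> t * ?k4 t))"
        using k[THEN integrable_mult_test_fun[OF _ \<psi>]]
        by (simp only: Bochner_Integration.integral_add Bochner_Integration.integral_diff Bochner_Integration.integrable_diff)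
      also have "\<dots> = 0"
        using weak1[OF s \<psi> h hD] weak2[OF s \<psi> h hD] by linarith
      finally show "(LINT t|lebesgue_on {s<..<T}. ?g t * \<psi> t) = 0" .
    qed simp
    then show ?thesis
      by (subst (asm) AE_restrict_space_iff) auto
  qed
  \<comment> \<open>The exceptional times depend on \<open>s\<close>; rational \<open>s\<close>
    leave only a countable union of null sets.\<close>
  have "AE t in lebesgue. \<forall>s\<in>\<rat>. 0 < s \<and> s < T \<longrightarrow> t \<in> {s<..<T} \<longrightarrow> pairing \<Omega> (a t) (w s) - pairing \<Omega> (a' t) (w s)
      + (pairing \<Omega> (\<sigma> t) (e (w s)) - pairing \<Omega> (\<sigma>' t) (e (w s))) = 0"
  proof (subst AE_ball_countable[OF countable_rat], intro ballI)
    fix s :: real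
    show "AE t in lebesgue. 0 < s \<and> s < T \<longrightarrow> t \<in> {s<..<T} \<longrightarrow> pairing \<Omega> (a t) (w s) - pairing \<Omega> (a' t) (w s)
      + (pairing \<Omega> (\<sigma> t) (e (w s)) - pairing \<Omega> (\<sigma>' t) (e (w s))) = 0"
      using wk[of s] by (cases "0 < s \<and> s < T") auto
  qed
  then have "AE t in lebesgue. t \<in> {0<..<T} \<longrightarrow> (\<forall>s\<in>\<rat>. 0 < s \<and> s < T \<longrightarrow> t \<in> {s<..<T} \<longrightarrow> pairing \<Omega> (a t) (w s) - pairing \<Omega> (a' t) (w s)
      + (pairing \<Omega> (\<sigma> t) (e (w s)) - pairing \<Omega> (\<sigma>' t) (e (w s))) = 0)"
    by eventually_elim blast
  then have rat: "AE t in M. \<forall>s\<in>\<rat>. 0 < s \<and> s < T \<longrightarrow> t \<in> {s<..<T} \<longrightarrow> pairing \<Omega> (a t) (w s) - pairing \<Omega> (a' t) (w s)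
      + (pairing \<Omega> (\<sigma> t) (e (w s)) - pairing \<Omega> (\<sigma>' t) (e (w s))) = 0"
    by (subst AE_restrict_space_iff) auto
  \<comment> \<open>The equation at time t tested with Y(t); the displacement and velocity parts of
    the stress term combine to \<open>E\<close>.\<close>
  have key: "AE t in M. a t \<in> elts H \<and> a' t \<in> elts H \<and> \<sigma> t \<in> elts S \<and> \<sigma>' t \<in> elts S \<and> E t \<in> elts (L_space \<Omega> UNIV q) \<and>
      (AE x in lebesgue_on \<Omega>. E t x = G (\<sigma> t x) - G (\<sigma>' t x)) \<and>
      pairing \<Omega> (a t - a' t) (Y t) + pairing \<Omega> (\<sigma> t - \<sigma>' t) (E t) = 0"
    using rat aE G1 G2 space HH.difference_quotient[OF cH1 wH1 T] HH.difference_quotient[OF cH2 wH2 T]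
      VV.difference_quotient[OF c1 wV1 T] VV.difference_quotient[OF c2 wV2 T]
  proof eventually_elim
    case (elim t)
    then have t: "t \<in> {0..T}" "0 < t" "t < T"
      by auto
    have aH: "a t \<in> elts H" "a' t \<in> elts H" and \<sigma>S: "\<sigma> t \<in> elts S" "\<sigma>' t \<in> elts S"
      and vVE: "?vV t \<in> elts V" "?vV' t \<in> elts V"
      using elim by blast+
    define A where "A = a t - a' t"
    define \<tau> where "\<tau> = \<sigma> t - \<sigma>' t"
    have A: "A \<in> elts H" and \<tau>: "\<tau> \<in> elts S"
      unfolding A_def \<tau>_def using aH \<sigma>S by (auto intro: HH.diff SS.diff)
    let ?l1 = "\<lambda>x. pairing \<Omega> x A" and ?l2 = "\<lambda>x. pairing \<Omega> \<tau> (e x)"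
    note l1 = H_functional[OF A] and l2 = V_functional[OF \<tau>]
    \<comment> \<open>The data are frozen at \<open>t\<close> and only the tested displacement w(s)
      varies. The function is continuous and vanishes at the rationals below \<open>t\<close>, hence
      on all of [0, t]; its value and its backward difference quotient at \<open>t\<close> provide
      the two equations that are added.\<close>
    define \<Theta> where "\<Theta> s = ?l1 (u s) - ?l1 (u' s) + (?l2 (u s) - ?l2 (u' s))" for s
    have \<Theta>_eq: "\<Theta> s = pairing \<Omega> (a t) (w s) - pairing \<Omega> (a' t) (w s)
        + (pairing \<Omega> (\<sigma> t) (e (w s)) - pairing \<Omega> (\<sigma>' t) (e (w s)))" if s: "s \<in> {0..T}" for s
    proof -
      have "pairing \<Omega> (a t) (w s) - pairing \<Omega> (a' t) (w s) = pairing \<Omega> A (w s)"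
        unfolding A_def using HH.functional_diff[OF H_functional[OF wE(1)[OF s]] aH] by simp
      also have "\<dots> = ?l1 (u s) - ?l1 (u' s)"
        unfolding pairing_commute[of \<Omega> A] w_def by (rule HH.functional_diff[OF l1 uE(1,2)[OF s]])
      finally have 1: "pairing \<Omega> (a t) (w s) - pairing \<Omega> (a' t) (w s) = ?l1 (u s) - ?l1 (u' s)" .
      have "pairing \<Omega> (\<sigma> t) (e (w s)) - pairing \<Omega> (\<sigma>' t) (e (w s)) = ?l2 (w s)"
        unfolding \<tau>_def using SS.functional_diff[OF S_functional[OF e_L[OF wE(4)[OF s]]] \<sigma>S] by simp
      also have "\<dots> = ?l2 (u s) - ?l2 (u' s)"
        unfolding w_def by (rule VV.functional_diff[OF l2 uE(5,6)[OF s]])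
      finally show ?thesis
        unfolding \<Theta>_def 1 by simp
    qed
    have "continuous_on {0..T} \<Theta>"
      unfolding \<Theta>_def
      by (intro continuous_on_add continuous_on_diff HH.functional_continuous_on[OF l1] VV.functional_continuous_on[OF l2] cH1 cH2 c1 c2)
    then have \<Theta>0: "\<Theta> s = 0" if "s \<in> {0..t}" for s
    proof (rule continuous_zero_of_Rats[OF _ t(2) less_imp_le[OF t(3)] _ that])
      fix s assume s: "s \<in> \<rat>" "0 < s" "s < t"
      then show "\<Theta> s = 0"
        using elim t \<Theta>_eq[of s] by auto
    qed
    \<comment> \<open>The inertia part is differentiated in \<open>H\<close> and the stress part in
      \<open>V\<close>. Both functionals depend on \<open>t\<close>, which is legitimate because
      \<open>difference_quotient\<close> has one null set for all functionals.\<close>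
    have lim: "((\<lambda>h. (?l1 (u t) - ?l1 (u (t - h))) / h - (?l1 (u' t) - ?l1 (u' (t - h))) / h
        + ((?l2 (u t) - ?l2 (u (t - h))) / h - (?l2 (u' t) - ?l2 (u' (t - h))) / h)) \<longlongrightarrow>
        ?l1 (v t) - ?l1 (v' t) + (?l2 (?vV t) - ?l2 (?vV' t))) (at_right 0)"
      using elim l1 l2 by (intro tendsto_add tendsto_diff) blast+
    have "\<forall>\<^sub>F h in at_right 0. 0 < h \<and> h < t"
      using t by (auto simp: eventually_at_right_field intro!: exI[of _ t])
    then have "\<forall>\<^sub>F h in at_right 0. (?l1 (u t) - ?l1 (u (t - h))) / h - (?l1 (u' t) - ?l1 (u' (t - h))) / h
        + ((?l2 (u t) - ?l2 (u (t - h))) / h - (?l2 (u' t) - ?l2 (u' (t - h))) / h) = 0"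
    proof eventually_elim
      case (elim h)
      have "(?l1 (u t) - ?l1 (u (t - h))) / h - (?l1 (u' t) - ?l1 (u' (t - h))) / h
          + ((?l2 (u t) - ?l2 (u (t - h))) / h - (?l2 (u' t) - ?l2 (u' (t - h))) / h) = (\<Theta> t - \<Theta> (t - h)) / h"
        unfolding \<Theta>_def diff_divide_distrib add_divide_distrib by simp
      then show ?case
        using \<Theta>0[of t] \<Theta>0[of "t - h"] elim t by simp
    qed
    then have "((\<lambda>h. (?l1 (u t) - ?l1 (u (t - h))) / h - (?l1 (u' t) - ?l1 (u' (t - h))) / h
        + ((?l2 (u t) - ?l2 (u (t - h))) / h - (?l2 (u' t) - ?l2 (u' (t - h))) / h)) \<longlongrightarrow> 0) (at_right 0)"
      by (rule tendsto_eventually)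
    from tendsto_unique[OF _ lim this]
    have d0: "?l1 (v t) - ?l1 (v' t) + (?l2 (?vV t) - ?l2 (?vV' t)) = 0"
      by simp
    have "?l1 (Y t) = (?l1 (u t) - ?l1 (u' t)) + (?l1 (v t) - ?l1 (v' t))"
      unfolding Y_def w_def dv_def
      using HH.functional_lin[OF l1 HH.diff[OF uE(1,2)[OF t(1)]] HH.diff[OF uE(3,4)[OF t(1)]], of 1]
        HH.functional_diff[OF l1 uE(1,2)[OF t(1)]] HH.functional_diff[OF l1 uE(3,4)[OF t(1)]] by simp
    moreover have "\<Theta> t = 0"
      by (rule \<Theta>0) (use t in simp)
    moreover have "pairing \<Omega> \<tau> (E t) = ?l2 (u t) + ?l2 (?vV t) - (?l2 (u' t) + ?l2 (?vV' t))"
    proof -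
      have i: "integrable (lebesgue_on \<Omega>) (\<lambda>x. \<tau> x \<bullet> e k x)" if "k \<in> elts V" for k
        by (rule L_space_pairing_integrable[OF \<tau> e_L[OF that] p(1) q])
      note ii = i[OF uE(5)[OF t(1)]] i[OF uE(6)[OF t(1)]] i[OF vVE(1)] i[OF vVE(2)]
      show ?thesis
        unfolding pairing_def E_def inner_diff_right inner_add_right using ii by simp
    qed
    ultimately have "pairing \<Omega> (Y t) A + pairing \<Omega> \<tau> (E t) = 0"
      using d0 unfolding \<Theta>_def by simp
    then have "pairing \<Omega> A (Y t) + pairing \<Omega> \<tau> (E t) = 0"
      by (simp only: pairing_commute[of \<Omega> A])
    moreover have "E t \<in> elts (L_space \<Omega> UNIV q)"
    proof -
      have q0: "q > 0"
        using q(1) by simp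
      have "E t = (e (u t) + e (?vV t)) - (e (u' t) + e (?vV' t))"
        by (simp add: E_def fun_eq_iff)
      then show ?thesis
        by (simp only:) (intro L_space_diff L_space_add e_L uE[OF t(1)] vVE q0 subspace_UNIV)
    qed
    moreover have "AE x in lebesgue_on \<Omega>. E t x = G (\<sigma> t x) - G (\<sigma>' t x)"
      using elim(3,4) by eventually_elim (simp add: E_def)
    ultimately show ?case
      using aH \<sigma>S unfolding A_def \<tau>_def by blast
  qed
  \<comment> \<open>Monotonicity gives the sign pointwise in space; the pointwise form returns in
    the uniqueness of the stress.\<close>
  have sgn: "AE t in M. (AE x in lebesgue_on \<Omega>. (\<sigma> t - \<sigma>' t) x \<bullet> E t x \<ge> 0) \<and> pairing \<Omega> (\<sigma> t - \<sigma>' t) (E t) \<ge> 0"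
    using key
  proof eventually_elim
    case (elim t)
    then have "AE x in lebesgue_on \<Omega>. \<sigma> t x \<in> sym_matrices" "AE x in lebesgue_on \<Omega>. \<sigma>' t x \<in> sym_matrices"
      "AE x in lebesgue_on \<Omega>. E t x = G (\<sigma> t x) - G (\<sigma>' t x)"
      by (auto simp: L_space_elts_iff)
    then have "AE x in lebesgue_on \<Omega>. (\<sigma> t - \<sigma>' t) x \<bullet> E t x \<ge> 0"
      by eventually_elim (use mono in \<open>auto simp: inner_commute\<close>)
    then show ?case
      unfolding pairing_def by (auto intro: integral_nonneg_AE)
  qed
  have cw: "continuous_in H T w" and cdv: "continuous_in H T dv"
    unfolding w_def dv_def
    using continuous_in_lin[OF HH.seminormed_fspace_axioms cH1 cH2, of "-1"] continuous_in_lin[OF HH.seminormed_fspace_axioms cv1 cv2, of "-1"]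
    by simp_all
  have cY: "continuous_in H T Y"
    unfolding Y_def using continuous_in_lin[OF HH.seminormed_fspace_axioms cw cdv, of 1] by simp
  \<comment> \<open>One integrable bound for the time derivatives of both \<open>w\<close> and
    \<open>Y\<close>.\<close>
  define nb where "nb t = snorm H (v t) + snorm H (v' t) + (snorm H (a t) + snorm H (a' t))" for t
  have nbi: "integrable M nb"
    unfolding nb_def using bochner_L_snorm_integrable[OF vL1 _ L_space_nonneg] bochner_L_snorm_integrable[OF vL2 _ L_space_nonneg]
      bochner_L_snorm_integrable[OF aL1 _ L_space_nonneg] bochner_L_snorm_integrable[OF aL2 _ L_space_nonneg] by simp
  let ?g1 = "\<lambda>t. pairing \<Omega> (dv t) (Y t)" and ?g2 = "\<lambda>t. pairing \<Omega> (dv t) (w t)"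
  have cg: "continuous_on {0..T} ?g1" "continuous_on {0..T} ?g2"
    by (rule continuous_pairing[OF cdv cY], rule continuous_pairing[OF cdv cw])
  let ?\<beta>2 = "\<lambda>r h. pairing \<Omega> (v r) h - pairing \<Omega> (v' r) h"
  \<comment> \<open>Written with separate pairings, since linearity is at hand only where the
    accelerations lie in \<open>H\<close>, that is, at almost every time.\<close>
  let ?\<beta>1 = "\<lambda>r h. ?\<beta>2 r h + (pairing \<Omega> (a r) h - pairing \<Omega> (a' r) h)"
  have int2: "set_integrable lebesgue {s<..t} (\<lambda>r. ?\<beta>2 r h) \<and>
      pairing \<Omega> (w t) h - pairing \<Omega> (w s) h = (LINT r:{s<..t}|lebesgue. ?\<beta>2 r h)"
    and int1: "set_integrable lebesgue {s<..t} (\<lambda>r. ?\<beta>1 r h) \<and>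
      pairing \<Omega> (Y t) h - pairing \<Omega> (Y s) h = (LINT r:{s<..t}|lebesgue. ?\<beta>1 r h)"
    if h: "h \<in> elts H" and st: "0 < s" "s < t" "t < T" for h s t
  proof -
    note l = H_functional[OF h]
    note I = HH.weak_tderiv_integrable[OF l cH1 wH1 st] HH.weak_tderiv_integrable[OF l cH2 wH2 st]
      HH.weak_tderiv_integrable[OF l cv1 wv1 st] HH.weak_tderiv_integrable[OF l cv2 wv2 st]
    note J = HH.weak_tderiv_integral[OF l cH1 wH1 st] HH.weak_tderiv_integral[OF l cH2 wH2 st]
      HH.weak_tderiv_integral[OF l cv1 wv1 st] HH.weak_tderiv_integral[OF l cv2 wv2 st]
    have T': "s \<in> {0..T}" "t \<in> {0..T}"
      using st by auto
    have wl: "pairing \<Omega> (w r) h = pairing \<Omega> (u r) h - pairing \<Omega> (u' r) h" if "r \<in> {0..T}" for r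
      unfolding w_def by (rule HH.functional_diff[OF l uE(1,2)[OF that]])
    have Yl: "pairing \<Omega> (Y r) h = pairing \<Omega> (w r) h + (pairing \<Omega> (v r) h - pairing \<Omega> (v' r) h)" if "r \<in> {0..T}" for r
      using HH.functional_lin[OF l wE(1,2)[OF that], of 1] HH.functional_diff[OF l uE(3,4)[OF that]]
      by (simp add: Y_def dv_def)
    note I2 = set_integral_diff[OF I(1,2)] and I3 = set_integral_diff[OF I(3,4)]
    show "set_integrable lebesgue {s<..t} (\<lambda>r. ?\<beta>2 r h) \<and>
      pairing \<Omega> (w t) h - pairing \<Omega> (w s) h = (LINT r:{s<..t}|lebesgue. ?\<beta>2 r h)"
      using I2 J wl[OF T'(1)] wl[OF T'(2)] by simp
    show "set_integrable lebesgue {s<..t} (\<lambda>r. ?\<beta>1 r h) \<and>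
      pairing \<Omega> (Y t) h - pairing \<Omega> (Y s) h = (LINT r:{s<..t}|lebesgue. ?\<beta>1 r h)"
      using set_integral_add[OF I2(1) I3(1)] I2(2) I3(2) J wl[OF T'(1)] wl[OF T'(2)] Yl[OF T'(1)] Yl[OF T'(2)] by simp
  qed
  have \<beta>2_eq: "?\<beta>2 r h = pairing \<Omega> (dv r) h" if "h \<in> elts H" "r \<in> {0..T}" for h r
    unfolding dv_def by (rule HH.functional_diff[OF H_functional[OF that(1)] uE(3,4)[OF that(2)], symmetric])
  have ndv: "snorm H (dv r) \<le> snorm H (v r) + snorm H (v' r)" if "r \<in> {0..T}" for r
    unfolding dv_def using L_space_triangle_diff[OF uE(3,4)[OF that]] by (simp add: subspace_UNIV)
  have b2: "AE r in M. dv r \<in> elts H \<and> snorm H (dv r) \<le> nb r \<and> pairing \<Omega> (dv r) (w r) \<le> ?g2 r \<and>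
      (\<forall>h\<in>elts H. ?\<beta>2 r h = pairing \<Omega> (dv r) h)"
    using space
  proof eventually_elim
    case (elim r)
    then have r: "r \<in> {0..T}"
      by simp
    show ?case
      using wE(2)[OF r] ndv[OF r] \<beta>2_eq[OF _ r] L_space_nonneg[of \<Omega> UNIV 2 "a r"] L_space_nonneg[of \<Omega> UNIV 2 "a' r"]
      unfolding nb_def by auto
  qed
  have b1: "AE r in M. dv r + (a r - a' r) \<in> elts H \<and> snorm H (dv r + (a r - a' r)) \<le> nb r \<and>
      pairing \<Omega> (dv r + (a r - a' r)) (Y r) \<le> ?g1 r \<and> (\<forall>h\<in>elts H. ?\<beta>1 r h = pairing \<Omega> (dv r + (a r - a' r)) h)"
    using space key sgn
  proof eventually_elim
    case (elim r)
    then have r: "r \<in> {0..T}" and aH: "a r \<in> elts H" "a' r \<in> elts H"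
      by auto
    note dA = HH.diff[OF aH]
    have lin: "pairing \<Omega> (dv r + (a r - a' r)) h = pairing \<Omega> (dv r) h + pairing \<Omega> (a r - a' r) h" if "h \<in> elts H" for h
      using H_pairing_lin[OF wE(2)[OF r] dA that, of 1] by simp
    have "snorm H (a r - a' r) \<le> snorm H (a r) + snorm H (a' r)"
      using L_space_triangle_diff[OF aH] by (simp add: subspace_UNIV)
    then have "snorm H (dv r + (a r - a' r)) \<le> nb r"
      using HH.N_add[OF wE(2)[OF r] dA] ndv[OF r] unfolding nb_def by linarith
    moreover have "pairing \<Omega> (dv r + (a r - a' r)) (Y r) \<le> ?g1 r"
      unfolding lin[OF wE(3)[OF r]] using elim(2,3) by linarith
    moreover have "?\<beta>1 r h = pairing \<Omega> (dv r + (a r - a' r)) h" if "h \<in> elts H" for h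
      unfolding lin[OF that] \<beta>2_eq[OF that r] using HH.functional_diff[OF H_functional[OF that] aH] by simp
    ultimately show ?case
      using HH.add[OF wE(2)[OF r] dA] by blast
  qed
  define F where "F t = (snorm H (Y t))\<^sup>2 + (snorm H (w t))\<^sup>2" for t
  \<comment> \<open>As dv = Y - w, the two terms add up to |Y|^2 - |w|^2; this is the purpose of
    adding |w|^2 to the energy.\<close>
  have sum_g: "?g1 r + ?g2 r \<le> F r" if r: "r \<in> {0..T}" for r
  proof -
    have "dv r = Y r - w r"
      by (simp add: Y_def)
    then have "?g1 r + ?g2 r = pairing \<Omega> (Y r) (Y r) - pairing \<Omega> (w r) (w r)"
      using HH.functional_diff[OF H_functional[OF wE(3)[OF r]] wE(3,1)[OF r]]
        HH.functional_diff[OF H_functional[OF wE(1)[OF r]] wE(3,1)[OF r]]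
      by (simp add: pairing_commute[of \<Omega> "w r" "Y r"])
    then show ?thesis
      by (simp add: F_def H_pairing_self)
  qed
  have F0: "F 0 = 0"
  proof -
    have z: "0 \<in> {0..T}"
      using T by simp
    \<comment> \<open>The initial displacement is prescribed in \<open>V\<close>, whose norm
      dominates an L^q norm; equality almost everywhere then serves as the bridge to
      \<open>H\<close>.\<close>
    have "AE x in lebesgue_on \<Omega>. u 0 x - u0 x = 0" "AE x in lebesgue_on \<Omega>. u' 0 x - u0 x = 0"
    proof -
      have q1: "q \<ge> 1"
        using q(1) by simp
      have u0V: "u0 \<in> elts V"
        by (rule W_space_subset[OF Ut(1) U Ut(2) u0]) (use T in auto)
      have "AE x in lebesgue_on \<Omega>. (k - u0) x = 0" if "k \<in> elts V" "snorm V (k - u0) = 0" for k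
      proof -
        have "snorm (L_space U UNIV q) (k - u0) = 0"
          using L_le_snorm_W[OF q1, of U "k - u0"] that(2) L_space_nonneg[of U UNIV q "k - u0"] by simp
        from L_space_snorm_eq_0D[OF W_space_L[OF VV.diff[OF that(1) u0V]] this] show ?thesis
          unfolding AE_U .
      qed
      from this[OF uE(5)[OF z] i1(1)] this[OF uE(6)[OF z] i2(1)]
      show "AE x in lebesgue_on \<Omega>. u 0 x - u0 x = 0" "AE x in lebesgue_on \<Omega>. u' 0 x - u0 x = 0"
        by simp_all
    qed
    then have "AE x in lebesgue_on \<Omega>. w 0 x = 0"
      by eventually_elim (simp add: w_def)
    then have w0: "snorm H (w 0) = 0"
      by (rule L_space_snorm_eq_0I) simp
    have "snorm H (dv 0) \<le> snorm H (v 0 - u1) + snorm H (u1 - v' 0)"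
      using HH.N_add[OF HH.diff[OF uE(3)[OF z] u1_H] HH.diff[OF u1_H uE(4)[OF z]]] by (simp add: dv_def)
    then have "snorm H (dv 0) = 0"
      using i1(2) i2(2) HH.N_commute[OF u1_H uE(4)[OF z]] HH.N_nonneg[of "dv 0"] by simp
    then have "snorm H (Y 0) = 0"
      using HH.N_add[OF wE(1,2)[OF z]] w0 HH.N_nonneg[of "Y 0"] by (simp add: Y_def)
    then show ?thesis
      using w0 by (simp add: F_def)
  qed
  have F_zero: "F t = 0" if "t \<in> {0..T}" for t
  \<comment> \<open>The constant 2 is the factor in \<open>energy_inequality\<close>.\<close>
  proof (rule Gronwall_zero[of T F 2, OF _ _ F0 _ T _ that])
    show "continuous_on {0..T} F"
      unfolding F_def H_pairing_self[symmetric]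
      by (intro continuous_on_add continuous_pairing cY cw)
    show "F t \<ge> 0" for t
      by (simp add: F_def)
    fix s t m assume st: "0 < s" "s < t" "t < T" and m: "\<And>r. r \<in> {s..t} \<Longrightarrow> F r \<le> m"
    have e1: "(snorm H (Y t))\<^sup>2 - (snorm H (Y s))\<^sup>2 \<le> 2 * (LINT r:{s<..t}|lebesgue. ?g1 r)"
      by (rule energy_inequality[OF cY int1 b1 nbi cg(1) st])
    have e2: "(snorm H (w t))\<^sup>2 - (snorm H (w s))\<^sup>2 \<le> 2 * (LINT r:{s<..t}|lebesgue. ?g2 r)"
      by (rule energy_inequality[OF cw int2 b2 nbi cg(2) st])
    have gi: "set_integrable lebesgue {s<..t} g" if "continuous_on {0..T} g" for g :: "real \<Rightarrow> real"
      by (rule set_integrable_subset[OF set_integrable_continuous_compact[OF compact_Icc that]]) (use st in auto)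
    have ci: "set_integrable lebesgue {s<..t} (\<lambda>_. m)"
      by (rule gi) (rule continuous_on_const)
    have "(LINT r:{s<..t}|lebesgue. ?g1 r) + (LINT r:{s<..t}|lebesgue. ?g2 r) = (LINT r:{s<..t}|lebesgue. ?g1 r + ?g2 r)"
      by (rule set_integral_add(2)[OF gi[OF cg(1)] gi[OF cg(2)], symmetric])
    also have "\<dots> \<le> (LINT r:{s<..t}|lebesgue. m)"
    proof (rule set_integral_mono[OF set_integral_add(1)[OF gi[OF cg(1)] gi[OF cg(2)]] ci])
      fix r assume "r \<in> {s<..t}"
      then show "?g1 r + ?g2 r \<le> m"
        using order_trans[OF sum_g m] st by auto
    qed
    also have "\<dots> = (t - s) * m"
      using st by (simp add: set_lebesgue_integral_def)
    finally show "F t - F s \<le> 2 * (t - s) * m"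
      using e1 e2 unfolding F_def mult.assoc by linarith
  qed simp
  then have zero: "snorm H (Y t) = 0" "snorm H (w t) = 0" if "t \<in> {0..T}" for t
    using that unfolding F_def by (simp_all add: sum_power2_eq_zero_iff)
  show "AE x in lebesgue_on \<Omega>. u t x = u' t x" if "t \<in> {0..T}"
    using L_space_snorm_eq_0D[OF wE(1)[OF that] zero(2)[OF that]] by eventually_elim (simp add: w_def)
  assume strict: "\<forall>\<xi>1 \<in> sym_matrices. \<forall>\<xi>2 \<in> sym_matrices. \<xi>1 \<noteq> \<xi>2 \<longrightarrow> (G \<xi>1 - G \<xi>2) \<bullet> (\<xi>1 - \<xi>2) > 0"
  show "AE t in M. AE x in lebesgue_on \<Omega>. \<sigma> t x = \<sigma>' t x"
    using key sgn space
  proof eventually_elim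
    case (elim t)
    then have t: "t \<in> {0..T}" and aH: "a t \<in> elts H" "a' t \<in> elts H" and \<sigma>S: "\<sigma> t \<in> elts S" "\<sigma>' t \<in> elts S"
      and EL: "E t \<in> elts (L_space \<Omega> UNIV q)"
      by auto
    \<comment> \<open>Since Y(t) has norm 0, the equation tested with it reduces to the stress term;
      its nonnegative integrand must then vanish almost everywhere.\<close>
    have "pairing \<Omega> (a t - a' t) (Y t) = 0"
      using H_pairing_le[OF HH.diff[OF aH] wE(3)[OF t]] zero(1)[OF t] by simp
    then have "(LINT x|lebesgue_on \<Omega>. (\<sigma> t - \<sigma>' t) x \<bullet> E t x) = 0"
      using elim(1) by (simp add: pairing_def)
    then have "AE x in lebesgue_on \<Omega>. (\<sigma> t - \<sigma>' t) x \<bullet> E t x = 0"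
      using integral_nonneg_eq_0_iff_AE[OF L_space_pairing_integrable[OF SS.diff[OF \<sigma>S] EL p(1) q]] elim(2) by blast
    moreover have "AE x in lebesgue_on \<Omega>. E t x = G (\<sigma> t x) - G (\<sigma>' t x)"
      using elim(1) by blast
    moreover have "AE x in lebesgue_on \<Omega>. \<sigma> t x \<in> sym_matrices" "AE x in lebesgue_on \<Omega>. \<sigma>' t x \<in> sym_matrices"
      using \<sigma>S by (auto simp: L_space_elts_iff)
    ultimately show ?case
    proof eventually_elim
      case (elim x)
      show ?case
      proof (rule ccontr)
        assume "\<sigma> t x \<noteq> \<sigma>' t x"
        then have "(G (\<sigma> t x) - G (\<sigma>' t x)) \<bullet> (\<sigma> t x - \<sigma>' t x) > 0"
          using strict elim by blast
        then show False
          using elim by (simp add: inner_commute)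
      qed
    qed
  qed
qed

end

theorem theorem3p10:
  fixes T p b1 b2 b3 :: real
    and \<Omega> dD \<Gamma> \<Omega>1 \<Omega>2 :: "(real^'n) set"
    and \<Gamma>t :: "real \<Rightarrow> (real^'n) set"
    and \<phi> :: "real^'n^'n \<Rightarrow> real"
    and G :: "real^'n^'n \<Rightarrow> real^'n^'n"
    and f z :: "real \<Rightarrow> real^'n \<Rightarrow> real^'n"
    and u0 u1 :: "real^'n \<Rightarrow> real^'n"
  assumes T: "T > 0"
    and dim: "CARD('n) \<ge> 2"
    and Omega: "lipschitz_domain \<Omega>"
    and Dirichlet: "dD \<subseteq> frontier \<Omega>" "dD \<in> sets borel"
    and Gamma: "\<Gamma> \<subseteq> closure \<Omega>"
    and E1: "closed \<Gamma>" "emeasure lborel \<Gamma> = 0"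
      "hausdorff_outer (real CARD('n) - 1) (\<Gamma> \<inter> frontier \<Omega>) = 0"
    and E2: "\<Omega> - \<Gamma> = \<Omega>1 \<union> \<Omega>2" "\<Omega>1 \<inter> \<Omega>2 = {}" "lipschitz_domain \<Omega>1" "lipschitz_domain \<Omega>2"
    and E3: "contains_lipschitz_graph (dD \<inter> frontier \<Omega>1)"
      "contains_lipschitz_graph (dD \<inter> frontier \<Omega>2)"
    and E4: "\<And>t. 0 \<le> t \<Longrightarrow> t \<le> T \<Longrightarrow> closed (\<Gamma>t t) \<and> \<Gamma>t t \<subseteq> \<Gamma>"
      "\<And>s t. 0 \<le> s \<Longrightarrow> s \<le> t \<Longrightarrow> t \<le> T \<Longrightarrow> \<Gamma>t s \<subseteq> \<Gamma>t t"
    and p: "1 < p" "ereal p < crit_exp CARD('n)"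
    and G_sym: "\<And>\<xi>. \<xi> \<in> sym_matrices \<Longrightarrow> G \<xi> \<in> sym_matrices"
    and G1: "convex_on sym_matrices \<phi>"
      "\<And>\<xi>. \<xi> \<in> sym_matrices \<Longrightarrow> (\<phi> has_derivative (\<lambda>\<eta>. G \<xi> \<bullet> \<eta>)) (at \<xi> within sym_matrices)"
      "continuous_on sym_matrices G"
    and G2: "b1 > 0" "b2 \<ge> 0"
      "\<And>\<xi>. \<xi> \<in> sym_matrices \<Longrightarrow> G \<xi> \<bullet> \<xi> \<ge> b1 * norm \<xi> powr p - b2"
    and G3: "b3 > 0"
      "\<And>\<xi>. \<xi> \<in> sym_matrices \<Longrightarrow> norm (G \<xi>) \<le> b3 * (1 + norm \<xi> powr (p - 1))"
    and D1: "f \<in> bochner_L 2 T (H_space \<Omega>)"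
    and D2: "z \<in> bochner_W 2 (conj_exp p) T (W_space (\<Omega> - \<Gamma>t 0) (conj_exp p))"
    and D3: "u0 \<in> elts (W_space (\<Omega> - \<Gamma>t 0) (conj_exp p))"
      "u1 \<in> elts (W_space (\<Omega> - \<Gamma>t 0) (conj_exp p))"
      "u0 - z 0 \<in> W_D \<Omega>1 \<Omega>2 dD (\<Omega> - \<Gamma>t 0) (conj_exp p)"
      "u1 - tderiv (W_space (\<Omega> - \<Gamma>t 0) (conj_exp p)) T z 0
         \<in> W_D \<Omega>1 \<Omega>2 dD (\<Omega> - \<Gamma>t 0) (conj_exp p)"
  shows "(\<forall>u \<sigma> u' \<sigma>'.
            ivp_solution T p \<Omega> \<Gamma> \<Gamma>t \<Omega>1 \<Omega>2 dD G f z u0 u1 u \<sigma> \<and>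
            ivp_solution T p \<Omega> \<Gamma> \<Gamma>t \<Omega>1 \<Omega>2 dD G f z u0 u1 u' \<sigma>' \<longrightarrow>
            (\<forall>t \<in> {0..T}. AE x in lebesgue_on \<Omega>. u t x = u' t x)) \<and>
         ((\<forall>\<xi>1 \<in> sym_matrices. \<forall>\<xi>2 \<in> sym_matrices.
             \<xi>1 \<noteq> \<xi>2 \<longrightarrow> (G \<xi>1 - G \<xi>2) \<bullet> (\<xi>1 - \<xi>2) > 0) \<longrightarrow>
          (\<forall>u \<sigma> u' \<sigma>'.
             ivp_solution T p \<Omega> \<Gamma> \<Gamma>t \<Omega>1 \<Omega>2 dD G f z u0 u1 u \<sigma> \<and>
             ivp_solution T p \<Omega> \<Gamma> \<Gamma>t \<Omega>1 \<Omega>2 dD G f z u0 u1 u' \<sigma>' \<longrightarrow>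
             (AE t in lebesgue_on {0<..<T}. AE x in lebesgue_on \<Omega>. \<sigma> t x = \<sigma>' t x)))"
proof -
  have "\<Gamma> \<in> null_sets lebesgue"
    using E1(1,2) by (intro null_sets_completionI) (auto simp: null_sets_def)
  then interpret cracked_domain T p \<Omega> dD \<Gamma> \<Omega>1 \<Omega>2 \<Gamma>t G f z u0 u1
    by unfold_locales (use T lipschitz_domain_open[OF Omega] E1(1) E2(1,3,4) E4 p(1) crit_exp_conj[OF p dim]
        convex_gradient_monotone[OF subspace_sym_matrices G1(1,2)] D3(1,2) in auto)
  show ?thesis
    using uniqueness by blast
qed

end
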